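(* Let $d\ge1$, $0\le\mathfrak a<\mathfrak b$, $\mathfrak c\ge0$, $\beta\ge0$, $\gamma>-1$, $r\in\mathbb N$, and let $f\in L^p(\mathbf W^{\beta,\gamma}_{\mathfrak a,\mathfrak b,\mathfrak c},\Lambda^{d+1}_{\mathfrak a,\mathfrak b,\mathfrak c})$ if $1\le p<\infty$, $f\in C(\Lambda^{d+1}_{\mathfrak a,\mathfrak b,\mathfrak c})$ if $p=\infty$. Then there is a constant $c$ independent of $f$ and $n$ such that for $n=1,2,\dots$: (i) $E_n(f)_p\le c\,K_r(f;n^{-1})_p$; (ii) $K_r(f;n^{-1})_p\le c\,n^{-r}\sum_{k=0}^n(k+1)^{r-1}E_k(f)_p$.
   Context: $\mathbb X^{d+1}_{\mathfrak a,\mathfrak b,\mathfrak c}=\{(\mathbf x,t)\in\mathbb R^d\times\mathbb R:\|\mathbf x\|\le1,\ \mathfrak a+(\mathfrak c-\mathfrak a)\|\mathbf x\|^2\le t^2\le\mathfrak b+(\mathfrak c-\mathfrak b)\|\mathbf x\|^2\}$, $\Lambda^{d+1}_{\mathfrak a,\mathfrak b,\mathfrak c}=\{(\mathbf x,t)\in\mathbb X^{d+1}_{\mathfrak a,\mathfrak b,\mathfrak c}:t\ge0\}$, weight $\mathbf W^{\beta,\gamma}_{\mathfrak a,\mathfrak b,\mathfrak c}(\mathbf x,t)=|t|\Big(\frac{-\mathfrak a+(\mathfrak a-\mathfrak c)\|\mathbf x\|^2+t^2}{\mathfrak b-\mathfrak a}\Big)^{\beta-\frac12}\Big(\frac{\mathfrak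 b-(\mathfrak b-\mathfrak c)\|\mathbf x\|^2-t^2}{\mathfrak b-\mathfrak a}\Big)^\gamma$. $\|\cdot\|_p$ is the $L^p$ norm on $\Lambda^{d+1}_{\mathfrak a,\mathfrak b,\mathfrak c}$ with respect to $\mathbf W^{\beta,\gamma}_{\mathfrak a,\mathfrak b,\mathfrak c}\,d\mathbf x\,dt$ (uniform norm if $p=\infty$). $\Pi^{\circ,\mathsf E}_n$ is the space of polynomials of degree at most $n$ in $d+1$ variables that are even in the last variable, and $E_n(f)_p=\inf_{g\in\Pi^{\circ,\mathsf E}_n}\|f-g\|_p$. $\mathcal V^{\mathsf E}_n$ is the space of polynomials of degree $n$, even in $t$, orthogonal in $L^2(\mathbf W^{\beta,\gamma}_{\mathfrak a,\mathfrak b,\mathfrak c},\mathbb X^{d+1}_{\mathfrak a,\mathfrak b,\mathfrak c})$ to all polynomials of lower degree, and $\operatorname{proj}_n$ the orthogonal projection of $L^2(\mathbf W^{\beta,\gamma}_{\mathfrak a,\mathfrak b,\mathfrak c},\Lambda^{d+1}_{\mathfrak a,\mathfrak b,\mathfrak c})$ onto it. The fractional operator is defined spectrally by $\operatorname{proj}_n\big((-\mathfrak D)^{r/2}g\big)=\big(n(n+2\beta+2\gamma+d+1)\big)^{r/2}\operatorname{proj}_n g$ for all $n$ (the numbers $-n(n+2\beta+2\gamma+d+1)$ being the eigenvalues on $\mathcal V^{\mathsf E}_n$ of a second-order differential operator $\mathfrak D$). The K-functional is $K_r(f;\rho)_p=\inf_{g\in C^r(\Lambda^{d+1}_{\mathfrak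 a,\mathfrak b,\mathfrak c})}\{\|f-g\|_p+\rho^r\|(-\mathfrak D)^{r/2}g\|_p\}$. *)

theory Defs
  imports "HOL-Analysis.Analysis"
begin

type_synonym 'd pt = "(real^'d) \<times> real"

definition XX :: "real \<Rightarrow> real \<Rightarrow> real \<Rightarrow> 'd::finite pt set" where
  "XX a b c = {(x,t). norm x \<le> 1 \<and> a + (c - a) * (norm x)^2 \<le> t^2 \<and> t^2 \<le> b + (c - b) * (norm x)^2}"

definition LL :: "real \<Rightarrow> real \<Rightarrow> real \<Rightarrow> 'd::finite pt set" where
  "LL a b c = {(x,t). (x,t) \<in> XX a b c \<and> t \<ge> 0}"

definition WW :: "real \<Rightarrow> real \<Rightarrow> real \<Rightarrow> real \<Rightarrow> real \<Rightarrow> 'd::finite pt \<Rightarrow> real" where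
  "WW a b c \<beta> \<gamma> = (\<lambda>(x,t). \<bar>t\<bar>
      * ((- a + (a - c) * (norm x)^2 + t^2) / (b - a)) powr (\<beta> - 1/2)
      * ((b - (b - c) * (norm x)^2 - t^2) / (b - a)) powr \<gamma>)"

definition wnorm :: "real \<Rightarrow> real \<Rightarrow> real \<Rightarrow> real \<Rightarrow> real \<Rightarrow> ennreal \<Rightarrow> ('d::finite pt \<Rightarrow> real) \<Rightarrow> ennreal" where
  "wnorm a b c \<beta> \<gamma> p f =
    (if p = \<infinity> then (SUP z\<in>LL a b c. ennreal \<bar>f z\<bar>)
     else (let I = (\<integral>\<^sup>+ z. indicator (LL a b c) z * ennreal (WW a b c \<beta> \<gamma> z * \<bar>f z\<bar> powr enn2real p) \<partial>lborel)
           in if I = \<infinity> then \<infinity> else ennreal ((enn2real I) powr (1 / enn2real p))))"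

definition in_Lp :: "real \<Rightarrow> real \<Rightarrow> real \<Rightarrow> real \<Rightarrow> real \<Rightarrow> real \<Rightarrow> ('d::finite pt \<Rightarrow> real) \<Rightarrow> bool" where
  "in_Lp a b c \<beta> \<gamma> p f \<longleftrightarrow> (\<lambda>z. indicator (LL a b c) z * f z) \<in> borel_measurable lborel \<and>
     (\<integral>\<^sup>+ z. indicator (LL a b c) z * ennreal (WW a b c \<beta> \<gamma> z * \<bar>f z\<bar> powr p) \<partial>lborel) < \<infinity>"

definition mindex :: "nat \<Rightarrow> (('d::finite \<Rightarrow> nat) \<times> nat) set" where
  "mindex n = {(\<alpha>, k). (\<Sum>i\<in>UNIV. \<alpha> i) + k \<le> n}"

definition polys :: "nat \<Rightarrow> ('d::finite pt \<Rightarrow> real) set" where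
  "polys n = {P. \<exists>coef. P = (\<lambda>(x,t). \<Sum>(\<alpha>,k)\<in>mindex n. coef \<alpha> k * (\<Prod>i\<in>UNIV. (x $ i) ^ \<alpha> i) * t ^ k)}"

definition polysE :: "nat \<Rightarrow> ('d::finite pt \<Rightarrow> real) set" where
  "polysE n = {P \<in> polys n. \<forall>x t. P (x, - t) = P (x, t)}"

definition VE :: "real \<Rightarrow> real \<Rightarrow> real \<Rightarrow> real \<Rightarrow> real \<Rightarrow> nat \<Rightarrow> ('d::finite pt \<Rightarrow> real) set" where
  "VE a b c \<beta> \<gamma> n = {P \<in> polysE n. \<forall>m<n. \<forall>Q\<in>polys m.
      (LINT z : XX a b c | lborel. WW a b c \<beta> \<gamma> z * P z * Q z) = 0}"

definition proj :: "real \<Rightarrow> real \<Rightarrow> real \<Rightarrow> real \<Rightarrow> real \<Rightarrow> nat \<Rightarrow> ('d::finite pt \<Rightarrow> real) \<Rightarrow> ('d pt \<Rightarrow> real)" where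
  "proj a b c \<beta> \<gamma> n g = (THE q. q \<in> VE a b c \<beta> \<gamma> n \<and>
      (\<forall>v\<in>VE a b c \<beta> \<gamma> n. (LINT z : LL a b c | lborel. WW a b c \<beta> \<gamma> z * (g z - q z) * v z) = 0))"

text \<open>h = (-D)^{r/2} g, defined spectrally (h in L^2(W, Lambda)).\<close>
definition frac_op :: "real \<Rightarrow> real \<Rightarrow> real \<Rightarrow> real \<Rightarrow> real \<Rightarrow> nat \<Rightarrow> ('d::finite pt \<Rightarrow> real) \<Rightarrow> ('d pt \<Rightarrow> real) \<Rightarrow> bool" where
  "frac_op a b c \<beta> \<gamma> r g h \<longleftrightarrow> in_Lp a b c \<beta> \<gamma> 2 h \<and>
     (\<forall>n. proj a b c \<beta> \<gamma> n h =
        (\<lambda>z. (sqrt (real n * (real n + 2 * \<beta> + 2 * \<gamma> + real CARD('d) + 1))) ^ r * proj a b c \<beta> \<gamma> n g z))"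

fun Cr_on :: "nat \<Rightarrow> 'a::euclidean_space set \<Rightarrow> ('a \<Rightarrow> real) \<Rightarrow> bool" where
  "Cr_on 0 U F = continuous_on U F"
| "Cr_on (Suc k) U F = (F differentiable_on U \<and>
      (\<forall>e\<in>Basis. Cr_on k U (\<lambda>z. frechet_derivative F (at z) e)))"

definition Cr :: "nat \<Rightarrow> 'a::euclidean_space set \<Rightarrow> ('a \<Rightarrow> real) set" where
  "Cr r S = {g. \<exists>U G. open U \<and> S \<subseteq> U \<and> Cr_on r U G \<and> (\<forall>z\<in>S. G z = g z)}"

definition En :: "real \<Rightarrow> real \<Rightarrow> real \<Rightarrow> real \<Rightarrow> real \<Rightarrow> ennreal \<Rightarrow> nat \<Rightarrow> ('d::finite pt \<Rightarrow> real) \<Rightarrow> ennreal" where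
  "En a b c \<beta> \<gamma> p n f = (INF g\<in>polysE n. wnorm a b c \<beta> \<gamma> p (\<lambda>z. f z - g z))"

definition Kfun :: "real \<Rightarrow> real \<Rightarrow> real \<Rightarrow> real \<Rightarrow> real \<Rightarrow> ennreal \<Rightarrow> nat \<Rightarrow> ('d::finite pt \<Rightarrow> real) \<Rightarrow> real \<Rightarrow> ennreal" where
  "Kfun a b c \<beta> \<gamma> p r f \<rho> = Inf {wnorm a b c \<beta> \<gamma> p (\<lambda>z. f z - g z) + ennreal (\<rho> ^ r) * wnorm a b c \<beta> \<gamma> p h
      | g h. g \<in> Cr r (LL a b c) \<and> frac_op a b c \<beta> \<gamma> r g h}"

end

theory Submission
  imports Defs "HOL-Computational_Algebra.Computational_Algebra"
begin

text \<open>
  In the coordinates \<open>x\<close>, \<open>\<tau> = (t\<^sup>2 - a - (c - a)|x|\<^sup>2) / (b - a)\<close>, \<open>v = 1 - |x|\<^sup>2 - \<tau>\<close> the weight is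
  \<open>|t| \<tau> powr (\<beta> - 1/2) * v powr \<gamma>\<close>, so the moments are explicit and independent of \<open>a\<close>, \<open>b\<close>, \<open>c\<close> up to a factor.
  Replacing \<open>\<xi>\<close> in a polynomial \<open>k\<close> on \<open>[-1, 1]\<close> by \<open>x \<bullet> x' + s \<surd>(\<tau> \<tau>') + s' \<surd>(v v')\<close> and averaging over \<open>s\<close>, \<open>s'\<close> lifts it
  to a kernel. The lift of \<open>Z\<^sub>n = (n + lam) / lam * C\<^sub>n\<close>, with \<open>C\<^sub>n\<close> the Gegenbauer polynomial of index
  \<open>lam = \<beta> + \<gamma> + (d + 1) / 2\<close>, is the reproducing kernel of the n-th eigenspace: orthogonality follows from the
  symmetry of the differential operator on moments, the normalisation from an approximate identity.

  High Cesaro sums of \<open>Z\<^sub>n\<close> and of its derivatives are nonnegative on \<open>[-1, 1]\<close>, hence so are their lifts. Summation by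
  parts then bounds a multiplier on every weighted space at once (Schur's test) by the weighted sum of its
  high-order differences. Applied to smooth cutoffs this gives polynomial near-identities, and applied to cutoffs times
  powers of the eigenvalues \<open>k (k + 2 lam)\<close> it gives the inequalities of Jackson and Bernstein. The first yields (i); the second,
  summed over a dyadic sequence of near-best polynomials, yields (ii).
\<close>

section \<open>Gegenbauer polynomials\<close>

text \<open>The averaging behind the lift needs parameters at least 1/2.
  \<open>bb = \<beta> + 1/2\<close> meets this, but \<open>gg = \<gamma> + 1\<close> can be any
  positive number, and for \<open>gg < 1/2\<close> the lift is not an average: a polynomial
  nonnegative on [-1, 1] may then have a kernel that changes sign. Convexity makes up for this. One
  lift is nonnegative if the polynomial and its second derivative are, and the double lift if the
  derivatives of order 0, 2 and 4 are. This is why derivatives of Cesaro sums appear and why the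
  order of summation grows with \<open>lam + 5\<close>. Positivity reduces the multiplier estimates
  to masses. By orthogonality to constants, a lifted kernel integrates to the same number at every
  point and, being symmetric, in either variable. A nonnegative kernel is thus a multiple of a
  doubly stochastic one, and its norm is at most its mass for every p at once.\<close>

definition gegen :: "real \<Rightarrow> nat \<Rightarrow> real poly" where
  "gegen s n = (\<Sum>k\<le>n div 2. monom ((-1) ^ k * pochhammer s (n - k) * 2 ^ (n - 2 * k) / (fact k * fact (n - 2 * k))) (n - 2 * k))"

lemma coeff_gegen:
  "coeff (gegen s n) m = (if m \<le> n \<and> even (n - m)
     then (-1) ^ ((n - m) div 2) * pochhammer s ((n + m) div 2) * 2 ^ m / (fact ((n - m) div 2) * fact m) else 0)"
proof (cases "m \<le> n \<and> even (n - m)")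
  case True
  then obtain k where k: "n - m = 2 * k" by (blast elim: evenE)
  with True have n: "n = m + 2 * k" by simp
  have "coeff (gegen s n) m = (\<Sum>j\<le>n div 2. if j = k then (-1) ^ j * pochhammer s (n - j) * 2 ^ (n - 2 * j) / (fact j * fact (n - 2 * j)) else 0)"
    unfolding gegen_def coeff_sum coeff_monom by (intro sum.cong refl) (use n in auto)
  also have "\<dots> = (-1) ^ k * pochhammer s (n - k) * 2 ^ (n - 2 * k) / (fact k * fact (n - 2 * k))"
    using n by (subst sum.delta) auto
  finally show ?thesis using True n k by (simp add: algebra_simps)
next
  case False
  then show ?thesis
    unfolding gegen_def coeff_sum coeff_monom
    by (subst sum.neutral) auto
qed

lemma coeff_gegen_add:
  "coeff (gegen s (m + 2 * k)) m = (-1) ^ k * pochhammer s (m + k) * 2 ^ m / (fact k * fact m)"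
  by (simp add: coeff_gegen)

lemma coeff_gegen_eq_0: "\<not> (m \<le> n \<and> even (n - m)) \<Longrightarrow> coeff (gegen s n) m = 0"
  by (simp only: coeff_gegen if_False)

lemma pderiv_gegen_Suc: "pderiv (gegen s (Suc n)) = smult (2 * s) (gegen (s + 1) n)"
proof (rule poly_eqI)
  fix m
  show "coeff (pderiv (gegen s (Suc n))) m = coeff (smult (2 * s) (gegen (s + 1) n)) m"
  proof (cases "m \<le> n \<and> even (n - m)")
    case True
    then obtain k where "n - m = 2 * k" by (blast elim: evenE)
    with True have n: "n = m + 2 * k" by simp
    have "coeff (gegen s (Suc m + 2 * k)) (Suc m) = (-1) ^ k * pochhammer s (Suc m + k) * 2 ^ Suc m / (fact k * fact (Suc m))"
      by (rule coeff_gegen_add)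
    then have 1: "coeff (gegen s (Suc n)) (Suc m) = (-1) ^ k * (s * pochhammer (s + 1) (m + k)) * 2 ^ Suc m / (fact k * (real (Suc m) * fact m))"
      by (simp add: n pochhammer_rec)
    have 2: "coeff (gegen (s + 1) n) m = (-1) ^ k * pochhammer (s + 1) (m + k) * 2 ^ m / (fact k * fact m)"
      unfolding n by (rule coeff_gegen_add)
    show ?thesis unfolding coeff_pderiv coeff_smult 1 2 by (simp add: divide_simps)
  next
    case False
    then show ?thesis by (auto simp: coeff_pderiv coeff_gegen)
  qed
qed

lemma gegen_0 [simp]: "gegen s 0 = 1"
  by (simp add: gegen_def monom_0 one_pCons)

lemma gegen_1: "gegen s (Suc 0) = [:0, 2 * s:]"
  by (simp add: gegen_def monom_Suc monom_0)

lemma degree_gegen_le: "degree (gegen s n) \<le> n"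
  by (rule degree_le) (auto simp: coeff_gegen)

text \<open>The three-term recurrence, checked coefficient by coefficient on the explicit formula.
  It yields the differential equation of the generating series and the values at 1.\<close>

lemma gegen_rec:
  "smult (real n + 2) (gegen s (Suc (Suc n))) =
     smult (2 * (real n + 1 + s)) ([:0, 1:] * gegen s (Suc n)) - smult (real n + 2 * s) (gegen s n)"
proof (rule poly_eqI)
  fix m
  have X: "coeff ([:0, 1:] * gegen s (Suc n)) m = (case m of 0 \<Rightarrow> 0 | Suc l \<Rightarrow> coeff (gegen s (Suc n)) l)"
    by (simp add: coeff_pCons)
  show "coeff (smult (real n + 2) (gegen s (Suc (Suc n)))) m =
     coeff (smult (2 * (real n + 1 + s)) ([:0, 1:] * gegen s (Suc n)) - smult (real n + 2 * s) (gegen s n)) m"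
  proof (cases "m \<le> Suc (Suc n) \<and> even (Suc (Suc n) - m)")
    case True
    then obtain k where "Suc (Suc n) - m = 2 * k" by (blast elim: evenE)
    with True have nk: "Suc (Suc n) = m + 2 * k" by simp
    have c1: "coeff (gegen s (Suc (Suc n))) m = (-1) ^ k * pochhammer s (m + k) * 2 ^ m / (fact k * fact m)"
      unfolding nk by (rule coeff_gegen_add)
    have c2: "coeff ([:0, 1:] * gegen s (Suc n)) m = (if m = 0 then 0 else
       (-1) ^ k * pochhammer s (m - 1 + k) * 2 ^ (m-1) / (fact k * fact (m-1)))"
    proof (cases m)
      case 0 then show ?thesis by simp
    next
      case (Suc l)
      then have "Suc n = l + 2 * k" using nk by simp
      then show ?thesis unfolding X using Suc coeff_gegen_add[of s l k] by simp
    qed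
    have c3: "coeff (gegen s n) m = (if k = 0 then 0 else
       (-1) ^ (k-1) * pochhammer s (m + (k - 1)) * 2 ^ m / (fact (k-1) * fact m))"
    proof (cases k)
      case 0 then show ?thesis using nk by (auto simp: coeff_gegen)
    next
      case (Suc l)
      then have "n = m + 2 * l" using nk by simp
      then show ?thesis using Suc coeff_gegen_add[of s m l] by simp
    qed
    have rn: "real n = real m + 2 * real k - 2" using nk by linarith
    show ?thesis unfolding coeff_diff coeff_smult c1 c2 c3 rn
    proof (cases m; cases k)
      assume "m = 0" "k = 0" then show "(real m + 2 * real k - 2 + 2) * ((- 1) ^ k * pochhammer s (m + k) * 2 ^ m / (fact k * fact m)) =
    2 * (real m + 2 * real k - 2 + 1 + s) *
    (if m = 0 then 0 else (- 1) ^ k * pochhammer s (m - 1 + k) * 2 ^ (m - 1) / (fact k * fact (m - 1))) -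
    (real m + 2 * real k - 2 + 2 * s) *
    (if k = 0 then 0 else (- 1) ^ (k - 1) * pochhammer s (m + (k - 1)) * 2 ^ m / (fact (k - 1) * fact m))"
        using nk by simp
    next
      fix l assume "m = 0" "k = Suc l" then show "(real m + 2 * real k - 2 + 2) * ((- 1) ^ k * pochhammer s (m + k) * 2 ^ m / (fact k * fact m)) =
    2 * (real m + 2 * real k - 2 + 1 + s) *
    (if m = 0 then 0 else (- 1) ^ k * pochhammer s (m - 1 + k) * 2 ^ (m - 1) / (fact k * fact (m - 1))) -
    (real m + 2 * real k - 2 + 2 * s) *
    (if k = 0 then 0 else (- 1) ^ (k - 1) * pochhammer s (m + (k - 1)) * 2 ^ m / (fact (k - 1) * fact m))"
        by (simp add: pochhammer_Suc divide_simps) (simp add: algebra_simps)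
    next
      fix l assume "m = Suc l" "k = 0" then show "(real m + 2 * real k - 2 + 2) * ((- 1) ^ k * pochhammer s (m + k) * 2 ^ m / (fact k * fact m)) =
    2 * (real m + 2 * real k - 2 + 1 + s) *
    (if m = 0 then 0 else (- 1) ^ k * pochhammer s (m - 1 + k) * 2 ^ (m - 1) / (fact k * fact (m - 1))) -
    (real m + 2 * real k - 2 + 2 * s) *
    (if k = 0 then 0 else (- 1) ^ (k - 1) * pochhammer s (m + (k - 1)) * 2 ^ m / (fact (k - 1) * fact m))"
        by (simp add: pochhammer_Suc divide_simps)
    next
      fix l l' assume "m = Suc l" "k = Suc l'" then show "(real m + 2 * real k - 2 + 2) * ((- 1) ^ k * pochhammer s (m + k) * 2 ^ m / (fact k * fact m)) =
    2 * (real m + 2 * real k - 2 + 1 + s) *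
    (if m = 0 then 0 else (- 1) ^ k * pochhammer s (m - 1 + k) * 2 ^ (m - 1) / (fact k * fact (m - 1))) -
    (real m + 2 * real k - 2 + 2 * s) *
    (if k = 0 then 0 else (- 1) ^ (k - 1) * pochhammer s (m + (k - 1)) * 2 ^ m / (fact (k - 1) * fact m))"
        by (simp add: pochhammer_Suc divide_simps) (simp add: algebra_simps)
    qed
  next
    case False
    have "coeff ([:0, 1:] * gegen s (Suc n)) m = 0"
      unfolding X using False by (auto split: nat.splits simp: coeff_gegen)
    moreover have "coeff (gegen s n) m = 0" using False by (auto simp: coeff_gegen)
    moreover have "coeff (gegen s (Suc (Suc n))) m = 0" using False by (rule coeff_gegen_eq_0)
    ultimately show ?thesis by (simp only: coeff_smult coeff_diff mult_zero_right diff_zero)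
  qed
qed

text \<open>The generating series (1 - 2 x r + r^2)^(-s). It is handled through its differential
  equation, so that the real exponent never has to be interpreted for formal series.\<close>

definition gfps :: "real \<Rightarrow> real \<Rightarrow> real fps" where
  "gfps s x = Abs_fps (\<lambda>n. poly (gegen s n) x)"

text \<open>For x = cos theta this is the real part of the geometric series with terms e^(i (k+1)
  theta) r^k, hence (x - r) / (1 - 2 x r + r^2). Up to the factor 2 s it is the logarithmic
  derivative of \<open>gfps\<close>.\<close>

definition cfps :: "real \<Rightarrow> real fps" where
  "cfps x = Abs_fps (\<lambda>n. cos (real (Suc n) * arccos x))"

lemma gfps_ode:
  "(1 - fps_const (2 * x) * fps_X + fps_X ^ 2) * fps_deriv (gfps s x) = fps_const (2 * s) * (fps_const x - fps_X) * gfps s x"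
proof (rule fps_ext)
  fix n
  have r: "(real l + 2) * poly (gegen s (Suc (Suc l))) x =
     2 * (real l + 1 + s) * (x * poly (gegen s (Suc l)) x) - (real l + 2 * s) * poly (gegen s l) x" for l
    using arg_cong[OF gegen_rec[of l s], of "\<lambda>p. poly p x"] by simp
  have "(1 - fps_const (2 * x) * fps_X + fps_X ^ 2) * fps_deriv (gfps s x) =
     fps_deriv (gfps s x) - fps_const (2 * x) * (fps_X * fps_deriv (gfps s x)) + fps_X * (fps_X * fps_deriv (gfps s x))"
    by (simp add: algebra_simps power2_eq_square)
  moreover have "fps_const (2 * s) * (fps_const x - fps_X) * gfps s x = fps_const (2 * s * x) * gfps s x - fps_const (2 * s) * (fps_X * gfps s x)"
    by (simp add: algebra_simps flip: fps_const_mult)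
  moreover have "(fps_deriv (gfps s x) - fps_const (2 * x) * (fps_X * fps_deriv (gfps s x)) + fps_X * (fps_X * fps_deriv (gfps s x))) $ n
     = (fps_const (2 * s * x) * gfps s x - fps_const (2 * s) * (fps_X * gfps s x)) $ n"
  proof (cases n)
    case 0
    then show ?thesis by (simp add: gfps_def gegen_1)
  next
    case (Suc l)
    then show ?thesis using r[of l]
      by (cases l) (simp_all add: gfps_def gegen_1 algebra_simps)
  qed
  ultimately show "((1 - fps_const (2 * x) * fps_X + fps_X ^ 2) * fps_deriv (gfps s x)) $ n = (fps_const (2 * s) * (fps_const x - fps_X) * gfps s x) $ n"
    by simp
qed

lemma cfps_eq:
  assumes "\<bar>x\<bar> \<le> 1"
  shows "(1 - fps_const (2 * x) * fps_X + fps_X ^ 2) * cfps x = fps_const x - fps_X"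
proof (rule fps_ext)
  fix n
  have c: "cos (arccos x) = x" using assms by (simp add: abs_le_iff)
  have e: "(1 - fps_const (2 * x) * fps_X + fps_X ^ 2) * cfps x = cfps x - fps_const (2 * x) * (fps_X * cfps x) + fps_X * (fps_X * cfps x)"
    by (simp add: algebra_simps power2_eq_square)
  have r: "cos (real (Suc (Suc m)) * arccos x) = 2 * x * cos (real (Suc m) * arccos x) - cos (real m * arccos x)" for m
  proof -
    have "cos (real (Suc (Suc m)) * arccos x) + cos (real m * arccos x) = 2 * (cos (real (Suc m) * arccos x) * cos (arccos x))"
      unfolding cos_times_cos by (simp add: algebra_simps)
    then show ?thesis using c by (simp only: mult.assoc mult.commute[of x])
  qed
  show "((1 - fps_const (2 * x) * fps_X + fps_X ^ 2) * cfps x) $ n = (fps_const x - fps_X) $ n"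
  proof (cases n)
    case 0 then show ?thesis unfolding e by (simp add: cfps_def c)
  next
    case (Suc l)
    show ?thesis
    proof (cases l)
      case 0
      have "cos (2 * arccos x) = 2 * x * x - 1" using r[of 0] c by simp
      then show ?thesis unfolding e Suc 0 by (simp add: cfps_def c algebra_simps)
    next
      case (Suc m)
      show ?thesis unfolding e \<open>n = Suc l\<close> Suc using r[of "Suc m"]
        by (simp add: cfps_def)
    qed
  qed
qed

text \<open>For \<open>x = cos \<theta>\<close> the series \<open>F = (1 - r)\<^sup>-\<^sup>M (1 - 2 x r + r\<^sup>2)\<^sup>-\<^sup>s\<close> satisfies
  \<open>F' = F * (\<Sum>k. (M + 2 s cos ((k + 1) \<theta>)) r\<^sup>k)\<close>, a recurrence with nonnegative weights once \<open>M \<ge> 2 s\<close>.\<close>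

lemma gegen_sums_nonneg:
  assumes x: "\<bar>x\<bar> \<le> 1" and s: "0 \<le> s" "2 * s \<le> real M"
  shows "0 \<le> (gfps s x * inverse (1 - fps_X) ^ M) $ n"
proof -
  let ?I = "inverse (1 - fps_X) :: real fps"
  let ?q = "1 - fps_const (2 * x) * fps_X + fps_X ^ 2"
  have q0: "?q \<noteq> 0"
  proof
    assume q: "?q = 0"
    have "fps_nth ?q 0 = 1" by simp
    then show False unfolding q by simp
  qed
  have "?q * fps_deriv (gfps s x) = ?q * (fps_const (2 * s) * cfps x * gfps s x)"
    unfolding gfps_ode cfps_eq[OF x, symmetric] by (simp only: mult_ac)
  then have dG: "fps_deriv (gfps s x) = fps_const (2 * s) * cfps x * gfps s x"
    using q0 by simp
  have dI: "fps_deriv ?I = ?I * ?I"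
    by (simp add: fps_inverse_deriv power2_eq_square)
  have dIM: "fps_deriv (?I ^ M) = fps_const (real M) * ?I * ?I ^ M"
    by (induction M) (simp_all add: dI algebra_simps del: fps_inverse_deriv flip: fps_const_add)
  define F where "F = gfps s x * ?I ^ M"
  have dF: "fps_deriv F = F * (fps_const (2 * s) * cfps x + fps_const (real M) * ?I)"
    unfolding F_def fps_deriv_mult dG dIM by (simp add: algebra_simps)
  have I: "?I $ k = 1" for k by (simp add: fps_inverse_gp' flip: fps_inverse_gp')
  have w: "(fps_const (2 * s) * cfps x + fps_const (real M) * ?I) $ k \<ge> 0" for k
  proof -
    have "- 1 \<le> cos (real (Suc k) * arccos x)" by simp
    then have "2 * s * (-1) \<le> 2 * s * cos (real (Suc k) * arccos x)"
      using s by (intro mult_left_mono) auto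
    then show ?thesis using s I by (simp add: cfps_def)
  qed
  have "0 \<le> F $ n"
  proof (induction n rule: less_induct)
    case (less n)
    show ?case
    proof (cases n)
      case 0 then show ?thesis by (simp add: F_def gfps_def fps_power_zeroth)
    next
      case (Suc m)
      have "real n * F $ n = (fps_deriv F) $ m" using Suc by simp
      also have "\<dots> \<ge> 0" unfolding dF fps_mult_nth
        by (intro sum_nonneg mult_nonneg_nonneg w less.IH) (use Suc in auto)
      finally show ?thesis using Suc by (simp add: zero_le_mult_iff)
    qed
  qed
  then show ?thesis by (simp add: F_def)
qed

section \<open>Finite differences and discrete symbols\<close>

text \<open>The sign is that of minus the forward difference, so that summation by parts against
  \<open>psum\<close> produces no signs, even when iterated.\<close>

definition nab :: "(nat \<Rightarrow> real) \<Rightarrow> nat \<Rightarrow> real" where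
  "nab m k = m k - m (Suc k)"

definition psum :: "(nat \<Rightarrow> real) \<Rightarrow> nat \<Rightarrow> real" where
  "psum z k = (\<Sum>n\<le>k. z n)"

lemma nab_funpow_vanish: "(\<And>k. k > L \<Longrightarrow> m k = 0) \<Longrightarrow> k > L \<Longrightarrow> (nab ^^ j) m k = 0"
proof (induction j arbitrary: k)
  case (Suc j)
  have "(nab ^^ j) m k = 0" "(nab ^^ j) m (Suc k) = 0" using Suc by auto
  then show ?case by (simp add: nab_def[of "(nab ^^ j) m"])
qed simp

lemma abel_summation:
  "(\<Sum>k\<le>L. m k * z k) = (\<Sum>k\<le>L. nab m k * psum z k) + m (Suc L) * psum z L"
proof (induction L)
  case (Suc L)
  have "psum z (Suc L) = psum z L + z (Suc L)" by (simp add: psum_def)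
  with Suc show ?case by (simp add: nab_def algebra_simps)
qed (simp add: nab_def psum_def algebra_simps)

text \<open>Differences look only forward, so they vanish beyond \<open>L\<close> together with
  \<open>m\<close>, and every boundary term of the repeated summation by parts disappears.\<close>

lemma abel_summation_iterated:
  assumes "\<And>k. k > L \<Longrightarrow> m k = 0"
  shows "(\<Sum>k\<le>L. m k * z k) = (\<Sum>k\<le>L. (nab ^^ j) m k * (psum ^^ j) z k)"
proof (induction j)
  case (Suc j)
  have "(nab ^^ j) m (Suc L) = 0" using nab_funpow_vanish[OF assms] by simp
  then show ?case unfolding Suc by (subst abel_summation) simp
qed simp

text \<open>Discrete symbols of order \<open>a\<close>, uniformly in the index \<open>i\<close>.\<close>

definition symb :: "nat \<Rightarrow> real \<Rightarrow> ('i \<Rightarrow> nat \<Rightarrow> real) \<Rightarrow> bool" where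
  "symb J a m \<longleftrightarrow> (\<exists>C. \<forall>j\<le>J. \<forall>i k. \<bar>(nab ^^ j) (m i) k\<bar> \<le> C * real (Suc k) powr (a - real j))"

lemma symb_0: "symb 0 a m \<longleftrightarrow> (\<exists>C. \<forall>i k. \<bar>m i k\<bar> \<le> C * real (Suc k) powr a)"
  by (simp add: symb_def)

text \<open>The induction scheme of the symbol calculus: each closure property follows from a rule
  for the first difference alone, without a Leibniz formula of higher order.\<close>

lemma symb_Suc: "symb (Suc J) a m \<longleftrightarrow> symb 0 a m \<and> symb J (a - 1) (\<lambda>i. nab (m i))"
proof
  assume "symb (Suc J) a m"
  then obtain C where C: "\<forall>j\<le>Suc J. \<forall>i k. \<bar>(nab ^^ j) (m i) k\<bar> \<le> C * real (Suc k) powr (a - real j)"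
    unfolding symb_def by blast
  have "symb 0 a m" unfolding symb_0 using C[rule_format, of 0] by auto
  moreover have "symb J (a - 1) (\<lambda>i. nab (m i))"
    unfolding symb_def
  proof (intro exI[of _ C] allI impI)
    fix j i k assume "j \<le> J"
    then have "\<bar>(nab ^^ Suc j) (m i) k\<bar> \<le> C * real (Suc k) powr (a - real (Suc j))" using C by blast
    then show "\<bar>(nab ^^ j) (nab (m i)) k\<bar> \<le> C * real (Suc k) powr (a - 1 - real j)"
      by (simp add: funpow_swap1 algebra_simps)
  qed
  ultimately show "symb 0 a m \<and> symb J (a - 1) (\<lambda>i. nab (m i))" by blast
next
  assume A: "symb 0 a m \<and> symb J (a - 1) (\<lambda>i. nab (m i))"
  then obtain C1 where C1: "\<forall>i k. \<bar>m i k\<bar> \<le> C1 * real (Suc k) powr a" unfolding symb_0 by blast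
  from A obtain C2 where C2: "\<forall>j\<le>J. \<forall>i k. \<bar>(nab ^^ j) (nab (m i)) k\<bar> \<le> C2 * real (Suc k) powr (a - 1 - real j)"
    unfolding symb_def by blast
  show "symb (Suc J) a m" unfolding symb_def
  proof (intro exI[of _ "max C1 C2"] allI impI)
    fix j i k assume j: "j \<le> Suc J"
    show "\<bar>(nab ^^ j) (m i) k\<bar> \<le> max C1 C2 * real (Suc k) powr (a - real j)"
    proof (cases j)
      case 0
      have "\<bar>m i k\<bar> \<le> C1 * real (Suc k) powr a" using C1 by blast
      also have "\<dots> \<le> max C1 C2 * real (Suc k) powr a" by (intro mult_right_mono) auto
      finally show ?thesis using 0 by simp
    next
      case (Suc l)
      have "\<bar>(nab ^^ l) (nab (m i)) k\<bar> \<le> C2 * real (Suc k) powr (a - 1 - real l)" using C2 j Suc by simp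
      also have "\<dots> \<le> max C1 C2 * real (Suc k) powr (a - 1 - real l)" by (intro mult_right_mono) auto
      finally show ?thesis using Suc by (simp add: funpow_swap1 algebra_simps)
    qed
  qed
qed

lemma symb_SucD: "symb (Suc J) a m \<Longrightarrow> symb J a m"
  unfolding symb_def by (meson le_Suc_eq)

lemma symb_imp_0: "symb J a m \<Longrightarrow> symb 0 a m"
  unfolding symb_def by fastforce

lemma symb_zero: "symb J a (\<lambda>i k. 0)"
proof -
  have "(nab ^^ j) (\<lambda>k. 0) = (\<lambda>k. 0)" for j by (induction j) (auto simp: nab_def)
  then show ?thesis unfolding symb_def by (auto intro!: exI[of _ 0])
qed

lemma symb_add: "symb J a m \<Longrightarrow> symb J a m' \<Longrightarrow> symb J a (\<lambda>i k. m i k + m' i k)"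
proof (induction J arbitrary: a m m')
  case 0
  then obtain C1 C2 where C: "\<And>i k. \<bar>m i k\<bar> \<le> C1 * real (Suc k) powr a" "\<And>i k. \<bar>m' i k\<bar> \<le> C2 * real (Suc k) powr a"
    unfolding symb_0 by blast
  show ?case unfolding symb_0
  proof (intro exI[of _ "C1 + C2"] allI)
    fix i k show "\<bar>m i k + m' i k\<bar> \<le> (C1 + C2) * real (Suc k) powr a"
      using C(1)[of i k] C(2)[of i k] unfolding distrib_right by linarith
  qed
next
  case (Suc J)
  have e: "nab (\<lambda>k. m i k + m' i k) = (\<lambda>k. nab (m i) k + nab (m' i) k)" for i by (auto simp: nab_def)
  have m: "symb J a m" "symb J a m'" using Suc.prems symb_SucD by blast+
  have n: "symb J (a - 1) (\<lambda>i. nab (m i))" "symb J (a - 1) (\<lambda>i. nab (m' i))" using Suc.prems symb_Suc by blast+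
  have "symb J (a - 1) (\<lambda>i. nab (\<lambda>k. m i k + m' i k))" unfolding e by (rule Suc.IH[OF n])
  moreover have "symb 0 a (\<lambda>i k. m i k + m' i k)" using Suc.IH[OF m] symb_imp_0 by blast
  ultimately show ?case unfolding symb_Suc[of J] by blast
qed

lemma symb_reindex: "symb J a m \<Longrightarrow> symb J a (\<lambda>i. m (f i))"
  unfolding symb_def by blast

lemma symb_cmult: "symb J a m \<Longrightarrow> symb J a (\<lambda>i k. c * m i k)"
proof (induction J arbitrary: a m)
  case 0
  then obtain C1 where C: "\<And>i k. \<bar>m i k\<bar> \<le> C1 * real (Suc k) powr a"
    unfolding symb_0 by blast
  show ?case unfolding symb_0
  proof (intro exI[of _ "\<bar>c\<bar> * C1"] allI)
    fix i k show "\<bar>c * m i k\<bar> \<le> \<bar>c\<bar> * C1 * real (Suc k) powr a"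
      using mult_left_mono[OF C(1)[of i k], of "\<bar>c\<bar>"] by (simp add: abs_mult mult.assoc)
  qed
next
  case (Suc J)
  have e: "nab (\<lambda>k. c * m i k) = (\<lambda>k. c * nab (m i) k)" for i by (auto simp: nab_def algebra_simps)
  have "symb J (a - 1) (\<lambda>i. nab (m i))" using Suc.prems symb_Suc by blast
  then have 1: "symb J (a - 1) (\<lambda>i. nab (\<lambda>k. c * m i k))" unfolding e by (rule Suc.IH)
  have "symb J a m" using Suc.prems symb_SucD by blast
  then have "symb J a (\<lambda>i k. c * m i k)" by (rule Suc.IH)
  then have "symb 0 a (\<lambda>i k. c * m i k)" by (rule symb_imp_0)
  with 1 show ?case unfolding symb_Suc[of J] by blast
qed

lemma powr_shift_le: "real (Suc (Suc k)) powr e \<le> 2 powr \<bar>e\<bar> * real (Suc k) powr e"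
proof (cases "e \<ge> 0")
  case True
  have "real (Suc (Suc k)) powr e \<le> (2 * real (Suc k)) powr e" by (rule powr_mono2) (use True in auto)
  also have "\<dots> = 2 powr \<bar>e\<bar> * real (Suc k) powr e" using True by (simp only: powr_mult abs_of_nonneg)
  finally show ?thesis .
next
  case False
  have "real (Suc (Suc k)) powr e \<le> real (Suc k) powr e" by (rule powr_mono2') (use False in auto)
  also have "\<dots> \<le> 2 powr \<bar>e\<bar> * real (Suc k) powr e"
    using mult_right_mono[of 1 "2 powr \<bar>e\<bar>" "real (Suc k) powr e"] ge_one_powr_ge_zero[of 2 "\<bar>e\<bar>"] by simp
  finally show ?thesis .
qed

text \<open>The product and quotient rules for \<open>nab\<close> involve a factor taken at
  \<open>Suc k\<close>. Powers of k + 1 and k + 2 are comparable, so the shift costs only a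
  constant.\<close>

lemma symb_shift: "symb J a m \<Longrightarrow> symb J a (\<lambda>i k. m i (Suc k))"
proof (induction J arbitrary: a m)
  case 0
  then obtain C where C: "\<And>i k. \<bar>m i k\<bar> \<le> C * real (Suc k) powr a"
    unfolding symb_0 by blast
  \<comment> \<open>Any index of the nonempty index type shows that the bound is
    nonnegative.\<close>
  have C0: "C \<ge> 0" using order_trans[OF abs_ge_zero C[of undefined 0]] by simp
  show ?case unfolding symb_0
  proof (intro exI[of _ "C * 2 powr \<bar>a\<bar>"] allI)
    fix i k
    have "\<bar>m i (Suc k)\<bar> \<le> C * real (Suc (Suc k)) powr a" by (rule C)
    also have "\<dots> \<le> C * (2 powr \<bar>a\<bar> * real (Suc k) powr a)" by (intro mult_left_mono powr_shift_le C0)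
    finally show "\<bar>m i (Suc k)\<bar> \<le> C * 2 powr \<bar>a\<bar> * real (Suc k) powr a" by (simp add: mult.assoc)
  qed
next
  case (Suc J)
  have e: "nab (\<lambda>k. m i (Suc k)) = (\<lambda>k. nab (m i) (Suc k))" for i by (auto simp: nab_def)
  have "symb J (a - 1) (\<lambda>i. nab (m i))" using Suc.prems symb_Suc by blast
  then have 1: "symb J (a - 1) (\<lambda>i. nab (\<lambda>k. m i (Suc k)))" unfolding e by (rule Suc.IH)
  have "symb J a m" using Suc.prems symb_SucD by blast
  then have "symb 0 a (\<lambda>i k. m i (Suc k))" using Suc.IH symb_imp_0 by blast
  with 1 show ?case unfolding symb_Suc[of J] by blast
qed

text \<open>The first difference of a product is \<open>m * nab m'\<close> plus \<open>nab m\<close>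
  times the shifted \<open>m'\<close>; both terms have order a + b - 1, and the induction hypothesis
  applies to each.\<close>

lemma symb_mult: "symb J a m \<Longrightarrow> symb J b m' \<Longrightarrow> symb J (a + b) (\<lambda>i k. m i k * m' i k)"
proof (induction J arbitrary: a b m m')
  case 0
  then obtain C1 C2 where C: "\<And>i k. \<bar>m i k\<bar> \<le> C1 * real (Suc k) powr a" "\<And>i k. \<bar>m' i k\<bar> \<le> C2 * real (Suc k) powr b"
    unfolding symb_0 by blast
  show ?case unfolding symb_0
  proof (intro exI[of _ "C1 * C2"] allI)
    fix i k
    have "\<bar>m i k * m' i k\<bar> \<le> (C1 * real (Suc k) powr a) * (C2 * real (Suc k) powr b)"
      unfolding abs_mult by (intro mult_mono C abs_ge_zero order_trans[OF abs_ge_zero C(1)])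
    then show "\<bar>m i k * m' i k\<bar> \<le> C1 * C2 * real (Suc k) powr (a + b)"
      by (simp add: powr_add mult_ac)
  qed
next
  case (Suc J)
  have e: "nab (\<lambda>k. m i k * m' i k) = (\<lambda>k. m i k * nab (m' i) k + nab (m i) k * m' i (Suc k))" for i
    by (auto simp: nab_def algebra_simps)
  have m: "symb J a m" "symb J b m'" using Suc.prems symb_SucD by blast+
  have n: "symb J (a - 1) (\<lambda>i. nab (m i))" "symb J (b - 1) (\<lambda>i. nab (m' i))" using Suc.prems symb_Suc by blast+
  have "symb J (a + (b - 1)) (\<lambda>i k. m i k * nab (m' i) k)" by (rule Suc.IH[OF m(1) n(2)])
  moreover have "symb J ((a - 1) + b) (\<lambda>i k. nab (m i) k * m' i (Suc k))" by (rule Suc.IH[OF n(1) symb_shift[OF m(2)]])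
  ultimately have "symb J (a + b - 1) (\<lambda>i. nab (\<lambda>k. m i k * m' i k))"
    unfolding e by (intro symb_add) (simp_all add: algebra_simps)
  moreover have "symb 0 (a + b) (\<lambda>i k. m i k * m' i k)" using Suc.IH[OF m] symb_imp_0 by blast
  ultimately show ?case unfolding symb_Suc[of J] by blast
qed

text \<open>The first difference of 1/m is minus \<open>nab m\<close> divided by two consecutive
  values of m, of order (a - 1) - 2 a = - a - 1. The lower bound gives the estimate of order 0 and
  keeps m away from zero.\<close>

lemma symb_inverse:
  assumes c: "c > 0" "\<And>i k. c * real (Suc k) powr a \<le> \<bar>m i k\<bar>"
  shows "symb J a m \<Longrightarrow> symb J (- a) (\<lambda>i k. inverse (m i k))"
proof (induction J)
  case 0
  show ?case unfolding symb_0
  proof (intro exI[of _ "inverse c"] allI)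
    fix i k
    have "\<bar>inverse (m i k)\<bar> = inverse \<bar>m i k\<bar>" by simp
    also have "\<dots> \<le> inverse (c * real (Suc k) powr a)"
      by (rule le_imp_inverse_le[OF c(2)]) (use c in simp)
    finally show "\<bar>inverse (m i k)\<bar> \<le> inverse c * real (Suc k) powr - a"
      by (simp add: powr_minus)
  qed
next
  case (Suc J)
  have nz: "m i k \<noteq> 0" for i k
  proof -
    have "0 < c * real (Suc k) powr a" using c(1) by simp
    with c(2)[of k i] show ?thesis by auto
  qed
  have e: "nab (\<lambda>k. inverse (m i k)) = (\<lambda>k. (-1) * (nab (m i) k * (inverse (m i k) * inverse (m i (Suc k)))))" for i
    using nz by (auto simp: nab_def field_simps)
  have m: "symb J a m" using Suc.prems symb_SucD by blast
  have n: "symb J (a - 1) (\<lambda>i. nab (m i))" using Suc.prems symb_Suc by blast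
  note I = Suc.IH[OF m]
  have "symb J ((a - 1) + (- a + - a)) (\<lambda>i k. nab (m i) k * (inverse (m i k) * inverse (m i (Suc k))))"
    by (rule symb_mult[OF n symb_mult[OF I symb_shift[OF I]]])
  moreover have "(a - 1) + (- a + - a) = - a - 1" by simp
  ultimately have "symb J (- a - 1) (\<lambda>i. nab (\<lambda>k. inverse (m i k)))"
    unfolding e by (intro symb_cmult) simp
  then show ?case unfolding symb_Suc[of J] using symb_imp_0[OF I] by blast
qed

lemma symb_power: "symb J a m \<Longrightarrow> symb J (real r * a) (\<lambda>i k. m i k ^ r)"
proof (induction r)
  case 0
  have "symb J 0 (\<lambda>i k. 1)"
  proof (cases J)
    case 0 show ?thesis unfolding 0 symb_0 by (intro exI[of _ 1]) simp
  next
    case (Suc l)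
    have "nab (\<lambda>k. 1) = (\<lambda>k. 0)" by (auto simp: nab_def)
    then show ?thesis unfolding Suc symb_Suc[of l] symb_0
      by (auto intro!: exI[of _ 1] symb_zero)
  qed
  then show ?case by simp
next
  case (Suc r)
  have "symb J (a + real r * a) (\<lambda>i k. m i k * m i k ^ r)" by (rule symb_mult[OF Suc.prems Suc.IH[OF Suc.prems]])
  then show ?case by (simp add: algebra_simps)
qed

lemma symb_one: "symb J 0 (\<lambda>i k. 1)"
  using symb_power[where r = 0, of J 0 "\<lambda>i k. 0"] symb_zero by auto

lemma symb_id: "symb J 1 (\<lambda>i. real)"
proof (cases J)
  case 0
  show ?thesis unfolding 0 symb_0 by (intro exI[of _ 1]) auto
next
  case (Suc l)
  have e: "nab real = (\<lambda>k. (-1) * 1)" by (auto simp: nab_def)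
  have "symb l (1 - 1) (\<lambda>i. nab real)" unfolding e using symb_cmult[OF symb_one] by simp
  then show ?thesis unfolding Suc symb_Suc[of l] symb_0 by (auto intro!: exI[of _ 1])
qed

text \<open>Added to an eigenvalue sequence vanishing at 0, it makes the sequence invertible without changing other entries.\<close>

definition delta0 :: "nat \<Rightarrow> real" where "delta0 k = (if k = 0 then 1 else 0)"

lemma nab_delta0: "(nab ^^ j) delta0 = delta0"
  by (induction j) (auto simp: nab_def delta0_def)

lemma symb_delta0: "symb J a (\<lambda>i. delta0)"
  unfolding symb_def nab_delta0 by (intro exI[of _ 1]) (auto simp: delta0_def)

section \<open>Symbol estimates for eigenvalues and smooth cutoffs\<close>

definition eigsq :: "real \<Rightarrow> nat \<Rightarrow> real" where
  "eigsq l k = sqrt (real k * (real k + 2 * l))"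

lemma eigsq_ge: "l \<ge> 0 \<Longrightarrow> real k \<le> eigsq l k"
  unfolding eigsq_def by (rule real_le_rsqrt) (simp add: power2_eq_square mult_left_mono)

text \<open>Rationalising the square root: consecutive squares of \<open>eigsq\<close> differ by an
  affine function of k, so \<open>nab eigsq\<close> is that function, of order 1, divided by the sum
  of two consecutive values. This sum is at least k + 1, so its inverse has order -1 by the
  induction hypothesis.\<close>

lemma symb_eigsq:
  assumes l: "l \<ge> 0"
  shows "symb J 1 (\<lambda>i. eigsq l)"
proof (induction J)
  case 0
  show ?case unfolding symb_0
  proof (intro exI[of _ "1 + 2 * l"] allI)
    fix i k
    have "real k * (real k + 2 * l) \<le> ((1 + 2 * l) * real (Suc k))\<^sup>2"
    proof -
      have "real k + 2 * l \<le> (1 + 2 * l) * real (Suc k)" using l by (simp add: algebra_simps)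
      moreover have "real k \<le> (1 + 2 * l) * real (Suc k)" using l by (simp add: algebra_simps)
      ultimately show ?thesis unfolding power2_eq_square using l by (intro mult_mono) auto
    qed
    then have "eigsq l k \<le> (1 + 2 * l) * real (Suc k)"
      unfolding eigsq_def using l by (intro real_le_lsqrt) auto
    moreover have "eigsq l k \<ge> 0" using l by (simp add: eigsq_def)
    ultimately show "\<bar>eigsq l k\<bar> \<le> (1 + 2 * l) * real (Suc k) powr 1" by simp
  qed
next
  case (Suc J)
  have pos: "eigsq l k + eigsq l (Suc k) \<ge> real (Suc k)" for k
    using eigsq_ge[OF l, of "Suc k"] eigsq_ge[OF l, of k] by linarith
  have "nab (eigsq l) k = (- 2 * real k + (- 1 - 2 * l) * 1) * inverse (eigsq l k + eigsq l (Suc k))" for k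
  proof -
    have sq: "eigsq l k ^ 2 = real k * (real k + 2 * l)" for k
      unfolding eigsq_def using l by (intro real_sqrt_pow2) auto
    have "(eigsq l k - eigsq l (Suc k)) * (eigsq l k + eigsq l (Suc k)) = - 2 * real k + (- 1 - 2 * l) * 1"
      using sq[of k] sq[of "Suc k"] by (simp add: algebra_simps power2_eq_square)
    then show ?thesis using pos[of k] by (simp add: nab_def field_simps)
  qed
  then have e: "nab (eigsq l) = (\<lambda>k. ((- 2) * real k + (- 1 - 2 * l) * 1) * inverse (eigsq l k + eigsq l (Suc k)))" by auto
  have 1: "symb J 1 (\<lambda>(i::'a). (\<lambda>k. (- 2) * real k + (- 1 - 2 * l) * 1))"
  proof (intro symb_add symb_cmult symb_id)
    \<comment> \<open>A constant has order 0 and therefore order 1, since powers of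
      \<open>Suc k\<close> increase with the exponent.\<close>
    have "symb J (0 + 1) (\<lambda>(i::'a) k. 1 + 0)"
    proof -
      have "\<exists>C. \<forall>j\<le>J. \<forall>(i::'a) k. \<bar>(nab ^^ j) (\<lambda>k. 1) k\<bar> \<le> C * real (Suc k) powr (0 - real j)"
        using symb_one[of J] unfolding symb_def by blast
      then obtain C where C: "\<And>j k. j \<le> J \<Longrightarrow> \<bar>(nab ^^ j) (\<lambda>k. 1) k\<bar> \<le> C * real (Suc k) powr (0 - real j)" by blast
      have C0: "C \<ge> 0" using C[of 0 0] by simp
      show ?thesis unfolding symb_def
      proof (intro exI[of _ C] allI impI)
        fix j and i::'a and k assume "j \<le> J"
        then have "\<bar>(nab ^^ j) (\<lambda>k. 1) k\<bar> \<le> C * real (Suc k) powr (0 - real j)" by (rule C)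
        also have "\<dots> \<le> C * real (Suc k) powr (0 + 1 - real j)" by (intro mult_left_mono powr_mono C0) auto
        finally show "\<bar>(nab ^^ j) (\<lambda>k. 1 + 0) k\<bar> \<le> C * real (Suc k) powr (0 + 1 - real j)" by simp
      qed
    qed
    then show "symb J 1 (\<lambda>(i::'a) k. 1)" by simp
  qed
  have 2: "symb J (- 1) (\<lambda>(i::'a). (\<lambda>k. inverse (eigsq l k + eigsq l (Suc k))))"
  proof (rule symb_inverse[of 1])
    show "symb J 1 (\<lambda>(i::'a) k. eigsq l k + eigsq l (Suc k))"
      by (intro symb_add symb_shift[of J 1 "\<lambda>i. eigsq l"] Suc)
    show "1 * real (Suc k) powr 1 \<le> \<bar>eigsq l k + eigsq l (Suc k)\<bar>" for k
      using pos[of k] by simp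
  qed simp
  have "symb J (1 - 1) (\<lambda>(i::'a). nab (eigsq l))"
    unfolding e using symb_mult[OF 1 2] by simp
  then show ?case unfolding symb_Suc[of J] using symb_imp_0[OF Suc] by blast
qed

text \<open>Each window average trades one difference for a factor \<open>1/N\<close>, so that \<open>J\<close> averages of a step have \<open>J\<close> controlled
  differences. For \<open>N = 0\<close> the average is junk (division by 0), whence the case distinction in the cutoff.\<close>

definition wavg :: "nat \<Rightarrow> (nat \<Rightarrow> real) \<Rightarrow> nat \<Rightarrow> real" where
  "wavg N f k = (\<Sum>i<N. f (k + i)) / real N"

text \<open>The step is placed at (J + 1) N because each of the J averages looks ahead by fewer than
  N places: the value 1 then survives up to N, and the support does not grow.\<close>

definition cutoff :: "nat \<Rightarrow> nat \<Rightarrow> nat \<Rightarrow> real" where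
  "cutoff J N = (if N = 0 then delta0 else (wavg N ^^ J) (\<lambda>k. if k \<le> (J + 1) * N then 1 else 0))"

lemma nab_wavg: "nab (wavg N f) = wavg N (nab f)"
  by (auto simp: nab_def wavg_def sum_subtractf diff_divide_distrib)

lemma nab_wavg_funpow: "nab ((wavg N ^^ J) f) = (wavg N ^^ J) (nab f)"
  by (induction J) (auto simp: nab_wavg)

lemma nab_wavg_eq: "nab (wavg N f) k = (f k - f (k + N)) / real N"
proof -
  have "(\<Sum>i<N. f (k + i)) - (\<Sum>i<N. f (Suc k + i)) = f k - f (k + N)"
    by (induction N) auto
  then show ?thesis by (simp add: nab_def wavg_def diff_divide_distrib[symmetric])
qed

lemma wavg_bound:
  assumes "\<And>k. \<bar>f k\<bar> \<le> B"
  shows "\<bar>wavg N f k\<bar> \<le> B"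
proof (cases "N = 0")
  case True then show ?thesis using order_trans[OF abs_ge_zero assms] by (simp add: wavg_def)
next
  case False
  have "\<bar>\<Sum>i<N. f (k + i)\<bar> \<le> (\<Sum>i<N. B)" by (rule order_trans[OF sum_abs]) (intro sum_mono assms)
  then show ?thesis using False by (simp add: wavg_def field_simps)
qed

text \<open>The first difference of an average telescopes to (f k - f (k + N)) / N, at most 2 B / N
  in size. Differences commute with the remaining averages, and these do not increase the
  supremum.\<close>

lemma nab_wavg_bound:
  assumes "\<And>k. \<bar>f k\<bar> \<le> B" "N > 0" "j \<le> J"
  shows "\<bar>(nab ^^ j) ((wavg N ^^ J) f) k\<bar> \<le> (2 / real N) ^ j * B"
  using assms
proof (induction j arbitrary: f B J k)
  case 0
  have "\<bar>(wavg N ^^ J) f k\<bar> \<le> B" for k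
    by (induction J arbitrary: k) (use 0 in \<open>auto intro!: wavg_bound\<close>)
  then show ?case by simp
next
  case (Suc j)
  then obtain J' where J': "J = Suc J'" by (cases J) auto
  have "(nab ^^ Suc j) ((wavg N ^^ J) f) = (nab ^^ j) ((wavg N ^^ J') (nab (wavg N f)))"
    unfolding J' funpow_Suc_right comp_def nab_wavg_funpow ..
  moreover have "\<bar>(nab ^^ j) ((wavg N ^^ J') (nab (wavg N f))) k\<bar> \<le> (2 / real N) ^ j * (2 / real N * B)"
  proof (rule Suc.IH)
    fix k show "\<bar>nab (wavg N f) k\<bar> \<le> 2 / real N * B"
      unfolding nab_wavg_eq using Suc.prems(1)[of k] Suc.prems(1)[of "k + N"] Suc.prems(2)
      by (simp add: field_simps abs_divide)
  qed (use Suc.prems J' in auto)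
  ultimately show ?case by (simp add: mult_ac)
qed

lemma wavg_funpow_const:
  assumes "N > 0" "\<And>k. k \<le> M \<Longrightarrow> f k = c" "k + J * N \<le> M"
  shows "(wavg N ^^ J) f k = c"
  using assms(3)
proof (induction J arbitrary: k)
  case (Suc J)
  have "(wavg N ^^ J) f (k + i) = c" if "i < N" for i by (rule Suc.IH) (use that Suc.prems in auto)
  then show ?case using assms(1) by (simp add: wavg_def[of N "(wavg N ^^ J) f"])
qed (use assms in auto)

lemma wavg_funpow_zero:
  assumes "\<And>k. k > M \<Longrightarrow> f k = 0" "k > M"
  shows "(wavg N ^^ J) f k = 0"
  using assms(2)
proof (induction J arbitrary: k)
  case (Suc J)
  then show ?case by (simp add: wavg_def[of N "(wavg N ^^ J) f"])
qed (use assms in auto)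

lemma cutoff_eq_1: "k \<le> N \<Longrightarrow> cutoff J N k = 1"
  unfolding cutoff_def by (auto simp: delta0_def intro!: wavg_funpow_const[where M = "(J + 1) * N"])

lemma cutoff_eq_0: "k > (J + 1) * N \<Longrightarrow> cutoff J N k = 0"
  unfolding cutoff_def by (auto simp: delta0_def intro!: wavg_funpow_zero[where M = "(J + 1) * N"])

text \<open>Differences of order j are at most a constant times N^(-j). On the support k + 1 is at
  most (J + 2) N, so each factor 1/N may be replaced by a multiple of 1/(k + 1), uniformly in
  N.\<close>

lemma symb_cutoff: "symb J 0 (cutoff J)"
  unfolding symb_def
proof (intro exI[of _ "(2 * (real J + 2)) ^ J"] allI impI)
  fix j N k assume j: "j \<le> J"
  have C1: "(2 * (real J + 2)) ^ J \<ge> 1" by (rule one_le_power) simp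
  show "\<bar>(nab ^^ j) (cutoff J N) k\<bar> \<le> (2 * (real J + 2)) ^ J * real (Suc k) powr (0 - real j)"
  proof (cases "N = 0")
    case True
    then have "\<bar>(nab ^^ j) (cutoff J N) k\<bar> = delta0 k" by (simp add: cutoff_def nab_delta0 delta0_def)
    also have "\<dots> \<le> (2 * (real J + 2)) ^ J * real (Suc k) powr (0 - real j)"
      using C1 by (auto simp: delta0_def)
    finally show ?thesis .
  next
    case N: False
    show ?thesis
    proof (cases "k > (J + 1) * N")
      case True
      then have "(nab ^^ j) (cutoff J N) k = 0" by (intro nab_funpow_vanish[where L = "(J + 1) * N"] cutoff_eq_0) auto
      then show ?thesis by simp
    next
      case False
      then have "Suc k \<le> Suc ((J + 1) * N)" by simp
      also have "\<dots> \<le> (J + 2) * N" using N by simp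
      finally have "real (Suc k) \<le> real ((J + 2) * N)" by (simp only: of_nat_le_iff)
      then have kN: "2 / real N \<le> 2 * (real J + 2) / real (Suc k)" using N by (simp add: field_simps)
      have "\<bar>(nab ^^ j) (cutoff J N) k\<bar> \<le> (2 / real N) ^ j * 1"
        unfolding cutoff_def using N j by (simp del: mult_1_right) (rule nab_wavg_bound, auto)
      also have "\<dots> \<le> (2 * (real J + 2) / real (Suc k)) ^ j" using kN by (simp add: power_mono)
      also have "\<dots> = (2 * (real J + 2)) ^ j * real (Suc k) powr (0 - real j)"
        by (simp add: power_mult_distrib power_inverse powr_minus powr_realpow divide_inverse)
      also have "\<dots> \<le> (2 * (real J + 2)) ^ J * real (Suc k) powr (0 - real j)"
        by (intro mult_right_mono power_increasing j) auto
      finally show ?thesis .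
    qed
  qed
qed

lemma bernstein_symbol:
  assumes "l \<ge> 0"
  shows "\<exists>C\<ge>0. \<forall>N k. \<bar>(nab ^^ J) (\<lambda>k. cutoff J N k * eigsq l k ^ r) k\<bar> \<le> C * real (Suc k) powr (real r - real J)"
proof -
  have "symb J (0 + real r * 1) (\<lambda>N k. cutoff J N k * eigsq l k ^ r)"
    by (intro symb_mult symb_cutoff symb_power symb_eigsq assms)
  then obtain C where C: "\<And>N k. \<bar>(nab ^^ J) (\<lambda>k. cutoff J N k * eigsq l k ^ r) k\<bar> \<le> C * real (Suc k) powr (real r - real J)"
    unfolding symb_def by auto
  have "C \<ge> 0" using order_trans[OF abs_ge_zero C[of 0 0]] by simp
  with C show ?thesis by blast
qed

lemma jackson_symbol:
  assumes "l \<ge> 0"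
  shows "\<exists>C\<ge>0. \<forall>N N' k. \<bar>(nab ^^ J) (\<lambda>k. (cutoff J N' k - cutoff J N k) * inverse (eigsq l k + delta0 k) ^ r) k\<bar>
     \<le> C * real (Suc k) powr (- real r - real J)"
proof -
  \<comment> \<open>For k >= 1 the eigenvalue root is at least k >= (k + 1)/2, and at k = 0 the sum
    equals 1.\<close>
  have low: "1/2 * real (Suc k) powr 1 \<le> \<bar>eigsq l k + delta0 k\<bar>" for k
    using eigsq_ge[OF assms, of k] by (cases k) (auto simp: delta0_def eigsq_def)
  have "symb J (-1) (\<lambda>i::nat\<times>nat. \<lambda>k. inverse (eigsq l k + delta0 k))"
    by (rule symb_inverse[OF _ low]) (auto intro!: symb_add symb_eigsq assms symb_delta0)
  then have I: "symb J (real r * (-1)) (\<lambda>i::nat\<times>nat. \<lambda>k. inverse (eigsq l k + delta0 k) ^ r)"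
    by (rule symb_power)
  have "symb J 0 (\<lambda>i::nat\<times>nat. \<lambda>k. cutoff J (fst i) k + (-1) * cutoff J (snd i) k)"
    by (intro symb_add symb_cmult symb_reindex[OF symb_cutoff])
  from symb_mult[OF this I] obtain C where C: "\<And>i k. \<bar>(nab ^^ J) (\<lambda>k. (cutoff J (fst i) k + (-1) * cutoff J (snd i) k) * inverse (eigsq l k + delta0 k) ^ r) k\<bar>
     \<le> C * real (Suc k) powr (0 + real r * (-1) - real J)"
    unfolding symb_def by blast
  have "C \<ge> 0" using order_trans[OF abs_ge_zero C[of "(0,0)" 0]] by simp
  moreover have "\<bar>(nab ^^ J) (\<lambda>k. (cutoff J N' k - cutoff J N k) * inverse (eigsq l k + delta0 k) ^ r) k\<bar>
     \<le> C * real (Suc k) powr (- real r - real J)" for N N' k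
    using C[of "(N',N)" k] by simp
  ultimately show ?thesis by blast
qed

section \<open>Lifting polynomials to kernels\<close>

lemma pderiv_funpow_pcompose_shift:
  fixes p :: "real poly"
  shows "(pderiv ^^ n) (pcompose p [:c, 1:]) = pcompose ((pderiv ^^ n) p) [:c, 1:]"
proof (induction n)
  case (Suc n)
  then show ?case by (simp add: pderiv_pcompose pderiv_pCons)
qed simp

lemma coeff_0_pderiv_funpow:
  fixes p :: "real poly"
  shows "coeff ((pderiv ^^ n) p) 0 = fact n * coeff p n"
proof (induction n arbitrary: p)
  case (Suc n)
  have "coeff ((pderiv ^^ Suc n) p) 0 = coeff ((pderiv ^^ n) (pderiv p)) 0" by (simp only: funpow_Suc_right o_apply)
  also have "\<dots> = fact (Suc n) * coeff p (Suc n)" unfolding Suc by (simp add: coeff_pderiv algebra_simps)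
  finally show ?case .
qed simp

lemma coeff_shift_poly:
  fixes p :: "real poly"
  shows "coeff (pcompose p [:c, 1:]) n = poly ((pderiv ^^ n) p) c / fact n"
proof -
  have "fact n * coeff (pcompose p [:c, 1:]) n = poly ((pderiv ^^ n) p) c"
    unfolding coeff_0_pderiv_funpow[symmetric] pderiv_funpow_pcompose_shift
    by (simp flip: poly_0_coeff_0 add: poly_pcompose)
  then show ?thesis by (simp add: field_simps)
qed

lemma degree_pderiv_funpow: "degree ((pderiv ^^ n) p) \<le> degree (p::real poly) - n"
  by (induction n) (simp_all add: degree_pderiv)

lemma pderiv_funpow_eq_0: "n > degree p \<Longrightarrow> (pderiv ^^ n) p = (0::real poly)"
proof (induction n)
  case (Suc n)
  have "degree ((pderiv ^^ n) p) = 0" using degree_pderiv_funpow[of n p] Suc.prems by simp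
  then show ?case by (simp add: pderiv_eq_0_iff)
qed simp

text \<open>For \<open>b > 1/2\<close>, \<open>poly (JP b k (y\<^sup>2)) A\<close> is the mean of \<open>poly k (A + s y)\<close> over the density proportional to
  \<open>(1 - s\<^sup>2) powr (b - 3/2)\<close> on \<open>[-1, 1]\<close>. The series makes sense for all \<open>b > 0\<close>.\<close>

definition wcoef :: "real \<Rightarrow> nat \<Rightarrow> real" where
  "wcoef b i = pochhammer (1/2) i / (pochhammer b i * fact (2 * i))"

definition JP :: "real \<Rightarrow> real poly \<Rightarrow> real \<Rightarrow> real poly" where
  "JP b k Y = (\<Sum>i\<le>degree k. smult (wcoef b i * Y ^ i) ((pderiv ^^ (2 * i)) k))"

lemma JP_eq:
  assumes "degree k \<le> N"
  shows "JP b k Y = (\<Sum>i\<le>N. smult (wcoef b i * Y ^ i) ((pderiv ^^ (2 * i)) k))"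
  unfolding JP_def
  by (rule sum.mono_neutral_left) (use assms in \<open>auto simp: pderiv_funpow_eq_0\<close>)

lemma pderiv_funpow_add: "(pderiv ^^ n) (p + q) = (pderiv ^^ n) p + (pderiv ^^ n) (q::real poly)"
  by (induction n) (simp_all add: pderiv_add)

lemma pderiv_funpow_smult: "(pderiv ^^ n) (smult c p) = smult c ((pderiv ^^ n) (p::real poly))"
  by (induction n) (simp_all add: pderiv_smult)

lemma JP_add: "JP b (p + q) Y = JP b p Y + JP b q Y"
proof -
  define N where "N = max (degree p) (degree q)"
  have "degree (p + q) \<le> N" "degree p \<le> N" "degree q \<le> N" unfolding N_def by (auto intro: degree_add_le)
  then show ?thesis by (simp add: JP_eq[where N = N] pderiv_funpow_add smult_add_right sum.distrib)
qed

lemma JP_smult: "JP b (smult c p) Y = smult c (JP b p Y)"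
proof -
  have "degree (smult c p) \<le> degree p" by (rule degree_smult_le)
  then show ?thesis
    by (intro poly_eqI) (simp add: JP_eq[where N = "degree p"] pderiv_funpow_smult coeff_sum sum_distrib_left mult_ac)
qed

lemma JP_0 [simp]: "JP b 0 Y = 0"
  by (simp add: JP_def)

lemma JP_sum: "JP b (sum f I) Y = (\<Sum>i\<in>I. JP b (f i) Y)"
  by (induction I rule: infinite_finite_induct) (simp_all add: JP_add)

lemma pderiv_sum_poly: "pderiv (sum f I) = (\<Sum>i\<in>I. pderiv (f i :: real poly))"
  by (induction I rule: infinite_finite_induct) (simp_all add: pderiv_add)

lemma pderiv_JP: "pderiv (JP b k Y) = JP b (pderiv k) Y"
proof -
  have "degree (pderiv k) \<le> degree k" by (simp add: degree_pderiv)
  then show ?thesis unfolding JP_eq[OF \<open>degree (pderiv k) \<le> degree k\<close>] JP_def[of b k]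
    by (simp add: pderiv_sum_poly pderiv_smult funpow_swap1)
qed

lemma JP_pcompose_shift: "JP b (pcompose k [:c, 1:]) Y = pcompose (JP b k Y) [:c, 1:]"
proof -
  have "degree (pcompose k [:c, 1:]) = degree k" by (simp add: degree_pcompose)
  then show ?thesis unfolding JP_def
    by (simp add: pderiv_funpow_pcompose_shift pcompose_smult pcompose_sum)
qed

lemma sum_even_odd: "(\<Sum>n\<le>2 * N + 1. f n) = (\<Sum>i\<le>N. f (2 * i)) + (\<Sum>i\<le>N. f (2 * i + 1 :: nat) :: real)"
  by (induction N) (simp_all add: algebra_simps)

lemma poly_even_part:
  assumes "degree q \<le> N"
  shows "(poly q h + poly q (- h)) / 2 = (\<Sum>i\<le>N. coeff q (2 * i) * h ^ (2 * i) :: real)"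
proof -
  have "poly q x = (\<Sum>n\<le>2 * N + 1. coeff q n * x ^ n)" for x
    unfolding poly_altdef by (rule sum.mono_neutral_left) (use assms in \<open>auto simp: coeff_eq_0\<close>)
  then show ?thesis unfolding sum_even_odd by (simp add: sum_negf)
qed

text \<open>The quotient of Pochhammer symbols is the i-th moment of the Beta density with
  parameters 1/2 and b + 1/2 on [0, 1]. The sum is therefore the mean of a nonnegative
  polynomial.\<close>

lemma sum_Beta_nonneg:
  fixes f :: "nat \<Rightarrow> real"
  assumes b: "b > 0" and nn: "\<And>s. 0 \<le> s \<Longrightarrow> s \<le> 1 \<Longrightarrow> 0 \<le> (\<Sum>i\<le>N. f i * s ^ i)"
  shows "0 \<le> (\<Sum>i\<le>N. f i * (pochhammer (1/2) i / pochhammer (b + 1) i))"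
proof -
  let ?B = "Beta (1/2) (b + 1/2) :: real"
  have G: "Beta (1/2 + real i) (b + 1/2) = ?B * (pochhammer (1/2) i / pochhammer (b + 1) i)" for i
  proof -
    have P: "Gamma (x + real i) = Gamma x * pochhammer x i" if "x > 0" for x :: real
    proof -
      have "x \<notin> \<int>\<^sub>\<le>\<^sub>0" using nonpos_Ints_nonpos[of x] that by linarith
      then have "pochhammer x i = Gamma (x + real i) / Gamma x" by (rule pochhammer_Gamma)
      moreover have "Gamma x \<noteq> 0" using Gamma_real_pos[OF that] by simp
      ultimately show ?thesis by simp
    qed
    have e1: "Gamma (1/2 + real i) = Gamma (1/2) * pochhammer (1/2) i" by (rule P) simp
    have e2: "Gamma (b + 1 + real i) = Gamma (b + 1) * pochhammer (b + 1) i" by (rule P) (use b in simp)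
    have e3: "1/2 + real i + (b + 1/2) = b + 1 + real i" "1/2 + (b + 1/2) = b + 1" by auto
    show ?thesis unfolding Beta_def e3 e1 e2 by simp
  qed
  have B0: "?B > 0" unfolding Beta_def using b by (intro divide_pos_pos mult_pos_pos Gamma_real_pos) auto
  have "((\<lambda>s. s powr (1/2 + real i - 1) * (1 - s) powr (b + 1/2 - 1)) has_integral Beta (1/2 + real i) (b + 1/2)) {0..1}" for i
    by (rule has_integral_Beta_real) (use b in auto)
  then have "((\<lambda>s. \<Sum>i\<le>N. f i * (s powr (1/2 + real i - 1) * (1 - s) powr (b + 1/2 - 1))) has_integral
     (\<Sum>i\<le>N. f i * Beta (1/2 + real i) (b + 1/2))) {0..1}"
    by (intro has_integral_sum has_integral_mult_right) auto
  moreover have "0 \<le> (\<Sum>i\<le>N. f i * (s powr (1/2 + real i - 1) * (1 - s) powr (b + 1/2 - 1)))" if "s \<in> {0..1}" for s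
  proof -
    have e: "s powr (1/2 + real i - 1) = s powr (-1/2) * s ^ i" for i
    proof (cases "s = 0")
      case True then show ?thesis by simp
    next
      case False
      then have "s > 0" using that by simp
      then show ?thesis by (simp add: powr_realpow[symmetric] powr_add[symmetric])
    qed
    have "(\<Sum>i\<le>N. f i * (s powr (1/2 + real i - 1) * (1 - s) powr (b + 1/2 - 1))) =
       s powr (-1/2) * (1 - s) powr (b + 1/2 - 1) * (\<Sum>i\<le>N. f i * s ^ i)"
      unfolding e sum_distrib_left by (simp add: mult_ac)
    also have "\<dots> \<ge> 0" using that by (intro mult_nonneg_nonneg nn) auto
    finally show ?thesis .
  qed
  ultimately have "0 \<le> (\<Sum>i\<le>N. f i * Beta (1/2 + real i) (b + 1/2))" by (rule has_integral_nonneg)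
  also have "\<dots> = ?B * (\<Sum>i\<le>N. f i * (pochhammer (1/2) i / pochhammer (b + 1) i))"
    unfolding G sum_distrib_left by (simp add: mult_ac)
  finally show ?thesis using B0 by (simp add: zero_le_mult_iff)
qed

text \<open>Taylor expansion of the polynomial at \<open>A\<close>: the coefficient of order 2 i is
  multiplied by the moment of s^(2 i), and the odd orders drop out by symmetry.\<close>

lemma poly_JP_eq:
  assumes "degree k \<le> N"
  shows "poly (JP b k (y ^ 2)) A = (\<Sum>i\<le>N. coeff (pcompose k [:A, 1:]) (2 * i) * y ^ (2 * i) * (pochhammer (1/2) i / pochhammer b i))"
  unfolding JP_eq[OF assms] coeff_shift_poly
  by (simp add: poly_sum wcoef_def mult_ac flip: power_mult)

text \<open>For \<open>b \<le> 1/2\<close> there is no averaging density. Passing to the parameter \<open>b + 1\<close> costs one Euler derivative \<open>y d/dy\<close>,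
  which is where convexity of \<open>k\<close> enters.\<close>

lemma JP_nonneg:
  assumes b: "b > 0" and y: "y \<ge> 0"
    and k0: "\<And>x. A - y \<le> x \<Longrightarrow> x \<le> A + y \<Longrightarrow> 0 \<le> poly k x"
    and k2: "\<And>x. A - y \<le> x \<Longrightarrow> x \<le> A + y \<Longrightarrow> 0 \<le> poly (pderiv (pderiv k)) x"
  shows "0 \<le> poly (JP b k (y ^ 2)) A"
proof -
  let ?q = "pcompose k [:A, 1:]"
  let ?N = "degree k"
  let ?r = "pCons 0 (pderiv ?q)"
  have dq: "degree ?q \<le> ?N" by (simp add: degree_pcompose)
  have dr: "degree ?r \<le> Suc ?N"
    by (intro degree_le allI impI) (auto simp: coeff_pCons coeff_pderiv coeff_eq_0 degree_pcompose split: nat.splits)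
  have cr: "coeff ?r n = real n * coeff ?q n" for n by (simp add: coeff_pCons coeff_pderiv split: nat.splits)
  have dq': "degree ?q \<le> Suc ?N" using dq by simp
  \<comment> \<open>The factor 1 + i/b is the quotient of \<open>pochhammer (b + 1) i\<close> by
    \<open>pochhammer b i\<close>. On powers h^(2 i) it acts as 1 + (h d/dh) / (2 b), and
    \<open>?r\<close> is the Euler derivative h q'(h).\<close>
  define f where "f i = coeff ?q (2 * i) * y ^ (2 * i) * (1 + real i / b)" for i
  have "0 \<le> (\<Sum>i\<le>Suc ?N. f i * s ^ i)" if s: "0 \<le> s" "s \<le> 1" for s
  proof -
    define h where "h = y * sqrt s"
    have h: "0 \<le> h" "h \<le> y" unfolding h_def using s y by (auto simp: mult_left_le)
    have h2: "h ^ (2 * i) = y ^ (2 * i) * s ^ i" for i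
      unfolding h_def using s by (simp add: power_mult_distrib power_mult)
    have "(\<Sum>i\<le>Suc ?N. f i * s ^ i) = (\<Sum>i\<le>Suc ?N. coeff ?q (2 * i) * h ^ (2 * i)) + (\<Sum>i\<le>Suc ?N. coeff ?r (2 * i) * h ^ (2 * i)) / (2 * b)"
      unfolding sum_divide_distrib sum.distrib[symmetric] f_def cr h2
      by (intro sum.cong refl) (use b in \<open>simp add: field_simps\<close>)
    also have "\<dots> = (poly ?q h + poly ?q (- h)) / 2 + (poly ?r h + poly ?r (- h)) / 2 / (2 * b)"
      unfolding poly_even_part[OF dq'] poly_even_part[OF dr] ..
    also have "\<dots> \<ge> 0"
    proof -
      \<comment> \<open>The even part of h q'(h) is half of h (k'(A + h) - k'(A - h)), which is
        nonnegative because k' increases.\<close>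
      have "poly (pderiv k) (A - h) \<le> poly (pderiv k) (A + h)"
        by (rule DERIV_nonneg_imp_nondecreasing[of _ _ "poly (pderiv k)"])
          (use h k2 in \<open>auto intro!: exI[of _ "poly (pderiv (pderiv k)) _"] poly_DERIV\<close>)
      then have "0 \<le> h * (poly (pderiv k) (A + h) - poly (pderiv k) (A - h))" using h by simp
      also have "\<dots> = poly ?r h + poly ?r (- h)"
        by (simp add: pderiv_pcompose poly_pcompose pderiv_pCons algebra_simps)
      finally have "0 \<le> poly ?r h + poly ?r (- h)" .
      moreover have "0 \<le> poly ?q h + poly ?q (- h)"
        using k0[of "A + h"] k0[of "A - h"] h by (simp add: poly_pcompose)
      ultimately show ?thesis using b by (intro add_nonneg_nonneg[OF divide_nonneg_nonneg divide_nonneg_nonneg] divide_nonneg_nonneg) auto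
    qed
    finally show ?thesis .
  qed
  then have "0 \<le> (\<Sum>i\<le>Suc ?N. f i * (pochhammer (1/2) i / pochhammer (b + 1) i))"
    by (rule sum_Beta_nonneg[OF b])
  also have "\<dots> = (\<Sum>i\<le>Suc ?N. coeff ?q (2 * i) * y ^ (2 * i) * (pochhammer (1/2) i / pochhammer b i))"
  proof (intro sum.cong refl)
    fix i
    have aux: "c * e * (p / Q) = c * (p / R)" if "e / Q = 1 / R" for c e p Q R :: real
    proof -
      have "c * e * (p / Q) = c * p * (e / Q)" by (simp add: mult_ac)
      then show ?thesis by (simp add: that)
    qed
    have "b * pochhammer (b + 1) i = pochhammer b i * (b + real i)"
      unfolding pochhammer_rec[symmetric] pochhammer_Suc ..
    moreover have "pochhammer b i > 0" "pochhammer (b + 1) i > 0" using b by (auto intro: pochhammer_pos)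
    ultimately have "(1 + real i / b) / pochhammer (b + 1) i = 1 / pochhammer b i"
      using b by (simp add: frac_eq_eq add_divide_eq_iff mult.commute)
    then show "f i * (pochhammer (1/2) i / pochhammer (b + 1) i) = coeff ?q (2 * i) * y ^ (2 * i) * (pochhammer (1/2) i / pochhammer b i)"
      unfolding f_def by (rule aux)
  qed
  also have "\<dots> = poly (JP b k (y ^ 2)) A" by (rule poly_JP_eq[symmetric]) simp
  finally show ?thesis .
qed

text \<open>At b = 1/2 all the moments are 1, so the averaging measure has collapsed to the two end
  points s = 1 and s = -1.\<close>

lemma JP_half: "poly (JP (1/2) k (y ^ 2)) A = (poly k (A + y) + poly k (A - y)) / 2"
proof -
  have "poly (JP (1/2) k (y ^ 2)) A = (\<Sum>i\<le>degree k. coeff (pcompose k [:A, 1:]) (2 * i) * y ^ (2 * i))"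
    by (subst poly_JP_eq[OF order_refl]) (simp add: pochhammer_pos less_imp_neq[symmetric])
  also have "\<dots> = (poly (pcompose k [:A, 1:]) y + poly (pcompose k [:A, 1:]) (- y)) / 2"
    by (rule poly_even_part[symmetric]) (simp add: degree_pcompose)
  finally show ?thesis by (simp add: poly_pcompose)
qed

text \<open>\<open>A\<close>, \<open>B\<close>, \<open>C\<close> will be the inner product of the
  x-parts, \<open>tau tau'\<close> and \<open>v v'\<close>. Only even powers of the amplitudes
  occur, so their squares serve as arguments and the lift stays a polynomial in the
  coordinates.\<close>

definition Phi :: "real \<Rightarrow> real \<Rightarrow> real poly \<Rightarrow> real \<Rightarrow> real \<Rightarrow> real \<Rightarrow> real" where
  "Phi b g k A B C = poly (JP g (JP b k B) C) A"

lemma Phi_add: "Phi b g (p + q) A B C = Phi b g p A B C + Phi b g q A B C"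
  by (simp add: Phi_def JP_add)

lemma Phi_smult: "Phi b g (smult c p) A B C = c * Phi b g p A B C"
  by (simp add: Phi_def JP_smult)

lemma Phi_0 [simp]: "Phi b g 0 A B C = 0"
  by (simp add: Phi_def)

lemma Phi_sum: "Phi b g (sum f I) A B C = (\<Sum>i\<in>I. Phi b g (f i) A B C)"
  by (induction I rule: infinite_finite_induct) (simp_all add: Phi_add)

text \<open>\<open>JP_nonneg\<close> is used twice. The outer lift requires the inner lift and its
  second derivative to be nonnegative; differentiation commutes with lifting, so orders 0, 2 and 4
  of k are what is needed. The inequality on A, y, w keeps all arguments in [-1, 1].\<close>

lemma Phi_nonneg:
  assumes b: "b > 0" "g > 0" and y: "y \<ge> 0" "w \<ge> 0" and le: "\<bar>A\<bar> + y + w \<le> 1"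
    and k0: "\<And>x. \<bar>x\<bar> \<le> 1 \<Longrightarrow> 0 \<le> poly k x"
    and k2: "\<And>x. \<bar>x\<bar> \<le> 1 \<Longrightarrow> 0 \<le> poly ((pderiv ^^ 2) k) x"
    and k4: "\<And>x. \<bar>x\<bar> \<le> 1 \<Longrightarrow> 0 \<le> poly ((pderiv ^^ 4) k) x"
  shows "0 \<le> Phi b g k A (y ^ 2) (w ^ 2)"
  unfolding Phi_def
proof (rule JP_nonneg[OF b(2) y(2)])
  fix x assume x: "A - w \<le> x" "x \<le> A + w"
  then have le': "\<bar>x\<bar> + y \<le> 1" using le by linarith
  show "0 \<le> poly (JP b k (y ^ 2)) x"
    using k0 k2 le' by (intro JP_nonneg b y) (auto simp: numeral_2_eq_2)
  show "0 \<le> poly (pderiv (pderiv (JP b k (y ^ 2)))) x"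
    unfolding pderiv_JP using k2 k4 le' by (intro JP_nonneg b y) (auto simp: eval_nat_numeral)
qed

lemma pderiv_funpow_monom:
  "(pderiv ^^ n) (monom (1::real) m) = (if n \<le> m then monom (fact m / fact (m - n)) (m - n) else 0)"
proof (induction n)
  case (Suc n)
  show ?case
  proof (cases "Suc n \<le> m")
    case True
    then have "m - n = Suc (m - Suc n)" by simp
    then show ?thesis using Suc True by (simp add: pderiv_monom divide_simps)
  next
    case False
    then show ?thesis using Suc by (auto simp: pderiv_monom)
  qed
qed simp

text \<open>Coefficients of the lift of the m-th power: the multinomial coefficient for exponents m
  - 2 i - 2 j, 2 i, 2 j times the two moments. The explicit zero guards the range in which natural
  subtraction would be truncated.\<close>

definition tcoef :: "real \<Rightarrow> real \<Rightarrow> nat \<Rightarrow> nat \<Rightarrow> nat \<Rightarrow> real" where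
  "tcoef b g m i j = (if 2 * i + 2 * j \<le> m then fact m / fact (m - 2 * i - 2 * j) * wcoef b i * wcoef g j else 0)"

lemma Phi_monom:
  assumes "m \<le> N"
  shows "Phi b g (monom 1 m) A B C = (\<Sum>i\<le>N. \<Sum>j\<le>N. tcoef b g m i j * A ^ (m - 2 * i - 2 * j) * B ^ i * C ^ j)"
proof -
  have d: "degree (monom (1::real) m) \<le> N" using assms by (simp add: degree_monom_eq)
  have 1: "JP b (monom 1 m) B = (\<Sum>i\<le>N. if 2 * i \<le> m then smult (wcoef b i * B ^ i * (fact m / fact (m - 2 * i))) (monom 1 (m - 2 * i)) else 0)"
    unfolding JP_eq[OF d] pderiv_funpow_monom
    by (intro sum.cong refl) (auto simp: smult_monom)
  have d2: "degree (monom (1::real) (m - 2 * i)) \<le> N" for i using assms by (simp add: degree_monom_eq)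
  have 2: "JP g (monom 1 (m - 2 * i)) C = (\<Sum>j\<le>N. if 2 * j \<le> m - 2 * i then smult (wcoef g j * C ^ j * (fact (m - 2 * i) / fact (m - 2 * i - 2 * j))) (monom 1 (m - 2 * i - 2 * j)) else 0)" for i
    unfolding JP_eq[OF d2] pderiv_funpow_monom
    by (intro sum.cong refl) (auto simp: smult_monom)
  have "Phi b g (monom 1 m) A B C = (\<Sum>i\<le>N. if 2 * i \<le> m then (wcoef b i * B ^ i * (fact m / fact (m - 2 * i))) * poly (JP g (monom 1 (m - 2 * i)) C) A else 0)"
    unfolding Phi_def 1 JP_sum poly_sum
    by (intro sum.cong refl) (auto simp: JP_smult)
  also have "\<dots> = (\<Sum>i\<le>N. \<Sum>j\<le>N. tcoef b g m i j * A ^ (m - 2 * i - 2 * j) * B ^ i * C ^ j)"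
    unfolding 2 poly_sum
    by (intro sum.cong refl) (auto simp: sum_distrib_left tcoef_def poly_monom algebra_simps intro!: sum.cong)
  finally show ?thesis .
qed

lemma Phi_eq_sum:
  assumes "degree k \<le> N"
  shows "Phi b g k A B C = (\<Sum>m\<le>N. coeff k m * Phi b g (monom 1 m) A B C)"
proof -
  have "k = (\<Sum>m\<le>N. smult (coeff k m) (monom 1 m))"
    using poly_as_sum_of_monoms'[OF assms] by (simp add: smult_monom)
  then have "Phi b g k A B C = Phi b g (\<Sum>m\<le>N. smult (coeff k m) (monom 1 m)) A B C" by simp
  then show ?thesis by (simp add: Phi_sum Phi_smult)
qed

lemma Phi_00: "Phi b g k A 0 0 = poly k A"
proof -
  have 1: "JP b k 0 = k" for b k
  proof -
    have "JP b k 0 = (\<Sum>i\<le>degree k. if i = 0 then k else 0)"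
      unfolding JP_def by (intro sum.cong refl) (auto simp: wcoef_def)
    then show ?thesis by simp
  qed
  show ?thesis by (simp add: Phi_def 1)
qed

lemma Phi_shift: "Phi b g (pcompose k [:c, 1:]) A B C = Phi b g k (A + c) B C"
  by (simp add: Phi_def JP_pcompose_shift poly_pcompose add.commute)

text \<open>The quotient (1/2)_i / (b)_i grows like i^(1/2 - b), hence slower than i. The induction
  step works from i = 1 on; the first step is paid for by the factor 1 + 1/b. A polynomial loss is
  harmless here, as it will stand against geometric decay.\<close>

lemma wcoef_le:
  assumes b: "b > 0"
  shows "wcoef b i \<le> (1 + 1 / b) * real (Suc i) * wcoef (1/2) i"
proof -
  have "pochhammer (1/2) i \<le> (1 + 1 / b) * real (Suc i) * pochhammer b i"
  proof (induction i)
    case 0 then show ?case using b by simp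
  next
    case (Suc i)
    show ?case
    proof (cases i)
      case 0
      then show ?thesis using b by (simp add: algebra_simps)
    next
      case (Suc l)
      have "(1/2 + real i) * real (Suc i) \<le> real (Suc (Suc i)) * (b + real i)"
        using b Suc by (simp add: algebra_simps)
      then have *: "1/2 + real i \<le> real (Suc (Suc i)) / real (Suc i) * (b + real i)" by (simp add: field_simps)
      have "pochhammer (1/2) (Suc i) = pochhammer (1/2) i * (1/2 + real i)" by (rule pochhammer_Suc)
      also have "\<dots> \<le> ((1 + 1 / b) * real (Suc i) * pochhammer b i) * (real (Suc (Suc i)) / real (Suc i) * (b + real i))"
        by (intro mult_mono Suc.IH *) (use b in \<open>auto intro!: mult_nonneg_nonneg pochhammer_nonneg\<close>)
      also have "\<dots> = (1 + 1 / b) * real (Suc (Suc i)) * pochhammer b (Suc i)" by (simp add: pochhammer_Suc)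
      finally show ?thesis .
    qed
  qed
  moreover have "pochhammer b i > 0" "pochhammer (1/2::real) i > 0" using b by (auto intro: pochhammer_pos)
  ultimately show ?thesis unfolding wcoef_def by (simp add: field_simps)
qed

lemma wcoef_nonneg: "b > 0 \<Longrightarrow> 0 \<le> wcoef b i"
  unfolding wcoef_def by (intro divide_nonneg_nonneg mult_nonneg_nonneg pochhammer_nonneg) auto

lemma tcoef_nonneg: "b > 0 \<Longrightarrow> g > 0 \<Longrightarrow> 0 \<le> tcoef b g m i j"
  unfolding tcoef_def by (auto intro!: mult_nonneg_nonneg divide_nonneg_nonneg wcoef_nonneg)

lemma Phi_monom_nonneg:
  assumes "b > 0" "g > 0" "A \<ge> 0" "B \<ge> 0" "C \<ge> 0"
  shows "0 \<le> Phi b g (monom 1 m) A B C"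
  unfolding Phi_monom[OF order_refl]
  by (intro sum_nonneg mult_nonneg_nonneg tcoef_nonneg) (use assms in auto)

text \<open>Comparison with the parameters 1/2, where the lift is the mean of the m-th powers of the
  four numbers A + w + y, A + w - y, A - w + y, A - w - y, all bounded in modulus by A + y +
  w.\<close>

lemma Phi_monom_le:
  assumes b: "b > 0" "g > 0" and A: "A \<ge> 0" "y \<ge> 0" "w \<ge> 0"
  shows "Phi b g (monom 1 m) A (y ^ 2) (w ^ 2) \<le> (1 + 1 / b) * (1 + 1 / g) * real (Suc m) ^ 2 * (A + y + w) ^ m"
proof -
  let ?K = "(1 + 1 / b) * (1 + 1 / g) * real (Suc m) ^ 2"
  have t: "tcoef b g m i j \<le> ?K * tcoef (1/2) (1/2) m i j" if "i \<le> m" "j \<le> m" for i j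
  proof -
    have w1: "wcoef b i \<le> (1 + 1 / b) * real (Suc m) * wcoef (1/2) i"
      by (rule order_trans[OF wcoef_le[OF b(1)]]) (use that b in \<open>auto intro!: mult_mono wcoef_nonneg mult_nonneg_nonneg\<close>)
    have w2: "wcoef g j \<le> (1 + 1 / g) * real (Suc m) * wcoef (1/2) j"
      by (rule order_trans[OF wcoef_le[OF b(2)]]) (use that b in \<open>auto intro!: mult_mono wcoef_nonneg mult_nonneg_nonneg\<close>)
    have "wcoef b i * wcoef g j \<le> ((1 + 1 / b) * real (Suc m) * wcoef (1/2) i) * ((1 + 1 / g) * real (Suc m) * wcoef (1/2) j)"
      by (intro mult_mono w1 w2 wcoef_nonneg b order_trans[OF wcoef_nonneg w1])
    also have "\<dots> = ?K * (wcoef (1/2) i * wcoef (1/2) j)" by (simp add: power2_eq_square mult_ac)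
    finally have "fact m / fact (m - 2 * i - 2 * j) * (wcoef b i * wcoef g j) \<le> fact m / fact (m - 2 * i - 2 * j) * (?K * (wcoef (1/2) i * wcoef (1/2) j))"
      by (intro mult_left_mono) auto
    then show ?thesis unfolding tcoef_def by (simp add: mult_ac)
  qed
  have "Phi b g (monom 1 m) A (y ^ 2) (w ^ 2) \<le> (\<Sum>i\<le>m. \<Sum>j\<le>m. (?K * tcoef (1/2) (1/2) m i j) * A ^ (m - 2 * i - 2 * j) * (y ^ 2) ^ i * (w ^ 2) ^ j)"
    unfolding Phi_monom[OF order_refl] by (intro sum_mono mult_right_mono t) (use A in auto)
  also have "\<dots> = ?K * Phi (1/2) (1/2) (monom 1 m) A (y ^ 2) (w ^ 2)"
    unfolding Phi_monom[OF order_refl] by (simp add: sum_distrib_left mult.assoc)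
  also have "Phi (1/2) (1/2) (monom 1 m) A (y ^ 2) (w ^ 2) = ((A + w + y) ^ m + (A + w - y) ^ m + (A - w + y) ^ m + (A - w - y) ^ m) / 4"
    unfolding Phi_def JP_half by (simp add: poly_monom field_simps)
  also have "\<dots> \<le> (A + y + w) ^ m"
  proof -
    have "z ^ m \<le> (A + y + w) ^ m" if "\<bar>z\<bar> \<le> A + y + w" for z
      using power_mono[OF that, of m] power_abs[of z m] abs_ge_self[of "z ^ m"] by simp
    from this[of "A + w + y"] this[of "A + w - y"] this[of "A - w + y"] this[of "A - w - y"] show ?thesis
      using A by (auto simp: abs_le_iff)
  qed
  finally show ?thesis using b by (simp add: mult_left_mono)
qed

section \<open>Polynomials in several variables\<close>

definition pmono :: "('d::finite \<Rightarrow> nat) \<Rightarrow> nat \<Rightarrow> 'd pt \<Rightarrow> real" where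
  "pmono \<alpha> k z = (\<Prod>i\<in>UNIV. (fst z $ i) ^ \<alpha> i) * snd z ^ k"

lemma finite_mindex: "finite (mindex n :: (('d::finite \<Rightarrow> nat) \<times> nat) set)"
proof (rule finite_subset)
  show "(mindex n :: (('d \<Rightarrow> nat) \<times> nat) set) \<subseteq> (Pi\<^sub>E UNIV (\<lambda>_. {..n})) \<times> {..n}"
  proof
    fix p :: "('d \<Rightarrow> nat) \<times> nat" assume "p \<in> mindex n"
    then have le: "(\<Sum>i\<in>UNIV. fst p i) + snd p \<le> n" by (auto simp: mindex_def)
    have "fst p i \<le> n" for i
      using member_le_sum[of i UNIV "fst p"] le by simp
    then show "p \<in> (Pi\<^sub>E UNIV (\<lambda>_. {..n})) \<times> {..n}" using le by (cases p) auto
  qed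
  show "finite ((Pi\<^sub>E (UNIV::'d set) (\<lambda>_. {..n})) \<times> {..n})" by (intro finite_cartesian_product finite_PiE) auto
qed

lemma polys_iff: "P \<in> polys n \<longleftrightarrow> (\<exists>cf. P = (\<lambda>z. \<Sum>p\<in>mindex n. cf p * pmono (fst p) (snd p) z))"
proof
  assume "P \<in> polys n"
  then obtain coef where P: "P = (\<lambda>(x,t). \<Sum>(\<alpha>,k)\<in>mindex n. coef \<alpha> k * (\<Prod>i\<in>UNIV. (x $ i) ^ \<alpha> i) * t ^ k)"
    unfolding polys_def by blast
  show "\<exists>cf. P = (\<lambda>z. \<Sum>p\<in>mindex n. cf p * pmono (fst p) (snd p) z)"
    unfolding P by (intro exI[of _ "\<lambda>p. coef (fst p) (snd p)"] ext)
      (auto simp: pmono_def case_prod_beta mult.assoc)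
next
  assume "\<exists>cf. P = (\<lambda>z. \<Sum>p\<in>mindex n. cf p * pmono (fst p) (snd p) z)"
  then obtain cf where P: "P = (\<lambda>z. \<Sum>p\<in>mindex n. cf p * pmono (fst p) (snd p) z)" by blast
  show "P \<in> polys n" unfolding polys_def P
    by (intro CollectI exI[of _ "\<lambda>\<alpha> k. cf (\<alpha>, k)"] ext)
      (auto simp: pmono_def case_prod_beta mult.assoc)
qed

lemma polys_add: "P \<in> polys n \<Longrightarrow> Q \<in> polys n \<Longrightarrow> (\<lambda>z. P z + Q z) \<in> polys n"
proof -
  assume "P \<in> polys n" "Q \<in> polys n"
  then obtain c d where "P = (\<lambda>z. \<Sum>p\<in>mindex n. c p * pmono (fst p) (snd p) z)" "Q = (\<lambda>z. \<Sum>p\<in>mindex n. d p * pmono (fst p) (snd p) z)"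
    unfolding polys_iff by blast
  then show ?thesis unfolding polys_iff
    by (intro exI[of _ "\<lambda>p. c p + d p"]) (simp add: sum.distrib distrib_right)
qed

lemma polys_cmult: "P \<in> polys n \<Longrightarrow> (\<lambda>z. c * P z) \<in> polys n"
proof -
  assume "P \<in> polys n"
  then obtain d where "P = (\<lambda>z. \<Sum>p\<in>mindex n. d p * pmono (fst p) (snd p) z)"
    unfolding polys_iff by blast
  then show ?thesis unfolding polys_iff
    by (intro exI[of _ "\<lambda>p. c * d p"]) (simp add: sum_distrib_left mult.assoc)
qed

lemma polys_zero: "(\<lambda>z. 0) \<in> polys n"
  unfolding polys_iff by (intro exI[of _ "\<lambda>p. 0"]) simp

lemma polys_sum: "(\<And>i. i \<in> I \<Longrightarrow> P i \<in> polys n) \<Longrightarrow> (\<lambda>z. \<Sum>i\<in>I. P i z) \<in> polys n"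
  by (induction I rule: infinite_finite_induct) (simp_all add: polys_zero polys_add)

lemma pmono_in_polys: "p \<in> mindex n \<Longrightarrow> pmono (fst p) (snd p) \<in> polys n"
  unfolding polys_iff
  by (intro exI[of _ "\<lambda>q. if q = p then 1 else 0"] ext)
    (simp add: finite_mindex if_distrib[of "\<lambda>x. x * _"] sum.delta cong: if_cong)

lemma pmono_in_polys': "(\<Sum>i\<in>UNIV. \<alpha> i) + k \<le> n \<Longrightarrow> pmono \<alpha> k \<in> polys n"
  using pmono_in_polys[of "(\<alpha>, k)" n] by (simp add: mindex_def)

lemma mindex_mono: "n \<le> m \<Longrightarrow> mindex n \<subseteq> mindex m"
  by (auto simp: mindex_def)

lemma polys_mono: assumes "P \<in> polys n" "n \<le> m" shows "P \<in> polys m"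
proof -
  obtain d where P: "P = (\<lambda>z. \<Sum>p\<in>mindex n. d p * pmono (fst p) (snd p) z)"
    using assms unfolding polys_iff by blast
  show ?thesis unfolding P
    by (intro polys_sum polys_cmult pmono_in_polys) (use mindex_mono[OF assms(2)] in blast)
qed

lemma pmono_mult: "pmono \<alpha> k z * pmono \<alpha>' k' z = pmono (\<lambda>i. \<alpha> i + \<alpha>' i) (k + k') z"
  by (simp add: pmono_def power_add prod.distrib)

lemma polys_mult: assumes "P \<in> polys n" "Q \<in> polys m" shows "(\<lambda>z. P z * Q z) \<in> polys (n + m)"
proof -
  obtain c d where P: "P = (\<lambda>z. \<Sum>p\<in>mindex n. c p * pmono (fst p) (snd p) z)" and Q: "Q = (\<lambda>z. \<Sum>p\<in>mindex m. d p * pmono (fst p) (snd p) z)"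
    using assms unfolding polys_iff by blast
  have "(\<lambda>z. P z * Q z) = (\<lambda>z. \<Sum>p\<in>mindex n. \<Sum>q\<in>mindex m. (c p * d q) * pmono (\<lambda>i. fst p i + fst q i) (snd p + snd q) z)"
    unfolding P Q sum_product pmono_mult[symmetric] by (simp add: mult_ac)
  also have "\<dots> \<in> polys (n + m)"
  proof (intro polys_sum polys_cmult)
    fix p q :: "('a \<Rightarrow> nat) \<times> nat" assume "p \<in> mindex n" "q \<in> mindex m"
    then have "((\<lambda>i. fst p i + fst q i), snd p + snd q) \<in> mindex (n + m)"
      by (auto simp: mindex_def sum.distrib)
    from pmono_in_polys[OF this] show "pmono (\<lambda>i. fst p i + fst q i) (snd p + snd q) \<in> polys (n + m)" by simp
  qed
  finally show ?thesis .
qed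

lemma polys_const: "(\<lambda>z. c) \<in> polys n"
proof -
  have "pmono (\<lambda>_. 0) 0 \<in> polys n" by (rule pmono_in_polys') simp
  from polys_cmult[OF this, of c] show ?thesis by (simp add: pmono_def)
qed

lemma polys_power: "P \<in> polys n \<Longrightarrow> (\<lambda>z. P z ^ k) \<in> polys (k * n)"
  by (induction k) (simp_all add: polys_const polys_mult)

lemma polys_nth: "(\<lambda>z. fst z $ i) \<in> polys 1"
proof -
  have "pmono (\<lambda>j. if j = i then 1 else 0) 0 \<in> polys 1" by (rule pmono_in_polys') simp
  moreover have "pmono (\<lambda>j. if j = i then 1 else 0) 0 = (\<lambda>z. fst z $ i)"
    by (rule ext) (simp add: pmono_def if_distrib[of "(^) _"] cong: if_cong)
  ultimately show ?thesis by simp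
qed

lemma polys_snd: "(\<lambda>z. snd z) \<in> polys 1"
proof -
  have "pmono (\<lambda>_. 0) 1 \<in> polys 1" by (rule pmono_in_polys') simp
  then show ?thesis by (simp add: pmono_def[abs_def])
qed

lemma polys_inner: "(\<lambda>z. fst z \<bullet> u) \<in> polys 1"
proof -
  have "(\<lambda>z. \<Sum>i\<in>UNIV. u $ i * fst z $ i) \<in> polys 1" by (intro polys_sum polys_cmult polys_nth)
  then show ?thesis by (simp add: inner_vec_def mult.commute)
qed

lemma polys_norm2: "(\<lambda>z. (norm (fst z))\<^sup>2) \<in> polys 2"
proof -
  have eq: "(\<lambda>z::'a pt. (norm (fst z))\<^sup>2) = (\<lambda>z. \<Sum>i\<in>UNIV. fst z $ i * fst z $ i)"
    unfolding power2_norm_eq_inner inner_vec_def by simp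
  have "(\<lambda>z::'a pt. \<Sum>i\<in>UNIV. fst z $ i * fst z $ i) \<in> polys (1 + 1)" by (intro polys_sum polys_mult polys_nth)
  then show ?thesis unfolding eq by (rule polys_mono) simp
qed

definition tflip :: "'d::finite pt \<Rightarrow> 'd pt" where "tflip z = (fst z, - snd z)"

lemma polys_tflip: "P \<in> polys n \<Longrightarrow> (\<lambda>z. P (tflip z)) \<in> polys n"
proof -
  assume "P \<in> polys n"
  then obtain d where P: "P = (\<lambda>z. \<Sum>p\<in>mindex n. d p * pmono (fst p) (snd p) z)"
    unfolding polys_iff by blast
  have m: "pmono (fst p) (snd p) (tflip z) = (-1) ^ snd p * pmono (fst p) (snd p) z" for p :: "('a \<Rightarrow> nat) \<times> nat" and z
    unfolding pmono_def tflip_def fst_conv snd_conv power_minus[of "snd z" "snd p"] by (simp only: mult.left_commute)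
  have "(\<lambda>z. \<Sum>p\<in>mindex n. (d p * (-1) ^ snd p) * pmono (fst p) (snd p) z) \<in> polys n"
    unfolding polys_iff by (rule exI[of _ "\<lambda>p. d p * (-1) ^ snd p"]) (rule refl)
  moreover have "(\<lambda>z. P (tflip z)) = (\<lambda>z. \<Sum>p\<in>mindex n. (d p * (-1) ^ snd p) * pmono (fst p) (snd p) z)"
    by (simp only: P m mult.assoc)
  ultimately show ?thesis by (simp only:)
qed

lemma polysE_iff: "P \<in> polysE n \<longleftrightarrow> P \<in> polys n \<and> (\<forall>z. P (tflip z) = P z)"
  unfolding polysE_def tflip_def by (simp only: mem_Collect_eq split_paired_All fst_conv snd_conv)

lemma polysE_add: "P \<in> polysE n \<Longrightarrow> Q \<in> polysE n \<Longrightarrow> (\<lambda>z. P z + Q z) \<in> polysE n"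
  by (auto simp: polysE_iff intro: polys_add)
lemma polysE_cmult: "P \<in> polysE n \<Longrightarrow> (\<lambda>z. c * P z) \<in> polysE n"
  by (auto simp: polysE_iff intro: polys_cmult)
lemma polysE_diff: "P \<in> polysE n \<Longrightarrow> Q \<in> polysE n \<Longrightarrow> (\<lambda>z. P z - Q z) \<in> polysE n"
  using polysE_add[OF _ polysE_cmult[of Q n "-1"], of P] by simp
lemma polysE_sum: "(\<And>i. i \<in> I \<Longrightarrow> P i \<in> polysE n) \<Longrightarrow> (\<lambda>z. \<Sum>i\<in>I. P i z) \<in> polysE n"
  by (auto simp: polysE_iff intro: polys_sum)
lemma polysE_mono: "P \<in> polysE n \<Longrightarrow> n \<le> m \<Longrightarrow> P \<in> polysE m"
  by (auto simp: polysE_iff intro: polys_mono)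
lemma polysE_mult: "P \<in> polysE n \<Longrightarrow> Q \<in> polysE m \<Longrightarrow> (\<lambda>z. P z * Q z) \<in> polysE (n + m)"
  by (auto simp: polysE_iff intro: polys_mult)
lemma polysE_const: "(\<lambda>z. c) \<in> polysE n"
  by (auto simp: polysE_iff intro: polys_const)
lemma polysE_power: "P \<in> polysE n \<Longrightarrow> (\<lambda>z. P z ^ k) \<in> polysE (k * n)"
  by (auto simp: polysE_iff intro: polys_power)
lemma polysE_nth: "(\<lambda>z. fst z $ i) \<in> polysE 1"
  using polys_nth by (auto simp: polysE_iff tflip_def)
lemma polysE_inner: "(\<lambda>z. fst z \<bullet> u) \<in> polysE 1"
  using polys_inner by (auto simp: polysE_iff tflip_def)
lemma polysE_norm2: "(\<lambda>z. (norm (fst z))\<^sup>2) \<in> polysE 2"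
  using polys_norm2 by (auto simp: polysE_iff tflip_def)
lemma polysE_snd2: "(\<lambda>z. (snd z)\<^sup>2) \<in> polysE 2"
  using polys_power[OF polys_snd, of 2] by (auto simp: polysE_iff tflip_def)
lemma polysE_symmetrize: "P \<in> polys n \<Longrightarrow> (\<lambda>z. P z + P (tflip z)) \<in> polysE n"
  using polys_add[OF _ polys_tflip, of P n P] by (simp add: polysE_iff) (simp add: tflip_def)

text \<open>The mean of P and its reflection is P again, and taking it cancels the monomials of odd
  degree in t.\<close>

lemma polysE_even_monomials:
  assumes "P \<in> polysE n"
  shows "\<exists>cf. P = (\<lambda>z. \<Sum>p\<in>mindex n. cf p * pmono (fst p) (snd p) z) \<and> (\<forall>p. odd (snd p) \<longrightarrow> cf p = 0)"
proof -
  obtain d where P: "P = (\<lambda>z. \<Sum>p\<in>mindex n. d p * pmono (fst p) (snd p) z)"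
    using assms unfolding polysE_iff polys_iff by blast
  have m: "pmono (fst p) (snd p) (tflip z) = (-1) ^ snd p * pmono (fst p) (snd p) z" for p :: "('a \<Rightarrow> nat) \<times> nat" and z
    unfolding pmono_def tflip_def fst_conv snd_conv power_minus[of "snd z" "snd p"] by (simp only: mult.left_commute)
  have "P z = (\<Sum>p\<in>mindex n. (if even (snd p) then d p else 0) * pmono (fst p) (snd p) z)" for z
  proof -
    have "P z = (P z + P (tflip z)) / 2" using assms by (simp only: polysE_iff) simp
    also have "\<dots> = (\<Sum>p\<in>mindex n. (d p * pmono (fst p) (snd p) z + d p * pmono (fst p) (snd p) (tflip z)) / 2)"
      unfolding P by (simp add: sum.distrib sum_divide_distrib add_divide_distrib)
    also have "\<dots> = (\<Sum>p\<in>mindex n. (if even (snd p) then d p else 0) * pmono (fst p) (snd p) z)"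
      unfolding m by (intro sum.cong refl) auto
    finally show ?thesis .
  qed
  then show ?thesis by (intro exI[of _ "\<lambda>p. if even (snd p) then d p else 0"]) auto
qed

lemma polys_real_polynomial_function: "P \<in> polys n \<Longrightarrow> real_polynomial_function P"
proof -
  assume "P \<in> polys n"
  then obtain d where P: "P = (\<lambda>z. \<Sum>p\<in>mindex n. d p * pmono (fst p) (snd p) z)"
    unfolding polys_iff by blast
  have pr: "real_polynomial_function (\<lambda>z. \<Prod>i\<in>I. f i z)" if "\<And>i. i \<in> I \<Longrightarrow> real_polynomial_function (f i)"
    for I and f :: "'b \<Rightarrow> 'a pt \<Rightarrow> real"
    using that by (induction I rule: infinite_finite_induct) (auto intro: real_polynomial_function.intros)
  have "bounded_linear (\<lambda>z::'a pt. fst z $ i)" for i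
    by (intro bounded_linear_compose[OF bounded_linear_vec_nth bounded_linear_fst])
  then have f: "real_polynomial_function (\<lambda>z::'a pt. fst z $ i)" for i by (rule real_polynomial_function.intros(1))
  have s: "real_polynomial_function (\<lambda>z::'a pt. snd z)"
    by (rule real_polynomial_function.intros(1)[OF bounded_linear_snd])
  show ?thesis unfolding P pmono_def
    by (intro real_polynomial_function_sum finite_mindex real_polynomial_function.intros(4) real_polynomial_function.intros(2) pr real_polynomial_function_power f s)
qed

lemma polys_continuous_on: "P \<in> polys n \<Longrightarrow> continuous_on S P"
  using continuous_on_polymonial_function[of P S] polys_real_polynomial_function[of P n]
  by (simp add: real_polynomial_function_eq)

text \<open>On the line from a point of the open set to an arbitrary y, the function is a polynomial
  in one variable that vanishes on an interval, hence identically.\<close>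

lemma real_polynomial_function_vanish:
  fixes P :: "'a::euclidean_space \<Rightarrow> real"
  assumes P: "real_polynomial_function P" and S: "open S" "S \<noteq> {}" and z: "\<And>x. x \<in> S \<Longrightarrow> P x = 0"
  shows "P = (\<lambda>x. 0)"
proof
  fix y
  obtain x0 where x0: "x0 \<in> S" using S by blast
  then obtain e where e: "e > 0" "ball x0 e \<subseteq> S" using S openE by blast
  define h where "h s = x0 + s *\<^sub>R (y - x0)" for s :: real
  have "polynomial_function h"
    unfolding h_def by (intro polynomial_function_add polynomial_function_const polynomial_function_mult polynomial_function_id)
  then have "real_polynomial_function (P \<circ> h)" using P by (rule real_polynomial_function_compose)
  then obtain a n where a: "P \<circ> h = (\<lambda>s. \<Sum>i\<le>n. a i * s ^ i)"
    using real_polynomial_function_iff_sum by blast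
  define d where "d = e / (norm (y - x0) + 1)"
  have d: "d > 0" unfolding d_def using e by (intro divide_pos_pos) (auto intro: add_nonneg_pos)
  have "(\<Sum>i\<le>n. a i * s ^ i) = 0" if "s \<in> {0<..<d}" for s
  proof -
    have "norm (s *\<^sub>R (y - x0)) \<le> s * (norm (y - x0) + 1)" using that by simp
    also have "\<dots> < d * (norm (y - x0) + 1)" using that by (intro mult_strict_right_mono add_nonneg_pos) auto
    also have "\<dots> = e"
    proof -
      have "norm (y - x0) + 1 \<noteq> 0" using norm_ge_zero[of "y - x0"] by linarith
      then show ?thesis by (simp add: d_def)
    qed
    finally have "h s \<in> ball x0 e" by (simp add: h_def dist_norm)
    then have "(P \<circ> h) s = 0" using e z by auto
    then show ?thesis by (simp add: a)
  qed
  then have "{0<..<d} \<subseteq> {s. (\<Sum>i\<le>n. a i * s ^ i) = 0}" by blast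
  moreover have "infinite {0<..<d}" using d by simp
  ultimately have "infinite {s. (\<Sum>i\<le>n. a i * s ^ i) = 0}" using finite_subset by blast
  then have "\<forall>i\<le>n. a i = 0" using polyfun_finite_roots[of a n] by blast
  then have "(P \<circ> h) 1 = 0" by (simp add: a)
  then show "P y = 0" by (simp add: h_def)
qed

lemma real_polynomial_function_deriv:
  assumes "real_polynomial_function (P :: 'a::euclidean_space \<Rightarrow> real)"
  shows "\<exists>D. (\<forall>z. (P has_derivative D z) (at z)) \<and> (\<forall>e. real_polynomial_function (\<lambda>z. D z e))"
  using assms
proof induction
  case (linear f)
  then show ?case
    by (intro exI[of _ "\<lambda>z. f"]) (auto intro: bounded_linear_imp_has_derivative real_polynomial_function.intros(2))
next
  case (const c)
  then show ?case by (intro exI[of _ "\<lambda>z h. 0"]) (auto intro: real_polynomial_function.intros(2))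
next
  case (add f g)
  then obtain D E where "\<forall>z. (f has_derivative D z) (at z)" "\<forall>e. real_polynomial_function (\<lambda>z. D z e)"
    "\<forall>z. (g has_derivative E z) (at z)" "\<forall>e. real_polynomial_function (\<lambda>z. E z e)" by blast
  then show ?case
    by (intro exI[of _ "\<lambda>z h. D z h + E z h"]) (auto intro!: has_derivative_add real_polynomial_function.intros(3))
next
  case (mult f g)
  then obtain D E where "\<forall>z. (f has_derivative D z) (at z)" "\<forall>e. real_polynomial_function (\<lambda>z. D z e)"
    "\<forall>z. (g has_derivative E z) (at z)" "\<forall>e. real_polynomial_function (\<lambda>z. E z e)" by blast
  then show ?case using mult.hyps
    by (intro exI[of _ "\<lambda>z h. f z * E z h + D z h * g z"])
       (auto intro!: has_derivative_mult real_polynomial_function.intros(3) real_polynomial_function.intros(4))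
qed

lemma real_polynomial_function_Cr_on:
  "real_polynomial_function (P :: 'a::euclidean_space \<Rightarrow> real) \<Longrightarrow> Cr_on k UNIV P"
proof (induction k arbitrary: P)
  case 0
  then show ?case
    using continuous_on_polymonial_function[of P UNIV] by (simp add: real_polynomial_function_eq)
next
  case (Suc k)
  obtain D where D: "\<And>z. (P has_derivative D z) (at z)" "\<And>e. real_polynomial_function (\<lambda>z. D z e)"
    using real_polynomial_function_deriv[OF Suc.prems] by blast
  have "frechet_derivative P (at z) = D z" for z using frechet_derivative_at[OF D(1)] by simp
  then show ?case using D Suc.IH
    by (auto simp: differentiable_on_def differentiable_def)
qed

lemma polys_in_Cr: "P \<in> polys n \<Longrightarrow> P \<in> Cr r S"
  unfolding Cr_def using real_polynomial_function_Cr_on[OF polys_real_polynomial_function] by blast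

lemma Cr_imp_continuous_on: "g \<in> Cr r S \<Longrightarrow> continuous_on S g"
proof -
  assume "g \<in> Cr r S"
  then obtain U G where U: "open U" "S \<subseteq> U" "Cr_on r U G" "\<forall>z\<in>S. G z = g z" unfolding Cr_def by blast
  have "continuous_on U G"
    using U(3) by (cases r) (auto intro: differentiable_imp_continuous_on)
  then have "continuous_on S G" using U(2) continuous_on_subset by blast
  then show ?thesis using U(4) continuous_on_cong by blast
qed

section \<open>Moments of the Gaussian and of the ball\<close>

text \<open>Once the coefficients below m are known to vanish, dividing by s^m and letting s tend to
  0 isolates the coefficient m.\<close>

lemma powser_eq_0:
  fixes c :: "nat \<Rightarrow> real"
  assumes "\<And>s. (\<lambda>n. c n * s ^ n) sums 0"
  shows "c m = 0"
proof (induction m rule: less_induct)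
  case (less m)
  have "(\<lambda>n. c (n + m) * s ^ n) sums 0" if "s \<noteq> 0" for s
  proof -
    have "(\<lambda>n. c (n + m) * s ^ (n + m)) sums (0 - (\<Sum>i<m. c i * s ^ i))"
      using sums_split_initial_segment[OF assms[of s], of m] by simp
    then have "(\<lambda>n. c (n + m) * s ^ (n + m)) sums 0" using less by simp
    then have "(\<lambda>n. (1 / s ^ m) * (c (n + m) * s ^ (n + m))) sums ((1 / s ^ m) * 0)" by (rule sums_mult)
    moreover have "(1 / s ^ m) * (c (n + m) * s ^ (n + m)) = c (n + m) * s ^ n" for n
      using that by (simp add: power_add)
    ultimately show ?thesis by simp
  qed
  then have "((\<lambda>s. 0) \<longlongrightarrow> c (0 + m)) (at (0::real))"
    by (intro powser_limit_0_strong[of 1]) auto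
  then show ?case using tendsto_unique[OF _ _ tendsto_const] by (metis add_0 trivial_limit_at)
qed

lemma nn_integral_lborel_scale:
  fixes F :: "'a::euclidean_space \<Rightarrow> ennreal"
  assumes [measurable]: "F \<in> borel_measurable borel" and r: "r > 0"
  shows "(\<integral>\<^sup>+x. F x \<partial>lborel) = ennreal (r ^ DIM('a)) * (\<integral>\<^sup>+x. F (r *\<^sub>R x) \<partial>lborel)"
proof -
  have "(\<integral>\<^sup>+x. F x \<partial>lborel) = (\<integral>\<^sup>+x. F x \<partial>density (distr lborel borel (\<lambda>x. 0 + r *\<^sub>R x)) (\<lambda>_. \<bar>r\<bar> ^ DIM('a)))"
    using r lborel_affine[of r "0::'a"] by simp
  also have "\<dots> = ennreal (r ^ DIM('a)) * (\<integral>\<^sup>+x. F (r *\<^sub>R x) \<partial>lborel)"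
    using r by (simp add: nn_integral_density nn_integral_distr nn_integral_cmult)
  finally show ?thesis .
qed

lemma nn_integral_Beta_scaled:
  assumes p: "p > 0" "q > (0::real)" and R: "R \<ge> 0"
  shows "(\<integral>\<^sup>+t. ennreal (t powr (p - 1) * (R - t) powr (q - 1)) * indicator {0..R} t \<partial>lborel) = ennreal (R powr (p + q - 1) * Beta p q)"
proof (cases "R = 0")
  case True
  have "(\<integral>\<^sup>+t. ennreal (t powr (p - 1) * (R - t) powr (q - 1)) * indicator {0..R} t \<partial>lborel) = (\<integral>\<^sup>+t. 0 \<partial>(lborel::real measure))"
    by (intro nn_integral_cong) (auto simp: True indicator_def)
  then show ?thesis by (simp add: True)
next
  case False
  then have R: "R > 0" using R by simp
  have "(\<integral>\<^sup>+t. ennreal (t powr (p - 1) * (R - t) powr (q - 1)) * indicator {0..R} t \<partial>lborel)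
      = ennreal R * (\<integral>\<^sup>+t. ennreal ((R * t) powr (p - 1) * (R - R * t) powr (q - 1)) * indicator {0..R} (R * t) \<partial>lborel)"
    by (subst nn_integral_real_affine[where c = R and t = 0]) (use R in auto)
  also have "(\<integral>\<^sup>+t. ennreal ((R * t) powr (p - 1) * (R - R * t) powr (q - 1)) * indicator {0..R} (R * t) \<partial>lborel)
      = (\<integral>\<^sup>+t. ennreal (R powr (p + q - 2)) * (ennreal (t powr (p - 1) * (1 - t) powr (q - 1)) * indicator {0..1} t) \<partial>lborel)"
  proof (intro nn_integral_cong)
    fix t :: real
    have "R * t \<in> {0..R} \<longleftrightarrow> t \<in> {0..1}" using R by (auto simp: zero_le_mult_iff mult_le_cancel_left1)
    moreover have "(R * t) powr (p - 1) * (R - R * t) powr (q - 1) = R powr (p + q - 2) * (t powr (p - 1) * (1 - t) powr (q - 1))" if "t \<in> {0..1}"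
    proof -
      have "(R - R * t) = R * (1 - t)" by (simp add: algebra_simps)
      moreover have "R powr (p + q - 2) = R powr (p - 1) * R powr (q - 1)" by (simp flip: powr_add)
      ultimately show ?thesis using that R by (simp add: powr_mult)
    qed
    ultimately show "ennreal ((R * t) powr (p - 1) * (R - R * t) powr (q - 1)) * indicator {0..R} (R * t)
      = ennreal (R powr (p + q - 2)) * (ennreal (t powr (p - 1) * (1 - t) powr (q - 1)) * indicator {0..1} t)"
      by (cases "t \<in> {0..1}") (simp_all only: indicator_def of_bool_eq mult.assoc mult_1_right mult_zero_right ennreal_mult'[OF powr_ge_zero])
  qed
  also have "\<dots> = ennreal (R powr (p + q - 2)) * (\<integral>\<^sup>+t. ennreal (t powr (p - 1) * (1 - t) powr (q - 1)) * indicator {0..1} t \<partial>lborel)"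
    by (rule nn_integral_cmult) auto
  also have "(\<integral>\<^sup>+t. ennreal (t powr (p - 1) * (1 - t) powr (q - 1)) * indicator {0..1} t \<partial>lborel) = ennreal (Beta p q)"
    by (rule nn_integral_has_integral_lebesgue'[OF _ has_integral_Beta_real[OF p]]) auto
  also have "ennreal R * (ennreal (R powr (p + q - 2)) * ennreal (Beta p q)) = ennreal (R powr (p + q - 1) * Beta p q)"
  proof -
    have "R * R powr (p + q - 2) = R powr (p + q - 1)" using R powr_add[of R 1 "p + q - 2"] by simp
    moreover have "Beta p q > 0" unfolding Beta_def using p by (intro divide_pos_pos mult_pos_pos Gamma_real_pos) auto
    ultimately show ?thesis using R by (simp add: ennreal_mult'[symmetric] mult.assoc[symmetric])
  qed
  finally show ?thesis .
qed

definition gaussm :: "nat \<Rightarrow> 'a::euclidean_space \<Rightarrow> ennreal" where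
  "gaussm k w = (\<integral>\<^sup>+x. ennreal ((x \<bullet> w) ^ (2 * k) * exp (- (norm x)\<^sup>2)) \<partial>lborel)"

definition ballm :: "real \<Rightarrow> nat \<Rightarrow> 'a::euclidean_space \<Rightarrow> ennreal" where
  "ballm q k w = (\<integral>\<^sup>+x. ennreal (indicator (cball 0 1) x * ((x \<bullet> w) ^ (2 * k) * (1 - (norm x)\<^sup>2) powr q)) \<partial>lborel)"

text \<open>Slicing \<open>|x|\<^sup>2 + \<rho> = R\<close> in the Gaussian integral against \<open>\<rho>\<^sup>q e\<^sup>-\<^sup>\<rho>\<close> gives a dilated ball integral for each \<open>R\<close>.\<close>

lemma ballm_gaussm:
  fixes w :: "'a::euclidean_space"
  assumes q: "q > -1"
  shows "ennreal (Gamma (q + 1 + real DIM('a) / 2 + real k)) * ballm q k w = ennreal (Gamma (q + 1)) * gaussm k w"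
proof -
  have cb [measurable]: "cball (0::'a) 1 \<in> sets borel" by simp
  let ?g = "\<lambda>\<rho>::real. ennreal (indicator {0..} \<rho> * \<rho> powr q / exp \<rho>)"
  let ?F = "\<lambda>x::'a. (x \<bullet> w) ^ (2 * k)"
  let ?s = "q + 1 + real DIM('a) / 2 + real k"
  have F0: "?F x \<ge> 0" for x by (simp add: power_mult)
  have Gq: "ennreal (Gamma (q + 1)) = (\<integral>\<^sup>+\<rho>. ?g \<rho> \<partial>lborel)"
    using Gamma_conv_nn_integral_real[of "q + 1"] q by simp
  have "ennreal (Gamma (q + 1)) * gaussm k w = (\<integral>\<^sup>+x. ennreal (?F x * exp (- (norm x)\<^sup>2)) * ennreal (Gamma (q + 1)) \<partial>lborel)"
    unfolding gaussm_def by (subst nn_integral_multc) (auto simp: mult.commute)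
  also have "\<dots> = (\<integral>\<^sup>+x. (\<integral>\<^sup>+R. ennreal (?F x) * ennreal (indicator {0..} (R - (norm x)\<^sup>2) * (R - (norm x)\<^sup>2) powr q / exp R) \<partial>lborel) \<partial>lborel)"
  proof (intro nn_integral_cong)
    fix x :: 'a
    have "ennreal (?F x * exp (- (norm x)\<^sup>2)) * ennreal (Gamma (q + 1)) = ennreal (?F x * exp (- (norm x)\<^sup>2)) * (\<integral>\<^sup>+R. ?g (- (norm x)\<^sup>2 + 1 * R) \<partial>lborel)"
      unfolding Gq by (subst nn_integral_real_affine[where c = 1 and t = "- (norm x)\<^sup>2"]) auto
    also have "\<dots> = (\<integral>\<^sup>+R. ennreal (?F x * exp (- (norm x)\<^sup>2)) * ?g (- (norm x)\<^sup>2 + 1 * R) \<partial>lborel)"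
      by (rule nn_integral_cmult[symmetric]) measurable
    also have "\<dots> = (\<integral>\<^sup>+R. ennreal (?F x) * ennreal (indicator {0..} (R - (norm x)\<^sup>2) * (R - (norm x)\<^sup>2) powr q / exp R) \<partial>lborel)"
    proof (intro nn_integral_cong)
      fix R :: real
      have "exp (- (norm x)\<^sup>2) / exp (- (norm x)\<^sup>2 + 1 * R) = 1 / exp R" by (simp add: exp_diff exp_minus field_simps flip: exp_add)
      then have "exp (- (norm x)\<^sup>2) * (indicator {0..} (- (norm x)\<^sup>2 + 1 * R) * (- (norm x)\<^sup>2 + 1 * R) powr q / exp (- (norm x)\<^sup>2 + 1 * R))
         = indicator {0..} (R - (norm x)\<^sup>2) * (R - (norm x)\<^sup>2) powr q / exp R"
        by (simp add: field_simps)
      then show "ennreal (?F x * exp (- (norm x)\<^sup>2)) * ?g (- (norm x)\<^sup>2 + 1 * R) = ennreal (?F x) * ennreal (indicator {0..} (R - (norm x)\<^sup>2) * (R - (norm x)\<^sup>2) powr q / exp R)"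
        using F0[of x] by (simp only: ennreal_mult'[symmetric] ennreal_mult''[symmetric] F0 mult_nonneg_nonneg exp_ge_zero mult.assoc)
    qed
    finally show "ennreal (?F x * exp (- (norm x)\<^sup>2)) * ennreal (Gamma (q + 1)) = \<dots>" .
  qed
  also have "\<dots> = (\<integral>\<^sup>+R. (\<integral>\<^sup>+x. ennreal (?F x) * ennreal (indicator {0..} (R - (norm x)\<^sup>2) * (R - (norm x)\<^sup>2) powr q / exp R) \<partial>lborel) \<partial>lborel)"
    by (rule lborel_pair.Fubini[symmetric, where f = "\<lambda>(x, R). ennreal (?F x) * ennreal (indicator {0..} (R - (norm x)\<^sup>2) * (R - (norm x)\<^sup>2) powr q / exp R)", simplified]) measurable
  also have "\<dots> = (\<integral>\<^sup>+R. ennreal (indicator {0..} R * R powr (?s - 1) / exp R) * ballm q k w \<partial>lborel)"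
  proof (intro nn_integral_cong)
    fix R :: real
    show "(\<integral>\<^sup>+x. ennreal (?F x) * ennreal (indicator {0..} (R - (norm x)\<^sup>2) * (R - (norm x)\<^sup>2) powr q / exp R) \<partial>lborel)
       = ennreal (indicator {0..} R * R powr (?s - 1) / exp R) * ballm q k w"
    proof (cases "R > 0")
      case False
      have "ennreal (?F x) * ennreal (indicator {0..} (R - (norm x)\<^sup>2) * (R - (norm x)\<^sup>2) powr q / exp R) = 0" for x
      proof (cases "R - (norm x)\<^sup>2 \<ge> 0")
        case True
        then have "R - (norm x)\<^sup>2 = 0" using False zero_le_power2[of "norm x"] by linarith
        then show ?thesis by simp
      qed simp
      then have "(\<integral>\<^sup>+x. ennreal (?F x) * ennreal (indicator {0..} (R - (norm x)\<^sup>2) * (R - (norm x)\<^sup>2) powr q / exp R) \<partial>lborel) = (\<integral>\<^sup>+x. 0 \<partial>(lborel::'a measure))"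
        by (intro nn_integral_cong)
      moreover have "indicator {0..} R * R powr (?s - 1) = 0" using False by (auto simp: indicator_def)
      ultimately show ?thesis by (simp only: nn_integral_const mult_zero_left div_0 ennreal_0)
    next
      case True
      \<comment> \<open>Dilation by sqrt R maps the slice to the unit ball. The powers of R coming
        from the volume, the linear form and the weight combine to the exponent of a Gamma
        integrand.\<close>
      let ?r = "sqrt R"
      have r: "?r > 0" "?r ^ 2 = R" using True by auto
      have "(\<integral>\<^sup>+x. ennreal (?F x) * ennreal (indicator {0..} (R - (norm x)\<^sup>2) * (R - (norm x)\<^sup>2) powr q / exp R) \<partial>lborel)
        = ennreal (?r ^ DIM('a)) * (\<integral>\<^sup>+x. ennreal (?F (?r *\<^sub>R x)) * ennreal (indicator {0..} (R - (norm (?r *\<^sub>R x))\<^sup>2) * (R - (norm (?r *\<^sub>R x))\<^sup>2) powr q / exp R) \<partial>lborel)"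
        by (rule nn_integral_lborel_scale) (use r in auto)
      also have "(\<integral>\<^sup>+x. ennreal (?F (?r *\<^sub>R x)) * ennreal (indicator {0..} (R - (norm (?r *\<^sub>R x))\<^sup>2) * (R - (norm (?r *\<^sub>R x))\<^sup>2) powr q / exp R) \<partial>lborel)
        = (\<integral>\<^sup>+x. ennreal (R ^ k * R powr q / exp R) * ennreal (indicator (cball 0 1) x * (?F x * (1 - (norm x)\<^sup>2) powr q)) \<partial>lborel)"
      proof (intro nn_integral_cong)
        fix x :: 'a
        have n: "R - (norm (?r *\<^sub>R x))\<^sup>2 = R * (1 - (norm x)\<^sup>2)" using True by (simp add: power_mult_distrib algebra_simps)
        have f: "?F (?r *\<^sub>R x) = R ^ k * ?F x" using True by (simp add: power_mult_distrib power_mult)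
        have i: "indicator {0..} (R * (1 - (norm x)\<^sup>2)) = (indicator (cball 0 1) x :: real)"
          using True by (auto simp: indicator_def zero_le_mult_iff power_le_one_iff abs_square_le_1)
        have p: "indicator (cball 0 1) x * (R * (1 - (norm x)\<^sup>2)) powr q = indicator (cball 0 1) x * (R powr q * (1 - (norm x)\<^sup>2) powr q)"
          using True by (auto simp: indicator_def powr_mult power_le_one)
        show "ennreal (?F (?r *\<^sub>R x)) * ennreal (indicator {0..} (R - (norm (?r *\<^sub>R x))\<^sup>2) * (R - (norm (?r *\<^sub>R x))\<^sup>2) powr q / exp R)
           = ennreal (R ^ k * R powr q / exp R) * ennreal (indicator (cball 0 1) x * (?F x * (1 - (norm x)\<^sup>2) powr q))"
          unfolding n f i p using True F0[of x]
          by (subst (1 2) ennreal_mult'[symmetric]) (auto simp: mult_ac intro!: mult_nonneg_nonneg)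
      qed
      also have "\<dots> = ennreal (R ^ k * R powr q / exp R) * ballm q k w"
        unfolding ballm_def by (rule nn_integral_cmult) measurable
      also have "ennreal (?r ^ DIM('a)) * (ennreal (R ^ k * R powr q / exp R) * ballm q k w) = ennreal (?r ^ DIM('a) * (R ^ k * R powr q / exp R)) * ballm q k w"
      proof -
        have "?r ^ DIM('a) \<ge> 0" using True by simp
        then show ?thesis by (simp only: ennreal_mult' mult.assoc)
      qed
      also have "?r ^ DIM('a) * (R ^ k * R powr q / exp R) = indicator {0..} R * R powr (?s - 1) / exp R"
      proof -
        have "?r ^ DIM('a) = R powr (real DIM('a) / 2)"
          using True by (simp add: powr_half_sqrt[symmetric] powr_powr flip: powr_realpow)
        moreover have "R ^ k = R powr real k" using True by (simp add: powr_realpow)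
        ultimately show ?thesis using True by (simp add: powr_add[symmetric] algebra_simps)
      qed
      finally show ?thesis .
    qed
  qed
  also have "\<dots> = (\<integral>\<^sup>+R. ennreal (indicator {0..} R * R powr (?s - 1) / exp R) \<partial>lborel) * ballm q k w"
    by (rule nn_integral_multc) measurable
  also have "(\<integral>\<^sup>+R. ennreal (indicator {0..} R * R powr (?s - 1) / exp R) \<partial>lborel) = ennreal (Gamma ?s)"
    by (rule Gamma_conv_nn_integral_real[symmetric]) (use q in \<open>simp add: add_pos_nonneg\<close>)
  finally show ?thesis by simp
qed

text \<open>The Gaussian integral, pi^(d/2) in dimension d. It is kept as a symbol and absorbed into
  the total mass \<open>K0\<close>.\<close>

definition gauss0 :: "'a::euclidean_space itself \<Rightarrow> real" where
  "gauss0 _ = enn2real (gaussm 0 (0::'a))"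

text \<open>By \<open>ballm_gaussm\<close> with q = k = 0 the Gaussian integral is a positive
  multiple of \<open>ballm 0 0\<close>. Since \<open>0 powr 0 = 0\<close>, the latter misses the
  sphere, but it lies between the volumes of the open and the closed unit ball.\<close>

lemma gauss0:
  shows "gaussm 0 (w::'a::euclidean_space) = ennreal (gauss0 TYPE('a))" and "gauss0 TYPE('a) > 0"
proof -
  have e: "gaussm 0 w = gaussm 0 (0::'a)" for w :: 'a by (simp add: gaussm_def)
  let ?G = "Gamma (1 + real DIM('a) / 2)"
  have Gp: "?G > 0" by (rule Gamma_real_pos) simp
  have *: "ennreal ?G * ballm 0 0 (0::'a) = gaussm 0 (0::'a)"
    using ballm_gaussm[of 0 0 "0::'a"] by simp
  have "ballm 0 0 (0::'a) \<le> (\<integral>\<^sup>+x. indicator (cball (0::'a) 1) x \<partial>lborel)"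
    unfolding ballm_def by (intro nn_integral_mono) (auto simp: indicator_def powr_def)
  also have "\<dots> < \<infinity>" using emeasure_bounded_finite[OF bounded_cball, of "0::'a" 1] by simp
  finally have fin: "ballm 0 0 (0::'a) < \<infinity>" .
  have "0 < measure lborel (ball (0::'a) 1)" by (rule content_ball_pos) simp
  then have "0 < emeasure lborel (ball (0::'a) 1)" by (auto simp: measure_def zero_less_iff_neq_zero)
  also have "emeasure lborel (ball (0::'a) 1) = (\<integral>\<^sup>+x. indicator (ball (0::'a) 1) x \<partial>lborel)" by simp
  also have "\<dots> \<le> ballm 0 0 (0::'a)"
    unfolding ballm_def
  proof (intro nn_integral_mono)
    fix x :: 'a
    have "x \<in> ball 0 1 \<Longrightarrow> (1 - (norm x)\<^sup>2) powr 0 = 1"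
      using power_less_one_iff[of "norm x" 2] by auto
    then show "indicator (ball (0::'a) 1) x \<le> ennreal (indicator (cball 0 1) x * ((x \<bullet> 0) ^ (2 * 0) * (1 - (norm x)\<^sup>2) powr 0))"
      by (auto simp: indicator_def)
  qed
  finally have pos: "0 < ballm 0 0 (0::'a)" .
  have "gaussm 0 (0::'a) < \<infinity>" unfolding *[symmetric] using fin by (simp add: ennreal_mult_less_top)
  moreover have "gaussm 0 (0::'a) > 0" unfolding *[symmetric] using pos Gp by (simp add: ennreal_zero_less_mult_iff)
  ultimately show "gauss0 TYPE('a) > 0" "gaussm 0 w = ennreal (gauss0 TYPE('a))" unfolding gauss0_def e[of w]
    by (auto simp: enn2real_positive_iff)
qed

text \<open>Completing the square: translation by w/2 turns the exponent into |w|^2/4 -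
  |x|^2.\<close>

lemma gaussm_exp:
  fixes w :: "'a::euclidean_space"
  shows "(\<integral>\<^sup>+x. ennreal (exp (x \<bullet> w) * exp (- (norm x)\<^sup>2)) \<partial>lborel) = ennreal (gauss0 TYPE('a) * exp ((norm w)\<^sup>2 / 4))"
proof -
  have "(\<integral>\<^sup>+x. ennreal (exp (x \<bullet> w) * exp (- (norm x)\<^sup>2)) \<partial>lborel) = (\<integral>\<^sup>+x. ennreal (exp (x \<bullet> w) * exp (- (norm x)\<^sup>2)) \<partial>distr lborel borel ((+) ((1/2) *\<^sub>R w)))"
    unfolding lborel_distr_plus ..
  also have "\<dots> = (\<integral>\<^sup>+x. ennreal (exp (((1/2) *\<^sub>R w + x) \<bullet> w) * exp (- (norm ((1/2) *\<^sub>R w + x))\<^sup>2)) \<partial>lborel)"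
    by (subst nn_integral_distr) auto
  also have "\<dots> = (\<integral>\<^sup>+x. ennreal (exp ((norm w)\<^sup>2 / 4)) * ennreal ((x \<bullet> (0::'a)) ^ (2 * 0) * exp (- (norm x)\<^sup>2)) \<partial>lborel)"
  proof (intro nn_integral_cong)
    fix x :: 'a
    have "((1/2) *\<^sub>R w + x) \<bullet> w - (norm ((1/2) *\<^sub>R w + x))\<^sup>2 = (norm w)\<^sup>2 / 4 - (norm x)\<^sup>2"
      unfolding power2_norm_eq_inner by (simp add: inner_add_left inner_add_right inner_commute field_simps)
    then show "ennreal (exp (((1/2) *\<^sub>R w + x) \<bullet> w) * exp (- (norm ((1/2) *\<^sub>R w + x))\<^sup>2)) = ennreal (exp ((norm w)\<^sup>2 / 4)) * ennreal ((x \<bullet> (0::'a)) ^ (2 * 0) * exp (- (norm x)\<^sup>2))"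
      by (simp add: ennreal_mult'[symmetric] exp_add[symmetric])
  qed
  also have "\<dots> = ennreal (exp ((norm w)\<^sup>2 / 4)) * gaussm 0 (0::'a)"
    unfolding gaussm_def by (rule nn_integral_cmult) measurable
  finally show ?thesis using gauss0(2)[where 'a='a] unfolding gauss0(1)
    by (simp add: ennreal_mult'[symmetric] mult.commute)
qed

text \<open>The integral of cosh(s x.w) exp(-|x|^2) is expanded in powers of s and compared with the
  series of exp(s^2 |w|^2/4). Taking cosh rather than exp makes all terms nonnegative, so sum and
  integral may be exchanged freely.\<close>

lemma gaussm_eq:
  fixes w :: "'a::euclidean_space"
  shows "gaussm k w = ennreal (gauss0 TYPE('a) * pochhammer (1/2) k * norm w ^ (2 * k))"
proof -
  let ?C = "gauss0 TYPE('a)"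
  have C: "?C > 0" by (rule gauss0)
  have pw: "x ^ n = (x ^ 2) ^ (n div 2)" if "even n" for x :: real and n
    using that by (simp flip: power_mult)
  have half: "ennreal (1/2 * (A + B)) = ennreal (1/2) * (ennreal A + ennreal B)" if "A \<ge> 0" "B \<ge> 0" for A B
    using that by (subst ennreal_mult') auto
  define T where "T s n x = (if even n then (s * (x \<bullet> w)) ^ n / fact n else 0) * exp (- (norm x)\<^sup>2)" for s :: real and n and x :: 'a
  have T0: "T s n x \<ge> 0" for s n x
    unfolding T_def by (auto intro!: mult_nonneg_nonneg divide_nonneg_nonneg simp: zero_le_even_power simp del: power_mult_distrib)
  have sumT: "(\<Sum>n. ennreal (T s n x)) = ennreal (cosh (s * (x \<bullet> w)) * exp (- (norm x)\<^sup>2))" for s x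
  proof -
    have "(\<lambda>n. (if even n then (s * (x \<bullet> w)) ^ n /\<^sub>R fact n else 0)) sums cosh (s * (x \<bullet> w))"
      using cosh_converges[of "s * (x \<bullet> w)"] by simp
    then have "(\<lambda>n. T s n x) sums (cosh (s * (x \<bullet> w)) * exp (- (norm x)\<^sup>2))"
      unfolding T_def by (intro sums_mult2) (simp add: divide_inverse mult.commute cong: if_cong)
    then show ?thesis using T0 by (intro suminf_ennreal_eq) auto
  qed
  have tot: "(\<Sum>n. \<integral>\<^sup>+x. ennreal (T s n x) \<partial>lborel) = ennreal (?C * exp (s\<^sup>2 * (norm w)\<^sup>2 / 4))" for s
  proof -
    have "(\<Sum>n. \<integral>\<^sup>+x. ennreal (T s n x) \<partial>lborel) = (\<integral>\<^sup>+x. (\<Sum>n. ennreal (T s n x)) \<partial>lborel)"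
      by (rule nn_integral_suminf[symmetric]) (unfold T_def, measurable)
    also have "\<dots> = (\<integral>\<^sup>+x. ennreal (1/2) * (ennreal (exp (x \<bullet> (s *\<^sub>R w)) * exp (- (norm x)\<^sup>2)) + ennreal (exp (x \<bullet> (- s *\<^sub>R w)) * exp (- (norm x)\<^sup>2))) \<partial>lborel)"
      unfolding sumT cosh_def
    proof (intro nn_integral_cong)
      fix x :: 'a
      have "(exp (s * (x \<bullet> w)) + exp (- (s * (x \<bullet> w)))) /\<^sub>R 2 * exp (- (norm x)\<^sup>2)
        = 1/2 * (exp (x \<bullet> (s *\<^sub>R w)) * exp (- (norm x)\<^sup>2) + exp (x \<bullet> (- s *\<^sub>R w)) * exp (- (norm x)\<^sup>2))"
        by (simp add: algebra_simps)
      then show "ennreal ((exp (s * (x \<bullet> w)) + exp (- (s * (x \<bullet> w)))) /\<^sub>R 2 * exp (- (norm x)\<^sup>2)) =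
        ennreal (1/2) * (ennreal (exp (x \<bullet> (s *\<^sub>R w)) * exp (- (norm x)\<^sup>2)) + ennreal (exp (x \<bullet> (- s *\<^sub>R w)) * exp (- (norm x)\<^sup>2)))"
        by (simp only: half mult_nonneg_nonneg exp_ge_zero)
    qed
    also have "\<dots> = ennreal (1/2) * ((\<integral>\<^sup>+x. ennreal (exp (x \<bullet> (s *\<^sub>R w)) * exp (- (norm x)\<^sup>2)) \<partial>lborel) + (\<integral>\<^sup>+x. ennreal (exp (x \<bullet> (- s *\<^sub>R w)) * exp (- (norm x)\<^sup>2)) \<partial>lborel))"
      by (subst nn_integral_cmult, measurable, subst nn_integral_add) auto
    also have "\<dots> = ennreal (?C * exp (s\<^sup>2 * (norm w)\<^sup>2 / 4))"
    proof -
      have n: "(norm (s *\<^sub>R w))\<^sup>2 = s\<^sup>2 * (norm w)\<^sup>2" "(norm (- s *\<^sub>R w))\<^sup>2 = s\<^sup>2 * (norm w)\<^sup>2"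
        by (simp_all add: power_mult_distrib)
      have "0 \<le> ?C * exp (s\<^sup>2 * (norm w)\<^sup>2 / 4)" using C by simp
      from half[OF this this] show ?thesis unfolding gaussm_exp n by simp
    qed
    finally show ?thesis .
  qed
  have intT: "(\<integral>\<^sup>+x. ennreal (T s n x) \<partial>lborel) = (if even n then ennreal (s ^ n / fact n) * gaussm (n div 2) w else 0)" for s n
  proof (cases "even n")
    case True
    have "(\<integral>\<^sup>+x. ennreal (T s n x) \<partial>lborel) = (\<integral>\<^sup>+x. ennreal (s ^ n / fact n) * ennreal ((x \<bullet> w) ^ (2 * (n div 2)) * exp (- (norm x)\<^sup>2)) \<partial>lborel)"
      by (intro nn_integral_cong) (use True in \<open>simp add: T_def power_mult_distrib ennreal_mult'[symmetric] zero_le_even_power\<close>)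
    also have "\<dots> = ennreal (s ^ n / fact n) * gaussm (n div 2) w"
      unfolding gaussm_def by (rule nn_integral_cmult) measurable
    finally show ?thesis using True by simp
  qed (simp add: T_def)
  have fin: "gaussm j w < \<infinity>" for j
  proof -
    have "(\<integral>\<^sup>+x. ennreal (T 1 (2 * j) x) \<partial>lborel) \<le> (\<Sum>n. \<integral>\<^sup>+x. ennreal (T 1 n x) \<partial>lborel)"
      using sum_le_suminf[of "\<lambda>n. \<integral>\<^sup>+x. ennreal (T 1 n x) \<partial>lborel" "{2 * j}"] by simp
    also have "\<dots> < \<infinity>" unfolding tot by simp
    finally show ?thesis unfolding intT by (auto simp: ennreal_mult_less_top)
  qed
  define g where "g j = enn2real (gaussm j w)" for j
  have g: "gaussm j w = ennreal (g j)" "g j \<ge> 0" for j using fin[of j] by (auto simp: g_def)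
  have s1: "(\<lambda>n. (if even n then g (n div 2) / fact n else 0) * s ^ n) sums (?C * exp (s\<^sup>2 * (norm w)\<^sup>2 / 4))" for s
  proof -
    have nn: "(if even n then g (n div 2) / fact n else 0) * s ^ n \<ge> 0" for n
      using g by (auto simp: zero_le_even_power intro!: mult_nonneg_nonneg divide_nonneg_nonneg)
    have e: "ennreal ((if even n then g (n div 2) / fact n else 0) * s ^ n) = (\<integral>\<^sup>+x. ennreal (T s n x) \<partial>lborel)" for n
      unfolding intT g(1) using g(2)[of "n div 2"] by (auto simp: ennreal_mult''[symmetric] mult_ac zero_le_even_power)
    have "(\<lambda>n. ennreal ((if even n then g (n div 2) / fact n else 0) * s ^ n)) sums ennreal (?C * exp (s\<^sup>2 * (norm w)\<^sup>2 / 4))"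
      unfolding e tot[symmetric] by (rule summable_sums) simp
    then show ?thesis using nn C by (subst (asm) sums_ennreal) auto
  qed
  have s2: "(\<lambda>n. (if even n then ?C * ((norm w)\<^sup>2 / 4) ^ (n div 2) / fact (n div 2) else 0) * s ^ n) sums (?C * exp (s\<^sup>2 * (norm w)\<^sup>2 / 4))" for s
  proof -
    have "(\<lambda>n. (s\<^sup>2 * (norm w)\<^sup>2 / 4) ^ n /\<^sub>R fact n) sums exp (s\<^sup>2 * (norm w)\<^sup>2 / 4)" by (rule exp_converges)
    from sums_if[OF sums_zero sums_mult[OF this, of ?C]]
    have "(\<lambda>n. if even n then ?C * ((s\<^sup>2 * (norm w)\<^sup>2 / 4) ^ (n div 2) /\<^sub>R fact (n div 2)) else 0) sums (?C * exp (s\<^sup>2 * (norm w)\<^sup>2 / 4))" by simp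
    moreover have "(if even n then ?C * ((s\<^sup>2 * (norm w)\<^sup>2 / 4) ^ (n div 2) /\<^sub>R fact (n div 2)) else 0)
      = (if even n then ?C * ((norm w)\<^sup>2 / 4) ^ (n div 2) / fact (n div 2) else 0) * s ^ n" for n
    proof (cases "even n")
      case True
      have "(s\<^sup>2 * (norm w)\<^sup>2 / 4) ^ (n div 2) = s ^ n * ((norm w)\<^sup>2 / 4) ^ (n div 2)"
        unfolding times_divide_eq_right[symmetric] power_mult_distrib[of "s\<^sup>2"] by (simp only: pw[OF True, of s])
      then show ?thesis unfolding if_P[OF True] by (simp only: scaleR_conv_of_real of_real_eq_id id_apply divide_inverse mult_ac)
    qed simp
    ultimately show ?thesis by simp
  qed
  have "(\<lambda>n. ((if even n then g (n div 2) / fact n else 0) - (if even n then ?C * ((norm w)\<^sup>2 / 4) ^ (n div 2) / fact (n div 2) else 0)) * s ^ n) sums 0" for s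
    using sums_diff[OF s1[of s] s2[of s]] by (simp add: left_diff_distrib)
  from powser_eq_0[OF this, of "2 * k"] have "g k / fact (2 * k) = ?C * ((norm w)\<^sup>2 / 4) ^ k / fact k" by simp
  then have "g k = ?C * ((norm w)\<^sup>2 / 4) ^ k * (fact (2 * k) / fact k)" by (simp add: field_simps)
  also have "fact (2 * k) / fact k = (4 ^ k * pochhammer (1/2) k :: real)"
    unfolding fact_double by (simp add: power_mult)
  also have "?C * ((norm w)\<^sup>2 / 4) ^ k * (4 ^ k * pochhammer (1/2) k) = ?C * pochhammer (1/2) k * norm w ^ (2 * k)"
    by (simp add: power_divide power_mult)
  finally show ?thesis unfolding g(1) by simp
qed

lemma Gamma_add_nat: "x > 0 \<Longrightarrow> Gamma (x + real n) = Gamma x * pochhammer x n" for x :: real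
proof -
  assume x: "x > 0"
  have "x \<notin> \<int>\<^sub>\<le>\<^sub>0" using nonpos_Ints_nonpos[of x] x by linarith
  then have "pochhammer x n = Gamma (x + real n) / Gamma x" by (rule pochhammer_Gamma)
  moreover have "Gamma x \<noteq> 0" using Gamma_real_pos[OF x] by simp
  ultimately show ?thesis by simp
qed

lemma ballm_eq:
  fixes w :: "'a::euclidean_space"
  assumes q: "q > -1"
  shows "ballm q k w = ennreal (Gamma (q + 1) * gauss0 TYPE('a) * pochhammer (1/2) k * norm w ^ (2 * k) / Gamma (q + 1 + real DIM('a) / 2 + real k))"
proof -
  let ?G = "Gamma (q + 1 + real DIM('a) / 2 + real k)"
  have G: "?G > 0" by (rule Gamma_real_pos) (use q in \<open>simp add: add_pos_nonneg\<close>)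
  have Gq: "Gamma (q + 1) > 0" using q by (intro Gamma_real_pos) simp
  have nn: "gauss0 TYPE('a) * pochhammer (1/2) k * norm w ^ (2 * k) \<ge> 0"
    using gauss0(2)[where 'a='a] by (intro mult_nonneg_nonneg pochhammer_nonneg) auto
  have "ballm q k w = ennreal (1 / ?G) * (ennreal ?G * ballm q k w)"
    using G by (simp add: mult.assoc[symmetric] ennreal_mult'[symmetric])
  also have "\<dots> = ennreal (1 / ?G * (Gamma (q + 1) * (gauss0 TYPE('a) * pochhammer (1/2) k * norm w ^ (2 * k))))"
    unfolding ballm_gaussm[OF q] gaussm_eq using G Gq nn by (simp only: ennreal_mult'[symmetric] ennreal_mult''[symmetric] less_imp_le divide_nonneg_nonneg zero_le_one mult_nonneg_nonneg)
  finally show ?thesis by (simp add: mult_ac)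
qed

section \<open>Mixed Gaussian moments as coefficients of quadratic forms\<close>

lemma sum_poly_coeffs_eq:
  fixes c d :: "nat \<Rightarrow> real"
  assumes "\<And>s. (\<Sum>i\<le>n. c i * s ^ i) = (\<Sum>i\<le>n. d i * s ^ i)" "i \<le> n"
  shows "c i = d i"
proof -
  have "\<forall>x. (\<Sum>i\<le>n. (c i - d i) * x ^ i) = 0" using assms(1) by (simp add: left_diff_distrib sum_subtractf)
  then show ?thesis using polyfun_eq_0[of "\<lambda>i. c i - d i" n] assms(2) by auto
qed

text \<open>\<open>xmom U V U' p p'\<close> is the normalised Gaussian mean of \<open>(x \<bullet> u)\<^sup>p (x \<bullet> u')\<^sup>p\<^sup>'\<close>
  for \<open>U = |u|\<^sup>2\<close>, \<open>V = u \<bullet> u'\<close>, \<open>U' = |u'|\<^sup>2\<close>.\<close>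

definition xmom :: "real \<Rightarrow> real \<Rightarrow> real \<Rightarrow> nat \<Rightarrow> nat \<Rightarrow> real" where
  "xmom U V U' p p' = (if even (p + p') then
     coeff ([:U', 2 * V, U:] ^ ((p + p') div 2)) p / real (binomial (p + p') p) * pochhammer (1/2) ((p + p') div 2) else 0)"

text \<open>The quadratic is |s u + u'|^2 as a polynomial in s. Substituting 1/s for s exchanges u
  and u' and reverses the coefficients; the identity is compared on nonzero s, which
  suffices.\<close>

lemma coeff_quadratic_reflect:
  assumes "i \<le> 2 * k"
  shows "coeff ([:U', 2 * V, U:] ^ k) i = coeff ([:U, 2 * V, U' :: real:] ^ k) (2 * k - i)"
proof -
  define P where "P = [:U', 2 * V, U:] ^ k"
  define Q where "Q = [:U, 2 * V, U':] ^ k"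
  have dP: "degree P \<le> 2 * k" unfolding P_def by (rule order_trans[OF degree_power_le]) (simp add: degree_pCons_eq_if)
  have dQ: "degree Q \<le> 2 * k" unfolding Q_def by (rule order_trans[OF degree_power_le]) (simp add: degree_pCons_eq_if)
  have alt: "poly R s = (\<Sum>j\<le>2 * k. coeff R j * s ^ j)" if "degree R \<le> 2 * k" for R :: "real poly" and s
    unfolding poly_altdef by (rule sum.mono_neutral_left) (use that in \<open>auto simp: coeff_eq_0\<close>)
  have ne: "(\<Sum>j\<le>2 * k. coeff P j * s ^ j) = (\<Sum>j\<le>2 * k. coeff Q (2 * k - j) * s ^ j)" if "s \<noteq> 0" for s
  proof -
    have "(\<Sum>j\<le>2 * k. coeff P j * s ^ j) = (U' + s * (2 * V + s * U)) ^ k" unfolding alt[OF dP, symmetric] by (simp add: P_def)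
    also have "\<dots> = (s\<^sup>2 * (U + (1/s) * (2 * V + (1/s) * U'))) ^ k"
    proof -
      have "U' + s * (2 * V + s * U) = s\<^sup>2 * (U + (1/s) * (2 * V + (1/s) * U'))"
        using that by (simp add: field_simps power2_eq_square)
      then show ?thesis by (simp only:)
    qed
    also have "\<dots> = s ^ (2 * k) * poly Q (1 / s)" by (simp add: Q_def power_mult_distrib power_mult)
    also have "\<dots> = (\<Sum>j\<le>2 * k. coeff Q j * s ^ (2 * k - j))"
      unfolding alt[OF dQ] sum_distrib_left by (intro sum.cong refl) (use that in \<open>simp add: power_diff power_divide\<close>)
    also have "\<dots> = (\<Sum>j\<le>2 * k. coeff Q (2 * k - j) * s ^ j)"
      by (rule sum.reindex_bij_witness[of _ "\<lambda>j. 2 * k - j" "\<lambda>j. 2 * k - j"]) auto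
    finally show ?thesis .
  qed
  have "(\<Sum>j\<le>2 * k. (coeff P j - coeff Q (2 * k - j)) * s ^ j) = 0" if "s \<noteq> 0" for s
    using ne[OF that] by (simp add: left_diff_distrib sum_subtractf)
  then have sub: "UNIV - {0} \<subseteq> {s. (\<Sum>j\<le>2 * k. (coeff P j - coeff Q (2 * k - j)) * s ^ j) = 0}" by auto
  moreover have "infinite (UNIV - {0::real})" by (simp add: infinite_UNIV_char_0)
  ultimately have "infinite {s. (\<Sum>j\<le>2 * k. (coeff P j - coeff Q (2 * k - j)) * s ^ j) = 0}"
    using finite_subset by blast
  then have "\<forall>i\<le>2 * k. coeff P i - coeff Q (2 * k - i) = 0" using polyfun_finite_roots[of "\<lambda>i. coeff P i - coeff Q (2 * k - i)" "2 * k"] by blast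
  then show ?thesis using assms by (simp add: P_def Q_def)
qed

lemma xmom_sym: "xmom U V U' p p' = xmom U' V U p' p"
proof (cases "even (p + p')")
  case True
  then have "2 * ((p + p') div 2) = p + p'" by simp
  then have "coeff ([:U', 2 * V, U:] ^ ((p + p') div 2)) p = coeff ([:U, 2 * V, U':] ^ ((p + p') div 2)) p'"
    using coeff_quadratic_reflect[of p "(p + p') div 2" U' V U] by simp
  moreover have "binomial (p + p') p = binomial (p' + p) p'" using binomial_symmetric[of p "p + p'"] by (simp add: add.commute)
  ultimately show ?thesis using True by (simp add: xmom_def add.commute)
qed (simp add: xmom_def add.commute)

text \<open>Gaussian integration by parts for a variable of variance 1/2 in each direction. In terms
  of coefficients it is the derivative of the (k+1)-th power of the quadratic |s u + u'|^2.\<close>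

lemma xmom_rec:
  "2 * xmom U V U' (Suc p) p' = real p * U * xmom U V U' (p - 1) p' + real p' * V * xmom U V U' p (p' - 1)"
proof (cases "even (Suc p + p')")
  case False
  then have "p = 0 \<or> odd (p - 1 + p')" "p' = 0 \<or> odd (p + (p' - 1))" by presburger+
  then show ?thesis using False by (auto simp: xmom_def)
next
  case True
  then obtain k where k: "Suc p + p' = 2 * Suc k" by (metis add_Suc evenE nat.exhaust mult_0_right nat.distinct(1))
  let ?P = "[:U', 2 * V, U:] :: real poly"
  have "pderiv (?P ^ Suc k) = smult (real (Suc k)) (?P ^ k) * [:2 * V, 2 * U:]"
    unfolding pderiv_power_Suc by (simp add: pderiv_pCons)
  then have "coeff (pderiv (?P ^ Suc k)) p = coeff (smult (real (Suc k)) (?P ^ k) * [:2 * V, 2 * U:]) p" by simp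
  also have "smult (real (Suc k)) (?P ^ k) * [:2 * V, 2 * U:] = smult (real (Suc k) * (2 * V)) (?P ^ k) + pCons 0 (smult (real (Suc k) * (2 * U)) (?P ^ k))"
    by (rule poly_eqI) (simp add: coeff_pCons algebra_simps split: nat.split)
  finally have D: "real (Suc p) * coeff (?P ^ Suc k) (Suc p) = 2 * real (Suc k) * (V * coeff (?P ^ k) p + U * (if p = 0 then 0 else coeff (?P ^ k) (p - 1)))"
    unfolding coeff_pderiv by (cases p) (simp_all add: algebra_simps)
  have h1: "(Suc p + p') div 2 = Suc k" using k by simp
  have x1: "xmom U V U' (Suc p) p' = coeff (?P ^ Suc k) (Suc p) / real (binomial (2 * Suc k) (Suc p)) * pochhammer (1/2) (Suc k)"
    unfolding xmom_def using True k h1 by simp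
  have x2: "real p * xmom U V U' (p - 1) p' = real p * ((if p = 0 then 0 else coeff (?P ^ k) (p - 1)) / real (binomial (2 * k) (p - 1)) * pochhammer (1/2) k)"
  proof (cases p)
    case (Suc l)
    then have "l + p' = 2 * k" using k by simp
    then show ?thesis using Suc by (simp add: xmom_def)
  qed simp
  have x3: "real p' * xmom U V U' p (p' - 1) = real p' * (coeff (?P ^ k) p / real (binomial (2 * k) p) * pochhammer (1/2) k)"
  proof (cases p')
    case (Suc l)
    then have "p + l = 2 * k" using k by simp
    then show ?thesis using Suc by (simp add: xmom_def)
  qed simp
  \<comment> \<open>Absorption identities bring the binomials of the three moments to the common one
    of upper index 2 k + 1.\<close>
  have b1: "real (Suc p) * real (binomial (2 * Suc k) (Suc p)) = real (2 * Suc k) * real (binomial (Suc (2 * k)) p)"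
  proof -
    have "Suc p * (Suc (Suc (2 * k)) choose Suc p) = Suc (Suc (2 * k)) * (Suc (2 * k) choose p)" by (rule Suc_times_binomial)
    moreover have "2 * Suc k = Suc (Suc (2 * k))" by simp
    ultimately show ?thesis by (simp only: of_nat_mult[symmetric])
  qed
  have b2: "real p * real (binomial (Suc (2 * k)) p) = real (Suc (2 * k)) * (if p = 0 then 0 else real (binomial (2 * k) (p - 1)))"
  proof (cases p)
    case (Suc l)
    have "Suc l * (Suc (2 * k) choose Suc l) = Suc (2 * k) * (2 * k choose l)" by (rule Suc_times_binomial)
    then have "real (Suc l) * real (Suc (2 * k) choose Suc l) = real (Suc (2 * k)) * real (2 * k choose l)"
      by (simp only: of_nat_mult[symmetric])
    then show ?thesis using Suc by (simp only: nat.distinct if_False diff_Suc_1)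
  qed simp
  have b3: "real p' * real (binomial (Suc (2 * k)) p) = real (Suc (2 * k)) * real (binomial (2 * k) p)"
  proof -
    have "p' = Suc (2 * k) - p" using k by simp
    moreover have "(Suc (2 * k) - p) * (Suc (2 * k) choose p) = Suc (2 * k) * (2 * k choose p)"
      using binomial_absorb_comp[of "Suc (2 * k)" p] by simp
    ultimately show ?thesis by (simp only: of_nat_mult[symmetric])
  qed
  have ple: "p \<le> Suc (2 * k)" using k by simp
  have pos: "real (binomial (2 * Suc k) (Suc p)) > 0" "real (binomial (Suc (2 * k)) p) > 0" using ple by (simp_all only: of_nat_0_less_iff zero_less_binomial_iff Suc_le_mono mult_Suc_right add_2_eq_Suc Suc_le_mono)
  let ?B = "real (binomial (Suc (2 * k)) p)" and ?m = "real (Suc (2 * k))"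
  have e2: "real p * (X / real (binomial (2 * k) (p - 1))) = ?m / ?B * X * (if p = 0 then 0 else 1)" for X
  proof (cases "p = 0")
    case False
    then have "real (binomial (2 * k) (p - 1)) > 0" using ple by simp
    then show ?thesis using b2 pos False by (simp add: field_simps)
  qed simp
  have e3: "real p' * (X / real (binomial (2 * k) p)) = ?m / ?B * X * (if p' = 0 then 0 else 1)" for X
  proof (cases "p' = 0")
    case False
    then have "p \<le> 2 * k" using k by simp
    then have "real (binomial (2 * k) p) > 0" by simp
    then show ?thesis using b3 pos False by (simp add: field_simps)
  qed simp
  have cz: "p' = 0 \<Longrightarrow> coeff (?P ^ k) p = 0"
  proof -
    assume "p' = 0"
    then have "p = Suc (2 * k)" using k by simp
    moreover have "degree (?P ^ k) \<le> 2 * k" by (rule order_trans[OF degree_power_le]) (simp add: degree_pCons_eq_if)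
    ultimately show ?thesis by (intro coeff_eq_0) simp
  qed
  have "2 * xmom U V U' (Suc p) p' = 2 * (real (Suc p) * coeff (?P ^ Suc k) (Suc p)) / (real (Suc p) * real (binomial (2 * Suc k) (Suc p))) * (pochhammer (1/2) k * (1/2 + real k))"
    unfolding x1 pochhammer_Suc by simp
  also have "\<dots> = 2 * (2 * real (Suc k) * (V * coeff (?P ^ k) p + U * (if p = 0 then 0 else coeff (?P ^ k) (p - 1)))) / (real (2 * Suc k) * ?B) * (pochhammer (1/2) k * (1/2 + real k))"
    unfolding D b1 ..
  also have "\<dots> = (V * coeff (?P ^ k) p + U * (if p = 0 then 0 else coeff (?P ^ k) (p - 1))) * (?m / ?B) * pochhammer (1/2) k"
  proof -
    have "2 * (2 * K * X) / (2 * K * B) * (Y * (1/2 + r)) = X * ((2 * r + 1) / B) * Y" if "K \<noteq> 0" "B \<noteq> 0" for K B X Y r :: real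
      using that by (simp add: field_simps)
    moreover have "real (Suc k) \<noteq> 0" "?B \<noteq> 0" using pos by auto
    moreover have "real (2 * Suc k) = 2 * real (Suc k)" "?m = 2 * real k + 1" by simp_all
    ultimately show ?thesis by presburger
  qed
  also have "\<dots> = U * (real p * xmom U V U' (p - 1) p') + V * (real p' * xmom U V U' p (p' - 1))"
  proof -
    have "real p * ((if p = 0 then 0 else coeff (?P ^ k) (p - 1)) / real (binomial (2 * k) (p - 1))) = ?m / ?B * (if p = 0 then 0 else coeff (?P ^ k) (p - 1))"
      unfolding e2 by simp
    moreover have "real p' * (coeff (?P ^ k) p / real (binomial (2 * k) p)) = ?m / ?B * coeff (?P ^ k) p"
      unfolding e3 using cz by auto
    ultimately have y: "real p * xmom U V U' (p - 1) p' = ?m / ?B * (if p = 0 then 0 else coeff (?P ^ k) (p - 1)) * pochhammer (1/2) k"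
      "real p' * xmom U V U' p (p' - 1) = ?m / ?B * coeff (?P ^ k) p * pochhammer (1/2) k"
      unfolding x2 x3 by (simp_all only: mult.assoc[symmetric])
    have "(V * c2 + U * c1) * r * h = U * (r * c1 * h) + V * (r * c2 * h)" for c1 c2 r h :: real
      by (simp add: algebra_simps)
    then show ?thesis unfolding y .
  qed
  finally show ?thesis by (simp add: mult_ac)
qed

text \<open>Lowering p and lowering p' both produce the mixed term p p' V with exponents p - 1 and
  p' - 1; it cancels in the difference.\<close>

lemma xmom_antisym:
  "2 * (real p - real p') * xmom U V U' p p' =
     real p * (real p - 1) * U * xmom U V U' (p - 2) p' - real p' * (real p' - 1) * U' * xmom U V U' p (p' - 2)"
proof -
  have A: "2 * real p * xmom U V U' p p' = real p * (real p - 1) * U * xmom U V U' (p - 2) p' + real p * real p' * V * xmom U V U' (p - 1) (p' - 1)" for p p' U U'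
  proof (cases p)
    case (Suc l)
    have "real p * (2 * xmom U V U' (Suc l) p') = real p * (real l * U * xmom U V U' (l - 1) p' + real p' * V * xmom U V U' l (p' - 1))"
      unfolding xmom_rec ..
    then show ?thesis using Suc by (simp add: algebra_simps)
  qed simp
  have B: "2 * real p' * xmom U V U' p p' = real p' * (real p' - 1) * U' * xmom U V U' p (p' - 2) + real p * real p' * V * xmom U V U' (p - 1) (p' - 1)"
    using A[of p' U' U p] by (simp add: xmom_sym[of U' V U] mult_ac)
  show ?thesis using A[of p U U' p'] B by (simp add: algebra_simps)
qed

section \<open>The weighted hyperboloid\<close>

definition dimr :: "'d::finite itself \<Rightarrow> real" where "dimr _ = real CARD('d)"

lemma powr_mult_power: "x \<ge> 0 \<Longrightarrow> x powr e * x ^ n = x powr (e + real n)" for x :: real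
  by (cases "x = 0") (auto simp: powr_add powr_realpow)

text \<open>The parameter \<open>dt\<close> only carries the dimension type.\<close>

locale hyperboloid =
  fixes a b c \<beta> \<gamma> :: real and dt :: "'d::finite itself"
  assumes a_nonneg: "0 \<le> a" and a_less_b: "a < b" and c_nonneg: "0 \<le> c"
    and beta_nonneg: "0 \<le> \<beta>" and gamma_gt: "\<gamma> > -1"
begin

text \<open>\<open>tau\<close> and \<open>vv\<close> carry the exponents \<open>bb - 1\<close> and
  \<open>gg - 1\<close> in the weight, the form that suits Beta integrals and the lifts. Moreover
  \<open>lam + 1 = bb + gg + d/2\<close> is the total parameter of the resulting Dirichlet
  moments.\<close>

definition bb :: real where "bb = \<beta> + 1/2"
definition gg :: real where "gg = \<gamma> + 1"
definition lam :: real where "lam = (dimr dt + 1) / 2 + \<beta> + \<gamma>"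

lemma bb_pos: "bb > 0" and gg_pos: "gg > 0" and lam_pos: "lam > 0"
proof -
  have "CARD('d) \<ge> 1" by (simp add: Suc_leI)
  then have "dimr dt \<ge> 1" unfolding dimr_def by linarith
  then have "(dimr dt + 1) / 2 \<ge> 1" by simp
  then show "lam > 0" using beta_nonneg gamma_gt unfolding lam_def by linarith
qed (use beta_nonneg gamma_gt in \<open>auto simp: bb_def gg_def\<close>)

definition tau :: "'d pt \<Rightarrow> real" where
  "tau z = ((snd z)\<^sup>2 - a - (c - a) * (norm (fst z))\<^sup>2) / (b - a)"

definition vv :: "'d pt \<Rightarrow> real" where
  "vv z = 1 - (norm (fst z))\<^sup>2 - tau z"

lemma vv_eq: "vv z = (b - (b - c) * (norm (fst z))\<^sup>2 - (snd z)\<^sup>2) / (b - a)"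
  unfolding vv_def tau_def using a_less_b by (simp add: field_simps)

lemma sum_coords: "(norm (fst z))\<^sup>2 + tau z + vv z = 1"
  by (simp add: vv_def)

lemma mem_LL: "z \<in> LL a b c \<longleftrightarrow> tau z \<ge> 0 \<and> vv z \<ge> 0 \<and> snd z \<ge> 0"
proof -
  obtain x t where z: "z = (x, t)" by fastforce
  have "tau z \<ge> 0 \<longleftrightarrow> a + (c - a) * (norm x)\<^sup>2 \<le> t\<^sup>2"
    using a_less_b by (auto simp: z tau_def zero_le_divide_iff)
  moreover have "vv z \<ge> 0 \<longleftrightarrow> t\<^sup>2 \<le> b + (c - b) * (norm x)\<^sup>2"
    using a_less_b by (auto simp: z vv_eq zero_le_divide_iff algebra_simps)
  moreover have "norm x \<le> 1" if "tau z \<ge> 0" "vv z \<ge> 0"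
  proof -
    have "(norm x)\<^sup>2 \<le> 1" using sum_coords[of z] that by (simp add: z)
    then show ?thesis by (simp add: power_le_one_iff abs_square_le_1)
  qed
  ultimately show ?thesis by (auto simp: z LL_def XX_def)
qed

lemma WW_eq: "WW a b c \<beta> \<gamma> z = \<bar>snd z\<bar> * tau z powr (bb - 1) * vv z powr (gg - 1)"
proof -
  have 1: "(- a + (a - c) * (norm (fst z))\<^sup>2 + (snd z)\<^sup>2) / (b - a) = tau z" by (simp add: tau_def algebra_simps)
  have 2: "(b - (b - c) * (norm (fst z))\<^sup>2 - (snd z)\<^sup>2) / (b - a) = vv z" by (simp add: vv_eq)
  show ?thesis unfolding WW_def case_prod_beta 1 2 by (simp add: bb_def gg_def)
qed

lemma WW_nonneg: "WW a b c \<beta> \<gamma> (z :: 'd pt) \<ge> 0"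
  by (simp add: WW_eq)

lemma tau_polysE: "tau \<in> polysE 2"
proof -
  have "(\<lambda>z. (1 / (b - a)) * (((snd z)\<^sup>2 - a) - (c - a) * (norm (fst z))\<^sup>2)) \<in> polysE 2"
    by (intro polysE_cmult polysE_diff polysE_snd2 polysE_const polysE_norm2)
  then show ?thesis by (simp add: tau_def[abs_def])
qed

lemma vv_polysE: "vv \<in> polysE 2"
proof -
  have "(\<lambda>z. (1 - (norm (fst z))\<^sup>2) - tau z) \<in> polysE 2"
    by (intro polysE_diff polysE_const polysE_norm2 tau_polysE)
  then show ?thesis by (simp add: vv_def[abs_def])
qed

lemma polysE_continuous: "P \<in> polysE n \<Longrightarrow> continuous_on S P"
  using polys_continuous_on by (auto simp: polysE_iff)

lemma tau_continuous: "continuous_on S tau" and vv_continuous: "continuous_on S vv"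
  using tau_polysE vv_polysE polysE_continuous by blast+

lemma LL_closed: "closed (LL a b c :: 'd pt set)"
proof -
  have "LL a b c = {z :: 'd pt. 0 \<le> tau z} \<inter> {z. 0 \<le> vv z} \<inter> {z. 0 \<le> snd z}" using mem_LL by blast
  moreover have "closed {z :: 'd pt. 0 \<le> tau z}" "closed {z :: 'd pt. 0 \<le> vv z}" "closed {z :: 'd pt. 0 \<le> snd z}"
    by (intro closed_Collect_le continuous_on_const tau_continuous vv_continuous continuous_on_snd continuous_on_id)+
  ultimately show ?thesis by auto
qed

lemma LL_bounds:
  assumes "z \<in> LL a b c"
  shows "norm (fst z) \<le> 1" "0 \<le> tau z" "tau z \<le> 1" "0 \<le> vv z" "vv z \<le> 1" "snd z \<ge> 0" "(snd z)\<^sup>2 \<le> b + c"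
proof -
  show p: "0 \<le> tau z" "0 \<le> vv z" "snd z \<ge> 0" using assms mem_LL by auto
  have s: "(norm (fst z))\<^sup>2 \<le> 1" using sum_coords[of z] p by linarith
  then show "norm (fst z) \<le> 1" by (simp add: abs_square_le_1)
  show "tau z \<le> 1" "vv z \<le> 1" using sum_coords[of z] p zero_le_power2[of "norm (fst z)"] by linarith+
  have "(b - (b - c) * (norm (fst z))\<^sup>2 - (snd z)\<^sup>2) \<ge> 0" using p(2) a_less_b unfolding vv_eq by (simp add: zero_le_divide_iff)
  then have "(snd z)\<^sup>2 \<le> b * (1 - (norm (fst z))\<^sup>2) + c * (norm (fst z))\<^sup>2" by (simp add: algebra_simps)
  also have "\<dots> \<le> b * 1 + c * 1" using a_nonneg a_less_b c_nonneg s by (intro add_mono mult_left_mono) auto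
  finally show "(snd z)\<^sup>2 \<le> b + c" by simp
qed

lemma LL_compact: "compact (LL a b c :: 'd pt set)"
proof -
  have "norm z \<le> 1 + sqrt (b + c)" if z: "z \<in> LL a b c" for z :: "'d pt"
  proof -
    have "\<bar>snd z\<bar> \<le> sqrt (b + c)" using LL_bounds(7)[OF z] by (simp add: real_le_rsqrt)
    then show ?thesis using LL_bounds(1)[OF z] norm_Pair_le[of "fst z" "snd z"] by simp
  qed
  then have "bounded (LL a b c :: 'd pt set)" unfolding bounded_iff by blast
  then show ?thesis using LL_closed compact_eq_bounded_closed by blast
qed

section \<open>The weighted measure and its moments\<close>

lemma LL_sets [measurable, simp]: "(LL a b c :: 'd pt set) \<in> sets borel"
  using LL_closed by (rule borel_closed)

lemma tau_measurable [measurable]: "tau \<in> borel_measurable borel"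
  and vv_measurable [measurable]: "vv \<in> borel_measurable borel"
  using tau_continuous vv_continuous by (auto intro: borel_measurable_continuous_onI)

lemma fst_borel [measurable]: "(fst :: 'd pt \<Rightarrow> real ^ 'd) \<in> borel_measurable borel"
  and snd_borel [measurable]: "(snd :: 'd pt \<Rightarrow> real) \<in> borel_measurable borel"
  and inner_borel [measurable]: "(\<lambda>z :: 'd pt. fst z \<bullet> w) \<in> borel_measurable borel"
  by (intro borel_measurable_continuous_onI continuous_intros)+

lemma WW_measurable [measurable]: "(WW a b c \<beta> \<gamma> :: 'd pt \<Rightarrow> real) \<in> borel_measurable borel"
proof -
  have "(\<lambda>z. \<bar>snd z\<bar> * tau z powr (bb - 1) * vv z powr (gg - 1)) \<in> borel_measurable borel" by measurable
  then show ?thesis unfolding WW_eq[abs_def, symmetric] .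
qed

definition mu :: "'d pt measure" where
  "mu = density lborel (\<lambda>z. ennreal (indicator (LL a b c) z * WW a b c \<beta> \<gamma> z))"

lemma space_mu [simp]: "space mu = UNIV" by (simp add: mu_def)
lemma sets_mu [simp, measurable_cong]: "sets mu = sets borel" by (simp add: mu_def)

lemma nn_integral_mu: "f \<in> borel_measurable borel \<Longrightarrow>
    (\<integral>\<^sup>+z. f z \<partial>mu) = (\<integral>\<^sup>+z. ennreal (indicator (LL a b c) z * WW a b c \<beta> \<gamma> z) * f z \<partial>lborel)"
  unfolding mu_def by (subst nn_integral_density) auto

lemma AE_mu: "AE z in mu. z \<in> LL a b c"
  unfolding mu_def by (subst AE_density) (auto simp: indicator_def)

text \<open>On the fibre over x the substitution y = \<open>tau (x, t)\<close> has dy = 2 t dt / (b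
  - a), which absorbs the factor |t| of the weight. The new variable runs over [0, 1 - |x|^2], so a
  Beta integral remains and a, b, c survive only in a factor.\<close>

lemma fiber_integral:
  fixes x :: "real ^ 'd"
  shows "(\<integral>\<^sup>+t. ennreal (indicator (LL a b c) (x, t) * WW a b c \<beta> \<gamma> (x, t)) * ennreal (tau (x, t) ^ I * vv (x, t) ^ J) \<partial>lborel)
    = ennreal ((b - a) / 2 * Beta (bb + real I) (gg + real J) * (indicator (cball 0 1) x * (1 - (norm x)\<^sup>2) powr (bb + gg + real I + real J - 1)))"
proof (cases "norm x \<le> 1")
  case False
  have "(x, t) \<notin> LL a b c" for t using LL_bounds(1)[of "(x, t)"] False by auto
  then show ?thesis using False by simp
next
  case True
  define R where "R = 1 - (norm x)\<^sup>2"
  define \<alpha> where "\<alpha> = a + (c - a) * (norm x)\<^sup>2"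
  have R: "R \<ge> 0" unfolding R_def using True by (simp add: power_le_one)
  have "\<alpha> = a * R + c * (norm x)\<^sup>2" unfolding R_def \<alpha>_def by (simp add: algebra_simps)
  then have al: "\<alpha> \<ge> 0" using a_nonneg c_nonneg R by simp
  define g where "g t = (t\<^sup>2 - \<alpha>) / (b - a)" for t
  define t0 where "t0 = sqrt \<alpha>"
  define t1 where "t1 = sqrt (\<alpha> + (b - a) * R)"
  have t01: "0 \<le> t0" "t0 \<le> t1" unfolding t0_def t1_def using al R a_less_b by auto
  have g01: "g t0 = 0" "g t1 = R" unfolding g_def t0_def t1_def using al R a_less_b by auto
  have gt: "tau (x, t) = g t" for t by (simp add: tau_def g_def \<alpha>_def algebra_simps)
  have vt: "vv (x, t) = R - g t" for t by (simp add: vv_def gt R_def)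
  define p where "p = bb + real I"
  define q where "q = gg + real J"
  have pq: "p > 0" "q > 0" using bb_pos gg_pos by (auto simp: p_def q_def add_pos_nonneg)
  define f where "f y = (b - a) / 2 * (y powr (p - 1) * (R - y) powr (q - 1))" for y
  have mem: "(x, t) \<in> LL a b c \<longleftrightarrow> t \<in> {t0..t1}" for t
  proof (cases "t \<ge> 0")
    case False
    then show ?thesis using t01 mem_LL by auto
  next
    case t: True
    have "g t \<ge> 0 \<longleftrightarrow> \<alpha> \<le> t\<^sup>2" unfolding g_def using a_less_b by (simp add: zero_le_divide_iff)
    also have "\<dots> \<longleftrightarrow> t0 \<le> t" unfolding t0_def using t real_sqrt_le_iff[of \<alpha> "t\<^sup>2"] by simp
    finally have 1: "g t \<ge> 0 \<longleftrightarrow> t0 \<le> t" .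
    have "R - g t \<ge> 0 \<longleftrightarrow> t\<^sup>2 \<le> \<alpha> + (b - a) * R" unfolding g_def using a_less_b by (simp add: field_simps)
    also have "\<dots> \<longleftrightarrow> t \<le> t1" unfolding t1_def using t real_sqrt_le_iff[of "t\<^sup>2"] by simp
    finally show ?thesis using 1 t by (simp add: mem_LL gt vt)
  qed
  have "(\<integral>\<^sup>+t. ennreal (indicator (LL a b c) (x, t) * WW a b c \<beta> \<gamma> (x, t)) * ennreal (tau (x, t) ^ I * vv (x, t) ^ J) \<partial>lborel)
    = (\<integral>\<^sup>+t. ennreal (f (g t) * (2 * t / (b - a)) * indicator {t0..t1} t) \<partial>lborel)"
  proof (intro nn_integral_cong)
    fix t
    show "ennreal (indicator (LL a b c) (x, t) * WW a b c \<beta> \<gamma> (x, t)) * ennreal (tau (x, t) ^ I * vv (x, t) ^ J)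
      = ennreal (f (g t) * (2 * t / (b - a)) * indicator {t0..t1} t)"
    proof (cases "t \<in> {t0..t1}")
      case False
      then show ?thesis using mem by simp
    next
      case tt: True
      then have L: "(x, t) \<in> LL a b c" using mem by simp
      then have gp: "0 \<le> g t" "0 \<le> R - g t" "0 \<le> t" using mem_LL gt vt by auto
      have "WW a b c \<beta> \<gamma> (x, t) * (tau (x, t) ^ I * vv (x, t) ^ J) = t * (g t powr (bb - 1) * g t ^ I) * ((R - g t) powr (gg - 1) * (R - g t) ^ J)"
        unfolding WW_eq gt vt using gp by simp
      also have "\<dots> = t * g t powr (p - 1) * (R - g t) powr (q - 1)"
        unfolding powr_mult_power[OF gp(1)] powr_mult_power[OF gp(2)] p_def q_def by (simp add: algebra_simps)
      also have "\<dots> = f (g t) * (2 * t / (b - a))" unfolding f_def using a_less_b by simp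
      finally show ?thesis using L tt WW_nonneg by (simp add: ennreal_mult'[symmetric])
    qed
  qed
  also have "\<dots> = (\<integral>\<^sup>+y. ennreal (f y * indicator {g t0..g t1} y) \<partial>lborel)"
  proof (rule nn_integral_substitution[symmetric])
    show "set_borel_measurable borel {g t0..g t1} f" unfolding set_borel_measurable_def f_def by measurable
    show "(g has_real_derivative 2 * t / (b - a)) (at t)" if "t \<in> {t0..t1}" for t
      unfolding g_def using a_less_b by (auto intro!: derivative_eq_intros)
    show "continuous_on {t0..t1} (\<lambda>t. 2 * t / (b - a))" using a_less_b by (intro continuous_intros) auto
    show "0 \<le> 2 * t / (b - a)" if "t \<in> {t0..t1}" for t using that t01 a_less_b by auto
  qed (rule t01)
  also have "\<dots> = (\<integral>\<^sup>+y. ennreal ((b - a) / 2) * (ennreal (y powr (p - 1) * (R - y) powr (q - 1)) * indicator {0..R} y) \<partial>lborel)"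
    unfolding g01 f_def using a_less_b by (intro nn_integral_cong) (auto simp: indicator_def ennreal_mult'[symmetric])
  also have "\<dots> = ennreal ((b - a) / 2) * ennreal (R powr (p + q - 1) * Beta p q)"
    by (subst nn_integral_cmult) (auto simp: nn_integral_Beta_scaled[OF pq R])
  also have "\<dots> = ennreal ((b - a) / 2 * Beta (bb + real I) (gg + real J) * (indicator (cball 0 1) x * (1 - (norm x)\<^sup>2) powr (bb + gg + real I + real J - 1)))"
    using True a_less_b by (simp add: ennreal_mult'[symmetric] p_def q_def R_def algebra_simps)
  finally show ?thesis .
qed

text \<open>The total mass of the weighted measure.\<close>

definition K0 :: real where
  "K0 = (b - a) / 2 * Gamma bb * Gamma gg * gauss0 TYPE(real ^ 'd) / Gamma (lam + 1)"

lemma K0_pos: "K0 > 0"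
  unfolding K0_def using a_less_b bb_pos gg_pos lam_pos gauss0(2)[where 'a="real ^ 'd"]
  by (intro divide_pos_pos mult_pos_pos Gamma_real_pos) auto

text \<open>Dirichlet moments of degree k in |x|^2, I in \<open>tau\<close> and J in
  \<open>vv\<close>. The Pochhammer symbol belonging to the x-part is left to
  \<open>xmom\<close>.\<close>

definition kap :: "nat \<Rightarrow> nat \<Rightarrow> nat \<Rightarrow> real" where
  "kap k I J = K0 * pochhammer bb I * pochhammer gg J / pochhammer (lam + 1) (k + I + J)"

lemma nn_moment:
  "(\<integral>\<^sup>+z. ennreal ((fst z \<bullet> w) ^ (2 * k) * (tau z ^ I * vv z ^ J)) \<partial>mu) = ennreal (kap k I J * pochhammer (1/2) k * norm w ^ (2 * k))"
proof -
  let ?q = "bb + gg + real I + real J - 1"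
  let ?B = "(b - a) / 2 * Beta (bb + real I) (gg + real J)"
  have q: "?q > -1" using bb_pos gg_pos by simp
  have Bp: "?B > 0" unfolding Beta_def using a_less_b bb_pos gg_pos
    by (intro mult_pos_pos divide_pos_pos Gamma_real_pos) (auto intro: add_pos_nonneg)
  have wk: "(x \<bullet> w) ^ (2 * k) \<ge> 0" for x :: "real ^ 'd" by (simp add: power_mult)
  have "(\<integral>\<^sup>+z. ennreal ((fst z \<bullet> w) ^ (2 * k) * (tau z ^ I * vv z ^ J)) \<partial>mu)
     = (\<integral>\<^sup>+z. ennreal (indicator (LL a b c) z * WW a b c \<beta> \<gamma> z) * ennreal ((fst z \<bullet> w) ^ (2 * k) * (tau z ^ I * vv z ^ J)) \<partial>lborel)"
    by (rule nn_integral_mu) measurable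
  also have "\<dots> = (\<integral>\<^sup>+z. ennreal ((fst z \<bullet> w) ^ (2 * k)) * (ennreal (indicator (LL a b c) z * WW a b c \<beta> \<gamma> z) * ennreal (tau z ^ I * vv z ^ J)) \<partial>(lborel \<Otimes>\<^sub>M lborel))"
    unfolding lborel_prod by (intro nn_integral_cong) (subst ennreal_mult'[OF wk], rule mult.left_commute)
  also have "\<dots> = (\<integral>\<^sup>+x. \<integral>\<^sup>+t. ennreal ((x \<bullet> w) ^ (2 * k)) * (ennreal (indicator (LL a b c) (x, t) * WW a b c \<beta> \<gamma> (x, t)) * ennreal (tau (x, t) ^ I * vv (x, t) ^ J)) \<partial>lborel \<partial>lborel)"
    by (subst lborel.nn_integral_fst[symmetric]) (auto simp: lborel_prod)
  also have "\<dots> = (\<integral>\<^sup>+x. ennreal ((x \<bullet> w) ^ (2 * k)) * ennreal (?B * (indicator (cball 0 1) x * (1 - (norm x)\<^sup>2) powr ?q)) \<partial>lborel)"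
    unfolding fiber_integral[symmetric] by (intro nn_integral_cong nn_integral_cmult) measurable
  also have "\<dots> = (\<integral>\<^sup>+x. ennreal ?B * ennreal (indicator (cball 0 1) x * ((x \<bullet> w) ^ (2 * k) * (1 - (norm x)\<^sup>2) powr ?q)) \<partial>lborel)"
  proof (intro nn_integral_cong)
    fix x :: "real ^ 'd"
    have B0: "?B \<ge> 0" using Bp by simp
    have "(x \<bullet> w) ^ (2 * k) * (?B * (indicator (cball 0 1) x * (1 - (norm x)\<^sup>2) powr ?q)) = ?B * (indicator (cball 0 1) x * ((x \<bullet> w) ^ (2 * k) * (1 - (norm x)\<^sup>2) powr ?q))"
      by (simp only: mult_ac)
    then show "ennreal ((x \<bullet> w) ^ (2 * k)) * ennreal (?B * (indicator (cball 0 1) x * (1 - (norm x)\<^sup>2) powr ?q))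
      = ennreal ?B * ennreal (indicator (cball 0 1) x * ((x \<bullet> w) ^ (2 * k) * (1 - (norm x)\<^sup>2) powr ?q))"
      by (simp only: ennreal_mult'[OF wk, symmetric] ennreal_mult'[OF B0, symmetric])
  qed
  also have "\<dots> = ennreal ?B * ballm ?q k w"
  proof -
    have cb [measurable]: "cball (0::real ^ 'd) 1 \<in> sets borel" by simp
    show ?thesis unfolding ballm_def by (rule nn_integral_cmult) measurable
  qed
  also have "\<dots> = ennreal (?B * (Gamma (?q + 1) * gauss0 TYPE(real ^ 'd) * pochhammer (1/2) k * norm w ^ (2 * k) / Gamma (?q + 1 + real DIM(real ^ 'd) / 2 + real k)))"
    unfolding ballm_eq[OF q] using Bp by (simp only: ennreal_mult' less_imp_le)
  also have "?B * (Gamma (?q + 1) * gauss0 TYPE(real ^ 'd) * pochhammer (1/2) k * norm w ^ (2 * k) / Gamma (?q + 1 + real DIM(real ^ 'd) / 2 + real k))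
    = kap k I J * pochhammer (1/2) k * norm w ^ (2 * k)"
  proof -
    have 1: "?q + 1 + real DIM(real ^ 'd) / 2 + real k = lam + 1 + real (k + I + J)"
      by (simp add: lam_def dimr_def bb_def gg_def add_divide_distrib)
    have 2: "bb + real I + (gg + real J) = ?q + 1" by simp
    have "Gamma (?q + 1) > 0" using q by (intro Gamma_real_pos) simp
    moreover have "Gamma (lam + 1 + real (k + I + J)) = Gamma (lam + 1) * pochhammer (lam + 1) (k + I + J)"
      by (rule Gamma_add_nat) (use lam_pos in simp)
    moreover have "Gamma (bb + real I) = Gamma bb * pochhammer bb I" by (rule Gamma_add_nat[OF bb_pos])
    moreover have "Gamma (gg + real J) = Gamma gg * pochhammer gg J" by (rule Gamma_add_nat[OF gg_pos])
    ultimately show ?thesis unfolding 1 Beta_def 2 kap_def K0_def by (simp add: mult_ac)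
  qed
  finally show ?thesis .
qed

lemma emeasure_mu: "emeasure mu UNIV = ennreal K0"
  using nn_moment[of 0 0 0 0] by (simp add: kap_def)

sublocale mu: finite_measure mu
  by standard (simp add: emeasure_mu)

lemma integrable_mu_bounded:
  assumes "f \<in> borel_measurable borel" "\<And>z. z \<in> LL a b c \<Longrightarrow> \<bar>f z\<bar> \<le> B"
  shows "integrable mu (f :: 'd pt \<Rightarrow> real)"
  by (rule mu.integrable_const_bound[of _ B]) (use assms AE_mu in auto)

lemma polys_measurable: "P \<in> polys n \<Longrightarrow> (P :: 'd pt \<Rightarrow> real) \<in> borel_measurable borel"
  by (rule borel_measurable_continuous_onI) (rule polys_continuous_on)

lemma continuous_on_LL_bound:
  assumes "continuous_on (LL a b c) (f :: 'd pt \<Rightarrow> real)"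
  shows "\<exists>B. \<forall>z\<in>LL a b c. \<bar>f z\<bar> \<le> B"
proof -
  have "bounded (f ` LL a b c)" using assms LL_compact compact_continuous_image compact_imp_bounded by blast
  then show ?thesis unfolding bounded_iff by auto
qed

lemma integrable_polys: "P \<in> polys n \<Longrightarrow> integrable mu (P :: 'd pt \<Rightarrow> real)"
proof -
  assume P: "P \<in> polys n"
  obtain B where "\<forall>z\<in>LL a b c. \<bar>P z\<bar> \<le> B" using continuous_on_LL_bound[OF polys_continuous_on[OF P]] by blast
  then show ?thesis by (intro integrable_mu_bounded[of _ B] polys_measurable[OF P]) auto
qed

lemma polysE_D: "P \<in> polysE n \<Longrightarrow> P \<in> polys n"
  by (simp add: polysE_iff)

lemma integrable_polysE: "P \<in> polysE n \<Longrightarrow> integrable mu (P :: 'd pt \<Rightarrow> real)"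
  by (rule integrable_polys[OF polysE_D])

lemma polysE_measurable: "P \<in> polysE n \<Longrightarrow> (P :: 'd pt \<Rightarrow> real) \<in> borel_measurable borel"
  by (rule polys_measurable[OF polysE_D])

text \<open>These functions are the natural test family: lifted monomials are sums of them, their
  moments are explicit, and polarisation in \<open>u\<close> recovers all even polynomials.\<close>

definition ridge :: "real ^ 'd \<Rightarrow> nat \<Rightarrow> nat \<Rightarrow> nat \<Rightarrow> 'd pt \<Rightarrow> real" where
  "ridge u p i j z = (fst z \<bullet> u) ^ p * tau z ^ i * vv z ^ j"

lemma ridge_polysE: "ridge u p i j \<in> polysE (p + 2 * i + 2 * j)"
proof -
  have "(\<lambda>z. (fst z \<bullet> u) ^ p * tau z ^ i * vv z ^ j) \<in> polysE (p * 1 + i * 2 + j * 2)"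
    by (intro polysE_mult polysE_power polysE_inner tau_polysE vv_polysE)
  then show ?thesis by (simp add: ridge_def[abs_def] mult.commute)
qed

text \<open>Invariance under reflection of x, which makes the moments of odd degree in x
  vanish.\<close>

lemma distr_mu_uminus: "distr mu borel (\<lambda>z. (- fst z, snd z)) = mu"
proof -
  let ?h = "\<lambda>z :: 'd pt. (- fst z, snd z)"
  have hm [measurable]: "?h \<in> borel \<rightarrow>\<^sub>M borel"
    by (rule borel_measurable_continuous_onI) (intro continuous_on_Pair continuous_on_minus continuous_on_fst continuous_on_snd continuous_on_id)
  have swap: "(\<integral>\<^sup>+z. F (?h z) \<partial>lborel) = (\<integral>\<^sup>+z. F z \<partial>lborel)" if [measurable]: "F \<in> borel_measurable borel" for F :: "'d pt \<Rightarrow> ennreal"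
  proof -
    have [measurable]: "F \<in> borel_measurable (lborel \<Otimes>\<^sub>M lborel)" by (simp add: lborel_prod)
    have "(\<integral>\<^sup>+z. F z \<partial>lborel) = (\<integral>\<^sup>+t. \<integral>\<^sup>+x. F (x, t) \<partial>lborel \<partial>lborel)"
      by (subst lborel_pair.nn_integral_snd) (auto simp: lborel_prod)
    also have "\<dots> = (\<integral>\<^sup>+t. \<integral>\<^sup>+x. F (- x, t) \<partial>lborel \<partial>lborel)"
    proof (rule nn_integral_cong)
      fix t :: real
      have lm: "(lborel :: (real ^ 'd) measure) = distr lborel borel uminus"
        using lborel_affine[of "-1" "0 :: real ^ 'd"] by (simp add: density_1)
      have "(\<integral>\<^sup>+x. F (x, t) \<partial>lborel) = (\<integral>\<^sup>+x. F (x, t) \<partial>distr (lborel :: (real ^ 'd) measure) borel uminus)"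
        using lm by simp
      also have "\<dots> = (\<integral>\<^sup>+x. F (- x, t) \<partial>lborel)" by (subst nn_integral_distr) auto
      finally show "(\<integral>\<^sup>+x. F (x, t) \<partial>lborel) = (\<integral>\<^sup>+x. F (- x, t) \<partial>lborel)" .
    qed
    also have "\<dots> = (\<integral>\<^sup>+z. F (?h z) \<partial>lborel)"
    proof -
      have "(\<lambda>z. F (?h z)) \<in> borel_measurable (lborel \<Otimes>\<^sub>M lborel)" unfolding lborel_prod by measurable
      from lborel_pair.nn_integral_snd[OF this] show ?thesis by (simp add: lborel_prod)
    qed
    finally show ?thesis by simp
  qed
  have t: "tau (?h z) = tau z" "vv (?h z) = vv z" for z by (simp_all add: tau_def vv_def)
  have "emeasure (distr mu borel ?h) A = emeasure mu A" if A: "A \<in> sets borel" for A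
  proof -
    have [measurable]: "A \<in> sets borel" by (rule A)
    have "emeasure (distr mu borel ?h) A = emeasure mu (?h -` A)" using A by (subst emeasure_distr) auto
    also have "\<dots> = (\<integral>\<^sup>+z. indicator A (?h z) \<partial>mu)"
    proof -
      have "?h -` A \<in> sets mu" using measurable_sets_borel[OF hm A] by simp
      moreover have "(\<integral>\<^sup>+z. indicator A (?h z) \<partial>mu) = (\<integral>\<^sup>+z. indicator (?h -` A) z \<partial>mu)"
        by (rule nn_integral_cong) (simp add: indicator_def)
      ultimately show ?thesis by simp
    qed
    also have "\<dots> = (\<integral>\<^sup>+z. ennreal (indicator (LL a b c) (?h z) * WW a b c \<beta> \<gamma> (?h z)) * indicator A (?h z) \<partial>lborel)"
      by (subst nn_integral_mu) (auto simp: WW_eq t mem_LL indicator_def)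
    also have "\<dots> = (\<integral>\<^sup>+z. ennreal (indicator (LL a b c) z * WW a b c \<beta> \<gamma> z) * indicator A z \<partial>lborel)"
      by (rule swap) measurable
    also have "\<dots> = emeasure mu A" using A by (subst nn_integral_mu[symmetric]) auto
    finally show ?thesis .
  qed
  then show ?thesis by (intro measure_eqI) auto
qed

lemma integral_ridge:
  "(\<integral>z. ridge w n I J z \<partial>mu) = (if even n then kap (n div 2) I J * pochhammer (1/2) (n div 2) * norm w ^ n else 0)"
proof (cases "even n")
  case True
  then obtain k where n: "n = 2 * k" by blast
  have [measurable]: "ridge w n I J \<in> borel_measurable borel" by (rule polysE_measurable[OF ridge_polysE])
  have e: "ridge w n I J z = (fst z \<bullet> w) ^ (2 * k) * (tau z ^ I * vv z ^ J)" for z by (simp add: ridge_def n)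
  have "AE z in mu. 0 \<le> ridge w n I J z"
    using AE_mu by eventually_elim (use LL_bounds in \<open>auto simp: e power_mult intro!: mult_nonneg_nonneg\<close>)
  then have "(\<integral>z. ridge w n I J z \<partial>mu) = enn2real (\<integral>\<^sup>+z. ennreal (ridge w n I J z) \<partial>mu)"
    by (intro integral_eq_nn_integral) auto
  also have "\<dots> = kap k I J * pochhammer (1/2) k * norm w ^ (2 * k)"
    unfolding e nn_moment using K0_pos bb_pos gg_pos lam_pos unfolding kap_def
    by (intro enn2real_ennreal mult_nonneg_nonneg divide_nonneg_nonneg pochhammer_nonneg) auto
  finally show ?thesis using n by simp
next
  case False
  have [measurable]: "ridge w n I J \<in> borel_measurable borel" by (rule polysE_measurable[OF ridge_polysE])
  have "(\<integral>z. ridge w n I J z \<partial>mu) = (\<integral>z. ridge w n I J z \<partial>distr mu borel (\<lambda>z. (- fst z, snd z)))" unfolding distr_mu_uminus ..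
  also have "\<dots> = (\<integral>z. ridge w n I J (- fst z, snd z) \<partial>mu)" by (rule integral_distr) auto
  also have "\<dots> = (\<integral>z. - ridge w n I J z \<partial>mu)"
    using False by (intro Bochner_Integration.integral_cong) (auto simp: ridge_def tau_def vv_def)
  also have "\<dots> = - (\<integral>z. ridge w n I J z \<partial>mu)" by simp
  finally show ?thesis using False by simp
qed

text \<open>Polarisation: the moment for the direction s u + u' is a polynomial in s, and comparing
  coefficients of s^p with those of |s u + u'|^n isolates the mixed moment.\<close>

lemma integral_ridge2:
  "(\<integral>z. ridge u p i j z * ridge u' p' i' j' z \<partial>mu) =
     kap ((p + p') div 2) (i + i') (j + j') * xmom (u \<bullet> u) (u \<bullet> u') (u' \<bullet> u') p p'"
proof -
  define n where "n = p + p'"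
  define I where "I = i + i'"
  define J where "J = j + j'"
  define N where "N q = (\<integral>z. (fst z \<bullet> u) ^ q * (fst z \<bullet> u') ^ (n - q) * (tau z ^ I * vv z ^ J) \<partial>mu)" for q
  have int: "integrable mu (\<lambda>z. (fst z \<bullet> u) ^ q * (fst z \<bullet> u') ^ q' * (tau z ^ I * vv z ^ J))" for q q'
  proof -
    have "(\<lambda>z. (fst z \<bullet> u) ^ q * (fst z \<bullet> u') ^ q' * (tau z ^ I * vv z ^ J)) \<in> polysE (q * 1 + q' * 1 + (I * 2 + J * 2))"
      by (intro polysE_mult polysE_power polysE_inner tau_polysE vv_polysE)
    then show ?thesis by (rule integrable_polysE)
  qed
  have L: "(\<integral>z. ridge (s *\<^sub>R u + u') n I J z \<partial>mu) = (\<Sum>q\<le>n. (real (n choose q) * N q) * s ^ q)" for s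
  proof -
    have "ridge (s *\<^sub>R u + u') n I J z = (\<Sum>q\<le>n. (real (n choose q) * s ^ q) * ((fst z \<bullet> u) ^ q * (fst z \<bullet> u') ^ (n - q) * (tau z ^ I * vv z ^ J)))" for z
      unfolding ridge_def inner_add_right inner_scaleR_right binomial_ring sum_distrib_right
      by (intro sum.cong refl) (simp add: power_mult_distrib mult_ac)
    then have "(\<integral>z. ridge (s *\<^sub>R u + u') n I J z \<partial>mu) = (\<Sum>q\<le>n. (real (n choose q) * s ^ q) * N q)"
      unfolding N_def by (simp only:) (subst Bochner_Integration.integral_sum, auto intro!: int integrable_mult_right)
    then show ?thesis by (simp add: mult_ac)
  qed
  have main: "N p = kap (n div 2) I J * xmom (u \<bullet> u) (u \<bullet> u') (u' \<bullet> u') p p'"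
  proof (cases "even n")
    case True
    then obtain k where k: "n = 2 * k" by blast
    let ?P = "[:u' \<bullet> u', 2 * (u \<bullet> u'), u \<bullet> u:] ^ k"
    let ?c = "kap k I J * pochhammer (1/2) k"
    have "degree ?P \<le> n" unfolding k by (rule order_trans[OF degree_power_le]) (simp add: degree_pCons_eq_if)
    then have alt: "poly ?P s = (\<Sum>q\<le>n. coeff ?P q * s ^ q)" for s
      unfolding poly_altdef by (intro sum.mono_neutral_left) (auto simp: coeff_eq_0)
    have "(\<Sum>q\<le>n. (real (n choose q) * N q) * s ^ q) = (\<Sum>q\<le>n. (?c * coeff ?P q) * s ^ q)" for s
    proof -
      have nn: "norm (s *\<^sub>R u + u') ^ n = poly ?P s"
        unfolding k power_mult power2_norm_eq_inner
        by (simp add: inner_add_left inner_add_right inner_commute algebra_simps)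
      have "(\<Sum>q\<le>n. (real (n choose q) * N q) * s ^ q) = ?c * norm (s *\<^sub>R u + u') ^ n"
        unfolding L[symmetric] integral_ridge using k by simp
      also have "\<dots> = (\<Sum>q\<le>n. (?c * coeff ?P q) * s ^ q)"
        unfolding nn alt sum_distrib_left by (simp only: mult.assoc)
      finally show ?thesis .
    qed
    from sum_poly_coeffs_eq[OF this, of p] have "real (n choose p) * N p = ?c * coeff ?P p" unfolding n_def by simp
    moreover have "real (n choose p) > 0" unfolding n_def by simp
    ultimately have "N p = ?c * coeff ?P p / real (n choose p)" by (simp add: field_simps)
    then show ?thesis using k unfolding xmom_def n_def[symmetric] by simp
  next
    case False
    have "(\<Sum>q\<le>n. (real (n choose q) * N q) * s ^ q) = (\<Sum>q\<le>n. 0 * s ^ q)" for s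
      unfolding L[symmetric] integral_ridge using False by simp
    from sum_poly_coeffs_eq[OF this, of p] have "N p = 0" unfolding n_def by simp
    then show ?thesis using False unfolding xmom_def n_def by simp
  qed
  have "(\<integral>z. ridge u p i j z * ridge u' p' i' j' z \<partial>mu) = N p"
    unfolding N_def n_def I_def J_def ridge_def by (intro Bochner_Integration.integral_cong) (auto simp: power_add)
  then show ?thesis using main by (simp add: n_def I_def J_def)
qed

end

section \<open>Orthogonality of the Gegenbauer kernels\<close>

text \<open>The operator 4 (Y d^2/dY^2 + b d/dY) sends Y^i to 4 i (i + b - 1) Y^(i-1). The
  recurrence says that it fixes the series with coefficients \<open>wcoef b i\<close>, a Bessel-type
  equation.\<close>

lemma wcoef_Suc: "b > 0 \<Longrightarrow> 4 * real (Suc i) * (real (Suc i) + b - 1) * wcoef b (Suc i) = wcoef b i"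
proof -
  assume b: "b > 0"
  have p: "pochhammer b i > 0" "b + real i > 0" using b by (auto intro: pochhammer_pos add_pos_nonneg)
  have f: "fact (2 * Suc i) = (2 * real i + 2) * (2 * real i + 1) * (fact (2 * i) :: real)"
    by (simp add: algebra_simps)
  have "wcoef b (Suc i) = pochhammer (1/2) i * (1/2 + real i) / (pochhammer b i * (b + real i) * ((2 * real i + 2) * (2 * real i + 1) * fact (2 * i)))"
    unfolding wcoef_def f pochhammer_Suc by simp
  also have "\<dots> = (pochhammer (1/2) i / (pochhammer b i * fact (2 * i))) * (1 / (4 * (real i + 1) * (b + real i)))"
  proof -
    have "A * (1/2 + r) / (P * B * ((2 * r + 2) * (2 * r + 1) * F)) = (A / (P * F)) * (1 / (4 * (r + 1) * B))" if "r \<ge> 0" for A P B F r :: real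
    proof -
      have "(2 * r + 2) * (2 * r + 1) = 4 * (r + 1) * (1/2 + r)" by (simp add: algebra_simps)
      moreover have "1/2 + r \<noteq> 0" using that by simp
      ultimately show ?thesis by simp
    qed
    then show ?thesis by simp
  qed
  finally have "wcoef b (Suc i) = wcoef b i * (1 / (4 * (real i + 1) * (b + real i)))" by (simp add: wcoef_def)
  moreover have "4 * real (Suc i) * (real (Suc i) + b - 1) = 4 * (real i + 1) * (b + real i)" by (simp add: algebra_simps)
  moreover have "4 * (real i + 1) * (b + real i) \<noteq> 0" using p by simp
  ultimately show ?thesis by simp
qed

text \<open>This and its two companions for i and j say that the Laplacian in x and the Bessel-type
  operators in \<open>tau\<close> and \<open>vv\<close> each send the lifted m-th power to m (m - 1)
  times the lifted power m - 2, multiplied by |x|^2, \<open>tau\<close> or \<open>vv\<close> of the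
  other point.\<close>

lemma tcoef_p:
  assumes "2 * i + 2 * j \<le> m"
  shows "real (m - 2 * i - 2 * j) * (real (m - 2 * i - 2 * j) - 1) * tcoef b g m i j = real m * (real m - 1) * tcoef b g (m - 2) i j"
proof (cases "2 * i + 2 * j + 2 \<le> m")
  case False
  then have q: "m - 2 * i - 2 * j = 0 \<or> m - 2 * i - 2 * j = 1" using assms by auto
  show ?thesis
  proof (cases "m \<ge> 2")
    case True
    then have "tcoef b g (m - 2) i j = 0" using False by (simp add: tcoef_def)
    then show ?thesis using q by auto
  next
    case m: False
    then have "m = 0 \<or> m = 1" by auto
    then show ?thesis using q by auto
  qed
next
  case True
  define p where "p = m - 2 - 2 * i - 2 * j"
  have 1: "m - 2 * i - 2 * j = Suc (Suc p)" using True by (simp add: p_def)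
  obtain l where l: "m = Suc (Suc l)" using True by (metis add_2_eq_Suc' le_Suc_ex add.commute add_Suc_right)
  have 2: "2 * i + 2 * j \<le> l" using True l by simp
  have 3: "l - 2 * i - 2 * j = p" using l by (simp add: p_def)
  have f1: "fact m = real m * (real m - 1) * fact l" unfolding l by (simp add: algebra_simps)
  have f2: "fact (Suc (Suc p)) = real (Suc (Suc p)) * (real (Suc (Suc p)) - 1) * (fact p :: real)" by (simp add: algebra_simps)
  have n: "real (Suc (Suc p)) * (real (Suc (Suc p)) - 1) \<noteq> 0" by simp
  have "tcoef b g m i j = fact m / fact (Suc (Suc p)) * wcoef b i * wcoef g j" unfolding tcoef_def using assms 1 by simp
  moreover have "tcoef b g (m - 2) i j = fact l / fact p * wcoef b i * wcoef g j" unfolding tcoef_def using 2 3 l by simp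
  ultimately show ?thesis unfolding 1 f1 f2 using n by simp
qed

lemma tcoef_i: "b > 0 \<Longrightarrow> 4 * real (Suc i) * (real (Suc i) + b - 1) * tcoef b g m (Suc i) j = real m * (real m - 1) * tcoef b g (m - 2) i j"
proof (cases "2 * i + 2 * j + 2 \<le> m")
  case False
  then have "tcoef b g m (Suc i) j = 0" by (simp add: tcoef_def)
  moreover have "real m * (real m - 1) * tcoef b g (m - 2) i j = 0"
    using False by (cases "m \<ge> 2") (auto simp: tcoef_def not_le less_Suc_eq numeral_2_eq_2)
  ultimately show ?thesis by simp
next
  assume b: "b > 0"
  case True
  obtain l where l: "m = Suc (Suc l)" using True by (metis add_2_eq_Suc' le_Suc_ex add.commute add_Suc_right)
  have 2: "2 * i + 2 * j \<le> l" using True l by simp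
  have 3: "m - 2 * Suc i - 2 * j = l - 2 * i - 2 * j" using l by simp
  have f1: "fact m = real m * (real m - 1) * fact l" unfolding l by (simp add: algebra_simps)
  have "4 * real (Suc i) * (real (Suc i) + b - 1) * tcoef b g m (Suc i) j = fact m / fact (l - 2 * i - 2 * j) * (4 * real (Suc i) * (real (Suc i) + b - 1) * wcoef b (Suc i)) * wcoef g j"
    unfolding tcoef_def 3 using True by simp
  also have "\<dots> = real m * (real m - 1) * tcoef b g (m - 2) i j"
    unfolding wcoef_Suc[OF b] f1 tcoef_def using 2 l by simp
  finally show ?thesis .
qed

lemma tcoef_swap: "tcoef b g m i j = tcoef g b m j i"
  by (simp add: tcoef_def add.commute mult_ac diff_diff_eq)

lemma tcoef_j: "g > 0 \<Longrightarrow> 4 * real (Suc j) * (real (Suc j) + g - 1) * tcoef b g m i (Suc j) = real m * (real m - 1) * tcoef b g (m - 2) i j"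
  using tcoef_i[of g j b m i] by (simp add: tcoef_swap[of b g])

context hyperboloid
begin

text \<open>Lowering any one of the three indices yields the same factor \<open>lam\<close> plus
  total degree; this is what lets the three second-order parts be added.\<close>

lemma kap_x: "k \<ge> 1 \<Longrightarrow> kap (k - 1) I J = kap k I J * (lam + real (k + I + J))"
proof -
  assume "k \<ge> 1"
  then obtain l where l: "k = Suc l" by (cases k) auto
  have "lam + 1 + real (l + I + J) \<noteq> 0" using lam_pos by (simp add: add_pos_nonneg less_imp_neq[symmetric])
  then show ?thesis unfolding l kap_def by (simp add: pochhammer_Suc add_ac)
qed

lemma kap_i: "I \<ge> 1 \<Longrightarrow> kap k (I - 1) J * (bb + real I - 1) = kap k I J * (lam + real (k + I + J))"
proof -
  assume "I \<ge> 1"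
  then obtain l where l: "I = Suc l" by (cases I) auto
  have "lam + 1 + real (k + l + J) \<noteq> 0" using lam_pos by (simp add: add_pos_nonneg less_imp_neq[symmetric])
  then show ?thesis unfolding l kap_def by (simp add: pochhammer_Suc add_ac)
qed

lemma kap_j: "J \<ge> 1 \<Longrightarrow> kap k I (J - 1) * (gg + real J - 1) = kap k I J * (lam + real (k + I + J))"
proof -
  assume "J \<ge> 1"
  then obtain l where l: "J = Suc l" by (cases J) auto
  have "lam + 1 + real (k + I + l) \<noteq> 0" using lam_pos by (simp add: add_pos_nonneg less_imp_neq[symmetric])
  then show ?thesis unfolding l kap_def by (simp add: pochhammer_Suc add_ac)
qed

text \<open>The inner product of two ridge functions in the closed form of
  \<open>integral_ridge2\<close>. Symmetry of the differential operator thereby becomes an algebraic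
  identity, with no boundary terms to discuss.\<close>

definition Mom :: "real ^ 'd \<Rightarrow> real ^ 'd \<Rightarrow> nat \<Rightarrow> nat \<Rightarrow> nat \<Rightarrow> nat \<Rightarrow> nat \<Rightarrow> nat \<Rightarrow> real" where
  "Mom u u' p i j p' i' j' = kap ((p + p') div 2) (i + i') (j + j') * xmom (u \<bullet> u) (u \<bullet> u') (u' \<bullet> u') p p'"

text \<open>Symmetry of the second-order operator whose eigenvalues are \<open>-n(n + 2 lam)\<close>, tested on ridge monomials.\<close>

lemma Mom_adjoint:
  defines "m \<equiv> \<lambda>p i j :: nat. real p + 2 * real i + 2 * real j"
  shows "real p * (real p - 1) * (u \<bullet> u) * Mom u u' (p - 2) i j p' i' j'
      + 4 * real i * (real i + bb - 1) * Mom u u' p (i - 1) j p' i' j'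
      + 4 * real j * (real j + gg - 1) * Mom u u' p i (j - 1) p' i' j'
      - m p i j * (m p i j + 2 * lam) * Mom u u' p i j p' i' j'
    = real p' * (real p' - 1) * (u' \<bullet> u') * Mom u u' p i j (p' - 2) i' j'
      + 4 * real i' * (real i' + bb - 1) * Mom u u' p i j p' (i' - 1) j'
      + 4 * real j' * (real j' + gg - 1) * Mom u u' p i j p' i' (j' - 1)
      - m p' i' j' * (m p' i' j' + 2 * lam) * Mom u u' p i j p' i' j'"
proof -
  let ?U = "u \<bullet> u" and ?V = "u \<bullet> u'" and ?W = "u' \<bullet> u'"
  define k where "k = (p + p') div 2"
  define I where "I = i + i'"
  define J where "J = j + j'"
  define X where "X = xmom ?U ?V ?W p p'"
  \<comment> \<open>Each second-order part, minus its mirror image, is a multiple of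
    \<open>L\<close>: 2 (p - p'), 4 (i - i') and 4 (j - j') times. They add up to twice the
    difference of the degrees, as do the zero-order terms, because for even p + p' the two degrees
    sum to 2 (k + I + J); for odd p + p' the factor \<open>X\<close> is 0.\<close>
  define L where "L = kap k I J * X * (lam + real (k + I + J))"
  have P: "real p * (real p - 1) * ?U * Mom u u' (p - 2) i j p' i' j' - real p' * (real p' - 1) * ?W * Mom u u' p i j (p' - 2) i' j' = 2 * (real p - real p') * L"
  proof (cases "k \<ge> 1")
    case True
    have 1: "real p * (real p - 1) * ?U * Mom u u' (p - 2) i j p' i' j' = kap (k - 1) I J * (real p * (real p - 1) * ?U * xmom ?U ?V ?W (p - 2) p')"
    proof (cases "p \<ge> 2")
      case True
      then have "(p - 2 + p') div 2 = k - 1" unfolding k_def by (simp add: div_le_mono)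
      then show ?thesis by (simp add: Mom_def I_def J_def)
    next
      case False
      then have "p = 0 \<or> p = 1" by auto
      then show ?thesis by auto
    qed
    have 2: "real p' * (real p' - 1) * ?W * Mom u u' p i j (p' - 2) i' j' = kap (k - 1) I J * (real p' * (real p' - 1) * ?W * xmom ?U ?V ?W p (p' - 2))"
    proof (cases "p' \<ge> 2")
      case True
      then have "(p + (p' - 2)) div 2 = k - 1" unfolding k_def by (simp add: div_le_mono)
      then show ?thesis by (simp add: Mom_def I_def J_def)
    next
      case False
      then have "p' = 0 \<or> p' = 1" by auto
      then show ?thesis by auto
    qed
    show ?thesis unfolding 1 2 right_diff_distrib[symmetric] xmom_antisym[symmetric] kap_x[OF True] L_def X_def by simp
  next
    case False
    then have "p + p' < 2" unfolding k_def by simp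
    then have "p = 0 \<and> p' = 0 \<or> p + p' = 1" by auto
    then show ?thesis
    proof
      assume "p + p' = 1"
      then have "X = 0" "p = 0 \<or> p = 1" "p' = 0 \<or> p' = 1" unfolding X_def xmom_def by auto
      then show ?thesis by (auto simp: L_def)
    qed auto
  qed
  have Ii: "4 * real i * (real i + bb - 1) * Mom u u' p (i - 1) j p' i' j' - 4 * real i' * (real i' + bb - 1) * Mom u u' p i j p' (i' - 1) j' = 4 * (real i - real i') * L"
  proof (cases "I \<ge> 1")
    case True
    have 1: "real i * Mom u u' p (i - 1) j p' i' j' = real i * (kap k (I - 1) J * X)"
      unfolding Mom_def k_def I_def J_def X_def by (cases i) auto
    have 2: "real i' * Mom u u' p i j p' (i' - 1) j' = real i' * (kap k (I - 1) J * X)"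
      unfolding Mom_def k_def I_def J_def X_def by (cases i') auto
    have "4 * real i * (real i + bb - 1) * Mom u u' p (i - 1) j p' i' j' - 4 * real i' * (real i' + bb - 1) * Mom u u' p i j p' (i' - 1) j'
      = 4 * (real i + bb - 1) * (real i * Mom u u' p (i - 1) j p' i' j') - 4 * (real i' + bb - 1) * (real i' * Mom u u' p i j p' (i' - 1) j')" by (simp only: mult_ac)
    also have "\<dots> = 4 * (real i - real i') * (kap k (I - 1) J * (bb + real I - 1)) * X"
      unfolding 1 2 I_def by (simp add: algebra_simps)
    also have "\<dots> = 4 * (real i - real i') * L" unfolding kap_i[OF True] L_def by simp
    finally show ?thesis .
  next
    case False
    then have "i = 0" "i' = 0" unfolding I_def by auto
    then show ?thesis by simp
  qed
  have Jj: "4 * real j * (real j + gg - 1) * Mom u u' p i (j - 1) p' i' j' - 4 * real j' * (real j' + gg - 1) * Mom u u' p i j p' i' (j' - 1) = 4 * (real j - real j') * L"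
  proof (cases "J \<ge> 1")
    case True
    have 1: "real j * Mom u u' p i (j - 1) p' i' j' = real j * (kap k I (J - 1) * X)"
      unfolding Mom_def k_def I_def J_def X_def by (cases j) auto
    have 2: "real j' * Mom u u' p i j p' i' (j' - 1) = real j' * (kap k I (J - 1) * X)"
      unfolding Mom_def k_def I_def J_def X_def by (cases j') auto
    have "4 * real j * (real j + gg - 1) * Mom u u' p i (j - 1) p' i' j' - 4 * real j' * (real j' + gg - 1) * Mom u u' p i j p' i' (j' - 1)
      = 4 * (real j + gg - 1) * (real j * Mom u u' p i (j - 1) p' i' j') - 4 * (real j' + gg - 1) * (real j' * Mom u u' p i j p' i' (j' - 1))" by (simp only: mult_ac)
    also have "\<dots> = 4 * (real j - real j') * (kap k I (J - 1) * (gg + real J - 1)) * X"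
      unfolding 1 2 J_def by (simp add: algebra_simps)
    also have "\<dots> = 4 * (real j - real j') * L" unfolding kap_j[OF True] L_def by simp
    finally show ?thesis .
  next
    case False
    then have "j = 0" "j' = 0" unfolding J_def by auto
    then show ?thesis by simp
  qed
  have M: "Mom u u' p i j p' i' j' = kap k I J * X" by (simp add: Mom_def k_def I_def J_def X_def)
  have E: "m p i j * (m p i j + 2 * lam) * (kap k I J * X) - m p' i' j' * (m p' i' j' + 2 * lam) * (kap k I J * X) = 2 * (m p i j - m p' i' j') * L"
  proof (cases "even (p + p')")
    case True
    then have "2 * real k = real p + real p'" unfolding k_def using real_of_nat_div[of 2 "p + p'"] by (simp add: real_of_nat_div)
    then have s: "m p i j + m p' i' j' = 2 * real (k + I + J)" unfolding m_def I_def J_def by simp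
    have "m p i j * (m p i j + 2 * lam) - m p' i' j' * (m p' i' j' + 2 * lam) = (m p i j - m p' i' j') * (m p i j + m p' i' j' + 2 * lam)"
      by (simp add: algebra_simps)
    also have "\<dots> = 2 * (m p i j - m p' i' j') * (lam + real (k + I + J))" unfolding s by (simp add: algebra_simps)
    finally show ?thesis unfolding L_def by (simp only: left_diff_distrib[symmetric]) (simp only: mult_ac)
  next
    case False
    then have "X = 0" unfolding X_def xmom_def by simp
    then show ?thesis by (simp add: L_def)
  qed
  have "2 * (m p i j - m p' i' j') * L = 2 * (real p - real p') * L + 4 * (real i - real i') * L + 4 * (real j - real j') * L"
    unfolding m_def by (simp add: algebra_simps)
  then show ?thesis unfolding M using P Ii Jj E by linarith
qed

definition ker :: "real poly \<Rightarrow> 'd pt \<Rightarrow> 'd pt \<Rightarrow> real" where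
  "ker k z z' = Phi bb gg k (fst z \<bullet> fst z') (tau z * tau z') (vv z * vv z')"

lemma ker_monom:
  assumes "m \<le> N"
  shows "ker (monom 1 m) z z' = (\<Sum>i\<le>N. \<Sum>j\<le>N. (tcoef bb gg m i j * tau z ^ i * vv z ^ j) * ridge (fst z) (m - 2 * i - 2 * j) i j z')"
  unfolding ker_def Phi_monom[OF assms] ridge_def
  by (intro sum.cong refl) (simp add: power_mult_distrib inner_commute mult_ac)

lemma ridge2_integrable: "integrable mu (\<lambda>z'. ridge u p i j z' * ridge u' p' i' j' z')"
  by (rule integrable_polysE[OF polysE_mult[OF ridge_polysE ridge_polysE]])

lemma integral_ker_monom_ridge:
  assumes "m \<le> N"
  shows "(\<integral>z'. ker (monom 1 m) z z' * ridge u' p' i' j' z' \<partial>mu)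
    = (\<Sum>i\<le>N. \<Sum>j\<le>N. (tcoef bb gg m i j * tau z ^ i * vv z ^ j) * Mom (fst z) u' (m - 2 * i - 2 * j) i j p' i' j')"
proof -
  have "(\<integral>z'. ker (monom 1 m) z z' * ridge u' p' i' j' z' \<partial>mu)
    = (\<integral>z'. (\<Sum>i\<le>N. \<Sum>j\<le>N. (tcoef bb gg m i j * tau z ^ i * vv z ^ j) * (ridge (fst z) (m - 2 * i - 2 * j) i j z' * ridge u' p' i' j' z')) \<partial>mu)"
    unfolding ker_monom[OF assms] sum_distrib_right by (simp only: mult.assoc)
  also have "\<dots> = (\<Sum>i\<le>N. \<Sum>j\<le>N. (tcoef bb gg m i j * tau z ^ i * vv z ^ j) * (\<integral>z'. ridge (fst z) (m - 2 * i - 2 * j) i j z' * ridge u' p' i' j' z' \<partial>mu))"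
    by (simp add: Bochner_Integration.integral_sum ridge2_integrable)
  finally show ?thesis unfolding integral_ridge2 Mom_def .
qed

definition Sker :: "'d pt \<Rightarrow> real ^ 'd \<Rightarrow> nat \<Rightarrow> nat \<Rightarrow> nat \<Rightarrow> nat \<Rightarrow> real" where
  "Sker z u' m p' i' j' = (\<integral>z'. ker (monom 1 m) z z' * ridge u' p' i' j' z' \<partial>mu)"

text \<open>\<open>Mom_adjoint\<close> summed over the terms of the lifted power. On the kernel side
  the three second-order parts contribute the same quantity with factors |x|^2, \<open>tau z\<close>
  and \<open>vv z\<close>, whose sum is 1.\<close>

lemma Sker_adjoint:
  defines "e \<equiv> \<lambda>m::nat. real m * (real m + 2 * lam)"
  shows "real m * (real m - 1) * Sker z u' (m - 2) p' i' j' - e m * Sker z u' m p' i' j'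
    = real p' * (real p' - 1) * (u' \<bullet> u') * Sker z u' m (p' - 2) i' j'
      + 4 * real i' * (real i' + bb - 1) * Sker z u' m p' (i' - 1) j'
      + 4 * real j' * (real j' + gg - 1) * Sker z u' m p' i' (j' - 1)
      - e (p' + 2 * i' + 2 * j') * Sker z u' m p' i' j'"
proof -
  \<comment> \<open>One more than the lift needs, so that sums over i and j can be shifted by one;
    the extra terms are zero.\<close>
  define N where "N = Suc m"
  let ?u = "fst z"
  let ?q = "\<lambda>i j. m - 2 * i - 2 * j"
  define w where "w m i j = tcoef bb gg m i j * tau z ^ i * vv z ^ j" for m i j
  define M where "M p i j = Mom ?u u' p i j p' i' j'" for p i j
  have S: "Sker z u' l p'' i'' j'' = (\<Sum>i\<le>N. \<Sum>j\<le>N. w l i j * Mom ?u u' (l - 2 * i - 2 * j) i j p'' i'' j'')" if "l \<le> N" for l p'' i'' j''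
    unfolding Sker_def w_def by (rule integral_ker_monom_ridge[OF that])
  have lN: "m \<le> N" "m - 2 \<le> N" by (auto simp: N_def)
  have T1: "(\<Sum>i\<le>N. \<Sum>j\<le>N. w m i j * (real (?q i j) * (real (?q i j) - 1) * (?u \<bullet> ?u) * M (?q i j - 2) i j)) = (?u \<bullet> ?u) * (real m * (real m - 1) * Sker z u' (m - 2) p' i' j')"
  proof -
    have "w m i j * (real (?q i j) * (real (?q i j) - 1) * (?u \<bullet> ?u) * M (?q i j - 2) i j)
      = (?u \<bullet> ?u) * (real m * (real m - 1) * (w (m - 2) i j * Mom ?u u' (m - 2 - 2 * i - 2 * j) i j p' i' j'))" for i j
    proof (cases "2 * i + 2 * j \<le> m")
      case False
      then show ?thesis by (auto simp: w_def tcoef_def)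
    next
      case True
      have "?q i j - 2 = m - 2 - 2 * i - 2 * j" by simp
      then have "w m i j * (real (?q i j) * (real (?q i j) - 1) * (?u \<bullet> ?u) * M (?q i j - 2) i j)
        = (?u \<bullet> ?u) * tau z ^ i * vv z ^ j * (real (?q i j) * (real (?q i j) - 1) * tcoef bb gg m i j) * Mom ?u u' (m - 2 - 2 * i - 2 * j) i j p' i' j'"
        unfolding w_def M_def by (simp only: mult_ac)
      then show ?thesis unfolding tcoef_p[OF True] w_def by (simp only: mult_ac)
    qed
    then show ?thesis unfolding S[OF lN(2)] sum_distrib_left by (simp only:)
  qed
  have T2: "(\<Sum>i\<le>N. \<Sum>j\<le>N. w m i j * (4 * real i * (real i + bb - 1) * M (?q i j) (i - 1) j)) = tau z * (real m * (real m - 1) * Sker z u' (m - 2) p' i' j')"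
  proof -
    let ?f = "\<lambda>i j. real m * (real m - 1) * (w (m - 2) i j * Mom ?u u' (m - 2 - 2 * i - 2 * j) i j p' i' j')"
    have "(\<Sum>i\<le>N. \<Sum>j\<le>N. w m i j * (4 * real i * (real i + bb - 1) * M (?q i j) (i - 1) j))
      = (\<Sum>i\<le>m. \<Sum>j\<le>N. w m (Suc i) j * (4 * real (Suc i) * (real (Suc i) + bb - 1) * M (?q (Suc i) j) i j))"
      unfolding N_def by (subst sum.atMost_Suc_shift) simp
    also have "\<dots> = (\<Sum>i\<le>m. \<Sum>j\<le>N. tau z * ?f i j)"
    proof (intro sum.cong refl)
      fix i j
      have q: "?q (Suc i) j = m - 2 - 2 * i - 2 * j" by simp
      have "w m (Suc i) j * (4 * real (Suc i) * (real (Suc i) + bb - 1) * M (?q (Suc i) j) i j)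
        = tau z * tau z ^ i * vv z ^ j * (4 * real (Suc i) * (real (Suc i) + bb - 1) * tcoef bb gg m (Suc i) j) * Mom ?u u' (m - 2 - 2 * i - 2 * j) i j p' i' j'"
        unfolding w_def M_def q power_Suc by (simp only: mult_ac)
      then show "w m (Suc i) j * (4 * real (Suc i) * (real (Suc i) + bb - 1) * M (?q (Suc i) j) i j) = tau z * ?f i j"
        unfolding tcoef_i[OF bb_pos] w_def by (simp only: mult_ac)
    qed
    also have "\<dots> = (\<Sum>i\<le>N. \<Sum>j\<le>N. tau z * ?f i j)"
    proof -
      have "tcoef bb gg (m - 2) (Suc m) j = 0" for j by (auto simp: tcoef_def)
      then show ?thesis unfolding N_def by (simp add: w_def)
    qed
    finally show ?thesis unfolding S[OF lN(2)] sum_distrib_left .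
  qed
  have T3: "(\<Sum>i\<le>N. \<Sum>j\<le>N. w m i j * (4 * real j * (real j + gg - 1) * M (?q i j) i (j - 1))) = vv z * (real m * (real m - 1) * Sker z u' (m - 2) p' i' j')"
  proof -
    let ?f = "\<lambda>i j. real m * (real m - 1) * (w (m - 2) i j * Mom ?u u' (m - 2 - 2 * i - 2 * j) i j p' i' j')"
    have "(\<Sum>j\<le>N. w m i j * (4 * real j * (real j + gg - 1) * M (?q i j) i (j - 1))) = (\<Sum>j\<le>N. vv z * ?f i j)" for i
    proof -
      have "(\<Sum>j\<le>N. w m i j * (4 * real j * (real j + gg - 1) * M (?q i j) i (j - 1)))
        = (\<Sum>j\<le>m. w m i (Suc j) * (4 * real (Suc j) * (real (Suc j) + gg - 1) * M (?q i (Suc j)) i j))"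
        unfolding N_def by (subst sum.atMost_Suc_shift) simp
      also have "\<dots> = (\<Sum>j\<le>m. vv z * ?f i j)"
      proof (intro sum.cong refl)
        fix j
        have q: "?q i (Suc j) = m - 2 - 2 * i - 2 * j" by simp
        have "w m i (Suc j) * (4 * real (Suc j) * (real (Suc j) + gg - 1) * M (?q i (Suc j)) i j)
          = vv z * tau z ^ i * vv z ^ j * (4 * real (Suc j) * (real (Suc j) + gg - 1) * tcoef bb gg m i (Suc j)) * Mom ?u u' (m - 2 - 2 * i - 2 * j) i j p' i' j'"
          unfolding w_def M_def q power_Suc by (simp only: mult_ac)
        then show "w m i (Suc j) * (4 * real (Suc j) * (real (Suc j) + gg - 1) * M (?q i (Suc j)) i j) = vv z * ?f i j"
          unfolding tcoef_j[OF gg_pos] w_def by (simp only: mult_ac)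
      qed
      also have "\<dots> = (\<Sum>j\<le>N. vv z * ?f i j)"
      proof -
        have "tcoef bb gg (m - 2) i (Suc m) = 0" by (auto simp: tcoef_def)
        then show ?thesis unfolding N_def by (simp add: w_def)
      qed
      finally show ?thesis .
    qed
    then show ?thesis unfolding S[OF lN(2)] sum_distrib_left by (simp only:)
  qed
  have T4: "(\<Sum>i\<le>N. \<Sum>j\<le>N. w m i j * ((real (?q i j) + 2 * real i + 2 * real j) * (real (?q i j) + 2 * real i + 2 * real j + 2 * lam) * M (?q i j) i j)) = e m * Sker z u' m p' i' j'"
  proof -
    have "w m i j * ((real (?q i j) + 2 * real i + 2 * real j) * (real (?q i j) + 2 * real i + 2 * real j + 2 * lam) * M (?q i j) i j)
      = e m * (w m i j * Mom ?u u' (?q i j) i j p' i' j')" for i j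
    proof (cases "2 * i + 2 * j \<le> m")
      case False
      then show ?thesis by (simp add: w_def tcoef_def)
    next
      case True
      then have "real (?q i j) + 2 * real i + 2 * real j = real m" by simp
      then show ?thesis unfolding e_def M_def by (simp only: mult_ac)
    qed
    then show ?thesis unfolding S[OF lN(1)] sum_distrib_left by (simp only:)
  qed
  have one: "(?u \<bullet> ?u) + tau z + vv z = 1" using sum_coords[of z] by (simp add: power2_norm_eq_inner)
  have "real m * (real m - 1) * Sker z u' (m - 2) p' i' j' - e m * Sker z u' m p' i' j'
     = ((?u \<bullet> ?u) + tau z + vv z) * (real m * (real m - 1) * Sker z u' (m - 2) p' i' j') - e m * Sker z u' m p' i' j'"
    unfolding one by simp
  also have "\<dots> = (\<Sum>i\<le>N. \<Sum>j\<le>N. w m i j * (real (?q i j) * (real (?q i j) - 1) * (?u \<bullet> ?u) * M (?q i j - 2) i j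
       + 4 * real i * (real i + bb - 1) * M (?q i j) (i - 1) j + 4 * real j * (real j + gg - 1) * M (?q i j) i (j - 1)
       - (real (?q i j) + 2 * real i + 2 * real j) * (real (?q i j) + 2 * real i + 2 * real j + 2 * lam) * M (?q i j) i j))"
    unfolding distrib_right T1[symmetric] T2[symmetric] T3[symmetric] T4[symmetric] sum.distrib[symmetric] sum_subtractf[symmetric]
    by (simp only: distrib_left right_diff_distrib)
  also have "\<dots> = (\<Sum>i\<le>N. \<Sum>j\<le>N. w m i j * (real p' * (real p' - 1) * (u' \<bullet> u') * Mom ?u u' (?q i j) i j (p' - 2) i' j'
      + 4 * real i' * (real i' + bb - 1) * Mom ?u u' (?q i j) i j p' (i' - 1) j'
      + 4 * real j' * (real j' + gg - 1) * Mom ?u u' (?q i j) i j p' i' (j' - 1)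
      - (real p' + 2 * real i' + 2 * real j') * (real p' + 2 * real i' + 2 * real j' + 2 * lam) * Mom ?u u' (?q i j) i j p' i' j'))"
    unfolding M_def Mom_adjoint ..
  also have "\<dots> = real p' * (real p' - 1) * (u' \<bullet> u') * Sker z u' m (p' - 2) i' j'
      + 4 * real i' * (real i' + bb - 1) * Sker z u' m p' (i' - 1) j'
      + 4 * real j' * (real j' + gg - 1) * Sker z u' m p' i' (j' - 1)
      - e (p' + 2 * i' + 2 * j') * Sker z u' m p' i' j'"
    unfolding S[OF lN(1)] sum_distrib_left sum.distrib[symmetric] sum_subtractf[symmetric] e_def
    by (intro sum.cong refl) (simp add: algebra_simps)
  finally show ?thesis .
qed

lemma ker_eq_sum: "degree k \<le> N \<Longrightarrow> ker k z z' = (\<Sum>m\<le>N. coeff k m * ker (monom 1 m) z z')"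
  unfolding ker_def by (rule Phi_eq_sum)

lemma ker_monom_ridge_integrable: "integrable mu (\<lambda>z'. ker (monom 1 m) z z' * ridge u' p' i' j' z')"
  unfolding ker_monom[OF order_refl] sum_distrib_right mult.assoc
  by (intro Bochner_Integration.integrable_sum integrable_mult_right) (simp add: ridge2_integrable mult.assoc)

definition SZ :: "nat \<Rightarrow> 'd pt \<Rightarrow> real ^ 'd \<Rightarrow> nat \<Rightarrow> nat \<Rightarrow> nat \<Rightarrow> real" where
  "SZ n z u' p' i' j' = (\<integral>z'. ker (gegen lam n) z z' * ridge u' p' i' j' z' \<partial>mu)"

lemma SZ_eq: "SZ n z u' p' i' j' = (\<Sum>m\<le>n. coeff (gegen lam n) m * Sker z u' m p' i' j')"
  unfolding SZ_def ker_eq_sum[OF degree_gegen_le] Sker_def sum_distrib_right mult.assoc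
  by (simp add: Bochner_Integration.integral_sum ker_monom_ridge_integrable)

text \<open>The Gegenbauer equation (1 - x^2) y'' - (2 s + 1) x y' + n (n + 2 s) y = 0, read off at
  the power x^m.\<close>

lemma coeff_gegen_rec:
  "real (m + 2) * real (m + 1) * coeff (gegen s n) (m + 2) = (real m * (real m + 2 * s) - real n * (real n + 2 * s)) * coeff (gegen s n) m"
proof (cases "m + 2 \<le> n \<and> even (n - m)")
  case True
  then have "even (n - (m + 2))" by presburger
  then obtain k where "n - (m + 2) = 2 * k" by (blast elim: evenE)
  moreover have "m + 2 \<le> n" using True by blast
  ultimately have n: "n = (m + 2) + 2 * k" by linarith
  have n2: "n = m + 2 * Suc k" using n by simp
  have 1: "coeff (gegen s n) (m + 2) = (-1) ^ k * pochhammer s (m + 2 + k) * 2 ^ (m + 2) / (fact k * fact (m + 2))"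
    unfolding n by (rule coeff_gegen_add)
  have 2: "coeff (gegen s n) m = (-1) ^ Suc k * pochhammer s (m + Suc k) * 2 ^ m / (fact (Suc k) * fact m)"
    unfolding n2 by (rule coeff_gegen_add)
  have f: "fact (m + 2) = real (m + 2) * real (m + 1) * (fact m :: real)" by (simp add: algebra_simps)
  have p: "pochhammer s (m + 2 + k) = pochhammer s (m + Suc k) * (s + real (m + Suc k))"
  proof -
    have "m + 2 + k = Suc (m + Suc k)" by simp
    then show ?thesis by (simp only: pochhammer_Suc)
  qed
  have L: "real (m + 2) * real (m + 1) * coeff (gegen s n) (m + 2) = (-1) ^ k * pochhammer s (m + Suc k) * (s + real (m + Suc k)) * 4 * 2 ^ m / (fact k * fact m)"
  proof -
    have "M * (e * (P * E) * (T * 4) / (F * (M * G))) = e * P * E * 4 * T / (F * G)" if "M \<noteq> 0" for M e P E T F G :: real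
      using that by simp
    moreover have "(2::real) ^ (m + 2) = 2 ^ m * 4" by (simp add: power_add)
    moreover have "real (m + 2) * real (m + 1) \<noteq> 0" by simp
    ultimately show ?thesis unfolding 1 f p by presburger
  qed
  have q: "real m * (real m + 2 * s) - real n * (real n + 2 * s) = - (4 * real (Suc k) * (s + real (m + Suc k)))"
    unfolding n2 by (simp add: algebra_simps)
  have "(real m * (real m + 2 * s) - real n * (real n + 2 * s)) * coeff (gegen s n) m = (-1) ^ k * pochhammer s (m + Suc k) * (s + real (m + Suc k)) * 4 * 2 ^ m / (fact k * fact m)"
  proof -
    have "- (4 * K * E) * ((-1) ^ Suc k * P * T / ((K * F) * G)) = (-1) ^ k * P * E * 4 * T / (F * G)" if "K \<noteq> 0" for K E P T F G :: real
      using that by simp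
    moreover have "fact (Suc k) = real (Suc k) * (fact k :: real)" by simp
    moreover have "real (Suc k) \<noteq> 0" by simp
    ultimately show ?thesis unfolding q 2 by presburger
  qed
  then show ?thesis using L by simp
next
  case False
  then have "coeff (gegen s n) (m + 2) = 0" by (intro coeff_gegen_eq_0) auto
  moreover have "m = n \<or> coeff (gegen s n) m = 0"
  proof (cases "m \<le> n \<and> even (n - m)")
    case True
    then have "n - m < 2" using False by auto
    then have "m = n" using True by (metis One_nat_def diff_is_0_eq' even_Suc even_zero le_antisym less_2_cases_iff diff_is_0_eq)
    then show ?thesis by simp
  qed (simp add: coeff_gegen_eq_0)
  ultimately show ?thesis by auto
qed

text \<open>The Gegenbauer equation turns the kernel side of \<open>Sker_adjoint\<close> into
  multiplication by the n-th eigenvalue. What remains is an eigenvalue gap on the left and test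
  functions of lower degree on the right.\<close>

lemma SZ_rec:
  "(real (p' + 2 * i' + 2 * j') * (real (p' + 2 * i' + 2 * j') + 2 * lam) - real n * (real n + 2 * lam)) * SZ n z u' p' i' j'
    = real p' * (real p' - 1) * (u' \<bullet> u') * SZ n z u' (p' - 2) i' j'
      + 4 * real i' * (real i' + bb - 1) * SZ n z u' p' (i' - 1) j'
      + 4 * real j' * (real j' + gg - 1) * SZ n z u' p' i' (j' - 1)"
proof -
  define cc where "cc m = coeff (gegen lam n) m" for m
  define e where "e m = real m * (real m + 2 * lam)" for m
  let ?S = "\<lambda>m. Sker z u' m p' i' j'"
  have c0: "cc (Suc n) = 0" "cc (Suc (Suc n)) = 0" unfolding cc_def by (auto simp: coeff_gegen)
  have "(\<Sum>m\<le>n. cc m * (real m * (real m - 1) * ?S (m - 2))) = (\<Sum>m\<le>Suc (Suc n). cc m * (real m * (real m - 1) * ?S (m - 2)))"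
    using c0 by simp
  also have "\<dots> = (\<Sum>m\<le>n. cc (m + 2) * (real (m + 2) * real (m + 1) * ?S m))"
  proof -
    have sh: "(\<Sum>m\<le>Suc (Suc n). f m) = f 0 + (f (Suc 0) + (\<Sum>m\<le>n. f (Suc (Suc m))))" for f :: "nat \<Rightarrow> real"
      by (simp only: sum.atMost_Suc_shift)
    have "cc (Suc (Suc m)) * (real (Suc (Suc m)) * (real (Suc (Suc m)) - 1) * ?S (Suc (Suc m) - 2)) = cc (m + 2) * (real (m + 2) * real (m + 1) * ?S m)" for m
      by (simp add: add.commute)
    then show ?thesis unfolding sh by simp
  qed
  also have "\<dots> = (\<Sum>m\<le>n. (e m - e n) * cc m * ?S m)"
  proof (intro sum.cong refl)
    fix m
    show "cc (m + 2) * (real (m + 2) * real (m + 1) * ?S m) = (e m - e n) * cc m * ?S m"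
    proof -
      have "cc (m + 2) * (real (m + 2) * real (m + 1) * ?S m) = (real (m + 2) * real (m + 1) * cc (m + 2)) * ?S m"
        by (simp only: mult_ac)
      then show ?thesis unfolding cc_def e_def coeff_gegen_rec .
    qed
  qed
  finally have A: "(\<Sum>m\<le>n. cc m * (real m * (real m - 1) * ?S (m - 2))) = (\<Sum>m\<le>n. (e m - e n) * cc m * ?S m)" .
  have "- e n * SZ n z u' p' i' j' = (\<Sum>m\<le>n. (e m - e n) * cc m * ?S m) - (\<Sum>m\<le>n. cc m * (e m * ?S m))"
    unfolding SZ_eq cc_def sum_distrib_left sum_subtractf[symmetric] by (intro sum.cong refl) (simp add: algebra_simps)
  also have "\<dots> = (\<Sum>m\<le>n. cc m * (real m * (real m - 1) * ?S (m - 2) - e m * ?S m))"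
    unfolding A[symmetric] sum_subtractf[symmetric] by (simp add: right_diff_distrib)
  also have "\<dots> = real p' * (real p' - 1) * (u' \<bullet> u') * SZ n z u' (p' - 2) i' j'
      + 4 * real i' * (real i' + bb - 1) * SZ n z u' p' (i' - 1) j'
      + 4 * real j' * (real j' + gg - 1) * SZ n z u' p' i' (j' - 1)
      - e (p' + 2 * i' + 2 * j') * SZ n z u' p' i' j'"
    unfolding e_def Sker_adjoint SZ_eq sum_distrib_left sum.distrib[symmetric] sum_subtractf[symmetric] cc_def
    by (intro sum.cong refl) (simp add: algebra_simps)
  finally show ?thesis unfolding e_def by (simp add: left_diff_distrib)
qed

text \<open>By induction on the degree the right side of \<open>SZ_rec\<close> is zero, and the gap
  is nonzero because the eigenvalues increase strictly with the degree.\<close>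

lemma SZ_eq_0: "p' + 2 * i' + 2 * j' < n \<Longrightarrow> SZ n z u' p' i' j' = 0"
proof (induction "p' + 2 * i' + 2 * j'" arbitrary: p' i' j' rule: less_induct)
  case less
  define m where "m = p' + 2 * i' + 2 * j'"
  have 1: "real p' * (real p' - 1) * (u' \<bullet> u') * SZ n z u' (p' - 2) i' j' = 0"
  proof (cases "p' \<ge> 2")
    case True
    then have "SZ n z u' (p' - 2) i' j' = 0" using less.prems by (intro less.hyps) auto
    then show ?thesis by simp
  next
    case False
    then have "p' = 0 \<or> p' = 1" by auto
    then show ?thesis by auto
  qed
  have 2: "4 * real i' * (real i' + bb - 1) * SZ n z u' p' (i' - 1) j' = 0"
  proof (cases "i' \<ge> 1")
    case True
    then have "SZ n z u' p' (i' - 1) j' = 0" using less.prems by (intro less.hyps) auto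
    then show ?thesis by simp
  qed auto
  have 3: "4 * real j' * (real j' + gg - 1) * SZ n z u' p' i' (j' - 1) = 0"
  proof (cases "j' \<ge> 1")
    case True
    then have "SZ n z u' p' i' (j' - 1) = 0" using less.prems by (intro less.hyps) auto
    then show ?thesis by simp
  qed auto
  have "(real m * (real m + 2 * lam) - real n * (real n + 2 * lam)) * SZ n z u' p' i' j' = 0"
    unfolding m_def SZ_rec 1 2 3 by simp
  moreover have "real m * (real m + 2 * lam) < real n * (real n + 2 * lam)"
    using less.prems lam_pos unfolding m_def by (intro mult_strict_mono') auto
  ultimately show ?case by simp
qed

end

section \<open>From ridge functions to arbitrary even polynomials\<close>

lemma list_of_monomial:
  "finite A \<Longrightarrow> \<exists>is. length is = (\<Sum>i\<in>A. \<alpha> i) \<and> (\<forall>x :: real ^ 'd. (\<Prod>i\<in>A. (x $ i) ^ \<alpha> i) = prod_list (map (\<lambda>i. x $ i) is))"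
proof (induction A rule: finite_induct)
  case (insert l A)
  then obtain ls where "length ls = (\<Sum>i\<in>A. \<alpha> i)" "\<forall>x :: real ^ 'd. (\<Prod>i\<in>A. (x $ i) ^ \<alpha> i) = prod_list (map (\<lambda>i. x $ i) ls)" by blast
  with insert.hyps show ?case by (intro exI[of _ "replicate (\<alpha> l) l @ ls"]) simp
qed simp

context hyperboloid
begin

lemma ker_polysE_right: "degree k \<le> N \<Longrightarrow> ker k z \<in> polysE N"
proof -
  assume d: "degree k \<le> N"
  have m: "ker (monom 1 m) z \<in> polysE m" for m
  proof -
    have "(\<lambda>z'. (tcoef bb gg m i j * tau z ^ i * vv z ^ j) * ridge (fst z) (m - 2 * i - 2 * j) i j z') \<in> polysE m" for i j
    proof (cases "2 * i + 2 * j \<le> m")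
      case True
      then show ?thesis by (intro polysE_cmult polysE_mono[OF ridge_polysE]) simp
    next
      case False
      then show ?thesis by (simp add: tcoef_def polysE_const)
    qed
    then have "(\<lambda>z'. \<Sum>i\<le>m. \<Sum>j\<le>m. (tcoef bb gg m i j * tau z ^ i * vv z ^ j) * ridge (fst z) (m - 2 * i - 2 * j) i j z') \<in> polysE m"
      by (intro polysE_sum)
    then show ?thesis by (simp only: ker_monom[OF order_refl, symmetric])
  qed
  have "(\<lambda>z'. \<Sum>m\<le>N. coeff k m * ker (monom 1 m) z z') \<in> polysE N"
    by (intro polysE_sum polysE_cmult polysE_mono[OF m]) auto
  then show ?thesis by (simp only: ker_eq_sum[OF d, symmetric])
qed

lemma ker_sym: "ker k z z' = ker k z' z"
  by (simp add: ker_def inner_commute mult.commute)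

lemma ker_measurable: "ker k z \<in> borel_measurable borel"
  by (rule polysE_measurable[OF ker_polysE_right[OF order_refl]])

lemma ker_add: "ker (p + q) z z' = ker p z z' + ker q z z'" by (simp add: ker_def Phi_add)
lemma ker_smult: "ker (smult s p) z z' = s * ker p z z'" by (simp add: ker_def Phi_smult)
lemma ker_sum: "ker (sum f I) z z' = (\<Sum>i\<in>I. ker (f i) z z')" by (simp add: ker_def Phi_sum)

lemma ker_polysE_integrable: "Q \<in> polysE m \<Longrightarrow> integrable mu (\<lambda>z'. ker k z z' * Q z')"
  by (rule integrable_polysE[OF polysE_mult[OF ker_polysE_right[OF order_refl]]])

text \<open>Polarisation, one coordinate at a time. With u replaced by u + s e_l and p by p + 1, the
  integral vanishes for every s by the induction hypothesis; its coefficient of s is p + 1 times the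
  integral sought.\<close>

lemma ker_orth_list:
  assumes "p + length is + 2 * i + 2 * j < n"
  shows "(\<integral>z'. ker (gegen lam n) z z' * (ridge u p i j z' * prod_list (map (\<lambda>l. fst z' $ l) is)) \<partial>mu) = 0"
  using assms
proof (induction "is" arbitrary: u p)
  case Nil
  then show ?case using SZ_eq_0[of p i j n z u] by (simp add: SZ_def)
next
  case (Cons l ls)
  define R where "R z' = tau z' ^ i * vv z' ^ j * prod_list (map (\<lambda>l. fst z' $ l) ls)" for z' :: "'d pt"
  define J where "J q = (\<integral>z'. ker (gegen lam n) z z' * ((fst z' \<bullet> u) ^ (Suc p - q) * (fst z' $ l) ^ q * R z') \<partial>mu)" for q
  have Rp: "R \<in> polysE (i * 2 + j * 2 + length ls)"
  proof -
    have "(\<lambda>z'. prod_list (map (\<lambda>l. fst z' $ l) ls)) \<in> polysE (length ls)" for ls :: "'d list"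
    proof (induction ls)
      case Nil then show ?case by (simp add: polysE_const)
    next
      case (Cons a ls)
      from polysE_mult[OF polysE_nth[of a] this] show ?case by simp
    qed
    then show ?thesis unfolding R_def[abs_def] by (intro polysE_mult polysE_power tau_polysE vv_polysE)
  qed
  have int: "integrable mu (\<lambda>z'. ker (gegen lam n) z z' * ((fst z' \<bullet> u) ^ q' * (fst z' $ l) ^ q * R z'))" for q q'
    by (rule ker_polysE_integrable[OF polysE_mult[OF polysE_mult[OF polysE_power[OF polysE_inner] polysE_power[OF polysE_nth]] Rp]])
  have "(\<Sum>q\<le>Suc p. (real (Suc p choose q) * J q) * s ^ q) = (\<Sum>q\<le>Suc p. 0 * s ^ q)" for s
  proof -
    have "ridge (u + s *\<^sub>R axis l 1) (Suc p) i j z' * prod_list (map (\<lambda>l. fst z' $ l) ls)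
      = (\<Sum>q\<le>Suc p. real (Suc p choose q) * s ^ q * ((fst z' \<bullet> u) ^ (Suc p - q) * (fst z' $ l) ^ q * R z'))" for z' :: "'d pt"
    proof -
      have "fst z' \<bullet> (u + s *\<^sub>R axis l 1) = s * fst z' $ l + fst z' \<bullet> u"
        by (simp add: inner_add_right inner_axis)
      then have "ridge (u + s *\<^sub>R axis l 1) (Suc p) i j z' * prod_list (map (\<lambda>l. fst z' $ l) ls) = (s * fst z' $ l + fst z' \<bullet> u) ^ Suc p * R z'"
        by (simp only: ridge_def R_def mult.assoc)
      also have "\<dots> = (\<Sum>q\<le>Suc p. real (Suc p choose q) * s ^ q * ((fst z' \<bullet> u) ^ (Suc p - q) * (fst z' $ l) ^ q * R z'))"
        unfolding binomial_ring sum_distrib_right by (intro sum.cong refl) (simp only: power_mult_distrib mult_ac of_nat_id)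
      finally show ?thesis .
    qed
    then have "(\<integral>z'. ker (gegen lam n) z z' * (ridge (u + s *\<^sub>R axis l 1) (Suc p) i j z' * prod_list (map (\<lambda>l. fst z' $ l) ls)) \<partial>mu)
      = (\<integral>z'. (\<Sum>q\<le>Suc p. (real (Suc p choose q) * s ^ q) * (ker (gegen lam n) z z' * ((fst z' \<bullet> u) ^ (Suc p - q) * (fst z' $ l) ^ q * R z'))) \<partial>mu)"
      by (simp only: sum_distrib_left mult_ac)
    also have "\<dots> = (\<Sum>q\<le>Suc p. (real (Suc p choose q) * s ^ q) * J q)"
      unfolding J_def by (subst Bochner_Integration.integral_sum) (auto intro!: int integrable_mult_right simp del: sum.atMost_Suc binomial_Suc_Suc)
    finally have "(\<Sum>q\<le>Suc p. (real (Suc p choose q) * s ^ q) * J q) = 0"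
      using Cons.IH[of "Suc p" "u + s *\<^sub>R axis l 1"] Cons.prems by simp
    then show ?thesis by (simp only: mult_ac mult_zero_left sum.neutral_const)
  qed
  from sum_poly_coeffs_eq[OF this, of 1] have "J 1 = 0" by simp
  then show ?case unfolding J_def R_def ridge_def by (simp add: mult_ac)
qed

lemma snd_sq: "(snd z)\<^sup>2 = c + (b - c) * tau z + (a - c) * vv z" for z :: "'d pt"
proof -
  have "(b - a) * tau z = (snd z)\<^sup>2 - a - (c - a) * (norm (fst z))\<^sup>2" using a_less_b by (simp add: tau_def)
  moreover have "(norm (fst z))\<^sup>2 = 1 - tau z - vv z" by (simp add: vv_def)
  ultimately show ?thesis by (simp add: algebra_simps)
qed

text \<open>By \<open>snd_sq\<close> the square of t is an affine combination of \<open>tau\<close>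
  and \<open>vv\<close>, so a factor t^2 can be traded for 1, \<open>tau\<close> or
  \<open>vv\<close> without raising the degree.\<close>

lemma ker_orth_snd:
  assumes "length is + 2 * k + 2 * i + 2 * j < n"
  shows "(\<integral>z'. ker (gegen lam n) z z' * (prod_list (map (\<lambda>l. fst z' $ l) is) * (snd z')\<^sup>2 ^ k * tau z' ^ i * vv z' ^ j) \<partial>mu) = 0"
  using assms
proof (induction k arbitrary: i j)
  case 0
  then show ?case using ker_orth_list[of 0 "is" i j n z 0] by (simp add: ridge_def mult_ac)
next
  case (Suc k)
  let ?P = "\<lambda>i j z'. ker (gegen lam n) z z' * (prod_list (map (\<lambda>l. fst z' $ l) is) * (snd z')\<^sup>2 ^ k * tau z' ^ i * vv z' ^ j)"
  have int: "integrable mu (?P i j)" for i j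
  proof -
    have "(\<lambda>z'. prod_list (map (\<lambda>l. fst z' $ l) ls)) \<in> polysE (length ls)" for ls :: "'d list"
    proof (induction ls)
      case Nil then show ?case by (simp add: polysE_const)
    next
      case (Cons a ls)
      from polysE_mult[OF polysE_nth[of a] this] show ?case by simp
    qed
    then have "(\<lambda>z'. prod_list (map (\<lambda>l. fst z' $ l) is) * (snd z')\<^sup>2 ^ k * tau z' ^ i * vv z' ^ j) \<in> polysE (length is + k * 2 + i * 2 + j * 2)"
      by (intro polysE_mult polysE_power polysE_snd2 tau_polysE vv_polysE)
    then show ?thesis by (rule ker_polysE_integrable)
  qed
  have "(\<integral>z'. ker (gegen lam n) z z' * (prod_list (map (\<lambda>l. fst z' $ l) is) * (snd z')\<^sup>2 ^ Suc k * tau z' ^ i * vv z' ^ j) \<partial>mu)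
    = (\<integral>z'. c * ?P i j z' + (b - c) * ?P (Suc i) j z' + (a - c) * ?P i (Suc j) z' \<partial>mu)"
  proof (rule Bochner_Integration.integral_cong[OF refl])
    fix z' :: "'d pt"
    have "K * (L * (S * Q) * T * V) = c * (K * (L * Q * T * V)) + (b - c) * (K * (L * Q * (t * T) * V)) + (a - c) * (K * (L * Q * T * (v * V)))"
      if "S = c + (b - c) * t + (a - c) * v" for K L S Q T V t v :: real
      unfolding that by (simp add: algebra_simps)
    from this[OF snd_sq] show "ker (gegen lam n) z z' * (prod_list (map (\<lambda>l. fst z' $ l) is) * (snd z')\<^sup>2 ^ Suc k * tau z' ^ i * vv z' ^ j)
      = c * ?P i j z' + (b - c) * ?P (Suc i) j z' + (a - c) * ?P i (Suc j) z'"
      unfolding power_Suc .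
  qed
  also have "\<dots> = c * (\<integral>z'. ?P i j z' \<partial>mu) + (b - c) * (\<integral>z'. ?P (Suc i) j z' \<partial>mu) + (a - c) * (\<integral>z'. ?P i (Suc j) z' \<partial>mu)"
    using int[of i j] int[of "Suc i" j] int[of i "Suc j"]
    by (simp only: Bochner_Integration.integral_add integrable_mult_right Bochner_Integration.integrable_add integral_mult_right_zero)
  also have "\<dots> = 0"
    using Suc.IH[of i j] Suc.IH[of "Suc i" j] Suc.IH[of i "Suc j"] Suc.prems by simp
  finally show ?case .
qed

theorem ker_gegen_orth:
  assumes Q: "Q \<in> polysE m" and mn: "m < n"
  shows "(\<integral>z'. ker (gegen lam n) z z' * Q z' \<partial>mu) = 0"
proof -
  obtain cf where cf: "Q = (\<lambda>z. \<Sum>p\<in>mindex m. cf p * pmono (fst p) (snd p) z)" "\<forall>p. odd (snd p) \<longrightarrow> cf p = 0"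
    using polysE_even_monomials[OF Q] by blast
  have z: "(\<integral>z'. ker (gegen lam n) z z' * (cf p * pmono (fst p) (snd p) z') \<partial>mu) = 0
    \<and> integrable mu (\<lambda>z'. ker (gegen lam n) z z' * (cf p * pmono (fst p) (snd p) z'))" if p: "p \<in> mindex m" for p
  proof (cases "even (snd p)")
    case False
    then have "cf p = 0" using cf(2) by blast
    then show ?thesis by simp
  next
    case True
    then obtain k where k: "snd p = 2 * k" by blast
    obtain ls where ls: "length ls = (\<Sum>i\<in>UNIV. fst p i)" "\<forall>x :: real ^ 'd. (\<Prod>i\<in>UNIV. (x $ i) ^ fst p i) = prod_list (map (\<lambda>i. x $ i) ls)"
      using list_of_monomial[of UNIV "fst p"] by auto
    have e: "pmono (fst p) (snd p) z' = prod_list (map (\<lambda>l. fst z' $ l) ls) * (snd z')\<^sup>2 ^ k * tau z' ^ 0 * vv z' ^ 0" for z'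
      unfolding pmono_def k power_mult using ls(2) by simp
    have "length ls + 2 * k + 2 * 0 + 2 * 0 < n" using p mn ls(1) k by (cases p) (auto simp: mindex_def)
    from ker_orth_snd[OF this, of z] have "(\<integral>z'. cf p * (ker (gegen lam n) z z' * pmono (fst p) (snd p) z') \<partial>mu) = 0"
      unfolding e[symmetric] by simp
    moreover have "pmono (fst p) (snd p) \<in> polysE m"
      using pmono_in_polys[OF p] True by (simp add: polysE_iff) (simp add: pmono_def tflip_def)
    then have "integrable mu (\<lambda>z'. ker (gegen lam n) z z' * (cf p * pmono (fst p) (snd p) z'))"
      by (intro ker_polysE_integrable polysE_cmult)
    ultimately show ?thesis by (simp only: mult.left_commute)
  qed
  have "(\<integral>z'. ker (gegen lam n) z z' * Q z' \<partial>mu) = (\<integral>z'. (\<Sum>p\<in>mindex m. ker (gegen lam n) z z' * (cf p * pmono (fst p) (snd p) z')) \<partial>mu)"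
    unfolding cf(1) sum_distrib_left ..
  also have "\<dots> = (\<Sum>p\<in>mindex m. (\<integral>z'. ker (gegen lam n) z z' * (cf p * pmono (fst p) (snd p) z') \<partial>mu))"
    by (rule Bochner_Integration.integral_sum) (use z in blast)
  also have "\<dots> = 0" using z by simp
  finally show ?thesis .
qed

end

section \<open>Zonal polynomials and Cesaro sums\<close>

text \<open>The normalisation makes \<open>ker (zon lam n) / K0\<close> reproduce the n-th eigenspace.\<close>

definition zon :: "real \<Rightarrow> nat \<Rightarrow> real poly" where
  "zon l n = smult ((real n + l) / l) (gegen l n)"

text \<open>In generating series: those of the zonal polynomials sum to (1 - r^2) (1 - 2 x r +
  r^2)^(-l-1). The factor 1 - r^2 is what later saves one order of summation.\<close>

lemma zon_eq:
  assumes l: "l > 0"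
  shows "zon l n = gegen (l + 1) n - (if n \<ge> 2 then gegen (l + 1) (n - 2) else 0)"
proof (rule poly_eqI)
  fix m
  show "coeff (zon l n) m = coeff (gegen (l + 1) n - (if n \<ge> 2 then gegen (l + 1) (n - 2) else 0)) m"
  proof (cases "m \<le> n \<and> even (n - m)")
    case False
    then have "\<not> (m \<le> n - 2 \<and> even (n - 2 - m)) \<or> \<not> n \<ge> 2" by auto
    then have "coeff (if n \<ge> 2 then gegen (l + 1) (n - 2) else 0) m = 0" by (auto simp: coeff_gegen_eq_0)
    then show ?thesis using False by (simp add: zon_def coeff_gegen_eq_0)
  next
    case True
    then obtain k where "n - m = 2 * k" by (blast elim: evenE)
    then have n: "n = m + 2 * k" using True by linarith
    have pl: "l * pochhammer (l + 1) j = pochhammer l j * (l + real j)" for j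
      unfolding pochhammer_rec[symmetric] pochhammer_Suc ..
    have 1: "coeff (zon l n) m = (real n + l) / l * ((-1) ^ k * pochhammer l (m + k) * 2 ^ m / (fact k * fact m))"
      unfolding zon_def coeff_smult n coeff_gegen_add ..
    have 2: "coeff (gegen (l + 1) n) m = (-1) ^ k * pochhammer (l + 1) (m + k) * 2 ^ m / (fact k * fact m)"
      unfolding n by (rule coeff_gegen_add)
    show ?thesis
    proof (cases k)
      case 0
      then have c0: "coeff (if n \<ge> 2 then gegen (l + 1) (n - 2) else 0) m = 0" using n by (auto simp: coeff_gegen)
      have p: "pochhammer (l + 1) m = pochhammer l m * (l + real m) / l" using pl[of m] l by (simp add: field_simps)
      have "real n = real m" using n 0 by simp
      then show ?thesis unfolding coeff_diff 1 2 c0 0 add_0_right p by (simp add: add.commute)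
    next
      case (Suc j)
      have "n - 2 = m + 2 * j" "n \<ge> 2" using n Suc by auto
      then have 3: "coeff (if n \<ge> 2 then gegen (l + 1) (n - 2) else 0) m = (-1) ^ j * pochhammer (l + 1) (m + j) * 2 ^ m / (fact j * fact m)"
        using coeff_gegen_add[of "l + 1" m j] by simp
      have p1: "pochhammer (l + 1) (m + j) = pochhammer l (m + k) / l"
        using pl[of "m + j"] l unfolding Suc by (simp add: pochhammer_Suc field_simps)
      have p2: "pochhammer (l + 1) (m + k) = pochhammer l (m + k) * (l + real (m + k)) / l"
        using pl[of "m + k"] l by (simp add: field_simps)
      have "(real n + l) / l * (- s * P * T / (K * F * G)) = (- s * (P * (l + real (m + k)) / l) * T / (K * F * G)) - s * (P / l) * T / (F * G)"
        if "K = real k" "K \<noteq> 0" for s P T K F G :: real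
      proof (cases "F * G = 0")
        case False
        have nl: "real n + l = (l + real (m + k)) + K" using n that by simp
        show ?thesis unfolding nl using False that l by (simp add: field_simps)
      qed auto
      from this[of "real k" "(-1) ^ j" "pochhammer l (m + k)" "2 ^ m" "fact j" "fact m"]
      show ?thesis unfolding coeff_diff 1 2 3 p1 p2 using Suc by simp
    qed
  qed
qed

lemma zon_0 [simp]: "l > 0 \<Longrightarrow> zon l 0 = 1"
  by (simp add: zon_def)

lemma zon_1: "l > 0 \<Longrightarrow> zon l (Suc 0) = [:0, 2 * (l + 1):]"
  by (simp add: zon_def gegen_1 field_simps)

lemma degree_zon_le: "degree (zon l n) \<le> n"
  unfolding zon_def using degree_gegen_le degree_smult_le order_trans by blast

lemma lead_zon: "l > 0 \<Longrightarrow> coeff (zon l n) n > 0"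
proof -
  assume l: "l > 0"
  have "coeff (gegen l n) n = pochhammer l n * 2 ^ n / fact n"
    using coeff_gegen_add[of l n 0] by simp
  moreover have "pochhammer l n > 0" using l by (rule pochhammer_pos)
  ultimately show ?thesis using l by (simp add: zon_def)
qed

lemma zon_expansion:
  assumes l: "l > 0"
  shows "degree k \<le> N \<Longrightarrow> \<exists>\<kappa>. k = (\<Sum>j\<le>N. smult (\<kappa> j) (zon l j))"
proof (induction N arbitrary: k)
  case 0
  then obtain s where "k = [:s:]" by (auto elim: degree_eq_zeroE)
  then show ?case using l by (intro exI[of _ "\<lambda>_. s"]) (simp add: one_pCons)
next
  case (Suc N)
  define s where "s = coeff k (Suc N) / coeff (zon l (Suc N)) (Suc N)"
  have nz: "coeff (zon l (Suc N)) (Suc N) \<noteq> 0" using lead_zon[OF l, of "Suc N"] by simp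
  have "degree (k - smult s (zon l (Suc N))) \<le> N"
  proof (rule degree_le, intro allI impI)
    fix i assume "N < i"
    then consider "i = Suc N" | "i > Suc N" by linarith
    then show "coeff (k - smult s (zon l (Suc N))) i = 0"
    proof cases
      case 1 then show ?thesis using nz by (simp add: s_def)
    next
      case 2
      then have "coeff k i = 0" "coeff (zon l (Suc N)) i = 0"
        using Suc.prems degree_zon_le[of l "Suc N"] by (auto intro!: coeff_eq_0)
      then show ?thesis by simp
    qed
  qed
  then obtain \<kappa> where "k - smult s (zon l (Suc N)) = (\<Sum>j\<le>N. smult (\<kappa> j) (zon l j))" using Suc.IH by blast
  then have "k = (\<Sum>j\<le>Suc N. smult ((\<kappa>(Suc N := s)) j) (zon l j))" by (simp add: algebra_simps)
  then show ?case by blast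
qed

text \<open>For J >= 1 these are the binomial coefficients (m + J - 1 choose m), that is, the Cesaro
  weights of order J - 1.\<close>

definition cw :: "nat \<Rightarrow> nat \<Rightarrow> real" where
  "cw J m = (inverse (1 - fps_X) ^ J :: real fps) $ m"

lemma inverse_one_minus_X_nth: "(inverse (1 - fps_X) :: real fps) $ k = 1"
  by (simp add: fps_inverse_gp' flip: fps_inverse_gp')

lemma psum_fps: "(psum ^^ J) z N = (Abs_fps z * inverse (1 - fps_X) ^ J) $ N"
proof (induction J arbitrary: N)
  case (Suc J)
  have "(psum ^^ Suc J) z N = (\<Sum>n\<le>N. (Abs_fps z * inverse (1 - fps_X) ^ J) $ n)"
    by (simp add: psum_def[of "(psum ^^ J) z"] Suc)
  also have "\<dots> = ((Abs_fps z * inverse (1 - fps_X) ^ J) * inverse (1 - fps_X)) $ N"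
    unfolding fps_mult_nth[of "Abs_fps z * inverse (1 - fps_X) ^ J"] inverse_one_minus_X_nth
    by (simp add: atMost_atLeast0)
  finally show ?case by (simp only: power_Suc mult_ac)
qed simp

lemma psum_cw: "(psum ^^ J) z N = (\<Sum>n\<le>N. z n * cw J (N - n))"
  unfolding psum_fps fps_mult_nth cw_def by (simp add: atMost_atLeast0)

lemma cw_delta0: "cw J N = (psum ^^ J) delta0 N"
  unfolding psum_cw by (simp add: delta0_def if_distrib[of "\<lambda>x. x * _"] cong: if_cong)

lemma cw_Suc: "cw (Suc J) N = (\<Sum>n\<le>N. cw J n)"
  unfolding cw_delta0 by (simp add: psum_def[of "(psum ^^ J) delta0"])

lemma cw_nonneg: "cw J N \<ge> 0"
proof (induction J arbitrary: N)
  case 0 show ?case by (simp add: cw_def)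
next
  case (Suc J) then show ?case unfolding cw_Suc by (intro sum_nonneg)
qed

lemma cw_0 [simp]: "cw J 0 = 1"
  by (simp add: cw_def fps_power_zeroth inverse_one_minus_X_nth)

lemma cw_pos: "cw (Suc J) N > 0"
proof -
  have "cw J 0 \<le> cw (Suc J) N" unfolding cw_Suc by (rule member_le_sum) (auto simp: cw_nonneg)
  then show ?thesis by simp
qed

lemma cw_le: "cw (Suc J) N \<le> real (Suc N) ^ J"
proof (induction J arbitrary: N)
  case 0
  show ?case by (simp add: cw_def inverse_one_minus_X_nth)
next
  case (Suc J)
  have "cw (Suc (Suc J)) N \<le> (\<Sum>n\<le>N. real (Suc N) ^ J)"
    unfolding cw_Suc[of "Suc J"] by (intro sum_mono order_trans[OF Suc] power_mono) auto
  then show ?case by simp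
qed

lemma cw_rec: "real (Suc N) * cw J (Suc N) = (real N + real J) * cw J N"
proof -
  let ?I = "inverse (1 - fps_X) :: real fps"
  have I: "(1 - fps_X) * ?I = 1" by (subst mult.commute, rule inverse_mult_eq_1) simp
  have dI: "fps_deriv ?I = ?I * ?I"
    by (simp add: fps_inverse_deriv power2_eq_square)
  have dIM: "fps_deriv (?I ^ J) = fps_const (real J) * ?I * ?I ^ J"
    by (induction J) (simp_all add: dI algebra_simps del: fps_inverse_deriv flip: fps_const_add)
  have "(1 - fps_X) * fps_deriv (?I ^ J) = fps_const (real J) * ((1 - fps_X) * ?I) * ?I ^ J" unfolding dIM by (simp only: mult_ac)
  then have "fps_deriv (?I ^ J) - fps_X * fps_deriv (?I ^ J) = fps_const (real J) * ?I ^ J" unfolding I by (simp add: algebra_simps)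
  then have "(fps_deriv (?I ^ J) - fps_X * fps_deriv (?I ^ J)) $ N = (fps_const (real J) * ?I ^ J) $ N" by simp
  then show ?thesis unfolding cw_def by (cases N) (simp_all add: algebra_simps)
qed

text \<open>The weights grow polynomially, so neighbours are asymptotically equal. In the argument
  of Korovkin type this expresses the concentration of the Cesaro kernels.\<close>

lemma cw_ratio_tendsto: "(\<lambda>N. cw (Suc J) N / cw (Suc J) (Suc N)) \<longlonglongrightarrow> 1"
proof -
  have "cw (Suc J) N / cw (Suc J) (Suc N) = 1 - real J / (real (Suc N) + real J)" for N
  proof -
    have "real (Suc N) * cw (Suc J) (Suc N) = (real (Suc N) + real J) * cw (Suc J) N" using cw_rec[of N "Suc J"] by simp
    then have "cw (Suc J) N / cw (Suc J) (Suc N) = real (Suc N) / (real (Suc N) + real J)"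
      using cw_pos[of J "Suc N"] by (simp add: frac_eq_eq mult.commute)
    also have "\<dots> = 1 - real J / (real (Suc N) + real J)" by (simp add: field_simps)
    finally show ?thesis .
  qed
  moreover have "(\<lambda>N. 1 - real J / (real (Suc N) + real J)) \<longlonglongrightarrow> 1 - 0"
  proof (intro tendsto_diff tendsto_const)
    have "filterlim (\<lambda>N. real J + real (Suc N)) at_top sequentially"
      by (intro filterlim_tendsto_add_at_top[OF tendsto_const] filterlim_compose[OF filterlim_real_sequentially filterlim_Suc])
    then have "filterlim (\<lambda>N. real (Suc N) + real J) at_top sequentially" by (simp add: add.commute)
    then show "(\<lambda>N. real J / (real (Suc N) + real J)) \<longlonglongrightarrow> 0"
      by (rule real_tendsto_divide_at_top[OF tendsto_const])
  qed
  ultimately show ?thesis by simp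
qed

lemma cw_ratio_tendsto_shift: "(\<lambda>N. cw (Suc J) N / cw (Suc J) (N + n)) \<longlonglongrightarrow> 1"
proof (induction n)
  case 0
  show ?case using cw_pos[of J] by (simp add: less_imp_neq[symmetric])
next
  case (Suc n)
  have "(\<lambda>N. (cw (Suc J) N / cw (Suc J) (N + n)) * (cw (Suc J) (N + n) / cw (Suc J) (Suc (N + n)))) \<longlonglongrightarrow> 1 * 1"
    by (intro tendsto_mult Suc LIMSEQ_ignore_initial_segment[OF cw_ratio_tendsto])
  moreover have "(cw (Suc J) N / cw (Suc J) (N + n)) * (cw (Suc J) (N + n) / cw (Suc J) (Suc (N + n))) = cw (Suc J) N / cw (Suc J) (N + Suc n)" for N
    using cw_pos[of J "N + n"] by simp
  ultimately have "(\<lambda>N. cw (Suc J) N / cw (Suc J) (N + Suc n)) \<longlonglongrightarrow> 1 * 1" by (simp only:)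
  then show ?case by simp
qed

text \<open>Cesaro sums without division by \<open>cw J N\<close>: in this form they are exactly the
  J-fold partial sums produced by summation by parts.\<close>

definition Spoly :: "real \<Rightarrow> nat \<Rightarrow> nat \<Rightarrow> real poly" where
  "Spoly l J N = (\<Sum>n\<le>N. smult (cw J (N - n)) (zon l n))"

lemma pderiv_funpow_gegen:
  "(pderiv ^^ i) (gegen s n) = (if i \<le> n then smult (2 ^ i * pochhammer s i) (gegen (s + real i) (n - i)) else 0)"
proof (induction i)
  case (Suc i)
  show ?case
  proof (cases "Suc i \<le> n")
    case True
    then have "n - i = Suc (n - Suc i)" by simp
    then show ?thesis using Suc True
      by (simp add: pderiv_smult pderiv_gegen_Suc pochhammer_Suc algebra_simps)
  next
    case False
    then show ?thesis using Suc by (auto simp: pderiv_smult)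
  qed
qed simp

text \<open>Differentiating i times raises the Gegenbauer index by i and shifts the series by r^i.
  Since 1 - r^2 = (1 + r) (1 - r), one of the M + 1 factors 1/(1 - r) cancels, which leaves a series
  covered by \<open>gegen_sums_nonneg\<close>.\<close>

lemma poly_pderiv_Spoly:
  assumes l: "l > 0"
  shows "poly ((pderiv ^^ i) (Spoly l (Suc M) N)) x =
    2 ^ i * pochhammer (l + 1) i * (fps_X ^ i * (1 + fps_X) * (gfps (l + 1 + real i) x * inverse (1 - fps_X) ^ M)) $ N"
proof -
  let ?I = "inverse (1 - fps_X) :: real fps"
  let ?G = "gfps (l + 1 + real i) x"
  let ?c = "2 ^ i * pochhammer (l + 1) i"
  have dsum: "(pderiv ^^ i) (sum f A) = (\<Sum>a\<in>A. (pderiv ^^ i) (f a))" for f :: "nat \<Rightarrow> real poly" and A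
  proof -
    have "(pderiv ^^ i) 0 = (0 :: real poly)" by (induction i) auto
    then show ?thesis by (induction A rule: infinite_finite_induct) (simp_all add: pderiv_funpow_add)
  qed
  have z: "Abs_fps (\<lambda>n. poly ((pderiv ^^ i) (zon l n)) x) = fps_const ?c * (fps_X ^ i * ((1 - fps_X ^ 2) * ?G))"
  proof (rule fps_ext)
    fix n
    have d: "(pderiv ^^ i) (zon l n) = (pderiv ^^ i) (gegen (l + 1) n) + (if n \<ge> 2 then smult (-1) ((pderiv ^^ i) (gegen (l + 1) (n - 2))) else 0)"
    proof (cases "n \<ge> 2")
      case True
      then have "zon l n = gegen (l + 1) n + smult (-1) (gegen (l + 1) (n - 2))" unfolding zon_eq[OF l] by simp
      then show ?thesis using True by (simp only: pderiv_funpow_add pderiv_funpow_smult if_True)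
    next
      case False
      then show ?thesis unfolding zon_eq[OF l] by simp
    qed
    have e: "(1 - fps_X ^ 2) * ?G = ?G - fps_X ^ 2 * ?G" by (simp add: algebra_simps)
    show "Abs_fps (\<lambda>n. poly ((pderiv ^^ i) (zon l n)) x) $ n = (fps_const ?c * (fps_X ^ i * ((1 - fps_X ^ 2) * ?G))) $ n"
      unfolding fps_nth_Abs_fps d pderiv_funpow_gegen e
      by (auto simp: fps_X_power_mult_nth gfps_def algebra_simps)
  qed
  have "poly ((pderiv ^^ i) (Spoly l (Suc M) N)) x = (\<Sum>n\<le>N. poly ((pderiv ^^ i) (zon l n)) x * cw (Suc M) (N - n))"
    unfolding Spoly_def dsum pderiv_funpow_smult by (simp add: poly_sum mult.commute)
  also have "\<dots> = (Abs_fps (\<lambda>n. poly ((pderiv ^^ i) (zon l n)) x) * ?I ^ Suc M) $ N"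
    unfolding psum_cw[symmetric] psum_fps ..
  also have "Abs_fps (\<lambda>n. poly ((pderiv ^^ i) (zon l n)) x) * ?I ^ Suc M = fps_const ?c * (fps_X ^ i * (1 + fps_X) * (?G * ?I ^ M))"
  proof -
    have I: "(1 - fps_X) * ?I = 1" by (subst mult.commute, rule inverse_mult_eq_1) simp
    have "1 - fps_X ^ 2 = (1 + fps_X) * (1 - fps_X :: real fps)" by (simp add: algebra_simps power2_eq_square)
    then have "fps_const ?c * (fps_X ^ i * ((1 - fps_X ^ 2) * ?G)) * ?I ^ Suc M = fps_const ?c * (fps_X ^ i * (1 + fps_X) * (?G * ?I ^ M)) * ((1 - fps_X) * ?I)"
      by (simp only: power_Suc mult_ac)
    then show ?thesis unfolding z I by simp
  qed
  finally show ?thesis by simp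
qed

lemma poly_Spoly_nonneg:
  assumes l: "l > 0" and x: "\<bar>x\<bar> \<le> 1" and M: "2 * (l + 1 + real i) \<le> real M"
  shows "poly ((pderiv ^^ i) (Spoly l (Suc M) N)) x \<ge> 0"
proof -
  let ?F = "gfps (l + 1 + real i) x * inverse (1 - fps_X) ^ M"
  have F: "?F $ n \<ge> 0" for n using gegen_sums_nonneg[OF x _ M] l by simp
  have "(1 + fps_X) * ?F = ?F + fps_X * ?F" by (simp add: distrib_right)
  then have G: "((1 + fps_X) * ?F) $ n \<ge> 0" for n using F by (simp only: fps_add_nth fps_X_mult_nth) (auto intro: add_nonneg_nonneg)
  have "(fps_X ^ i * (1 + fps_X) * ?F) $ N \<ge> 0"
    unfolding mult.assoc[of "fps_X ^ i"] fps_X_power_mult_nth using G by auto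
  moreover have "pochhammer (l + 1) i \<ge> 0" using l by (intro pochhammer_nonneg) simp
  ultimately show ?thesis unfolding poly_pderiv_Spoly[OF l] by simp
qed

section \<open>Positive kernels and orthogonal spaces\<close>

lemma lborel_distr_tflip: "distr lborel borel tflip = (lborel :: 'd::finite pt measure)"
proof -
  have m [measurable]: "(tflip :: 'd pt \<Rightarrow> 'd pt) \<in> borel \<rightarrow>\<^sub>M borel"
    unfolding tflip_def[abs_def] by (rule borel_measurable_continuous_onI) (intro continuous_on_Pair continuous_on_minus continuous_on_fst continuous_on_snd continuous_on_id)
  have swap: "(\<integral>\<^sup>+z. F (tflip z) \<partial>lborel) = (\<integral>\<^sup>+z. F z \<partial>lborel)" if [measurable]: "F \<in> borel_measurable borel" for F :: "'d pt \<Rightarrow> ennreal"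
  proof -
    have F: "F \<in> borel_measurable (lborel \<Otimes>\<^sub>M lborel)" by (simp add: lborel_prod)
    have F2: "(\<lambda>z. F (tflip z)) \<in> borel_measurable (lborel \<Otimes>\<^sub>M lborel)" unfolding lborel_prod by measurable
    have "(\<integral>\<^sup>+z. F z \<partial>lborel) = (\<integral>\<^sup>+x. \<integral>\<^sup>+t. F (x, t) \<partial>lborel \<partial>lborel)"
      using lborel.nn_integral_fst[OF F] by (simp add: lborel_prod)
    also have "\<dots> = (\<integral>\<^sup>+x. \<integral>\<^sup>+t. F (x, - t) \<partial>lborel \<partial>lborel)"
    proof (rule nn_integral_cong)
      fix x :: "real ^ 'd"
      have [measurable]: "(\<lambda>t. F (x, t)) \<in> borel_measurable borel"
        by (rule measurable_compose[OF _ that]) (intro borel_measurable_continuous_onI continuous_on_Pair continuous_on_const continuous_on_id)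
      have "(\<integral>\<^sup>+t. F (x, t) \<partial>lborel) = (\<integral>\<^sup>+t. F (x, t) \<partial>distr lborel borel uminus)" unfolding lborel_distr_uminus ..
      also have "\<dots> = (\<integral>\<^sup>+t. F (x, - t) \<partial>lborel)" by (subst nn_integral_distr) auto
      finally show "(\<integral>\<^sup>+t. F (x, t) \<partial>lborel) = (\<integral>\<^sup>+t. F (x, - t) \<partial>lborel)" .
    qed
    also have "\<dots> = (\<integral>\<^sup>+z. F (tflip z) \<partial>lborel)"
      using lborel.nn_integral_fst[OF F2] by (simp add: lborel_prod tflip_def)
    finally show ?thesis by simp
  qed
  have "emeasure (distr lborel borel tflip) A = emeasure lborel A" if A: "A \<in> sets borel" for A :: "'d pt set"
  proof -
    have [measurable]: "A \<in> sets borel" by (rule A)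
    have pre: "tflip -` A \<in> sets lborel" using measurable_sets_borel[OF m A] by simp
    have "emeasure (distr lborel borel tflip) A = emeasure lborel (tflip -` A)" using A by (subst emeasure_distr) auto
    also have "\<dots> = (\<integral>\<^sup>+z. indicator (tflip -` A) z \<partial>lborel)" using pre by simp
    also have "\<dots> = (\<integral>\<^sup>+z. indicator A (tflip z) \<partial>lborel)" by (rule nn_integral_cong) (simp add: indicator_def)
    also have "\<dots> = (\<integral>\<^sup>+z. indicator A z \<partial>lborel)" by (rule swap) measurable
    also have "\<dots> = emeasure lborel A" using A by simp
    finally show ?thesis .
  qed
  then show ?thesis by (intro measure_eqI) auto
qed

section \<open>Orthogonality on the full domain and on its upper half\<close>

context hyperboloid
begin

lemma integral_mu: "f \<in> borel_measurable borel \<Longrightarrow>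
    (\<integral>z. f z \<partial>mu) = (\<integral>z. (indicator (LL a b c) z * WW a b c \<beta> \<gamma> z) * f z \<partial>lborel)" for f :: "'d pt \<Rightarrow> real"
  unfolding mu_def using WW_nonneg by (subst integral_density) auto

lemma integrable_mu: "f \<in> borel_measurable borel \<Longrightarrow>
    integrable mu f \<longleftrightarrow> integrable lborel (\<lambda>z. (indicator (LL a b c) z * WW a b c \<beta> \<gamma> z) * f z)" for f :: "'d pt \<Rightarrow> real"
  unfolding mu_def using WW_nonneg by (subst integrable_density) auto

lemma set_integral_LL:
  fixes f :: "'d pt \<Rightarrow> real"
  assumes [measurable]: "(\<lambda>z. indicator (LL a b c) z * f z) \<in> borel_measurable borel"
  shows "(LINT z : LL a b c | lborel. WW a b c \<beta> \<gamma> z * f z) = (\<integral>z. indicator (LL a b c) z * f z \<partial>mu)"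
  unfolding set_lebesgue_integral_def integral_mu[OF assms]
  by (rule Bochner_Integration.integral_cong[OF refl]) (simp add: indicator_def)

lemma integral_indicator_LL:
  fixes f :: "'d pt \<Rightarrow> real"
  assumes [measurable]: "f \<in> borel_measurable borel"
  shows "(\<integral>z. indicator (LL a b c) z * f z \<partial>mu) = (\<integral>z. f z \<partial>mu)"
  by (intro integral_cong_AE) (use AE_mu in auto)

text \<open>The full domain is the upper half together with its mirror image. Their overlap at t = 0
  is counted twice, but the factor |t| makes the weight vanish there.\<close>

lemma XX_weight: "indicator (XX a b c) z * WW a b c \<beta> \<gamma> z
   = indicator (LL a b c) z * WW a b c \<beta> \<gamma> z + indicator (LL a b c) (tflip z) * WW a b c \<beta> \<gamma> (tflip z)" for z :: "'d pt"
proof -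
  obtain x t where z: "z = (x, t)" by fastforce
  have W: "WW a b c \<beta> \<gamma> (x, - t) = WW a b c \<beta> \<gamma> (x, t)" by (simp add: WW_def)
  have X: "(x, - t) \<in> XX a b c \<longleftrightarrow> (x, t) \<in> XX a b c" by (simp add: XX_def)
  show ?thesis
  proof (cases "t = 0")
    case True
    then have "WW a b c \<beta> \<gamma> z = 0" by (simp add: z WW_def)
    then show ?thesis using W by (simp add: z tflip_def)
  next
    case False
    then show ?thesis using X W by (auto simp: z tflip_def LL_def indicator_def)
  qed
qed

lemma set_integral_XX:
  assumes P: "P \<in> polysE n" and Q: "Q \<in> polys m"
  shows "(LINT z : XX a b c | lborel. WW a b c \<beta> \<gamma> z * P z * Q z) = (\<integral>z. P z * (Q z + Q (tflip z)) \<partial>mu)"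
proof -
  have tm [measurable]: "(tflip :: 'd pt \<Rightarrow> 'd pt) \<in> borel \<rightarrow>\<^sub>M borel"
    unfolding tflip_def[abs_def] by (rule borel_measurable_continuous_onI) (intro continuous_on_Pair continuous_on_minus continuous_on_fst continuous_on_snd continuous_on_id)
  define w where "w z = indicator (LL a b c) z * WW a b c \<beta> \<gamma> z" for z :: "'d pt"
  have wm [measurable]: "w \<in> borel_measurable borel" unfolding w_def[abs_def] by measurable
  have i1: "(\<lambda>z. P z * Q z) \<in> polys (n + m)" and i2: "(\<lambda>z. P z * Q (tflip z)) \<in> polys (n + m)"
    using P Q polys_tflip[OF Q] by (auto intro!: polys_mult simp: polysE_D)
  note [measurable] = polys_measurable[OF i1] polys_measurable[OF i2]
  have I1: "integrable lborel (\<lambda>z. w z * (P z * Q z))" and I2: "integrable lborel (\<lambda>z. w z * (P z * Q (tflip z)))"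
    using integrable_polys[OF i1] integrable_polys[OF i2] by (simp_all add: integrable_mu w_def)
  have tt: "tflip (tflip z) = z" for z :: "'d pt" by (simp add: tflip_def)
  have Pt: "P (tflip z) = P z" for z using P polysE_iff by blast
  define G where "G z = w z * (P z * Q (tflip z))" for z
  have Gm [measurable]: "G \<in> borel_measurable borel" unfolding G_def[abs_def] by measurable
  have I2': "integrable lborel (\<lambda>z. G (tflip z))"
    using I2 integrable_distr[of tflip lborel borel G] by (simp add: lborel_distr_tflip G_def[abs_def])
  have e2: "(\<integral>z. G (tflip z) \<partial>lborel) = (\<integral>z. G z \<partial>lborel)"
    using integral_distr[of tflip lborel borel G] by (simp add: lborel_distr_tflip)
  have "(LINT z : XX a b c | lborel. WW a b c \<beta> \<gamma> z * P z * Q z) = (\<integral>z. w z * (P z * Q z) + G (tflip z) \<partial>lborel)"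
    unfolding set_lebesgue_integral_def
  proof (rule Bochner_Integration.integral_cong[OF refl])
    fix z :: "'d pt"
    have "indicator (XX a b c) z *\<^sub>R (WW a b c \<beta> \<gamma> z * P z * Q z) = (indicator (XX a b c) z * WW a b c \<beta> \<gamma> z) * (P z * Q z)" by simp
    also have "\<dots> = w z * (P z * Q z) + G (tflip z)"
      unfolding XX_weight G_def w_def tt Pt by (simp add: distrib_right)
    finally show "indicator (XX a b c) z *\<^sub>R (WW a b c \<beta> \<gamma> z * P z * Q z) = w z * (P z * Q z) + G (tflip z)" .
  qed
  also have "\<dots> = (\<integral>z. w z * (P z * Q z) \<partial>lborel) + (\<integral>z. G z \<partial>lborel)"
    unfolding e2[symmetric] by (rule Bochner_Integration.integral_add[OF I1 I2'])
  also have "\<dots> = (\<integral>z. P z * Q z \<partial>mu) + (\<integral>z. P z * Q (tflip z) \<partial>mu)"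
    by (simp add: integral_mu w_def G_def)
  also have "\<dots> = (\<integral>z. P z * Q z + P z * Q (tflip z) \<partial>mu)"
    by (rule Bochner_Integration.integral_add[OF integrable_polys[OF i1] integrable_polys[OF i2], symmetric])
  finally show ?thesis by (simp add: distrib_left)
qed

abbreviation "V n \<equiv> VE a b c \<beta> \<gamma> n :: ('d pt \<Rightarrow> real) set"

text \<open>Folding the integral over the full domain replaces Q by its symmetrisation, so testing
  with all polynomials amounts to testing with even ones on the upper half.\<close>

lemma VE_iff: "q \<in> V n \<longleftrightarrow> q \<in> polysE n \<and> (\<forall>m<n. \<forall>Q\<in>polysE m. (\<integral>z. q z * Q z \<partial>mu) = 0)"
proof (cases "q \<in> polysE n")
  case q: True
  show ?thesis
  proof
    assume L: "q \<in> V n"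
    have "(\<integral>z. q z * Q z \<partial>mu) = 0" if "m < n" "Q \<in> polysE m" for m Q
    proof -
      have "(LINT z : XX a b c | lborel. WW a b c \<beta> \<gamma> z * q z * Q z) = 0" using L that by (simp add: VE_def polysE_D)
      then have "(\<integral>z. q z * (Q z + Q (tflip z)) \<partial>mu) = 0" unfolding set_integral_XX[OF q polysE_D[OF that(2)]] .
      moreover have "Q (tflip z) = Q z" for z using that(2) polysE_iff by blast
      ultimately have "(\<integral>z. 2 * (q z * Q z) \<partial>mu) = 0" by (simp add: algebra_simps)
      then show ?thesis by simp
    qed
    then show "q \<in> polysE n \<and> (\<forall>m<n. \<forall>Q\<in>polysE m. (\<integral>z. q z * Q z \<partial>mu) = 0)" using q by blast
  next
    assume R: "q \<in> polysE n \<and> (\<forall>m<n. \<forall>Q\<in>polysE m. (\<integral>z. q z * Q z \<partial>mu) = 0)"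
    have "(LINT z : XX a b c | lborel. WW a b c \<beta> \<gamma> z * q z * Q z) = 0" if "m < n" "Q \<in> polys m" for m Q
    proof -
      have "\<forall>Q\<in>polysE m. (\<integral>z. q z * Q z \<partial>mu) = 0" using R that(1) by blast
      from bspec[OF this polysE_symmetrize[OF that(2)]] show ?thesis unfolding set_integral_XX[OF q that(2)] .
    qed
    then show "q \<in> V n" using q by (simp add: VE_def)
  qed
next
  case False
  then show ?thesis by (simp add: VE_def)
qed

lemma integrable_polysE_mult: "P \<in> polysE n \<Longrightarrow> Q \<in> polysE m \<Longrightarrow> integrable mu (\<lambda>z. P z * Q z :: real)"
  by (rule integrable_polysE[OF polysE_mult])

lemma VE_diff: "p \<in> V n \<Longrightarrow> q \<in> V n \<Longrightarrow> (\<lambda>z. p z - q z) \<in> V n"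
proof -
  assume p: "p \<in> V n" and q: "q \<in> V n"
  have "(\<integral>z. (p z - q z) * Q z \<partial>mu) = 0" if "m < n" "Q \<in> polysE m" for m Q
  proof -
    have "(\<integral>z. (p z - q z) * Q z \<partial>mu) = (\<integral>z. p z * Q z \<partial>mu) - (\<integral>z. q z * Q z \<partial>mu)"
      unfolding left_diff_distrib
      by (rule Bochner_Integration.integral_diff) (use p q that VE_iff integrable_polysE_mult in blast)+
    then show ?thesis using p q that VE_iff by simp
  qed
  then show ?thesis using p q polysE_diff by (auto simp: VE_iff)
qed

lemma VE_smult: "p \<in> V n \<Longrightarrow> (\<lambda>z. s * p z) \<in> V n"
  by (auto simp: VE_iff polysE_cmult mult.assoc)

lemma ker_zon_VE: "ker (zon lam n) z \<in> V n"
  unfolding VE_iff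
proof (intro conjI allI impI ballI)
  show "ker (zon lam n) z \<in> polysE n" by (rule ker_polysE_right[OF degree_zon_le])
  fix m and Q :: "'d pt \<Rightarrow> real" assume "m < n" "Q \<in> polysE m"
  then show "(\<integral>z'. ker (zon lam n) z z' * Q z' \<partial>mu) = 0"
    using ker_gegen_orth unfolding zon_def ker_smult mult.assoc by simp
qed

lemma ker_zon_orth:
  assumes q: "q \<in> V n" and jn: "j \<noteq> n"
  shows "(\<integral>z'. ker (zon lam j) z z' * q z' \<partial>mu) = 0"
proof (cases "j < n")
  case True
  have "(\<integral>z'. q z' * ker (zon lam j) z z' \<partial>mu) = 0"
    using q True ker_polysE_right[OF degree_zon_le] VE_iff by blast
  then show ?thesis by (simp only: mult.commute)
next
  case False
  then have "n < j" using jn by simp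
  then show ?thesis using ker_zon_VE[of j z] q VE_iff by blast
qed

text \<open>The inner product after embedding the domain in the unit sphere of dimension d + 1 by
  (x, sqrt tau, sqrt v); it is the largest argument at which a lifted polynomial is evaluated by the
  averaging.\<close>

definition dot :: "'d pt \<Rightarrow> 'd pt \<Rightarrow> real" where
  "dot z z' = fst z \<bullet> fst z' + sqrt (tau z) * sqrt (tau z') + sqrt (vv z) * sqrt (vv z')"

lemma dot_le_abs:
  assumes "z \<in> LL a b c" "z' \<in> LL a b c"
  shows "\<bar>fst z \<bullet> fst z'\<bar> + sqrt (tau z) * sqrt (tau z') + sqrt (vv z) * sqrt (vv z') \<le> 1"
proof -
  note B = LL_bounds[OF assms(1)] and B' = LL_bounds[OF assms(2)]
  have am: "x * y \<le> (x\<^sup>2 + y\<^sup>2) / 2" for x y :: real using sum_squares_ge_zero[of "x - y" 0] by (simp add: power2_eq_square algebra_simps)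
  have "\<bar>fst z \<bullet> fst z'\<bar> \<le> norm (fst z) * norm (fst z')" by (rule Cauchy_Schwarz_ineq2)
  also have "\<dots> \<le> ((norm (fst z))\<^sup>2 + (norm (fst z'))\<^sup>2) / 2" by (rule am)
  finally have 1: "\<bar>fst z \<bullet> fst z'\<bar> \<le> ((norm (fst z))\<^sup>2 + (norm (fst z'))\<^sup>2) / 2" .
  have 2: "sqrt (tau z) * sqrt (tau z') \<le> (tau z + tau z') / 2" using am[of "sqrt (tau z)" "sqrt (tau z')"] B B' by simp
  have 3: "sqrt (vv z) * sqrt (vv z') \<le> (vv z + vv z') / 2" using am[of "sqrt (vv z)" "sqrt (vv z')"] B B' by simp
  show ?thesis using 1 2 3 sum_coords[of z] sum_coords[of z'] by (simp add: field_simps)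
qed

text \<open>On the sphere the squared distance is 2 - 2 \<open>dot\<close>, so the embedded points
  coincide. Equal \<open>tau\<close> and \<open>vv\<close> give equal t^2, and t >= 0 gives equal
  t.\<close>

lemma dot_eq_1:
  assumes z: "z \<in> LL a b c" "z' \<in> LL a b c" and d: "dot z z' = 1"
  shows "z = z'"
proof -
  note B = LL_bounds[OF z(1)] and B' = LL_bounds[OF z(2)]
  have "(norm (fst z - fst z'))\<^sup>2 + (sqrt (tau z) - sqrt (tau z'))\<^sup>2 + (sqrt (vv z) - sqrt (vv z'))\<^sup>2
     = ((norm (fst z))\<^sup>2 + tau z + vv z) + ((norm (fst z'))\<^sup>2 + tau z' + vv z') - 2 * dot z z'"
    unfolding dot_def power2_diff power2_norm_eq_inner using B B' by (simp add: inner_diff_left inner_diff_right inner_commute)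
  also have "\<dots> = 0" unfolding sum_coords d by simp
  finally have s: "(norm (fst z - fst z'))\<^sup>2 + (sqrt (tau z) - sqrt (tau z'))\<^sup>2 + (sqrt (vv z) - sqrt (vv z'))\<^sup>2 = 0" .
  then have "(norm (fst z - fst z'))\<^sup>2 = 0" "(sqrt (tau z) - sqrt (tau z'))\<^sup>2 = 0"
    using zero_le_power2[of "norm (fst z - fst z')"] zero_le_power2[of "sqrt (tau z) - sqrt (tau z')"] zero_le_power2[of "sqrt (vv z) - sqrt (vv z')"] by linarith+
  then have x: "fst z = fst z'" and t: "tau z = tau z'" using B B' by auto
  then have "(snd z)\<^sup>2 = (snd z')\<^sup>2" unfolding snd_sq by (simp add: vv_def)
  then have "snd z = snd z'" using B B' by simp
  then show ?thesis using x by (simp add: prod_eq_iff)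
qed

lemma ker_nonneg:
  assumes z: "z \<in> LL a b c" "z' \<in> LL a b c"
    and k: "\<And>x. \<bar>x\<bar> \<le> 1 \<Longrightarrow> 0 \<le> poly k x"
      "\<And>x. \<bar>x\<bar> \<le> 1 \<Longrightarrow> 0 \<le> poly ((pderiv ^^ 2) k) x"
      "\<And>x. \<bar>x\<bar> \<le> 1 \<Longrightarrow> 0 \<le> poly ((pderiv ^^ 4) k) x"
  shows "0 \<le> ker k z z'"
proof -
  note B = LL_bounds[OF z(1)] and B' = LL_bounds[OF z(2)]
  have "0 \<le> Phi bb gg k (fst z \<bullet> fst z') ((sqrt (tau z) * sqrt (tau z'))\<^sup>2) ((sqrt (vv z) * sqrt (vv z'))\<^sup>2)"
    by (rule Phi_nonneg[OF bb_pos gg_pos _ _ dot_le_abs[OF z] k]) (use B B' in auto)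
  then show ?thesis unfolding ker_def using B B' by (simp add: power_mult_distrib)
qed

text \<open>The de la Vallee Poussin polynomial \<open>(1 + x)\<^sup>N\<close>, whose lift concentrates on the diagonal.\<close>

definition VPp :: "nat \<Rightarrow> real poly" where "VPp N = pcompose (monom 1 N) [:1, 1:]"

lemma ker_VPp: "ker (VPp N) z z' = Phi bb gg (monom 1 N) (fst z \<bullet> fst z' + 1) (tau z * tau z') (vv z * vv z')"
  unfolding ker_def VPp_def Phi_shift ..

lemma degree_VPp: "degree (VPp N) = N"
  by (simp add: VPp_def degree_pcompose degree_monom_eq)

lemma ker_VPp_bounds:
  assumes z: "z \<in> LL a b c" "z' \<in> LL a b c"
  shows "0 \<le> ker (VPp N) z z'" "ker (VPp N) z z' \<le> (1 + 1 / bb) * (1 + 1 / gg) * real (Suc N) ^ 2 * (1 + dot z z') ^ N"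
proof -
  note B = LL_bounds[OF z(1)] and B' = LL_bounds[OF z(2)]
  have p: "0 \<le> sqrt (tau z) * sqrt (tau z')" "0 \<le> sqrt (vv z) * sqrt (vv z')" using B B' by auto
  have A: "fst z \<bullet> fst z' + 1 \<ge> 0" using dot_le_abs[OF z] p by linarith
  show "0 \<le> ker (VPp N) z z'" unfolding ker_VPp
    by (rule Phi_monom_nonneg[OF bb_pos gg_pos A]) (use B B' in auto)
  have e: "tau z * tau z' = (sqrt (tau z) * sqrt (tau z'))\<^sup>2" "vv z * vv z' = (sqrt (vv z) * sqrt (vv z'))\<^sup>2"
    using B B' by (simp_all add: power_mult_distrib)
  show "ker (VPp N) z z' \<le> (1 + 1 / bb) * (1 + 1 / gg) * real (Suc N) ^ 2 * (1 + dot z z') ^ N"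
    unfolding ker_VPp e using Phi_monom_le[OF bb_pos gg_pos A p, of N] by (simp add: dot_def add_ac)
qed

end

section \<open>An approximate identity\<close>

text \<open>The three-term recurrence at 1 contains a subtraction. The first-order relation, carried
  along in the induction, rewrites the subtracted term as a multiple of the preceding value and so
  makes positivity visible.\<close>

lemma poly_gegen_1_pos:
  assumes s: "s > 0"
  shows "poly (gegen s n) 1 > 0 \<and> (real n + 1) * poly (gegen s (Suc n)) 1 = (2 * s + real n) * poly (gegen s n) 1"
proof (induction n)
  case 0
  show ?case by (simp add: gegen_1)
next
  case (Suc n)
  let ?p = "\<lambda>n. poly (gegen s n) 1"
  have "(real n + 1) * ?p (Suc n) > 0" using Suc s by (simp add: add_pos_nonneg)
  then have pos: "?p (Suc n) > 0" by (simp add: zero_less_mult_iff)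
  have "(real n + 2) * ?p (Suc (Suc n)) = 2 * (real n + 1 + s) * ?p (Suc n) - (real n + 2 * s) * ?p n"
    using arg_cong[OF gegen_rec[of n s], of "\<lambda>p. poly p 1"] by simp
  also have "(real n + 2 * s) * ?p n = (real n + 1) * ?p (Suc n)" using Suc by (simp add: add.commute)
  finally have "(real n + 2) * ?p (Suc (Suc n)) = (2 * s + real (Suc n)) * ?p (Suc n)" by (simp add: algebra_simps)
  then show ?case using pos by (simp add: add.commute)
qed

lemma Suc_sq_geometric_tendsto_0:
  assumes "0 \<le> r" "r < (1::real)"
  shows "(\<lambda>n. real (Suc n) ^ 2 * r ^ n) \<longlonglongrightarrow> 0"
proof -
  define s where "s = sqrt r"
  have s: "0 \<le> s" "s < 1" "s ^ 2 = r" using assms by (auto simp: s_def)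
  have "(\<lambda>n. real n * s ^ n + s ^ n) \<longlonglongrightarrow> 0 + 0"
    using s by (intro tendsto_add powser_times_n_limit_0 LIMSEQ_realpow_zero) auto
  then have "(\<lambda>n. (real n * s ^ n + s ^ n) ^ 2) \<longlonglongrightarrow> (0 + 0) ^ 2" by (rule tendsto_power)
  moreover have "(real n * s ^ n + s ^ n) ^ 2 = real (Suc n) ^ 2 * r ^ n" for n
  proof -
    have "(real n * s ^ n + s ^ n) ^ 2 = (real (Suc n) * s ^ n) ^ 2" by (simp add: algebra_simps)
    also have "\<dots> = real (Suc n) ^ 2 * (s ^ 2) ^ n" by (simp only: power_mult_distrib power_mult[symmetric] mult.commute)
    finally show ?thesis using s by simp
  qed
  ultimately show ?thesis by simp
qed

context hyperboloid
begin

definition LL_interior :: "'d pt set" where "LL_interior = {z. tau z > 0 \<and> vv z > 0 \<and> snd z > 0}"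

lemma open_LL_interior: "open LL_interior"
proof -
  have "LL_interior = {z. 0 < tau z} \<inter> {z. 0 < vv z} \<inter> {z. 0 < snd z}" unfolding LL_interior_def by auto
  moreover have "open {z. 0 < tau z}" "open {z. 0 < vv z}" "open {z :: 'd pt. 0 < snd z}"
    by (intro open_Collect_less continuous_on_const tau_continuous vv_continuous continuous_on_snd continuous_on_id)+
  ultimately show ?thesis by auto
qed

lemma emeasure_mu_open_pos:
  assumes U: "open U" "U \<subseteq> LL_interior" "U \<noteq> {}"
  shows "emeasure mu U > 0"
proof (rule ccontr)
  assume "\<not> emeasure mu U > 0"
  then have z: "emeasure mu U = 0" by simp
  have [measurable]: "U \<in> sets borel" using U by simp
  have "(\<integral>\<^sup>+z. ennreal (indicator (LL a b c) z * WW a b c \<beta> \<gamma> z) * indicator U z \<partial>lborel) = 0"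
    using z by (subst nn_integral_mu[symmetric]) auto
  then have "AE z in lborel. ennreal (indicator (LL a b c) z * WW a b c \<beta> \<gamma> z) * indicator U z = 0"
    by (subst (asm) nn_integral_0_iff_AE) auto
  then have "AE z in lborel. z \<notin> U"
  proof eventually_elim
    case (elim z)
    show ?case
    proof
      assume zU: "z \<in> U"
      then have p: "tau z > 0" "vv z > 0" "snd z > 0" using U by (auto simp: LL_interior_def)
      then have "z \<in> LL a b c" by (simp add: mem_LL)
      moreover have "WW a b c \<beta> \<gamma> z > 0" unfolding WW_eq using p by simp
      ultimately show False using elim zU by simp
    qed
  qed
  then have e0: "emeasure lborel U = 0" by (subst (asm) AE_iff_measurable[OF _ refl]) auto
  obtain x where "x \<in> U" using U by blast
  then obtain e where e: "e > 0" "ball x e \<subseteq> U" using U openE by blast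
  have "emeasure lborel (ball x e) \<le> emeasure lborel U" by (rule emeasure_mono[OF e(2)]) simp
  then have "emeasure lborel (ball x e) = 0" using e0 by simp
  then have "measure lborel (ball x e) = 0" by (simp add: measure_def)
  then show False using content_ball_pos[OF e(1), of x] by simp
qed

text \<open>A boundary point where \<open>tau\<close> and \<open>vv\<close> vanish, so that kernels degenerate to polynomials in one inner product.\<close>

definition zb :: "'d pt" where "zb = (axis undefined 1, sqrt c)"

lemma zb: "norm (fst zb) = 1" "tau zb = 0" "vv zb = 0" "zb \<in> LL a b c"
proof -
  show 1: "norm (fst zb) = 1" by (simp add: zb_def norm_axis_1)
  show 2: "tau zb = 0" using 1 c_nonneg unfolding tau_def by (simp add: zb_def)
  show 3: "vv zb = 0" unfolding vv_def 1 2 by simp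
  show "zb \<in> LL a b c" unfolding mem_LL 2 3 using c_nonneg by (simp add: zb_def)
qed

lemma ker_zb: "ker k zb z = poly k (fst zb \<bullet> fst z)"
  unfolding ker_def zb by (simp add: Phi_00)

lemma LL_interior_near_zb:
  assumes e: "0 < e" "e < 1"
  shows "{z \<in> LL_interior. fst zb \<bullet> fst z > 1 - e} \<noteq> {}"
proof -
  define r where "r = 1 - e / 2"
  define s where "s = r\<^sup>2"
  have r: "0 < r" "r < 1" using e by (auto simp: r_def)
  have s: "0 < s" "s < 1" unfolding s_def using r by (auto simp: power_less_one_iff)
  \<comment> \<open>The square of t for which \<open>tau\<close> and \<open>vv\<close> share the
    remaining 1 - |x|^2 equally, so that both are positive.\<close>
  define t2 where "t2 = (b - a) * ((1 - s) / 2) + (a * (1 - s) + c * s)"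
  have "0 \<le> a * (1 - s) + c * s" using a_nonneg c_nonneg s by (intro add_nonneg_nonneg mult_nonneg_nonneg) auto
  moreover have "0 < (b - a) * ((1 - s) / 2)" using a_less_b s by simp
  ultimately have t2: "t2 > 0" unfolding t2_def by linarith
  define z :: "'d pt" where "z = (r *\<^sub>R fst zb, sqrt t2)"
  have n: "(norm (fst z))\<^sup>2 = s" unfolding z_def s_def using zb(1) r by (simp add: power_mult_distrib)
  have "tau z = (1 - s) / 2"
    unfolding tau_def n using t2 a_less_b by (simp add: z_def t2_def field_simps)
  moreover from this have "vv z = (1 - s) / 2" unfolding vv_def n by (simp add: field_simps)
  moreover have "fst zb \<bullet> fst z = r" using zb(1) by (simp add: z_def norm_eq_1)
  ultimately have "z \<in> {z \<in> LL_interior. fst zb \<bullet> fst z > 1 - e}" unfolding LL_interior_def using s t2 e by (simp add: z_def r_def)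
  then show ?thesis by blast
qed

text \<open>Vanishing almost everywhere for the measure gives zeros on a nonempty open set, and then
  everywhere. This strength is needed because \<open>proj\<close> is a definite description over
  functions on the whole space.\<close>

lemma polysE_zero_of_integral_sq:
  assumes d: "d \<in> polysE n" and z: "(\<integral>z. d z * d z \<partial>mu) = 0"
  shows "d = (\<lambda>z. 0)"
proof -
  have [measurable]: "d \<in> borel_measurable borel" by (rule polysE_measurable[OF d])
  have "AE z in mu. d z * d z = 0"
    using z integral_nonneg_eq_0_iff_AE[OF integrable_polysE_mult[OF d d]] by simp
  then have ae: "AE z in mu. z \<notin> {z. d z \<noteq> 0}" by simp
  have ms: "{z. d z \<noteq> 0} \<in> sets mu" by simp
  have e0: "emeasure mu {z. d z \<noteq> 0} = 0" using ae by (subst (asm) AE_iff_measurable[OF ms]) auto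
  define U where "U = LL_interior \<inter> {z. d z \<noteq> 0}"
  have "open {z. d z \<noteq> 0}" using open_Collect_neq[OF polysE_continuous[OF d] continuous_on_const] .
  then have "open U" unfolding U_def using open_LL_interior by blast
  moreover have "emeasure mu U \<le> emeasure mu {z. d z \<noteq> 0}" by (rule emeasure_mono[OF _ ms]) (auto simp: U_def)
  ultimately have "U = {}" using emeasure_mu_open_pos[of U] e0 by (auto simp: U_def)
  then have v: "\<And>z. z \<in> LL_interior \<Longrightarrow> d z = 0" by (auto simp: U_def)
  have "LL_interior \<noteq> {}" using LL_interior_near_zb[of "1/2"] by auto
  then show ?thesis
    by (rule real_polynomial_function_vanish[OF polys_real_polynomial_function[OF polysE_D[OF d]] open_LL_interior _ v])
qed

lemma measure_mu [simp]: "measure mu UNIV = K0"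
  using K0_pos by (simp add: measure_def emeasure_mu)

lemma integral_const_mu: "(\<integral>z. s \<partial>mu) = s * K0" for s :: real
  using K0_pos by (simp add: measure_def emeasure_mu)

lemma const_V0: "(\<lambda>z. s) \<in> V 0"
  unfolding VE_iff by (simp add: polysE_const)

lemma ker_zon_0: "ker (zon lam 0) z z' = 1"
proof -
  have "zon lam 0 = monom 1 0" using lam_pos by (simp add: monom_0 one_pCons)
  then show ?thesis unfolding ker_def using Phi_monom[of 0 0 bb gg] by (simp add: tcoef_def wcoef_def)
qed

lemma integral_ker_expansion:
  assumes k: "k = (\<Sum>j\<le>N. smult (\<kappa> j) (zon lam j))" and q: "q \<in> V n"
  shows "(\<integral>z'. ker k z z' * q z' \<partial>mu) = (if n \<le> N then \<kappa> n * (\<integral>z'. ker (zon lam n) z z' * q z' \<partial>mu) else 0)"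
proof -
  have qE: "q \<in> polysE n" using q VE_iff by blast
  have "(\<integral>z'. ker k z z' * q z' \<partial>mu) = (\<integral>z'. (\<Sum>j\<le>N. \<kappa> j * (ker (zon lam j) z z' * q z')) \<partial>mu)"
    unfolding k ker_sum ker_smult sum_distrib_right by (simp only: mult.assoc)
  also have "\<dots> = (\<Sum>j\<le>N. \<kappa> j * (\<integral>z'. ker (zon lam j) z z' * q z' \<partial>mu))"
    by (subst Bochner_Integration.integral_sum) (auto intro!: integrable_mult_right ker_polysE_integrable[OF qE])
  also have "\<dots> = (\<Sum>j\<le>N. if j = n then \<kappa> n * (\<integral>z'. ker (zon lam n) z z' * q z' \<partial>mu) else 0)"
    by (intro sum.cong refl) (auto simp: ker_zon_orth[OF q])
  finally show ?thesis by simp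
qed

definition cN :: "nat \<Rightarrow> real" where "cN N = (\<integral>z'. ker (VPp N) zb z' \<partial>mu)"

text \<open>In the zonal expansion every term but the constant one is orthogonal to 1, so the mass
  is the same at all points and may be computed at \<open>zb\<close>.\<close>

lemma VP_mass: "(\<integral>z'. ker (VPp N) z z' \<partial>mu) = cN N"
proof -
  obtain \<kappa> where k: "VPp N = (\<Sum>j\<le>N. smult (\<kappa> j) (zon lam j))"
    using zon_expansion[OF lam_pos, of "VPp N" N] degree_VPp by auto
  have "(\<integral>z'. ker (VPp N) z z' \<partial>mu) = \<kappa> 0 * K0" for z
    using integral_ker_expansion[OF k const_V0[of 1], of z] by (simp add: ker_zon_0 integral_const_mu)
  then show ?thesis unfolding cN_def by simp
qed

text \<open>At \<open>zb\<close> there is no lift: the kernel is the N-th power of 1 + zb.x, at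
  least (2 - e)^N on a neighbourhood, inside the domain, that has positive measure.\<close>

lemma cN_lower:
  assumes e: "0 < e" "e < 1"
  shows "\<exists>m>0. \<forall>N. m * (2 - e) ^ N \<le> cN N"
proof -
  define U where "U = {z \<in> LL_interior. fst zb \<bullet> fst z > 1 - e}"
  have "open {z :: 'd pt. 1 - e < fst zb \<bullet> fst z}" by (intro open_Collect_less continuous_intros)
  moreover have "U = LL_interior \<inter> {z. 1 - e < fst zb \<bullet> fst z}" by (auto simp: U_def)
  ultimately have oU: "open U" using open_LL_interior by auto
  have pos: "emeasure mu U > 0" by (rule emeasure_mu_open_pos[OF oU]) (use LL_interior_near_zb[OF e] in \<open>auto simp: U_def\<close>)
  have fin: "emeasure mu U < \<infinity>" using mu.emeasure_finite[of U] by (simp add: less_top[symmetric])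
  have mp: "measure mu U > 0" using pos fin by (simp add: measure_def enn2real_positive_iff)
  have [measurable]: "U \<in> sets borel" using oU by simp
  have "measure mu U * (2 - e) ^ N \<le> cN N" for N
  proof -
    have "measure mu U * (2 - e) ^ N = (\<integral>z. (2 - e) ^ N * indicator U z \<partial>mu)" by simp
    also have "\<dots> \<le> (\<integral>z. ker (VPp N) zb z \<partial>mu)"
    proof (rule integral_mono_AE)
      show "integrable mu (\<lambda>z. (2 - e) ^ N * indicator U z)"
        by (intro integrable_mult_right integrable_real_indicator) (use fin in auto)
      show "integrable mu (\<lambda>z. ker (VPp N) zb z)" using ker_polysE_integrable[OF polysE_const, of "VPp N" zb 1] by simp
      show "AE z in mu. (2 - e) ^ N * indicator U z \<le> ker (VPp N) zb z"
        using AE_mu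
      proof eventually_elim
        case (elim z)
        show ?case
        proof (cases "z \<in> U")
          case True
          then have "2 - e \<le> fst zb \<bullet> fst z + 1" by (simp add: U_def)
          then have "(2 - e) ^ N \<le> (fst zb \<bullet> fst z + 1) ^ N" using e by (intro power_mono) auto
          then show ?thesis using True by (simp add: ker_zb VPp_def poly_pcompose poly_monom add.commute)
        next
          case False
          then show ?thesis using ker_VPp_bounds(1)[OF zb(4) elim] by simp
        qed
      qed
    qed
    finally show ?thesis by (simp add: cN_def)
  qed
  then show ?thesis using mp by blast
qed

lemma cN_pos: "cN N > 0"
proof -
  obtain m where m: "m > 0" "\<forall>N. m * (2 - 1/2) ^ N \<le> cN N" using cN_lower[of "1/2"] by auto
  have "0 < m * (2 - 1/2) ^ N" using m by simp
  then show ?thesis using m(2) less_le_trans by blast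
qed

lemma dot_continuous: "continuous_on S (dot z)"
  unfolding dot_def[abs_def] by (intro continuous_intros tau_continuous vv_continuous)

lemma dot_le_1: "z \<in> LL a b c \<Longrightarrow> z' \<in> LL a b c \<Longrightarrow> dot z z' \<le> 1"
  using dot_le_abs[of z z'] unfolding dot_def by linarith

text \<open>Where q differs from q z by at least r/2, compactness and \<open>dot_eq_1\<close> keep
  \<open>dot\<close> below 1 - e. There the kernel is at most a constant times (N + 1)^2 (2 - e)^N,
  geometrically small against the total mass.\<close>

lemma VP_tendsto:
  assumes q: "q \<in> polysE m" and z: "z \<in> LL a b c"
  shows "(\<lambda>N. (\<integral>z'. ker (VPp N) z z' * q z' \<partial>mu) / cN N) \<longlonglongrightarrow> q z"
proof (rule LIMSEQ_I)
  fix r :: real assume r: "r > 0"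
  define S where "S = {z' \<in> LL a b c. r / 2 \<le> \<bar>q z' - q z\<bar>}"
  have "S = LL a b c \<inter> {z'. r / 2 \<le> \<bar>q z' - q z\<bar>}" by (auto simp: S_def)
  moreover have "closed {z'. r / 2 \<le> \<bar>q z' - q z\<bar>}"
    by (intro closed_Collect_le continuous_on_const continuous_on_rabs continuous_on_diff polysE_continuous[OF q])
  ultimately have cS: "compact S" using LL_compact compact_Int_closed by metis
  have "\<exists>e. 0 < e \<and> e < 1 \<and> (\<forall>z'\<in>S. dot z z' \<le> 1 - e)"
  proof (cases "S = {}")
    case True
    then show ?thesis by (intro exI[of _ "1/2"]) auto
  next
    case False
    obtain w where w: "w \<in> S" "\<forall>z'\<in>S. dot z z' \<le> dot z w"
      using continuous_attains_sup[OF cS False dot_continuous] by blast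
    have "w \<in> LL a b c" "w \<noteq> z" using w r by (auto simp: S_def)
    then have "dot z w < 1" using dot_le_1[OF z] dot_eq_1[OF z] by (metis order_le_less)
    then show ?thesis using w by (intro exI[of _ "min (1/2) (1 - dot z w)"]) (auto intro: order_trans)
  qed
  then obtain e where e: "0 < e" "e < 1" "\<And>z'. z' \<in> S \<Longrightarrow> dot z z' \<le> 1 - e" by blast
  obtain B where B: "\<And>z'. z' \<in> LL a b c \<Longrightarrow> \<bar>q z' - q z\<bar> \<le> B"
    using continuous_on_LL_bound[OF continuous_on_diff[OF polysE_continuous[OF q] continuous_on_const]] by blast
  have B0: "B \<ge> 0" using B[OF z] by simp
  \<comment> \<open>Taking e/2 here leaves a gap between the bases 2 - e and 2 - e/2, which also
    beats the factor (N + 1)^2.\<close>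
  obtain m0 where m0: "m0 > 0" "\<And>N. m0 * (2 - e / 2) ^ N \<le> cN N" using cN_lower[of "e / 2"] e by auto
  define C where "C = (1 + 1 / bb) * (1 + 1 / gg)"
  have C0: "C \<ge> 0" unfolding C_def using bb_pos gg_pos by simp
  have main: "\<bar>(\<integral>z'. ker (VPp N) z z' * q z' \<partial>mu) / cN N - q z\<bar> \<le> r / 2 + (C * B * K0 / m0) * (real (Suc N) ^ 2 * ((2 - e) / (2 - e / 2)) ^ N)" for N
  proof -
    let ?k = "ker (VPp N) z"
    let ?T = "C * real (Suc N) ^ 2 * (2 - e) ^ N * B"
    have ik: "integrable mu ?k" using ker_polysE_integrable[OF polysE_const, of "VPp N" z 1] by simp
    have iq: "integrable mu (\<lambda>z'. ?k z' * (q z' - q z))" by (rule ker_polysE_integrable[OF polysE_diff[OF q polysE_const]])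
    have "(\<integral>z'. ?k z' * (q z' - q z) \<partial>mu) = (\<integral>z'. ?k z' * q z' \<partial>mu) - (\<integral>z'. ?k z' * q z \<partial>mu)"
      unfolding right_diff_distrib by (rule Bochner_Integration.integral_diff[OF ker_polysE_integrable[OF q] ker_polysE_integrable[OF polysE_const]])
    also have "(\<integral>z'. ?k z' * q z \<partial>mu) = cN N * q z" using VP_mass by simp
    finally have d: "(\<integral>z'. ?k z' * q z' \<partial>mu) - cN N * q z = (\<integral>z'. ?k z' * (q z' - q z) \<partial>mu)" by simp
    have "\<bar>\<integral>z'. ?k z' * (q z' - q z) \<partial>mu\<bar> \<le> (\<integral>z'. \<bar>?k z' * (q z' - q z)\<bar> \<partial>mu)" by (rule integral_abs_bound)
    also have "\<dots> \<le> (\<integral>z'. r / 2 * ?k z' + ?T \<partial>mu)"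
    proof (rule integral_mono_AE)
      show "integrable mu (\<lambda>z'. \<bar>?k z' * (q z' - q z)\<bar>)" using iq by simp
      show "integrable mu (\<lambda>z'. r / 2 * ?k z' + ?T)" using ik by simp
      show "AE z' in mu. \<bar>?k z' * (q z' - q z)\<bar> \<le> r / 2 * ?k z' + ?T"
        using AE_mu
      proof eventually_elim
        case (elim z')
        note kb = ker_VPp_bounds[OF z elim, of N]
        have T0: "?T \<ge> 0" using C0 B0 e by (intro mult_nonneg_nonneg) auto
        show ?case
        proof (cases "z' \<in> S")
          case False
          then have "\<bar>q z' - q z\<bar> \<le> r / 2" using elim by (auto simp: S_def)
          then have "?k z' * \<bar>q z' - q z\<bar> \<le> ?k z' * (r / 2)" using kb by (intro mult_left_mono)
          moreover have "\<bar>?k z' * (q z' - q z)\<bar> = ?k z' * \<bar>q z' - q z\<bar>" using kb by (simp add: abs_mult)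
          ultimately show ?thesis using T0 by (simp add: mult.commute)
        next
          case True
          have d0: "0 \<le> 1 + dot z z'"
            using dot_le_abs[OF z elim] LL_bounds[OF z] LL_bounds[OF elim] unfolding dot_def
            by (smt (verit) mult_nonneg_nonneg real_sqrt_ge_zero)
          have "(1 + dot z z') ^ N \<le> (2 - e) ^ N" using e(3)[OF True] d0 by (intro power_mono) auto
          then have "?k z' \<le> C * real (Suc N) ^ 2 * (2 - e) ^ N"
            using kb(2) C0 unfolding C_def[symmetric] by (smt (verit) mult_left_mono mult_nonneg_nonneg zero_le_power2)
          then have "?k z' * \<bar>q z' - q z\<bar> \<le> ?T" using B[OF elim] kb B0 C0 e by (intro mult_mono) auto
          moreover have "\<bar>?k z' * (q z' - q z)\<bar> = ?k z' * \<bar>q z' - q z\<bar>" using kb by (simp add: abs_mult)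
          ultimately show ?thesis using kb r by (smt (verit) mult_nonneg_nonneg zero_le_divide_iff)
        qed
      qed
    qed
    also have "\<dots> = r / 2 * cN N + ?T * K0"
      using ik VP_mass by (simp add: integral_const_mu)
    finally have I: "\<bar>(\<integral>z'. ?k z' * q z' \<partial>mu) - cN N * q z\<bar> \<le> r / 2 * cN N + ?T * K0" unfolding d .
    have cp: "cN N > 0" by (rule cN_pos)
    have "\<bar>A / s - x\<bar> = \<bar>A - s * x\<bar> / s" if "s > 0" for A s x :: real
    proof -
      have "A / s - x = (A - s * x) / s" using that by (simp add: diff_divide_distrib)
      then show ?thesis using that by (simp add: abs_divide)
    qed
    from this[OF cp] have "\<bar>(\<integral>z'. ?k z' * q z' \<partial>mu) / cN N - q z\<bar> = \<bar>(\<integral>z'. ?k z' * q z' \<partial>mu) - cN N * q z\<bar> / cN N" .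
    also have "\<dots> \<le> (r / 2 * cN N + ?T * K0) / cN N" using I cp by (simp add: divide_right_mono)
    also have "\<dots> = r / 2 + ?T * K0 / cN N" using cp by (simp add: add_divide_distrib)
    also have "?T * K0 / cN N \<le> ?T * K0 / (m0 * (2 - e / 2) ^ N)"
      using m0 e C0 B0 K0_pos by (intro divide_left_mono mult_pos_pos cp mult_nonneg_nonneg) auto
    also have "\<dots> = (C * B * K0 / m0) * (real (Suc N) ^ 2 * ((2 - e) / (2 - e / 2)) ^ N)"
      by (simp add: power_divide)
    finally show ?thesis by simp
  qed
  define D where "D = C * B * K0 / m0"
  define \<rho> where "\<rho> = (2 - e) / (2 - e / 2)"
  have \<rho>: "0 \<le> \<rho>" "\<rho> < 1" unfolding \<rho>_def using e by auto
  have "(\<lambda>N. D * (real (Suc N) ^ 2 * \<rho> ^ N)) \<longlonglongrightarrow> D * 0"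
    by (rule tendsto_mult[OF tendsto_const Suc_sq_geometric_tendsto_0[OF \<rho>]])
  then have "(\<lambda>N. D * (real (Suc N) ^ 2 * \<rho> ^ N)) \<longlonglongrightarrow> 0" by simp
  from LIMSEQ_D[OF this, of "r / 2"] r obtain no where no: "\<And>N. N \<ge> no \<Longrightarrow> \<bar>D * (real (Suc N) ^ 2 * \<rho> ^ N)\<bar> < r / 2"
    by auto
  have "norm ((\<integral>z'. ker (VPp N) z z' * q z' \<partial>mu) / cN N - q z) < r" if "N \<ge> no" for N
  proof -
    have "\<bar>(\<integral>z'. ker (VPp N) z z' * q z' \<partial>mu) / cN N - q z\<bar> \<le> r / 2 + D * (real (Suc N) ^ 2 * \<rho> ^ N)"
      unfolding D_def \<rho>_def by (rule main)
    also have "\<dots> \<le> r / 2 + \<bar>D * (real (Suc N) ^ 2 * \<rho> ^ N)\<bar>" by simp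
    also have "\<dots> < r / 2 + r / 2" using no[OF that] by (rule add_strict_left_mono)
    finally show ?thesis by simp
  qed
  then show "\<exists>no. \<forall>n\<ge>no. norm ((\<integral>z'. ker (VPp n) z z' * q z' \<partial>mu) / cN n - q z) < r" by blast
qed

end

section \<open>The orthogonal projections\<close>

text \<open>Finite sums of products with a common degree bound. For such kernels integrability,
  exchange of integrals and the degree of the image all follow by induction on the sum.\<close>

inductive finite_rank :: "nat \<Rightarrow> ('d::finite pt \<Rightarrow> 'd pt \<Rightarrow> real) \<Rightarrow> bool" where
  prod: "\<phi> \<in> polysE n \<Longrightarrow> \<psi> \<in> polysE n \<Longrightarrow> finite_rank n (\<lambda>z z'. \<phi> z * \<psi> z')"
| plus: "finite_rank n K \<Longrightarrow> finite_rank n K' \<Longrightarrow> finite_rank n (\<lambda>z z'. K z z' + K' z z')"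

lemma finite_rank_zero: "finite_rank n (\<lambda>z z'. 0)"
  using finite_rank.prod[OF polysE_const[of 0] polysE_const[of 0]] by simp

lemma finite_rank_const: "finite_rank n (\<lambda>z z'. s)"
  using finite_rank.prod[OF polysE_const[of s] polysE_const[of 1]] by simp

lemma finite_rank_sum: "(\<And>i. i \<in> I \<Longrightarrow> finite_rank n (K i)) \<Longrightarrow> finite_rank n (\<lambda>z z'. \<Sum>i\<in>I. K i z z')"
  by (induction I rule: infinite_finite_induct) (auto intro: finite_rank_zero finite_rank.plus)

lemma finite_rank_mult:
  assumes "finite_rank n K" "finite_rank m K'"
  shows "finite_rank (n + m) (\<lambda>z z'. K z z' * K' z z')"
  using assms
proof (induction rule: finite_rank.induct)
  case (prod \<phi> n \<psi>)
  from prod.prems prod.hyps show ?case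
  proof (induction rule: finite_rank.induct)
    case (prod \<phi>' m \<psi>')
    have "finite_rank (n + m) (\<lambda>z z'. (\<phi> z * \<phi>' z) * (\<psi> z' * \<psi>' z'))"
      by (intro finite_rank.prod polysE_mult prod)
    then show ?case by (simp add: mult_ac)
  next
    case (plus m K K')
    then show ?case using finite_rank.plus[OF plus.IH(1) plus.IH(2)] by (simp add: distrib_left)
  qed
next
  case (plus n K1 K2)
  then show ?case using finite_rank.plus by (simp add: distrib_right)
qed

lemma finite_rank_power: "finite_rank n K \<Longrightarrow> finite_rank (k * n) (\<lambda>z z'. K z z' ^ k)"
proof (induction k)
  case 0 show ?case using finite_rank_const[of 0 1] by simp
next
  case (Suc k) then show ?case using finite_rank_mult[of n K "k * n" "\<lambda>z z'. K z z' ^ k"] by simp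
qed

lemma finite_rank_mono: "finite_rank n K \<Longrightarrow> n \<le> m \<Longrightarrow> finite_rank m K"
  by (induction rule: finite_rank.induct) (auto intro: finite_rank.intros polysE_mono)

lemma finite_rank_transpose: "finite_rank n K \<Longrightarrow> finite_rank n (\<lambda>z z'. K z' z)"
proof (induction rule: finite_rank.induct)
  case (prod \<phi> n \<psi>)
  have "(\<lambda>z z'. \<phi> z' * \<psi> z) = (\<lambda>z z'. \<psi> z * \<phi> z')" by (intro ext mult.commute)
  then show ?case using finite_rank.prod[OF prod(2,1)] by simp
qed (rule finite_rank.plus)

lemma finite_rank_inner: "finite_rank 1 (\<lambda>(z :: 'd::finite pt) z'. fst z \<bullet> fst z')"
proof -
  have "finite_rank 1 (\<lambda>(z :: 'd pt) z'. \<Sum>i\<in>UNIV. fst z $ i * fst z' $ i)"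
    by (intro finite_rank_sum finite_rank.prod polysE_nth)
  then show ?thesis by (simp add: inner_vec_def)
qed

context hyperboloid
begin

text \<open>By the approximate identity the kernel acts on \<open>V n\<close> as a scalar. Its value is found at \<open>zb\<close>, testing the positive Cesaro
  kernels against a function that is Lipschitz in \<open>1 - zb \<bullet> x\<close>, in the manner of Korovkin.\<close>

theorem ker_zon_reproducing:
  assumes q: "q \<in> V n" and z: "z \<in> LL a b c"
  shows "(\<integral>z'. ker (zon lam n) z z' * q z' \<partial>mu) = K0 * q z"
proof -
  define E where "E q z = (\<integral>z'. ker (zon lam n) z z' * q z' \<partial>mu)" for q z
  have "\<forall>N. \<exists>\<kappa>. VPp N = (\<Sum>j\<le>N. smult (\<kappa> j) (zon lam j))"
    using zon_expansion[OF lam_pos] degree_VPp by (metis order_refl)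
  then obtain \<kappa> where \<kappa>: "\<And>N. VPp N = (\<Sum>j\<le>N. smult (\<kappa> N j) (zon lam j))" by metis
  \<comment> \<open>As soon as N >= n, only the n-th zonal term of \<open>VPp N\<close> acts on
    \<open>V n\<close>, with a scalar that depends neither on q nor on z.\<close>
  have lim: "(\<lambda>N. \<kappa> N n / cN N * E q z) \<longlonglongrightarrow> q z" if q: "q \<in> V n" and z: "z \<in> LL a b c" for q z
  proof -
    have "q \<in> polysE n" using q VE_iff by blast
    from VP_tendsto[OF this z] show ?thesis
    proof (rule Lim_transform_eventually)
      show "eventually (\<lambda>N. (\<integral>z'. ker (VPp N) z z' * q z' \<partial>mu) / cN N = \<kappa> N n / cN N * E q z) sequentially"
        using eventually_ge_at_top[of n] by eventually_elim (simp add: integral_ker_expansion[OF \<kappa> q] E_def)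
    qed
  qed
  define q0 where "q0 = ker (zon lam n) zb"
  have q0V: "q0 \<in> V n" unfolding q0_def by (rule ker_zon_VE)
  define f where "f = zon lam n"
  define \<zeta> where "\<zeta> z = fst zb \<bullet> fst z" for z :: "'d pt"
  have q0f: "q0 z = poly f (\<zeta> z)" for z by (simp add: q0_def ker_zb f_def \<zeta>_def)
  have zz: "\<zeta> zb = 1" using zb(1) by (simp add: \<zeta>_def norm_eq_1)
  have f1: "poly f 1 > 0" unfolding f_def zon_def using poly_gegen_1_pos[OF lam_pos, of n] lam_pos by simp
  have zabs: "\<bar>\<zeta> z\<bar> \<le> 1" if "z \<in> LL a b c" for z
    using dot_le_abs[OF zb(4) that] by (simp add: zb \<zeta>_def)
  have zV: "\<zeta> \<in> V 1"
  proof -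
    have "ker (zon lam 1) zb z = 2 * (lam + 1) * \<zeta> z" for z
      using zon_1[OF lam_pos] by (simp add: ker_zb \<zeta>_def)
    then have "\<zeta> = (\<lambda>z. (1 / (2 * (lam + 1))) * ker (zon lam 1) zb z)" using lam_pos by (simp add: fun_eq_iff)
    then show ?thesis using VE_smult[OF ker_zon_VE] by metis
  qed
  have z2: "(\<integral>z. \<zeta> z * \<zeta> z \<partial>mu) = K0 / (2 * (lam + 1))"
  proof -
    have "(\<integral>z. \<zeta> z * \<zeta> z \<partial>mu) = (\<integral>z. ridge (fst zb) 2 0 0 z \<partial>mu)"
      by (simp add: ridge_def \<zeta>_def power2_eq_square inner_commute)
    also have "\<dots> = K0 / (2 * (lam + 1))" unfolding integral_ridge using zb(1) by (simp add: kap_def)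
    finally show ?thesis .
  qed
  \<comment> \<open>Derivatives of order 0 are enough here, since at \<open>zb\<close> the kernel is
    the polynomial itself.\<close>
  obtain M :: nat where M: "2 * (lam + 1 + real 0) \<le> real M" using real_arch_simple by blast
  let ?S = "\<lambda>N z. ker (Spoly lam (Suc M) N) zb z"
  let ?cw = "cw (Suc M)"
  have S0: "?S N z \<ge> 0" if "z \<in> LL a b c" for N z
    unfolding ker_zb using poly_Spoly_nonneg[OF lam_pos zabs[OF that, unfolded \<zeta>_def] M] by simp
  have mass: "(\<integral>z. ?S N z \<partial>mu) = ?cw N * K0" for N
    using integral_ker_expansion[OF Spoly_def const_V0[of 1]] by (simp add: ker_zon_0 integral_const_mu)
  \<comment> \<open>The mass for \<open>Suc N\<close> is \<open>?cw (Suc N) * K0\<close>, so the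
    integral of 1 - zeta against the kernel is a difference of neighbouring weights, small relative
    to the mass.\<close>
  have S1: "(\<integral>z. ?S (Suc N) z * \<zeta> z \<partial>mu) = ?cw N * K0" for N
  proof -
    have "(\<integral>z. ker (zon lam 1) zb z * \<zeta> z \<partial>mu) = (\<integral>z. 2 * (lam + 1) * (\<zeta> z * \<zeta> z) \<partial>mu)"
      using zon_1[OF lam_pos] by (simp add: ker_zb \<zeta>_def mult_ac)
    also have "\<dots> = K0" using z2 lam_pos by simp
    finally show ?thesis using integral_ker_expansion[OF Spoly_def zV, of "Suc M" "Suc N" zb] by simp
  qed
  have Sn: "(\<integral>z. ?S (N + n) z * q0 z \<partial>mu) = ?cw N * E q0 zb" for N
    using integral_ker_expansion[OF Spoly_def q0V, of "Suc M" "N + n" zb] by (simp add: E_def)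
  obtain g where g: "f - [:poly f 1:] = [:- 1, 1:] * g"
    using poly_eq_0_iff_dvd[of "f - [:poly f 1:]" 1] by auto
  have "compact (poly g ` {-1..1})" by (intro compact_continuous_image continuous_on_poly continuous_on_id compact_Icc)
  then have "bounded (poly g ` {-1..1})" by (rule compact_imp_bounded)
  then obtain L where L: "\<And>x. x \<in> {-1..1} \<Longrightarrow> \<bar>poly g x\<bar> \<le> L"
    unfolding bounded_iff ball_simps real_norm_def by blast
  have Lip: "\<bar>poly f x - poly f 1\<bar> \<le> L * (1 - x)" if "\<bar>x\<bar> \<le> 1" for x
  proof -
    have "poly f x - poly f 1 = (x - 1) * poly g x" using arg_cong[OF g, of "\<lambda>p. poly p x"] by (simp add: algebra_simps)
    then have "\<bar>poly f x - poly f 1\<bar> = (1 - x) * \<bar>poly g x\<bar>" using that by (simp add: abs_mult)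
    also have "\<dots> \<le> (1 - x) * L" using that by (intro mult_left_mono L) auto
    finally show ?thesis by (simp add: mult.commute)
  qed
  have I1: "integrable mu (\<lambda>z. ?S N z)" for N using ker_polysE_integrable[OF polysE_const, of "Spoly lam (Suc M) N" zb 1] by simp
  have zE: "\<zeta> \<in> polysE 1" and q0E: "q0 \<in> polysE n" using zV q0V VE_iff by blast+
  have I2: "integrable mu (\<lambda>z. ?S N z * \<zeta> z)" "integrable mu (\<lambda>z. ?S N z * q0 z)" for N
    by (rule ker_polysE_integrable[OF zE] ker_polysE_integrable[OF q0E])+
  have key: "\<bar>?cw N * E q0 zb - poly f 1 * (?cw (N + n) * K0)\<bar> \<le> L * (?cw (N + n) * K0 - (\<integral>z. ?S (N + n) z * \<zeta> z \<partial>mu))" for N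
  proof -
    have "?cw N * E q0 zb - poly f 1 * (?cw (N + n) * K0) = (\<integral>z. ?S (N + n) z * q0 z - poly f 1 * ?S (N + n) z \<partial>mu)"
      using I1 I2 by (simp add: Sn mass)
    then have "\<bar>?cw N * E q0 zb - poly f 1 * (?cw (N + n) * K0)\<bar> = \<bar>\<integral>z. ?S (N + n) z * q0 z - poly f 1 * ?S (N + n) z \<partial>mu\<bar>"
      by (rule arg_cong)
    also have "\<dots> \<le> (\<integral>z. \<bar>?S (N + n) z * q0 z - poly f 1 * ?S (N + n) z\<bar> \<partial>mu)" by (rule integral_abs_bound)
    also have "\<dots> \<le> (\<integral>z. L * (?S (N + n) z - ?S (N + n) z * \<zeta> z) \<partial>mu)"
    proof (rule integral_mono_AE)
      show "integrable mu (\<lambda>z. \<bar>?S (N + n) z * q0 z - poly f 1 * ?S (N + n) z\<bar>)"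
        by (intro integrable_abs Bochner_Integration.integrable_diff integrable_mult_right I1 I2)
      show "integrable mu (\<lambda>z. L * (?S (N + n) z - ?S (N + n) z * \<zeta> z))"
        by (intro Bochner_Integration.integrable_diff integrable_mult_right I1 I2)
      show "AE z in mu. \<bar>?S (N + n) z * q0 z - poly f 1 * ?S (N + n) z\<bar> \<le> L * (?S (N + n) z - ?S (N + n) z * \<zeta> z)"
        using AE_mu
      proof eventually_elim
        case (elim z)
        have "\<bar>?S (N + n) z * q0 z - poly f 1 * ?S (N + n) z\<bar> = ?S (N + n) z * \<bar>poly f (\<zeta> z) - poly f 1\<bar>"
        proof -
          have "?S (N + n) z * q0 z - poly f 1 * ?S (N + n) z = ?S (N + n) z * (poly f (\<zeta> z) - poly f 1)"
            unfolding q0f by (simp only: algebra_simps)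
          then show ?thesis using S0[OF elim, of "N + n"] by (simp only: abs_mult abs_of_nonneg)
        qed
        also have "\<dots> \<le> ?S (N + n) z * (L * (1 - \<zeta> z))" by (intro mult_left_mono Lip zabs elim S0)
        also have "\<dots> = L * (?S (N + n) z - ?S (N + n) z * \<zeta> z)" by (simp only: algebra_simps)
        finally show ?case .
      qed
    qed
    also have "\<dots> = L * (?cw (N + n) * K0 - (\<integral>z. ?S (N + n) z * \<zeta> z \<partial>mu))"
      by (simp only: integral_mult_right_zero Bochner_Integration.integral_diff[OF I1 I2(1)] mass)
    finally show ?thesis .
  qed
  have "\<bar>?cw (Suc N) / ?cw (Suc N + n) * E q0 zb - poly f 1 * K0\<bar> \<le> L * K0 * (1 - ?cw (N + n) / ?cw (Suc (N + n)))" for N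
  proof -
    let ?w = "?cw (Suc (N + n))"
    have w: "?w > 0" by (rule cw_pos)
    have "\<bar>?cw (Suc N) * E q0 zb - poly f 1 * (?w * K0)\<bar> \<le> L * (?w * K0 - ?cw (N + n) * K0)"
      using key[of "Suc N"] S1[of "N + n"] by simp
    then have "\<bar>?cw (Suc N) * E q0 zb - poly f 1 * (?w * K0)\<bar> / ?w \<le> L * (?w * K0 - ?cw (N + n) * K0) / ?w"
      using w by (simp add: divide_right_mono)
    moreover have "\<bar>?cw (Suc N) * E q0 zb - poly f 1 * (?w * K0)\<bar> / ?w = \<bar>?cw (Suc N) / ?w * E q0 zb - poly f 1 * K0\<bar>"
    proof -
      have "?cw (Suc N) / ?w * E q0 zb - poly f 1 * K0 = (?cw (Suc N) * E q0 zb - poly f 1 * (?w * K0)) / ?w"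
        using w by (simp add: field_simps)
      then show ?thesis using w by (simp add: abs_divide)
    qed
    moreover have "L * (?w * K0 - ?cw (N + n) * K0) / ?w = L * K0 * (1 - ?cw (N + n) / ?w)" using w by (simp add: field_simps)
    ultimately show ?thesis by simp
  qed
  moreover have "(\<lambda>N. L * K0 * (1 - ?cw (N + n) / ?cw (Suc (N + n)))) \<longlonglongrightarrow> L * K0 * (1 - 1)"
    by (intro tendsto_mult tendsto_diff tendsto_const LIMSEQ_ignore_initial_segment[OF cw_ratio_tendsto])
  moreover have "(\<lambda>N. \<bar>?cw (Suc N) / ?cw (Suc N + n) * E q0 zb - poly f 1 * K0\<bar>) \<longlonglongrightarrow> \<bar>1 * E q0 zb - poly f 1 * K0\<bar>"
    by (intro tendsto_rabs tendsto_diff tendsto_mult tendsto_const LIMSEQ_Suc[OF cw_ratio_tendsto_shift])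
  ultimately have "\<bar>1 * E q0 zb - poly f 1 * K0\<bar> \<le> L * K0 * (1 - 1)"
    by (intro LIMSEQ_le[where X = "\<lambda>N. \<bar>?cw (Suc N) / ?cw (Suc N + n) * E q0 zb - poly f 1 * K0\<bar>"]) auto
  then have Eq0: "E q0 zb = poly f 1 * K0" by simp
  \<comment> \<open>The value of \<open>E q0 zb\<close> is now known and nonzero, so this one case
    determines the limit 1 / \<open>K0\<close> of the scalars for all q and z.\<close>
  have "(\<lambda>N. (\<kappa> N n / cN N * E q0 zb) * (1 / (poly f 1 * K0))) \<longlonglongrightarrow> q0 zb * (1 / (poly f 1 * K0))"
    by (intro tendsto_mult tendsto_const lim q0V zb)
  then have kl: "(\<lambda>N. \<kappa> N n / cN N) \<longlonglongrightarrow> 1 / K0"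
    unfolding Eq0 q0f zz using f1 K0_pos by simp
  have "(\<lambda>N. \<kappa> N n / cN N * E q z) \<longlonglongrightarrow> 1 / K0 * E q z" by (intro tendsto_mult kl tendsto_const)
  then have "1 / K0 * E q z = q z" using lim[OF q z] LIMSEQ_unique by blast
  then show ?thesis using K0_pos unfolding E_def by (simp add: field_simps)
qed

section \<open>Integral operators of finite rank and the projections\<close>

lemma finite_rank_ker: "degree k \<le> N \<Longrightarrow> finite_rank N (ker k)"
proof -
  assume d: "degree k \<le> N"
  have m: "finite_rank m (ker (monom 1 m))" for m
  proof -
    have "finite_rank m (\<lambda>z z'. tcoef bb gg m i j * ((fst z \<bullet> fst z') ^ (m - 2 * i - 2 * j) * ((tau z * tau z') ^ i * (vv z * vv z') ^ j)))" for i j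
    proof (cases "2 * i + 2 * j \<le> m")
      case True
      have "finite_rank (0 + ((m - 2 * i - 2 * j) * 1 + (i * 2 + j * 2))) (\<lambda>z z'. tcoef bb gg m i j * ((fst z \<bullet> fst z') ^ (m - 2 * i - 2 * j) * ((tau z * tau z') ^ i * (vv z * vv z') ^ j)))"
        by (intro finite_rank_mult finite_rank_power finite_rank_const finite_rank_inner finite_rank.prod tau_polysE vv_polysE)
      then show ?thesis by (rule finite_rank_mono) (use True in simp)
    next
      case False
      then show ?thesis by (simp add: tcoef_def finite_rank_zero)
    qed
    then have "finite_rank m (\<lambda>z z'. \<Sum>i\<le>m. \<Sum>j\<le>m. tcoef bb gg m i j * ((fst z \<bullet> fst z') ^ (m - 2 * i - 2 * j) * ((tau z * tau z') ^ i * (vv z * vv z') ^ j)))"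
      by (intro finite_rank_sum)
    moreover have "ker (monom 1 m) = (\<lambda>z z'. \<Sum>i\<le>m. \<Sum>j\<le>m. tcoef bb gg m i j * ((fst z \<bullet> fst z') ^ (m - 2 * i - 2 * j) * ((tau z * tau z') ^ i * (vv z * vv z') ^ j)))"
      unfolding ker_def Phi_monom[OF order_refl] by (simp add: mult.assoc)
    ultimately show ?thesis by simp
  qed
  have "finite_rank (0 + N) (\<lambda>z z'. \<Sum>m\<le>N. coeff k m * ker (monom 1 m) z z')"
    by (intro finite_rank_sum finite_rank_mult finite_rank_const finite_rank_mono[OF m]) auto
  moreover have "ker k = (\<lambda>z z'. \<Sum>m\<le>N. coeff k m * ker (monom 1 m) z z')"
    by (intro ext ker_eq_sum[OF d])
  ultimately show ?thesis by simp
qed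

lemma integrable_mult_polysE:
  fixes g :: "'d pt \<Rightarrow> real"
  assumes "integrable mu g" "\<phi> \<in> polysE n"
  shows "integrable mu (\<lambda>z. \<phi> z * g z)"
proof -
  obtain B where B: "\<forall>z\<in>LL a b c. \<bar>\<phi> z\<bar> \<le> B" using continuous_on_LL_bound[OF polysE_continuous[OF assms(2)]] by blast
  have [measurable]: "\<phi> \<in> borel_measurable borel" "g \<in> borel_measurable borel"
    using polysE_measurable[OF assms(2)] borel_measurable_integrable[OF assms(1)] by auto
  show ?thesis
  proof (rule Bochner_Integration.integrable_bound[of mu "\<lambda>z. B * g z"])
    show "integrable mu (\<lambda>z. B * g z)" using assms(1) by simp
    show "AE z in mu. norm (\<phi> z * g z) \<le> norm (B * g z)"
      using AE_mu
    proof eventually_elim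
      case (elim z)
      then have "\<bar>\<phi> z\<bar> \<le> \<bar>B\<bar>" using B by fastforce
      then show ?case by (simp add: abs_mult mult_right_mono)
    qed
  qed measurable
qed

lemma finite_rank_integrable:
  fixes g :: "'d pt \<Rightarrow> real"
  assumes "finite_rank n K" "integrable mu g"
  shows "integrable mu (\<lambda>z'. K z z' * g z')"
  using assms
proof (induction rule: finite_rank.induct)
  case (prod \<phi> n \<psi>)
  then show ?case using integrable_mult_polysE[OF prod.prems prod.hyps(2)] by (simp add: mult.assoc)
next
  case (plus n K K')
  then show ?case by (simp add: distrib_right)
qed

lemma finite_rank_integral_polysE:
  fixes g :: "'d pt \<Rightarrow> real"
  assumes "finite_rank n K" "integrable mu g"
  shows "(\<lambda>z. \<integral>z'. K z z' * g z' \<partial>mu) \<in> polysE n"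
  using assms
proof (induction rule: finite_rank.induct)
  case (prod \<phi> n \<psi>)
  have "(\<lambda>z. (\<integral>z'. \<psi> z' * g z' \<partial>mu) * \<phi> z) \<in> polysE n" by (rule polysE_cmult[OF prod.hyps(1)])
  then show ?case by (simp add: mult_ac)
next
  case (plus n K K')
  have "(\<integral>z'. (K z z' + K' z z') * g z' \<partial>mu) = (\<integral>z'. K z z' * g z' \<partial>mu) + (\<integral>z'. K' z z' * g z' \<partial>mu)" for z
    using finite_rank_integrable[OF plus.hyps(1) plus.prems] finite_rank_integrable[OF plus.hyps(2) plus.prems] by (simp add: distrib_right)
  then show ?case using polysE_add[OF plus.IH(1)[OF plus.prems] plus.IH(2)[OF plus.prems]] by simp
qed

lemma finite_rank_swap:
  fixes g :: "'d pt \<Rightarrow> real"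
  assumes "finite_rank n K" "integrable mu g" "Q \<in> polysE m"
  shows "(\<integral>z. (\<integral>z'. K z z' * g z' \<partial>mu) * Q z \<partial>mu) = (\<integral>z'. (\<integral>z. K z z' * Q z \<partial>mu) * g z' \<partial>mu)
    \<and> integrable mu (\<lambda>z'. (\<integral>z. K z z' * Q z \<partial>mu) * g z')"
  using assms
proof (induction rule: finite_rank.induct)
  case (prod \<phi> n \<psi>)
  define A where "A = (\<integral>z'. \<psi> z' * g z' \<partial>mu)"
  define B where "B = (\<integral>z. \<phi> z * Q z \<partial>mu)"
  have I: "integrable mu (\<lambda>z'. \<psi> z' * g z')" by (rule integrable_mult_polysE[OF prod.prems(1) prod.hyps(2)])
  have e1: "(\<integral>z'. \<phi> z * \<psi> z' * g z' \<partial>mu) = \<phi> z * A" for z by (simp add: mult.assoc A_def)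
  have r: "\<phi> z * s * Q z = s * (\<phi> z * Q z)" "\<psi> z * s * g z = s * (\<psi> z * g z)" for z s by simp_all
  have e2: "(\<integral>z. \<phi> z * \<psi> z' * Q z \<partial>mu) = \<psi> z' * B" for z' unfolding r B_def by (rule integral_mult_right_zero)
  have e3: "(\<integral>z. \<phi> z * A * Q z \<partial>mu) = A * B" unfolding r B_def by (rule integral_mult_right_zero)
  have e4: "(\<integral>z. \<psi> z * B * g z \<partial>mu) = B * A" unfolding r A_def by (rule integral_mult_right_zero)
  have e5: "integrable mu (\<lambda>z. \<psi> z * B * g z)" unfolding r using I by simp
  show ?case unfolding e1 e2 e3 e4 using e5 by simp
next
  case (plus n K K')
  have 1: "(\<integral>z'. (K z z' + K' z z') * g z' \<partial>mu) = (\<integral>z'. K z z' * g z' \<partial>mu) + (\<integral>z'. K' z z' * g z' \<partial>mu)" for z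
    using finite_rank_integrable[OF plus.hyps(1) plus.prems(1)] finite_rank_integrable[OF plus.hyps(2) plus.prems(1)] by (simp add: distrib_right)
  have Qi: "integrable mu Q" by (rule integrable_polysE[OF plus.prems(2)])
  have 2: "(\<integral>z. (K z z' + K' z z') * Q z \<partial>mu) = (\<integral>z. K z z' * Q z \<partial>mu) + (\<integral>z. K' z z' * Q z \<partial>mu)" for z'
    using finite_rank_integrable[OF finite_rank_transpose[OF plus.hyps(1)] Qi] finite_rank_integrable[OF finite_rank_transpose[OF plus.hyps(2)] Qi] by (simp add: distrib_right)
  have 3: "integrable mu (\<lambda>z. (\<integral>z'. L z z' * g z' \<partial>mu) * Q z)" if "finite_rank n L" for L
    by (rule integrable_polysE_mult[OF finite_rank_integral_polysE[OF that plus.prems(1)] plus.prems(2)])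
  show ?case unfolding 1 2 using plus.IH[OF plus.prems] 3[OF plus.hyps(1)] 3[OF plus.hyps(2)] by (simp add: distrib_right)
qed

text \<open>Functions are arbitrary outside the domain and need not be measurable there; all
  integrals of given functions pass through this restriction.\<close>

definition ind :: "('d pt \<Rightarrow> real) \<Rightarrow> 'd pt \<Rightarrow> real" where
  "ind g z = indicator (LL a b c) z * g z"

definition kop :: "real poly \<Rightarrow> ('d pt \<Rightarrow> real) \<Rightarrow> 'd pt \<Rightarrow> real" where
  "kop k g z = (1 / K0) * (\<integral>z'. ker k z z' * ind g z' \<partial>mu)"

lemma kop_polysE: "degree k \<le> N \<Longrightarrow> integrable mu (ind g) \<Longrightarrow> kop k g \<in> polysE N"
  unfolding kop_def[abs_def] by (intro polysE_cmult finite_rank_integral_polysE finite_rank_ker)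

lemma ind_polysE: "Q \<in> polysE n \<Longrightarrow> integrable mu (ind Q)"
proof -
  assume Q: "Q \<in> polysE n"
  have [measurable]: "Q \<in> borel_measurable borel" by (rule polysE_measurable[OF Q])
  have "AE z in mu. Q z = ind Q z" using AE_mu by eventually_elim (simp add: ind_def)
  then show ?thesis using integrable_polysE[OF Q] by (subst integrable_cong_AE[of _ _ Q]) (auto simp: ind_def[abs_def])
qed

lemma integral_ind: "Q \<in> polysE n \<Longrightarrow> (\<integral>z'. ker k z z' * ind Q z' \<partial>mu) = (\<integral>z'. ker k z z' * Q z' \<partial>mu)"
proof -
  assume Q: "Q \<in> polysE n"
  have [measurable]: "Q \<in> borel_measurable borel" "ker k z \<in> borel_measurable borel" by (rule polysE_measurable[OF Q] ker_measurable)+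
  show ?thesis by (intro integral_cong_AE) (use AE_mu in \<open>auto simp: ind_def[abs_def]\<close>)
qed

lemma kop_swap:
  assumes g: "integrable mu (ind g)" and Q: "Q \<in> polysE m"
  shows "(\<integral>z. kop k g z * Q z \<partial>mu) = (\<integral>z. kop k Q z * ind g z \<partial>mu)"
proof -
  have "(\<integral>z. (\<integral>z'. ker k z z' * ind g z' \<partial>mu) * Q z \<partial>mu) = (\<integral>z'. (\<integral>z. ker k z z' * Q z \<partial>mu) * ind g z' \<partial>mu)"
    using finite_rank_swap[OF finite_rank_ker[OF order_refl] g Q] by blast
  also have "\<dots> = (\<integral>z'. (\<integral>z. ker k z' z * ind Q z \<partial>mu) * ind g z' \<partial>mu)"
    unfolding integral_ind[OF Q] by (simp add: ker_sym)
  finally show ?thesis unfolding kop_def by (simp add: mult.assoc)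
qed

text \<open>The kernel is symmetric, so the operator can be moved to the test polynomial of lower
  degree, which it annihilates.\<close>

lemma kop_zon_V:
  assumes g: "integrable mu (ind g)"
  shows "kop (zon lam n) g \<in> V n"
  unfolding VE_iff
proof (intro conjI allI impI ballI)
  show "kop (zon lam n) g \<in> polysE n" by (rule kop_polysE[OF degree_zon_le g])
  fix m and Q :: "'d pt \<Rightarrow> real" assume mn: "m < n" and Q: "Q \<in> polysE m"
  have "kop (zon lam n) Q z = 0" for z
    unfolding kop_def integral_ind[OF Q] using ker_zon_VE[of n z] mn Q VE_iff by simp
  then show "(\<integral>z. kop (zon lam n) g z * Q z \<partial>mu) = 0" unfolding kop_swap[OF g Q] by simp
qed

text \<open>The reproducing property holds only on the domain, but both sides are polynomials, so
  they agree everywhere.\<close>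

lemma kop_zon_VE:
  assumes v: "v \<in> V n"
  shows "kop (zon lam n) v = v"
proof -
  have vE: "v \<in> polysE n" using v VE_iff by blast
  define d where "d = (\<lambda>z. kop (zon lam n) v z - v z)"
  have dE: "d \<in> polysE n" unfolding d_def by (intro polysE_diff kop_polysE degree_zon_le ind_polysE[OF vE] vE)
  have d0: "d z = 0" if "z \<in> LL a b c" for z
    using ker_zon_reproducing[OF v that] K0_pos unfolding d_def kop_def integral_ind[OF vE] by simp
  have dm: "d \<in> borel_measurable borel" by (rule polysE_measurable[OF dE])
  have "AE z in mu. d z * d z = 0" using AE_mu by eventually_elim (simp add: d0)
  then have "(\<integral>z. d z * d z \<partial>mu) = (\<integral>z. 0 \<partial>mu)"
    by (intro integral_eq_zero_AE[THEN trans]) auto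
  then have "d = (\<lambda>z. 0)" by (intro polysE_zero_of_integral_sq[OF dE]) simp
  then show ?thesis by (simp add: fun_eq_iff d_def)
qed

abbreviation prj :: "nat \<Rightarrow> ('d pt \<Rightarrow> real) \<Rightarrow> 'd pt \<Rightarrow> real" where
  "prj n g \<equiv> proj a b c \<beta> \<gamma> n g"

text \<open>The definite description in \<open>proj\<close> is met by the kernel operator and by
  nothing else: the difference of two solutions lies in \<open>V n\<close> and is orthogonal to
  itself. Integrability of g is all that is assumed, which covers every p.\<close>

theorem proj_eq_kop:
  assumes g: "integrable mu (ind g)"
  shows "prj n g = kop (zon lam n) g"
proof -
  have gm [measurable]: "ind g \<in> borel_measurable borel" using borel_measurable_integrable[OF g] by simp
  have conv: "(LINT z : LL a b c | lborel. WW a b c \<beta> \<gamma> z * (g z - q z) * v z) = (\<integral>z. ind g z * v z \<partial>mu) - (\<integral>z. q z * v z \<partial>mu)"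
    if q: "q \<in> V n" and v: "v \<in> V n" for q v
  proof -
    have qE: "q \<in> polysE n" and vE: "v \<in> polysE n" using q v VE_iff by blast+
    have [measurable]: "q \<in> borel_measurable borel" "v \<in> borel_measurable borel" by (rule polysE_measurable[OF qE] polysE_measurable[OF vE])+
    have e: "indicator (LL a b c) z * ((g z - q z) * v z) = ind g z * v z - indicator (LL a b c) z * (q z * v z)" for z
      by (simp add: ind_def algebra_simps)
    have m: "(\<lambda>z. indicator (LL a b c) z * ((g z - q z) * v z)) \<in> borel_measurable borel" unfolding e by measurable
    have I1: "integrable mu (\<lambda>z. ind g z * v z)" using integrable_mult_polysE[OF g vE] by (simp add: mult.commute)
    have I2: "integrable mu (\<lambda>z. q z * v z)" by (rule integrable_polysE_mult[OF qE vE])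
    have I3: "integrable mu (\<lambda>z. indicator (LL a b c) z * (q z * v z))"
      using ind_polysE[OF polysE_mult[OF qE vE]] by (simp add: ind_def[abs_def])
    have "(LINT z : LL a b c | lborel. WW a b c \<beta> \<gamma> z * (g z - q z) * v z) = (\<integral>z. indicator (LL a b c) z * ((g z - q z) * v z) \<partial>mu)"
      using set_integral_LL[OF m] by (simp add: mult.assoc)
    also have "\<dots> = (\<integral>z. ind g z * v z \<partial>mu) - (\<integral>z. indicator (LL a b c) z * (q z * v z) \<partial>mu)"
      unfolding e by (rule Bochner_Integration.integral_diff[OF I1 I3])
    also have "(\<integral>z. indicator (LL a b c) z * (q z * v z) \<partial>mu) = (\<integral>z. q z * v z \<partial>mu)"
      by (rule integral_indicator_LL) measurable
    finally show ?thesis .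
  qed
  let ?q = "kop (zon lam n) g"
  have qV: "?q \<in> V n" by (rule kop_zon_V[OF g])
  have ort: "(\<integral>z. ind g z * v z \<partial>mu) = (\<integral>z. ?q z * v z \<partial>mu)" if v: "v \<in> V n" for v
  proof -
    have vE: "v \<in> polysE n" using v VE_iff by blast
    show ?thesis unfolding kop_swap[OF g vE] kop_zon_VE[OF v] by (simp add: mult.commute)
  qed
  show ?thesis unfolding proj_def
  proof (rule the_equality)
    show "?q \<in> V n \<and> (\<forall>v\<in>V n. (LINT z : LL a b c | lborel. WW a b c \<beta> \<gamma> z * (g z - ?q z) * v z) = 0)"
      using qV conv[OF qV] ort by simp
  next
    fix q assume q: "q \<in> V n \<and> (\<forall>v\<in>V n. (LINT z : LL a b c | lborel. WW a b c \<beta> \<gamma> z * (g z - q z) * v z) = 0)"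
    let ?d = "\<lambda>z. ?q z - q z"
    have dV: "?d \<in> V n" using VE_diff[OF qV] q by blast
    have dE: "?d \<in> polysE n" using dV VE_iff by blast
    have E: "?q \<in> polysE n" "q \<in> polysE n" using qV q VE_iff by blast+
    have "(\<integral>z. ind g z * ?d z \<partial>mu) = (\<integral>z. q z * ?d z \<partial>mu)" using q conv[of q ?d] dV by simp
    then have "(\<integral>z. ?q z * ?d z \<partial>mu) - (\<integral>z. q z * ?d z \<partial>mu) = 0" using ort[OF dV] by simp
    then have "(\<integral>z. ?d z * ?d z \<partial>mu) = 0"
      unfolding left_diff_distrib[of "?q _"]
      by (subst Bochner_Integration.integral_diff[OF integrable_polysE_mult[OF E(1) dE] integrable_polysE_mult[OF E(2) dE]])
    then have "?d = (\<lambda>z. 0)" by (rule polysE_zero_of_integral_sq[OF dE])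
    then show "q = ?q" by (simp add: fun_eq_iff)
  qed
qed

end

section \<open>Weighted norms\<close>

text \<open>The power function lies above its tangent at y, by Young's inequality. Minkowski's
  inequality and the Jensen step in \<open>schur_bound\<close> both rest on this.\<close>

lemma powr_tangent_line:
  fixes x y q :: real
  assumes x: "x \<ge> 0" and y: "y \<ge> 0" and q: "q \<ge> 1"
  shows "y powr q + q * y powr (q - 1) * (x - y) \<le> x powr q"
proof (cases "x = 0 \<or> y = 0")
  case True
  have "y powr q * 1 \<le> y powr q * q" using q by (intro mult_left_mono) auto
  moreover have "y powr (q - 1) * y = y powr q" if "y > 0"
    using that by (simp add: powr_diff)
  ultimately have "y > 0 \<Longrightarrow> y powr q - q * y powr (q - 1) * y \<le> 0" by (simp add: mult_ac)
  then show ?thesis using True x y by (cases "y = 0") auto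
next
  case False
  with x y have x: "x > 0" and y: "y > 0" by auto
  have "(x powr q) powr (1 / q) * (y powr q) powr (1 - 1 / q) \<le> 1 / q * x powr q + (1 - 1 / q) * y powr q"
    using x y q by (intro Youngs_inequality_0) auto
  moreover have "(x powr q) powr (1 / q) * (y powr q) powr (1 - 1 / q) = x * y powr (q - 1)"
    using x y q by (simp add: powr_powr algebra_simps)
  ultimately have "q * (x * y powr (q - 1)) \<le> q * (1 / q * x powr q + (1 - 1 / q) * y powr q)"
    using q by (intro mult_left_mono) auto
  also have "\<dots> = x powr q + (q - 1) * y powr q" using q by (simp add: field_simps)
  finally have "q * (x * y powr (q - 1)) \<le> x powr q + (q - 1) * y powr q" .
  moreover have "y powr (q - 1) * y = y powr q" using y by (simp add: powr_diff)
  then have e: "q * y powr (q - 1) * (x - y) = q * (x * y powr (q - 1)) - q * y powr q" by (simp add: algebra_simps)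
  ultimately show ?thesis unfolding e by (simp add: left_diff_distrib)
qed

lemma powr_convex_comb:
  fixes q :: real
  assumes "u \<ge> 0" "v \<ge> 0" "s > 0" "t > 0" "q \<ge> 1"
  shows "((u + v) / (s + t)) powr q \<le> s / (s + t) * (u / s) powr q + t / (s + t) * (v / t) powr q"
proof -
  let ?y = "(u + v) / (s + t)"
  have y: "?y \<ge> 0" using assms by simp
  have 1: "s / (s + t) * (?y powr q + q * ?y powr (q - 1) * (u / s - ?y)) \<le> s / (s + t) * (u / s) powr q"
    using assms by (intro mult_left_mono powr_tangent_line y) auto
  have 2: "t / (s + t) * (?y powr q + q * ?y powr (q - 1) * (v / t - ?y)) \<le> t / (s + t) * (v / t) powr q"
    using assms by (intro mult_left_mono powr_tangent_line y) auto
  have e: "s / (s + t) * (A + B * (u / s - ?y)) + t / (s + t) * (A + B * (v / t - ?y)) = A" for A B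
  proof -
    have st: "s / (s + t) + t / (s + t) = 1" using assms by (simp add: add_divide_distrib[symmetric])
    have "s / (s + t) * (u / s) + t / (s + t) * (v / t) = ?y"
      using assms by (simp add: add_divide_distrib)
    moreover have "s / (s + t) * (A + B * (u / s - ?y)) + t / (s + t) * (A + B * (v / t - ?y))
      = (A - B * ?y) * (s / (s + t) + t / (s + t)) + B * (s / (s + t) * (u / s) + t / (s + t) * (v / t))"
      by (simp only: algebra_simps)
    ultimately show ?thesis unfolding st by simp
  qed
  show ?thesis using add_mono[OF 1 2] unfolding e .
qed

lemma ennreal_comb:
  "0 \<le> u \<Longrightarrow> 0 \<le> v \<Longrightarrow> 0 \<le> x \<Longrightarrow> 0 \<le> y \<Longrightarrow> ennreal (u * x + v * y) = ennreal u * ennreal x + ennreal v * ennreal y"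
  by (simp add: ennreal_plus ennreal_mult)

locale hyperboloid_Lp = hyperboloid a b c \<beta> \<gamma> dt for a b c \<beta> \<gamma> :: real and dt :: "'d::finite itself" +
  fixes p :: ennreal
  assumes p_ge_1: "1 \<le> p"
begin

text \<open>For \<open>p = \<infinity>\<close> this is the junk value 0.\<close>

definition q where "q = enn2real p"

lemma q_ge_1: "p \<noteq> \<infinity> \<Longrightarrow> q \<ge> 1"
  using p_ge_1 unfolding q_def
  by (metis enn2real_1 enn2real_mono infinity_ennreal_def top.not_eq_extremum)

definition nrm :: "('d pt \<Rightarrow> real) \<Rightarrow> ennreal" where "nrm = wnorm a b c \<beta> \<gamma> p"

definition meas :: "('d pt \<Rightarrow> real) \<Rightarrow> bool" where "meas f \<longleftrightarrow> ind f \<in> borel_measurable borel"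

lemma powr_integral_mu:
  assumes "meas f" "s > 0"
  shows "(\<integral>\<^sup>+ z. indicator (LL a b c) z * ennreal (WW a b c \<beta> \<gamma> z * \<bar>f z\<bar> powr s) \<partial>lborel) = (\<integral>\<^sup>+z. ennreal (\<bar>ind f z\<bar> powr s) \<partial>mu)"
proof -
  have [measurable]: "ind f \<in> borel_measurable borel" using assms by (simp add: meas_def)
  have "(\<lambda>z. ennreal (\<bar>ind f z\<bar> powr s)) \<in> borel_measurable borel" by measurable
  from nn_integral_mu[OF this] show ?thesis
    using assms by (auto simp: ind_def indicator_def WW_nonneg ennreal_mult intro!: nn_integral_cong)
qed

lemma powr_integral_scale:
  assumes "meas f" "t > 0"
  shows "(\<integral>\<^sup>+z. ennreal ((\<bar>ind f z\<bar> / t) powr s) \<partial>mu) = ennreal (1 / t powr s) * (\<integral>\<^sup>+z. ennreal (\<bar>ind f z\<bar> powr s) \<partial>mu)"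
proof -
  have [measurable]: "ind f \<in> borel_measurable borel" using assms by (simp add: meas_def)
  have "ennreal ((\<bar>ind f z\<bar> / t) powr s) = ennreal (1 / t powr s) * ennreal (\<bar>ind f z\<bar> powr s)" for z
    using assms by (subst ennreal_mult[symmetric]) (auto simp: powr_divide)
  then show ?thesis by (simp add: nn_integral_cmult)
qed

text \<open>The norm as the gauge of a unit ball: after division by t the condition involves no root
  and no infinite value. Inequalities between norms become convexity arguments, with p infinite
  treated in parallel.\<close>

lemma nrm_le_iff:
  assumes f: "meas f" and t: "t > 0"
  shows "nrm f \<le> ennreal t \<longleftrightarrow> (if p = \<infinity> then \<forall>z\<in>LL a b c. \<bar>f z\<bar> \<le> t
     else (\<integral>\<^sup>+z. ennreal ((\<bar>ind f z\<bar> / t) powr q) \<partial>mu) \<le> 1)"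
proof (cases "p = \<infinity>")
  case True
  show ?thesis unfolding nrm_def wnorm_def if_P[OF True] using t by (simp add: SUP_le_iff)
next
  case False
  define I where "I = (\<integral>\<^sup>+z. ennreal (\<bar>ind f z\<bar> powr q) \<partial>mu)"
  have q: "q \<ge> 1" by (rule q_ge_1[OF False])
  have n: "nrm f = (if I = \<infinity> then \<infinity> else ennreal (enn2real I powr (1 / q)))"
    using False q powr_integral_mu[OF f, of q] by (simp add: nrm_def wnorm_def q_def[symmetric] I_def Let_def)
  have s: "(\<integral>\<^sup>+z. ennreal ((\<bar>ind f z\<bar> / t) powr q) \<partial>mu) = ennreal (1 / t powr q) * I"
    unfolding I_def by (rule powr_integral_scale[OF f t])
  show ?thesis
  proof (cases I)
    case (real i)
    have "i powr (1 / q) \<le> t \<longleftrightarrow> i \<le> t powr q"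
    proof
      assume "i powr (1 / q) \<le> t"
      then have "(i powr (1 / q)) powr q \<le> t powr q" using q by (intro powr_mono2) auto
      then show "i \<le> t powr q" using q real by (simp add: powr_powr)
    next
      assume "i \<le> t powr q"
      then have "i powr (1 / q) \<le> (t powr q) powr (1 / q)" using q real by (intro powr_mono2) auto
      then show "i powr (1 / q) \<le> t" using q t by (simp add: powr_powr)
    qed
    moreover have "ennreal (1 / t powr q) * I \<le> 1 \<longleftrightarrow> i \<le> t powr q"
    proof -
      have "ennreal (1 / t powr q) * I = ennreal (i / t powr q)" using real t by (simp add: ennreal_mult[symmetric])
      then show ?thesis using t by (simp add: divide_le_eq)
    qed
    ultimately show ?thesis unfolding n s using real False t by simp
  next
    case top
    then show ?thesis unfolding n s using False t by (simp add: ennreal_mult_top top_unique)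
  qed
qed

lemma nrm_leI: "(\<And>t. t > 0 \<Longrightarrow> nrm f < ennreal t \<Longrightarrow> x \<le> ennreal K * ennreal t) \<Longrightarrow> K > 0 \<Longrightarrow> x \<le> ennreal K * nrm f"
proof (cases "nrm f")
  case (real r)
  assume *: "\<And>t. t > 0 \<Longrightarrow> nrm f < ennreal t \<Longrightarrow> x \<le> ennreal K * ennreal t" "K > 0"
  show ?thesis
  proof (rule ennreal_le_epsilon)
    fix e :: real assume e: "0 < e"
    have "x \<le> ennreal K * ennreal (r + e / K)" using real e *(2) by (intro *(1)) (auto simp: add_nonneg_pos ennreal_lessI)
    also have "\<dots> = ennreal K * nrm f + ennreal e"
      using real e *(2) by (simp add: ennreal_mult[symmetric] distrib_left flip: ennreal_plus)
    finally show "x \<le> ennreal K * nrm f + ennreal e" .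
  qed
next
  case top
  assume "K > 0"
  then show ?thesis using top by (simp add: ennreal_mult_top)
qed

lemma ind_add: "ind (\<lambda>z. f z + g z) z = ind f z + ind g z" by (simp add: ind_def distrib_left)
lemma meas_add: "meas f \<Longrightarrow> meas g \<Longrightarrow> meas (\<lambda>z. f z + g z)"
  unfolding meas_def ind_def[abs_def] distrib_left by simp

lemma meas_diff: "meas f \<Longrightarrow> meas g \<Longrightarrow> meas (\<lambda>z. f z - g z)"
  unfolding meas_def ind_def[abs_def] right_diff_distrib by simp

lemma meas_polysE: "P \<in> polysE n \<Longrightarrow> meas P"
  unfolding meas_def using ind_polysE borel_measurable_integrable[of mu "ind P"] by simp

lemma meas_continuous: "continuous_on (LL a b c) f \<Longrightarrow> meas f"
  unfolding meas_def ind_def[abs_def] using borel_measurable_continuous_on_indicator[OF LL_sets, of f] by simp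

text \<open>If f/s and g/t are in the unit ball, then (f + g)/(s + t) is their convex combination
  with weights s/(s + t) and t/(s + t), hence in the ball too; s and t then decrease to the
  norms.\<close>

lemma nrm_triangle:
  assumes f: "meas f" and g: "meas g"
  shows "nrm (\<lambda>z. f z + g z) \<le> nrm f + nrm g"
proof -
  have fg: "meas (\<lambda>z. f z + g z)" by (rule meas_add[OF f g])
  have [measurable]: "ind f \<in> borel_measurable borel" "ind g \<in> borel_measurable borel" using f g by (auto simp: meas_def)
  have key: "nrm (\<lambda>z. f z + g z) \<le> ennreal (s + t)" if s: "s > 0" "nrm f \<le> ennreal s" and t: "t > 0" "nrm g \<le> ennreal t" for s t
  proof (cases "p = \<infinity>")
    case True
    then have "\<forall>z\<in>LL a b c. \<bar>f z\<bar> \<le> s" "\<forall>z\<in>LL a b c. \<bar>g z\<bar> \<le> t"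
      using s t nrm_le_iff[OF f s(1)] nrm_le_iff[OF g t(1)] by auto
    then have "\<forall>z\<in>LL a b c. \<bar>f z + g z\<bar> \<le> s + t" by fastforce
    then show ?thesis using True s t nrm_le_iff[OF fg, of "s + t"] by auto
  next
    case False
    then have I: "(\<integral>\<^sup>+z. ennreal ((\<bar>ind f z\<bar> / s) powr q) \<partial>mu) \<le> 1" "(\<integral>\<^sup>+z. ennreal ((\<bar>ind g z\<bar> / t) powr q) \<partial>mu) \<le> 1"
      using s t nrm_le_iff[OF f s(1)] nrm_le_iff[OF g t(1)] by auto
    have q: "q \<ge> 1" by (rule q_ge_1[OF False])
    have "(\<integral>\<^sup>+z. ennreal ((\<bar>ind (\<lambda>z. f z + g z) z\<bar> / (s + t)) powr q) \<partial>mu)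
        \<le> (\<integral>\<^sup>+z. ennreal (s / (s + t)) * ennreal ((\<bar>ind f z\<bar> / s) powr q) + ennreal (t / (s + t)) * ennreal ((\<bar>ind g z\<bar> / t) powr q) \<partial>mu)"
    proof (rule nn_integral_mono)
      fix z
      have "(\<bar>ind (\<lambda>z. f z + g z) z\<bar> / (s + t)) powr q \<le> ((\<bar>ind f z\<bar> + \<bar>ind g z\<bar>) / (s + t)) powr q"
        using s t q by (intro powr_mono2 divide_right_mono) (auto simp: ind_add)
      also have "\<dots> \<le> s / (s + t) * (\<bar>ind f z\<bar> / s) powr q + t / (s + t) * (\<bar>ind g z\<bar> / t) powr q"
        using s t q by (intro powr_convex_comb) auto
      finally have "ennreal ((\<bar>ind (\<lambda>z. f z + g z) z\<bar> / (s + t)) powr q) \<le> ennreal (s / (s + t) * (\<bar>ind f z\<bar> / s) powr q + t / (s + t) * (\<bar>ind g z\<bar> / t) powr q)"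
        by (rule ennreal_leI)
      also have "\<dots> = ennreal (s / (s + t)) * ennreal ((\<bar>ind f z\<bar> / s) powr q) + ennreal (t / (s + t)) * ennreal ((\<bar>ind g z\<bar> / t) powr q)"
        using s t by (intro ennreal_comb) auto
      finally show "ennreal ((\<bar>ind (\<lambda>z. f z + g z) z\<bar> / (s + t)) powr q) \<le> \<dots>" .
    qed
    also have "\<dots> = ennreal (s / (s + t)) * (\<integral>\<^sup>+z. ennreal ((\<bar>ind f z\<bar> / s) powr q) \<partial>mu) + ennreal (t / (s + t)) * (\<integral>\<^sup>+z. ennreal ((\<bar>ind g z\<bar> / t) powr q) \<partial>mu)"
      by (subst nn_integral_add) (auto simp: nn_integral_cmult)
    also have "\<dots> \<le> ennreal (s / (s + t)) * 1 + ennreal (t / (s + t)) * 1" by (intro add_mono mult_left_mono I) auto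
    also have "\<dots> = ennreal (s / (s + t) + t / (s + t))" using s t by (simp add: ennreal_plus)
    also have "s / (s + t) + t / (s + t) = 1" using s t by (simp add: add_divide_distrib[symmetric])
    finally show ?thesis using False s t nrm_le_iff[OF fg, of "s + t"] by simp
  qed
  show ?thesis
  proof (rule ennreal_le_epsilon)
    fix e :: real assume e: "0 < e" and fin: "nrm f + nrm g < top"
    obtain s t where st: "nrm f = ennreal s" "nrm g = ennreal t" "s \<ge> 0" "t \<ge> 0"
      using fin by (metis add_top ennreal_add_eq_top ennreal_cases less_irrefl)
    have "nrm (\<lambda>z. f z + g z) \<le> ennreal ((s + e / 2) + (t + e / 2))" using st e by (intro key) (auto simp: add_nonneg_pos)
    also have "\<dots> = nrm f + nrm g + ennreal e" using st e by (simp flip: ennreal_plus)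
    finally show "nrm (\<lambda>z. f z + g z) \<le> nrm f + nrm g + ennreal e" .
  qed
qed

lemma nrm_minus: "nrm (\<lambda>z. - f z) = nrm f" by (simp add: nrm_def wnorm_def)

lemma nrm_diff_triangle:
  assumes "meas f" "meas g" "meas h"
  shows "nrm (\<lambda>z. f z - h z) \<le> nrm (\<lambda>z. f z - g z) + nrm (\<lambda>z. g z - h z)"
  using nrm_triangle[OF meas_diff[OF assms(1,2)] meas_diff[OF assms(2,3)]] by simp

lemma nrm_diff_le:
  assumes "meas f" "meas g"
  shows "nrm (\<lambda>z. f z - g z) \<le> nrm f + nrm g"
proof -
  have m: "meas (\<lambda>z. - g z)" using meas_diff[OF meas_polysE[OF polysE_const[of 0]] assms(2)] by simp
  show ?thesis using nrm_triangle[OF assms(1) m] by (simp add: nrm_minus)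
qed

lemma nrm_diff_commute: "nrm (\<lambda>z. f z - g z) = nrm (\<lambda>z. g z - f z)"
  using nrm_minus[of "\<lambda>z. f z - g z"] by simp

lemma nrm_sum_le:
  assumes "finite I" "\<And>i. i \<in> I \<Longrightarrow> meas (f i)"
  shows "nrm (\<lambda>z. \<Sum>i\<in>I. f i z) \<le> (\<Sum>i\<in>I. nrm (f i)) \<and> meas (\<lambda>z. \<Sum>i\<in>I. f i z)"
  using assms
proof (induction I)
  case empty
  have "nrm (\<lambda>z. 0) = 0"
  proof (cases "p = \<infinity>")
    case False then show ?thesis using q_ge_1[OF False] by (simp add: nrm_def wnorm_def Let_def q_def)
  next
    case True
    have "(SUP z\<in>LL a b c :: 'd pt set. ennreal \<bar>0\<bar>) \<le> 0" by (intro SUP_least) simp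
    then show ?thesis unfolding nrm_def wnorm_def if_P[OF True] by simp
  qed
  then show ?case using meas_polysE[OF polysE_const[of 0]] by simp
next
  case (insert i I)
  then have IH: "nrm (\<lambda>z. \<Sum>i\<in>I. f i z) \<le> (\<Sum>i\<in>I. nrm (f i))" "meas (\<lambda>z. \<Sum>i\<in>I. f i z)" "meas (f i)" by auto
  have "nrm (\<lambda>z. f i z + (\<Sum>i\<in>I. f i z)) \<le> nrm (f i) + nrm (\<lambda>z. \<Sum>i\<in>I. f i z)" by (rule nrm_triangle[OF IH(3,2)])
  also have "\<dots> \<le> nrm (f i) + (\<Sum>i\<in>I. nrm (f i))" by (intro add_left_mono IH)
  finally show ?case using insert meas_add[OF IH(3,2)] by simp
qed

text \<open>\<open>max 1 K0\<close> bounds the norm of the constant function 1 for every p at once.\<close>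

lemma nrm_bounded:
  assumes f: "meas f" and B: "B > 0" "\<And>z. z \<in> LL a b c \<Longrightarrow> \<bar>f z\<bar> \<le> B"
  shows "nrm f \<le> ennreal (max 1 K0 * B)"
proof (cases "p = \<infinity>")
  case True
  have "1 * B \<le> max 1 K0 * B" using B by (intro mult_right_mono) auto
  then have "\<forall>z\<in>LL a b c. \<bar>f z\<bar> \<le> max 1 K0 * B" using B(2) by fastforce
  then show ?thesis using True B nrm_le_iff[OF f, of "max 1 K0 * B"] by simp
next
  case False
  have q: "q \<ge> 1" by (rule q_ge_1[OF False])
  let ?M = "max 1 K0"
  have M: "?M \<ge> 1" by simp
  have "(\<integral>\<^sup>+z. ennreal ((\<bar>ind f z\<bar> / (?M * B)) powr q) \<partial>mu) \<le> (\<integral>\<^sup>+z. ennreal (1 / ?M) \<partial>mu)"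
  proof (intro nn_integral_mono ennreal_leI)
    fix z
    have "\<bar>ind f z\<bar> \<le> B" using B by (simp add: ind_def indicator_def)
    then have "\<bar>ind f z\<bar> / (?M * B) \<le> 1 / ?M" using B M by (simp add: field_simps)
    then have "(\<bar>ind f z\<bar> / (?M * B)) powr q \<le> (1 / ?M) powr q" using B q by (intro powr_mono2) auto
    also have "\<dots> \<le> (1 / ?M) powr 1" using q M by (intro powr_mono') (auto simp: divide_le_eq)
    finally show "(\<bar>ind f z\<bar> / (?M * B)) powr q \<le> 1 / ?M" by simp
  qed
  also have "\<dots> = ennreal (1 / ?M * K0)" using K0_pos by (subst ennreal_mult) (auto simp: emeasure_mu)
  also have "\<dots> \<le> 1" using M by (simp add: divide_le_eq)
  finally show ?thesis using False B M nrm_le_iff[OF f, of "?M * B"] by simp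
qed

text \<open>The measure is finite and u <= 1 + u^q for u >= 0, q >= 1, so kernel operators and
  projections are defined on every one of the spaces.\<close>

lemma nrm_finite_integrable:
  assumes f: "meas f" and fin: "nrm f < \<infinity>"
  shows "integrable mu (ind f)"
proof -
  obtain t where t: "t > 0" "nrm f \<le> ennreal t"
    using fin by (cases "nrm f") (auto intro: that[of "1 + enn2real (nrm f)"] simp: add_pos_nonneg)
  have [measurable]: "ind f \<in> borel_measurable borel" using f by (simp add: meas_def)
  show ?thesis
  proof (cases "p = \<infinity>")
    case True
    then show ?thesis using t nrm_le_iff[OF f t(1)] by (intro integrable_mu_bounded[of _ t]) (auto simp: ind_def)
  next
    case False
    have q: "q \<ge> 1" by (rule q_ge_1[OF False])
    have I: "(\<integral>\<^sup>+z. ennreal ((\<bar>ind f z\<bar> / t) powr q) \<partial>mu) \<le> 1" using False t nrm_le_iff[OF f t(1)] by simp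
    have "integrable mu (\<lambda>z. (\<bar>ind f z\<bar> / t) powr q)"
      by (rule integrableI_bounded) (use I in \<open>auto simp: le_less_trans[OF I]\<close>)
    then have J: "integrable mu (\<lambda>z. t * (1 + (\<bar>ind f z\<bar> / t) powr q))" by simp
    show ?thesis
    proof (rule Bochner_Integration.integrable_bound[OF J])
      show "AE z in mu. norm (ind f z) \<le> norm (t * (1 + (\<bar>ind f z\<bar> / t) powr q))"
      proof (rule AE_I2)
        fix z
        define u where "u = \<bar>ind f z\<bar> / t"
        have u: "u \<ge> 0" using t by (simp add: u_def)
        have "u \<le> 1 + u powr q"
        proof (cases "u \<le> 1")
          case False
          then have "u powr 1 \<le> u powr q" using q by (intro powr_mono) auto
          then show ?thesis using u by simp
        qed (simp add: add_increasing2)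
        then have "t * u \<le> t * (1 + u powr q)" using t by (intro mult_left_mono) auto
        then show "norm (ind f z) \<le> norm (t * (1 + (\<bar>ind f z\<bar> / t) powr q))" using t by (simp add: u_def)
      qed
    qed simp
  qed
qed

end

section \<open>Multipliers on the weighted spaces\<close>

lemma nab_funpow_cong: "(\<And>i. i \<le> j \<Longrightarrow> m (k + i) = m' (k + i)) \<Longrightarrow> (nab ^^ j) m k = (nab ^^ j) m' k"
proof (induction j arbitrary: k)
  case (Suc j)
  have "(nab ^^ j) m k = (nab ^^ j) m' k" by (rule Suc.IH) (use Suc.prems in auto)
  moreover have "(nab ^^ j) m (Suc k) = (nab ^^ j) m' (Suc k)"
    by (rule Suc.IH) (use Suc.prems[of "Suc _"] in auto)
  ultimately show ?case by (simp add: nab_def[of "(nab ^^ j) _"])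
qed simp

lemma nab_funpow_const: "j > 0 \<Longrightarrow> (nab ^^ j) (\<lambda>k. s) = (\<lambda>k. 0)"
proof -
  have "(nab ^^ i) (\<lambda>k. 0) = (\<lambda>k. 0)" for i by (induction i) (auto simp: nab_def)
  moreover assume "j > 0"
  then obtain i where "j = Suc i" by (cases j) auto
  ultimately show ?thesis by (simp only: funpow_Suc_right o_apply) (simp add: nab_def[abs_def])
qed

lemma sum_inverse_squares_tail: "(\<Sum>k=K..L. 1 / real (Suc k) ^ 2) \<le> 2 / real (Suc K)"
proof (cases "K \<le> L")
  case True
  have "(\<Sum>k=K..L. 1 / real (Suc k) ^ 2) \<le> (\<Sum>k=K..L. 2 * (1 / real (Suc k) - 1 / real (Suc (Suc k))))"
  proof (rule sum_mono)
    fix k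
    have "1 / real (Suc k) - 1 / real (Suc (Suc k)) = 1 / (real (Suc k) * real (Suc (Suc k)))"
      by (simp add: diff_frac_eq)
    moreover have "1 / (2 * real (Suc k) ^ 2) \<le> 1 / (real (Suc k) * real (Suc (Suc k)))"
      by (intro divide_left_mono mult_pos_pos) (auto simp: power2_eq_square algebra_simps intro: add_pos_nonneg)
    ultimately show "1 / real (Suc k) ^ 2 \<le> 2 * (1 / real (Suc k) - 1 / real (Suc (Suc k)))" by simp
  qed
  also have "\<dots> = 2 * (\<Sum>k=K..L. 1 / real (Suc k) - 1 / real (Suc (Suc k)))" by (rule sum_distrib_left[symmetric])
  also have "(\<Sum>k=K..L. 1 / real (Suc k) - 1 / real (Suc (Suc k))) = 1 / real (Suc K) - 1 / real (Suc (Suc L))"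
    using sum_Suc_diff[of K "Suc L" "\<lambda>k. - 1 / real (Suc k)"] True by (simp add: atLeastLessThanSuc_atLeastAtMost sum_Suc_diff')
  also have "2 * (1 / real (Suc K) - 1 / real (Suc (Suc L))) \<le> 2 / real (Suc K)" by simp
  finally show ?thesis .
qed simp

text \<open>The weight is at most (k + 1)^M and so uses up M of the M + 1 orders of decay supplied
  by the differences.\<close>

lemma cw_term_le:
  assumes b: "\<bar>x\<bar> \<le> C * real (Suc k) powr (e - real (Suc M))" and C: "C \<ge> 0"
  shows "\<bar>x\<bar> * cw (Suc M) k \<le> C * real (Suc k) powr (e - 1)"
proof -
  have "\<bar>x\<bar> * cw (Suc M) k \<le> (C * real (Suc k) powr (e - real (Suc M))) * real (Suc k) ^ M"
    using C by (intro mult_mono b cw_le cw_nonneg) auto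
  also have "\<dots> = C * (real (Suc k) powr (e - real (Suc M)) * real (Suc k) powr real M)"
    by (simp only: powr_realpow[OF of_nat_0_less_iff[THEN iffD2, OF zero_less_Suc]] mult.assoc)
  also have "real (Suc k) powr (e - real (Suc M)) * real (Suc k) powr real M = real (Suc k) powr (e - 1)"
    by (simp only: powr_add[symmetric]) (simp add: algebra_simps)
  finally show ?thesis .
qed

text \<open>The Cesaro kernel with last index k has mass proportional to \<open>cw J k\<close>.
  After summation by parts this number bounds the mass, and hence the norm, of the
  multiplier.\<close>

definition mbound :: "nat \<Rightarrow> nat \<Rightarrow> (nat \<Rightarrow> real) \<Rightarrow> real" where
  "mbound J L m = (\<Sum>k\<le>L. \<bar>(nab ^^ J) m k\<bar> * cw J k)"

text \<open>There are of the order of N terms, each at most of the order of N^(r-1).\<close>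

lemma bernstein_mbound:
  assumes l: "l \<ge> 0" and r: "r \<ge> 1"
  shows "\<exists>C>0. \<forall>N\<ge>1. mbound (Suc M) ((Suc M + 1) * N) (\<lambda>k. cutoff (Suc M) N k * eigsq l k ^ r) \<le> C * real N ^ r"
proof -
  obtain C where C: "C \<ge> 0" "\<And>N k. \<bar>(nab ^^ Suc M) (\<lambda>k. cutoff (Suc M) N k * eigsq l k ^ r) k\<bar> \<le> C * real (Suc k) powr (real r - real (Suc M))"
    using bernstein_symbol[OF l, of "Suc M" r] by blast
  let ?A = "real (Suc M + 2) ^ r"
  have "mbound (Suc M) ((Suc M + 1) * N) (\<lambda>k. cutoff (Suc M) N k * eigsq l k ^ r) \<le> (C + 1) * ?A * real N ^ r" if N: "N \<ge> 1" for N
  proof -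
    let ?L = "(Suc M + 1) * N"
    have "mbound (Suc M) ?L (\<lambda>k. cutoff (Suc M) N k * eigsq l k ^ r) \<le> (\<Sum>k\<le>?L. C * real (Suc ?L) ^ (r - 1))"
      unfolding mbound_def
    proof (rule sum_mono)
      fix k assume k: "k \<in> {..?L}"
      have "\<bar>(nab ^^ Suc M) (\<lambda>k. cutoff (Suc M) N k * eigsq l k ^ r) k\<bar> * cw (Suc M) k \<le> C * real (Suc k) powr (real r - 1)"
        by (rule cw_term_le[OF C(2) C(1)])
      also have "real (Suc k) powr (real r - 1) = real (Suc k) ^ (r - 1)"
        using r by (simp flip: powr_realpow add: of_nat_diff)
      also have "C * real (Suc k) ^ (r - 1) \<le> C * real (Suc ?L) ^ (r - 1)"
        using k C(1) by (intro mult_left_mono power_mono) (simp_all only: of_nat_le_iff atMost_iff Suc_le_mono of_nat_0_le_iff)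
      finally show "\<bar>(nab ^^ Suc M) (\<lambda>k. cutoff (Suc M) N k * eigsq l k ^ r) k\<bar> * cw (Suc M) k \<le> C * real (Suc ?L) ^ (r - 1)" .
    qed
    also have "\<dots> = C * (real (Suc ?L) * real (Suc ?L) ^ (r - 1))" by simp
    also have "real (Suc ?L) * real (Suc ?L) ^ (r - 1) = real (Suc ?L) ^ r" using r by (metis Suc_diff_1 less_eq_Suc_le One_nat_def power_Suc)
    also have "C * real (Suc ?L) ^ r \<le> (C + 1) * (real (Suc M + 2) * real N) ^ r"
    proof (intro mult_mono power_mono)
      have "Suc ?L \<le> (Suc M + 2) * N" using N by (simp add: algebra_simps)
      then show "real (Suc ?L) \<le> real (Suc M + 2) * real N" by (metis of_nat_le_iff of_nat_mult)
    qed (use C in auto)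
    finally show ?thesis by (simp add: power_mult_distrib mult.assoc)
  qed
  moreover have "(C + 1) * ?A > 0" using C by (intro mult_pos_pos zero_less_power) auto
  ultimately show ?thesis by blast
qed

text \<open>The symbol estimate alone gives terms C/(k + 1) and thus a logarithm. It disappears
  because differences vanish as long as their window stays in the range where the cutoff is 1, so
  only k comparable to N contribute.\<close>

lemma cutoff_mbound: "\<exists>C>0. \<forall>N. mbound (Suc M) ((Suc M + 1) * N) (cutoff (Suc M) N) \<le> C"
proof -
  obtain C where C: "C \<ge> 0" "\<And>N k. \<bar>(nab ^^ Suc M) (\<lambda>k. cutoff (Suc M) N k * eigsq 0 k ^ 0) k\<bar> \<le> C * real (Suc k) powr (real 0 - real (Suc M))"
    using bernstein_symbol[of 0 "Suc M" 0] by blast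
  let ?J = "real (Suc M + 1)"
  have "mbound (Suc M) ((Suc M + 1) * N) (cutoff (Suc M) N) \<le> (C + 1) * ?J * ?J" for N
  proof -
    let ?L = "(Suc M + 1) * N"
    have "mbound (Suc M) ?L (cutoff (Suc M) N) \<le> (\<Sum>k\<le>?L. C * (?J / real (Suc N)))"
      unfolding mbound_def
    proof (rule sum_mono)
      fix k assume k: "k \<in> {..?L}"
      show "\<bar>(nab ^^ Suc M) (cutoff (Suc M) N) k\<bar> * cw (Suc M) k \<le> C * (?J / real (Suc N))"
      proof (cases "k + Suc M \<le> N")
        case True
        have "(nab ^^ Suc M) (cutoff (Suc M) N) k = (nab ^^ Suc M) (\<lambda>k. 1) k"
          by (rule nab_funpow_cong) (use True in \<open>auto intro: cutoff_eq_1\<close>)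
        then show ?thesis using C by (simp only: nab_funpow_const[OF zero_less_Suc]) simp
      next
        case False
        have "\<bar>(nab ^^ Suc M) (cutoff (Suc M) N) k\<bar> * cw (Suc M) k \<le> C * real (Suc k) powr (real 0 - 1)"
          using cw_term_le[OF C(2)[of N k] C(1)] by simp
        also have "real (Suc k) powr (real 0 - 1) = 1 / real (Suc k)" by (simp add: powr_minus_divide)
        also have "\<dots> \<le> ?J / real (Suc N)"
        proof -
          have "Suc N \<le> (Suc M + 1) * Suc k" using False by simp
          then have "real (Suc N) \<le> ?J * real (Suc k)" by (metis of_nat_le_iff of_nat_mult)
          then show ?thesis by (simp add: field_simps)
        qed
        finally show ?thesis using C(1) by (simp add: mult_left_mono)
      qed
    qed
    also have "\<dots> = C * ?J * (real (Suc ?L) / real (Suc N))" by simp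
    also have "\<dots> \<le> (C + 1) * ?J * ?J"
    proof (intro mult_mono)
      have "Suc ?L \<le> (Suc M + 1) * Suc N" by simp
      then have "real (Suc ?L) \<le> ?J * real (Suc N)" by (metis of_nat_le_iff of_nat_mult)
      then show "real (Suc ?L) / real (Suc N) \<le> ?J" by (simp add: divide_le_eq)
    qed (use C in auto)
    finally show ?thesis .
  qed
  moreover have "(C + 1) * ?J * ?J > 0" using C by (intro mult_pos_pos) auto
  ultimately show ?thesis by blast
qed

text \<open>Both cutoffs are 1 up to N, so the differences vanish nearly up to N, and the tail of
  the sum of (k + 1)^(-r-1) has order N^(-r).\<close>

lemma jackson_mbound:
  assumes l: "l \<ge> 0" and r: "r \<ge> 1"
  shows "\<exists>C>0. \<forall>N N'. N \<le> N' \<longrightarrow> mbound (Suc M) ((Suc M + 1) * N')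
     (\<lambda>k. (cutoff (Suc M) N' k - cutoff (Suc M) N k) * inverse (eigsq l k + delta0 k) ^ r) \<le> C / real (Suc N) ^ r"
proof -
  define m where "m N N' = (\<lambda>k. (cutoff (Suc M) N' k - cutoff (Suc M) N k) * inverse (eigsq l k + delta0 k) ^ r)" for N N'
  obtain C where C: "C \<ge> 0" "\<And>N N' k. \<bar>(nab ^^ Suc M) (m N N') k\<bar> \<le> C * real (Suc k) powr (- real r - real (Suc M))"
    using jackson_symbol[OF l, of "Suc M" r] unfolding m_def by blast
  let ?J = "real (Suc M + 1)"
  have "mbound (Suc M) ((Suc M + 1) * N') (m N N') \<le> ((C + 1) * 2 * ?J ^ r) / real (Suc N) ^ r" if NN: "N \<le> N'" for N N'
  proof -
    let ?L = "(Suc M + 1) * N'"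
    \<comment> \<open>The first index whose window k, ..., k + M + 1 leaves {0..N}; the case
      distinction corrects the truncated subtraction for small N.\<close>
    define K where "K = N - Suc M + (if N < Suc M then 0 else 1)"
    have KN: "real (Suc N) \<le> ?J * real (Suc K)"
    proof -
      have "Suc N \<le> (Suc M + 1) * Suc K" unfolding K_def by auto
      then show ?thesis by (metis of_nat_le_iff of_nat_mult)
    qed
    have z: "(nab ^^ Suc M) (m N N') k = 0" if "k < K" for k
    proof -
      have "k + Suc M \<le> N" using that unfolding K_def by (auto split: if_splits)
      then have "(nab ^^ Suc M) (m N N') k = (nab ^^ Suc M) (\<lambda>k. 0) k"
        using NN by (intro nab_funpow_cong) (simp add: m_def cutoff_eq_1)
      then show ?thesis by (simp only: nab_funpow_const[OF zero_less_Suc])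
    qed
    have "mbound (Suc M) ?L (m N N') = (\<Sum>k=K..?L. \<bar>(nab ^^ Suc M) (m N N') k\<bar> * cw (Suc M) k)"
      unfolding mbound_def by (rule sum.mono_neutral_right) (use z in auto)
    also have "\<dots> \<le> (\<Sum>k=K..?L. C / real (Suc K) ^ (r - 1) * (1 / real (Suc k) ^ 2))"
    proof (rule sum_mono)
      fix k assume k: "k \<in> {K..?L}"
      have "\<bar>(nab ^^ Suc M) (m N N') k\<bar> * cw (Suc M) k \<le> C * real (Suc k) powr (- real r - 1)"
        by (rule cw_term_le[OF C(2) C(1)])
      also have "real (Suc k) powr (- real r - 1) = 1 / real (Suc k) ^ (r + 1)"
      proof -
        have "- real r - 1 = - real (r + 1)" by simp
        then show ?thesis by (simp only: powr_minus_divide powr_realpow[OF of_nat_0_less_iff[THEN iffD2, OF zero_less_Suc]])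
      qed
      also have "r + 1 = (r - 1) + 2" using r by simp
      also have "C * (1 / real (Suc k) ^ ((r - 1) + 2)) = C / real (Suc k) ^ (r - 1) * (1 / real (Suc k) ^ 2)"
        by (simp only: power_add) simp
      also have "\<dots> \<le> C / real (Suc K) ^ (r - 1) * (1 / real (Suc k) ^ 2)"
        using k C(1) by (intro mult_right_mono divide_left_mono power_mono) auto
      finally show "\<bar>(nab ^^ Suc M) (m N N') k\<bar> * cw (Suc M) k \<le> C / real (Suc K) ^ (r - 1) * (1 / real (Suc k) ^ 2)" .
    qed
    also have "\<dots> = C / real (Suc K) ^ (r - 1) * (\<Sum>k=K..?L. 1 / real (Suc k) ^ 2)" by (rule sum_distrib_left[symmetric])
    also have "\<dots> \<le> C / real (Suc K) ^ (r - 1) * (2 / real (Suc K))"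
      using C(1) by (intro mult_left_mono sum_inverse_squares_tail) auto
    also have "\<dots> = 2 * C / (real (Suc K) ^ (r - 1) * real (Suc K))" by simp
    also have "real (Suc K) ^ (r - 1) * real (Suc K) = real (Suc K) ^ r" using r by (metis Suc_diff_1 less_eq_Suc_le One_nat_def power_Suc2)
    also have "2 * C / real (Suc K) ^ r \<le> 2 * (C + 1) / (real (Suc N) / ?J) ^ r"
    proof (intro frac_le power_mono)
      show "real (Suc N) / ?J \<le> real (Suc K)" using KN by (simp add: divide_le_eq mult.commute)
    qed (use C in auto)
    finally show ?thesis by (simp add: power_divide mult_ac)
  qed
  moreover have "(C + 1) * 2 * ?J ^ r > 0" using C by (intro mult_pos_pos zero_less_power) auto
  ultimately show ?thesis unfolding m_def by blast
qed

section \<open>Multiplier operators and their dominating kernels\<close>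

context hyperboloid
begin

lemma finite_rank_measurable: "finite_rank n K \<Longrightarrow> (\<lambda>(z, z'). K z z') \<in> borel_measurable (mu \<Otimes>\<^sub>M mu)"
proof (induction rule: finite_rank.induct)
  case (prod \<phi> n \<psi>)
  have [measurable]: "\<phi> \<in> borel_measurable mu" "\<psi> \<in> borel_measurable mu"
    using prod[THEN polysE_measurable] by simp_all
  show ?case by measurable
next
  case (plus n K K')
  then show ?case by (simp add: case_prod_beta' borel_measurable_add)
qed

text \<open>The constant 5 leaves room for the fourth derivatives needed in \<open>ker_nonneg\<close>.\<close>

definition JM :: nat where "JM = nat \<lceil>2 * (lam + 5)\<rceil>"
definition JJ :: nat where "JJ = Suc JM"
definition SS :: "nat \<Rightarrow> real poly" where "SS N = Spoly lam JJ N"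

lemma ker_SS_nonneg: "z \<in> LL a b c \<Longrightarrow> z' \<in> LL a b c \<Longrightarrow> 0 \<le> ker (SS N) z z'"
proof (intro ker_nonneg)
  fix x :: real assume x: "\<bar>x\<bar> \<le> 1"
  have M: "2 * (lam + 5) \<le> real JM" unfolding JM_def by linarith
  show "0 \<le> poly (SS N) x" using poly_Spoly_nonneg[OF lam_pos x, of 0 JM N] M by (simp add: SS_def JJ_def)
  show "0 \<le> poly ((pderiv ^^ 2) (SS N)) x" using poly_Spoly_nonneg[OF lam_pos x, of 2 JM N] M unfolding SS_def JJ_def by simp
  show "0 \<le> poly ((pderiv ^^ 4) (SS N)) x" using poly_Spoly_nonneg[OF lam_pos x, of 4 JM N] M unfolding SS_def JJ_def by simp
qed

lemma ker_SS_mass: "(\<integral>z'. ker (SS N) z z' \<partial>mu) = cw JJ N * K0"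
  using integral_ker_expansion[OF Spoly_def const_V0[of 1]] by (simp add: SS_def ker_zon_0 integral_const_mu)

definition mpoly :: "nat \<Rightarrow> (nat \<Rightarrow> real) \<Rightarrow> real poly" where
  "mpoly L m = (\<Sum>k\<le>L. smult (m k) (zon lam k))"

text \<open>With absolute values on the differences, positivity of the Cesaro kernels makes the lift
  a nonnegative majorant of the multiplier kernel, and its mass is explicit.\<close>

definition dpoly :: "nat \<Rightarrow> (nat \<Rightarrow> real) \<Rightarrow> real poly" where
  "dpoly L m = (\<Sum>k\<le>L. smult \<bar>(nab ^^ JJ) m k\<bar> (SS k))"

lemma ker_mpoly_abel:
  assumes "\<And>k. k > L \<Longrightarrow> m k = 0"
  shows "ker (mpoly L m) z z' = (\<Sum>k\<le>L. (nab ^^ JJ) m k * ker (SS k) z z')"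
proof -
  have "ker (mpoly L m) z z' = (\<Sum>k\<le>L. m k * ker (zon lam k) z z')" by (simp add: mpoly_def ker_sum ker_smult)
  also have "\<dots> = (\<Sum>k\<le>L. (nab ^^ JJ) m k * (psum ^^ JJ) (\<lambda>k. ker (zon lam k) z z') k)"
    by (rule abel_summation_iterated[OF assms])
  also have "(\<lambda>k. (psum ^^ JJ) (\<lambda>k. ker (zon lam k) z z') k) = (\<lambda>k. ker (SS k) z z')"
    by (simp add: fun_eq_iff psum_cw SS_def Spoly_def ker_sum ker_smult mult.commute)
  finally show ?thesis by simp
qed

lemma ker_mpoly_abs_le:
  assumes "\<And>k. k > L \<Longrightarrow> m k = 0" "z \<in> LL a b c" "z' \<in> LL a b c"
  shows "\<bar>ker (mpoly L m) z z'\<bar> \<le> ker (dpoly L m) z z'"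
proof -
  have "\<bar>ker (mpoly L m) z z'\<bar> \<le> (\<Sum>k\<le>L. \<bar>(nab ^^ JJ) m k * ker (SS k) z z'\<bar>)"
    by (subst ker_mpoly_abel[OF assms(1)]) (auto intro: sum_abs)
  also have "\<dots> = ker (dpoly L m) z z'"
    using ker_SS_nonneg[OF assms(2,3)] by (simp add: dpoly_def ker_sum ker_smult abs_mult)
  finally show ?thesis .
qed

lemma ker_dpoly_mass: "(\<integral>z'. ker (dpoly L m) z z' \<partial>mu) = mbound JJ L m * K0"
proof -
  have I: "integrable mu (\<lambda>z'. ker (SS k) z z')" for k using ker_polysE_integrable[OF polysE_const, of "SS k" z 1] by simp
  have "(\<integral>z'. ker (dpoly L m) z z' \<partial>mu) = (\<Sum>k\<le>L. \<integral>z'. \<bar>(nab ^^ JJ) m k\<bar> * ker (SS k) z z' \<partial>mu)"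
    unfolding dpoly_def ker_sum ker_smult by (rule Bochner_Integration.integral_sum) (intro integrable_mult_right I)
  then show ?thesis by (simp add: ker_SS_mass mbound_def sum_distrib_right mult.assoc)
qed

lemma kop_mpoly:
  assumes g: "integrable mu (ind g)"
  shows "kop (mpoly L m) g z = (\<Sum>k\<le>L. m k * prj k g z)"
proof -
  have I: "integrable mu (\<lambda>z'. ker (zon lam k) z z' * ind g z')" for k by (rule finite_rank_integrable[OF finite_rank_ker[OF order_refl] g])
  have "(\<integral>z'. ker (mpoly L m) z z' * ind g z' \<partial>mu) = (\<Sum>k\<le>L. \<integral>z'. m k * (ker (zon lam k) z z' * ind g z') \<partial>mu)"
    unfolding mpoly_def ker_sum ker_smult sum_distrib_right mult.assoc
    by (rule Bochner_Integration.integral_sum) (intro integrable_mult_right I)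
  then show ?thesis by (simp add: kop_def proj_eq_kop[OF g] sum_divide_distrib)
qed

lemma mpoly_degree: "degree (mpoly L m) \<le> L"
  unfolding mpoly_def by (intro degree_sum_le) (auto intro: order_trans[OF degree_smult_le] order_trans[OF degree_zon_le])

lemma kop_diff:
  assumes "integrable mu (ind f)" "integrable mu (ind g)"
  shows "kop k (\<lambda>z. f z - g z) z = kop k f z - kop k g z"
proof -
  have I: "integrable mu (\<lambda>z'. ker k z z' * ind f z')" if "integrable mu (ind f)" for f
    by (rule finite_rank_integrable[OF finite_rank_ker[OF order_refl] that])
  have "ind (\<lambda>z. f z - g z) z' = ind f z' - ind g z'" for z' by (simp add: ind_def right_diff_distrib)
  then have "(\<integral>z'. ker k z z' * ind (\<lambda>z. f z - g z) z' \<partial>mu) = (\<integral>z'. ker k z z' * ind f z' - ker k z z' * ind g z' \<partial>mu)"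
    by (simp only: right_diff_distrib)
  also have "\<dots> = (\<integral>z'. ker k z z' * ind f z' \<partial>mu) - (\<integral>z'. ker k z z' * ind g z' \<partial>mu)"
    by (rule Bochner_Integration.integral_diff[OF I I]) (rule assms)+
  finally show ?thesis by (simp add: kop_def diff_divide_distrib)
qed

lemma kop_zon_V_orth: "v \<in> V n \<Longrightarrow> j \<noteq> n \<Longrightarrow> kop (zon lam j) v = (\<lambda>z. 0)"
  using ker_zon_orth[of v n j] VE_iff[of v n] by (auto simp: kop_def fun_eq_iff integral_ind)

lemma kop_zon_polysE_orth: "P \<in> polysE n \<Longrightarrow> n < j \<Longrightarrow> kop (zon lam j) P = (\<lambda>z. 0)"
  using ker_zon_VE[of j] VE_iff by (auto simp: kop_def fun_eq_iff integral_ind)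

lemma kop_sum:
  assumes "finite I" "\<And>i. i \<in> I \<Longrightarrow> integrable mu (ind (f i))"
  shows "kop k (\<lambda>z. \<Sum>i\<in>I. s i * f i z) z = (\<Sum>i\<in>I. s i * kop k (f i) z)"
proof -
  have I: "integrable mu (\<lambda>z'. ker k z z' * ind (f i) z')" if "i \<in> I" for i
    by (rule finite_rank_integrable[OF finite_rank_ker[OF order_refl] assms(2)[OF that]])
  have "ind (\<lambda>z. \<Sum>i\<in>I. s i * f i z) z' = (\<Sum>i\<in>I. s i * ind (f i) z')" for z'
    by (simp add: ind_def sum_distrib_left mult_ac)
  then have "(\<integral>z'. ker k z z' * ind (\<lambda>z. \<Sum>i\<in>I. s i * f i z) z' \<partial>mu) = (\<integral>z'. (\<Sum>i\<in>I. s i * (ker k z z' * ind (f i) z')) \<partial>mu)"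
    by (simp only: sum_distrib_left mult.left_commute)
  also have "\<dots> = (\<Sum>i\<in>I. \<integral>z'. s i * (ker k z z' * ind (f i) z') \<partial>mu)"
    by (rule Bochner_Integration.integral_sum) (intro integrable_mult_right I)
  finally show ?thesis by (simp add: kop_def sum_divide_distrib)
qed

text \<open>The defect D has all projections zero. Every polynomial is a combination of zonal ones,
  so every lifted kernel annihilates D, in particular the approximate identity \<open>VPp\<close>;
  hence D vanishes on the domain, and as a polynomial everywhere.\<close>

theorem sum_proj_polysE:
  assumes P: "P \<in> polysE n" and L: "n \<le> L"
  shows "(\<Sum>k\<le>L. prj k P z) = P z"
proof -
  have iP: "integrable mu (ind P)" by (rule ind_polysE[OF P])
  define S where "S = (\<lambda>z. \<Sum>k\<le>L. 1 * kop (zon lam k) P z)"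
  define D where "D = (\<lambda>z. P z - S z)"
  have TE: "kop (zon lam k) P \<in> polysE k" for k by (rule kop_polysE[OF degree_zon_le iP])
  have S: "S \<in> polysE L" unfolding S_def by (intro polysE_sum polysE_cmult polysE_mono[OF TE]) simp
  have D: "D \<in> polysE L" unfolding D_def by (intro polysE_diff S polysE_mono[OF P L])
  have T0: "kop (zon lam j) D z = 0" for j z
  proof (cases "j \<le> L")
    case True
    have "kop (zon lam j) S z = (\<Sum>k\<le>L. 1 * kop (zon lam j) (kop (zon lam k) P) z)"
      unfolding S_def by (rule kop_sum) (auto intro: ind_polysE[OF TE])
    also have "\<dots> = (\<Sum>k\<le>L. if k = j then kop (zon lam j) P z else 0)"
      by (intro sum.cong refl) (use kop_zon_V_orth[OF kop_zon_V[OF iP]] kop_zon_VE[OF kop_zon_V[OF iP]] in auto)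
    also have "\<dots> = kop (zon lam j) P z" using True by simp
    finally show ?thesis unfolding D_def kop_diff[OF iP ind_polysE[OF S]] by simp
  next
    case False
    then show ?thesis using kop_zon_polysE_orth[OF D, of j] by simp
  qed
  have K: "(\<integral>z'. ker k z z' * D z' \<partial>mu) = 0" for k z
  proof -
    obtain \<kappa> where k: "k = (\<Sum>j\<le>degree k. smult (\<kappa> j) (zon lam j))" using zon_expansion[OF lam_pos order_refl] by blast
    have "kop (mpoly (degree k) \<kappa>) D z = 0" unfolding kop_mpoly[OF ind_polysE[OF D]] proj_eq_kop[OF ind_polysE[OF D]] T0 by simp
    then have "kop k D z = 0" unfolding mpoly_def k[symmetric] .
    then show ?thesis using K0_pos by (simp add: kop_def integral_ind[OF D])
  qed
  have "D z = 0" if z: "z \<in> LL a b c" for z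
    using VP_tendsto[OF D z] unfolding K by (simp add: LIMSEQ_const_iff)
  then have "AE z in mu. D z * D z = 0" using AE_mu by (auto elim: eventually_mono)
  then have "(\<integral>z. D z * D z \<partial>mu) = 0" by (rule integral_eq_zero_AE)
  then have "D = (\<lambda>z. 0)" by (rule polysE_zero_of_integral_sq[OF D])
  from fun_cong[OF this, of z] show ?thesis by (simp add: D_def S_def proj_eq_kop[OF iP])
qed

end

context hyperboloid_Lp
begin

text \<open>After scaling, the kernel is a probability density in each variable: Jensen's inequality in the inner variable, then Fubini.\<close>

theorem schur_bound:
  assumes g: "integrable mu (ind g)" and u: "meas u" and B: "B > 0"
    and k0: "\<And>z z'. z \<in> LL a b c \<Longrightarrow> z' \<in> LL a b c \<Longrightarrow> 0 \<le> ker k z z'"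
    and mass: "\<And>z. (\<integral>z'. ker k z z' \<partial>mu) = B * K0"
    and le: "\<And>z. z \<in> LL a b c \<Longrightarrow> \<bar>u z\<bar> \<le> 1 / K0 * (\<integral>z'. ker k z z' * \<bar>ind g z'\<bar> \<partial>mu)"
  shows "nrm u \<le> ennreal B * nrm g"
proof (rule nrm_leI)
  have mg: "meas g" using borel_measurable_integrable[OF g] by (simp add: meas_def)
  fix t :: real assume t: "0 < t" "nrm g < ennreal t"
  then have gt: "nrm g \<le> ennreal t" by simp
  define h where "h z = \<bar>ind g z\<bar> / t" for z
  define w where "w z z' = ker k z z' / (B * K0)" for z z'
  have BK: "B * K0 > 0" using B K0_pos by simp
  have h0: "h z \<ge> 0" for z using t by (simp add: h_def)
  have ih: "integrable mu h" unfolding h_def[abs_def] using g by simp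
  have [measurable]: "h \<in> borel_measurable mu" using borel_measurable_integrable[OF ih] .
  have w0: "0 \<le> w z z'" if "z \<in> LL a b c" "z' \<in> LL a b c" for z z' using k0[OF that] BK by (simp add: w_def)
  have iw: "integrable mu (w z)" for z
    unfolding w_def[abs_def] using ker_polysE_integrable[OF polysE_const, of k z 1] by simp
  have w1: "(\<integral>z'. w z z' \<partial>mu) = 1" for z unfolding w_def using B K0_pos mass by simp
  have wsym: "w z z' = w z' z" for z z' by (simp add: w_def ker_sym)
  have kh: "integrable mu (\<lambda>z'. ker k z z' * \<bar>ind g z'\<bar>)" for z
    using finite_rank_integrable[OF finite_rank_ker[OF order_refl] integrable_abs[OF g]] .
  have wh: "w z z' * h z' = 1 / (B * K0 * t) * (ker k z z' * \<bar>ind g z'\<bar>)" for z z' by (simp add: w_def h_def)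
  have iwh: "integrable mu (\<lambda>z'. w z z' * h z')" for z unfolding wh by (intro integrable_mult_right kh)
  define y where "y z = (\<integral>z'. w z z' * h z' \<partial>mu)" for z
  have uy: "\<bar>u z\<bar> \<le> B * t * y z" if "z \<in> LL a b c" for z
  proof -
    have "y z = 1 / (B * K0 * t) * (\<integral>z'. ker k z z' * \<bar>ind g z'\<bar> \<partial>mu)" unfolding y_def wh by simp
    then have "B * t * y z = 1 / K0 * (\<integral>z'. ker k z z' * \<bar>ind g z'\<bar> \<partial>mu)" using B t K0_pos by simp
    then show ?thesis using le[OF that] by simp
  qed
  have y0: "y z \<ge> 0" if "z \<in> LL a b c" for z unfolding y_def
    by (rule integral_nonneg_AE) (use AE_mu h0 w0[OF that] in \<open>auto elim!: eventually_mono\<close>)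
  have "nrm u \<le> ennreal (B * t)"
  proof (cases "p = \<infinity>")
    case True
    then have h1: "h z \<le> 1" if "z \<in> LL a b c" for z
      using gt nrm_le_iff[OF mg t(1)] that t by (auto simp: h_def ind_def divide_le_eq)
    have "y z \<le> 1" if z: "z \<in> LL a b c" for z
    proof -
      have "y z \<le> (\<integral>z'. w z z' \<partial>mu)" unfolding y_def
      proof (rule integral_mono_AE[OF iwh iw])
        show "AE z' in mu. w z z' * h z' \<le> w z z'"
          using AE_mu by eventually_elim (use w0[OF z] h1 in \<open>auto intro: mult_left_le\<close>)
      qed
      then show ?thesis by (simp add: w1)
    qed
    then have "\<bar>u z\<bar> \<le> B * t" if "z \<in> LL a b c" for z
      using uy[OF that] that B t by (smt (verit) mult_left_le mult_pos_pos)
    then show ?thesis using True B t nrm_le_iff[OF u, of "B * t"] by simp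
  next
    case False
    have q: "q \<ge> 1" by (rule q_ge_1[OF False])
    have G: "(\<integral>\<^sup>+z. ennreal (h z powr q) \<partial>mu) \<le> 1" using False gt nrm_le_iff[OF mg t(1)] by (simp add: h_def)
    have [measurable]: "w z \<in> borel_measurable mu" for z using borel_measurable_integrable[OF iw] .
    \<comment> \<open>The tangent line at \<open>y z\<close> is integrated against the probability
      density \<open>w z\<close>, where its linear term has mean zero. If the right side is not
      integrable, it is infinite.\<close>
    have jensen: "ennreal (y z powr q) \<le> (\<integral>\<^sup>+z'. ennreal (w z z' * h z' powr q) \<partial>mu)" if z: "z \<in> LL a b c" for z
    proof (cases "integrable mu (\<lambda>z'. w z z' * h z' powr q)")
      case True
      have "y z powr q = (\<integral>z'. (y z powr q - q * y z powr (q - 1) * y z) * w z z' + q * y z powr (q - 1) * (w z z' * h z') \<partial>mu)"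
        by (subst Bochner_Integration.integral_add) (auto intro!: iw iwh simp: w1 y_def[symmetric])
      also have "\<dots> \<le> (\<integral>z'. w z z' * h z' powr q \<partial>mu)"
      proof (rule integral_mono_AE)
        show "integrable mu (\<lambda>z'. (y z powr q - q * y z powr (q - 1) * y z) * w z z' + q * y z powr (q - 1) * (w z z' * h z'))"
          by (intro Bochner_Integration.integrable_add integrable_mult_right iw iwh)
        show "AE z' in mu. (y z powr q - q * y z powr (q - 1) * y z) * w z z' + q * y z powr (q - 1) * (w z z' * h z') \<le> w z z' * h z' powr q"
          using AE_mu
        proof eventually_elim
          case (elim z')
          have "w z z' * (y z powr q + q * y z powr (q - 1) * (h z' - y z)) \<le> w z z' * h z' powr q"
            by (intro mult_left_mono powr_tangent_line h0 y0 z q w0 elim)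
          then show ?case by (simp add: algebra_simps)
        qed
      qed (rule True)
      finally have "ennreal (y z powr q) \<le> ennreal (\<integral>z'. w z z' * h z' powr q \<partial>mu)" by (rule ennreal_leI)
      also have "\<dots> = (\<integral>\<^sup>+z'. ennreal (w z z' * h z' powr q) \<partial>mu)"
        by (rule nn_integral_eq_integral[symmetric, OF True]) (use AE_mu w0[OF z] in \<open>auto elim!: eventually_mono\<close>)
      finally show ?thesis .
    next
      case False
      have "\<not> (\<integral>\<^sup>+z'. ennreal (w z z' * h z' powr q) \<partial>mu) < \<infinity>"
      proof
        assume "(\<integral>\<^sup>+z'. ennreal (w z z' * h z' powr q) \<partial>mu) < \<infinity>"
        then have "integrable mu (\<lambda>z'. w z z' * h z' powr q)"
          by (intro integrableI_nonneg) (use AE_mu w0[OF z] in \<open>auto elim!: eventually_mono\<close>)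
        then show False using False by simp
      qed
      then show ?thesis by (simp add: not_less top_unique)
    qed
    \<comment> \<open>Symmetry of the kernel makes it a probability density in the other variable
      too, as the exchange of integrals requires.\<close>
    have mass': "(\<integral>\<^sup>+z. ennreal (w z z') \<partial>mu) = 1" if z': "z' \<in> LL a b c" for z'
    proof -
      have "(\<integral>\<^sup>+z. ennreal (w z z') \<partial>mu) = (\<integral>\<^sup>+z. ennreal (w z' z) \<partial>mu)" by (simp add: wsym)
      also have "\<dots> = ennreal (\<integral>z. w z' z \<partial>mu)"
        by (rule nn_integral_eq_integral[OF iw]) (use AE_mu w0[OF z'] in \<open>auto elim!: eventually_mono\<close>)
      finally show ?thesis by (simp add: w1)
    qed
    interpret pp: pair_sigma_finite mu mu by unfold_locales
    have kmeas [measurable]: "(\<lambda>(z, z'). w z z') \<in> borel_measurable (mu \<Otimes>\<^sub>M mu)"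
      using finite_rank_measurable[OF finite_rank_ker[OF order_refl, of k]] unfolding w_def by (simp add: case_prod_beta')
    have "(\<integral>\<^sup>+z. ennreal ((\<bar>ind u z\<bar> / (B * t)) powr q) \<partial>mu) \<le> (\<integral>\<^sup>+z. (\<integral>\<^sup>+z'. ennreal (w z z' * h z' powr q) \<partial>mu) \<partial>mu)"
    proof (rule nn_integral_mono_AE)
      show "AE z in mu. ennreal ((\<bar>ind u z\<bar> / (B * t)) powr q) \<le> (\<integral>\<^sup>+z'. ennreal (w z z' * h z' powr q) \<partial>mu)"
        using AE_mu
      proof eventually_elim
        case (elim z)
        have "\<bar>ind u z\<bar> / (B * t) \<le> y z" using uy[OF elim] elim B t by (simp add: ind_def divide_le_eq mult_ac)
        then have "ennreal ((\<bar>ind u z\<bar> / (B * t)) powr q) \<le> ennreal (y z powr q)"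
          using q B t by (intro ennreal_leI powr_mono2) auto
        also note jensen[OF elim]
        finally show ?case .
      qed
    qed
    also have "\<dots> = (\<integral>\<^sup>+z'. (\<integral>\<^sup>+z. ennreal (w z z' * h z' powr q) \<partial>mu) \<partial>mu)"
      by (rule pp.Fubini'[symmetric]) (use kmeas in measurable)
    also have "\<dots> = (\<integral>\<^sup>+z'. ennreal (h z' powr q) \<partial>mu)"
    proof (rule nn_integral_cong_AE)
      show "AE z' in mu. (\<integral>\<^sup>+z. ennreal (w z z' * h z' powr q) \<partial>mu) = ennreal (h z' powr q)"
        using AE_mu
      proof eventually_elim
        case (elim z')
        have [measurable]: "(\<lambda>z. w z z') \<in> borel_measurable mu" unfolding wsym[of _ z'] by measurable
        have "(\<integral>\<^sup>+z. ennreal (w z z' * h z' powr q) \<partial>mu) = (\<integral>\<^sup>+z. ennreal (w z z') * ennreal (h z' powr q) \<partial>mu)"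
          by (simp add: ennreal_mult'')
        also have "\<dots> = (\<integral>\<^sup>+z. ennreal (w z z') \<partial>mu) * ennreal (h z' powr q)" by (rule nn_integral_multc) measurable
        finally show ?case by (simp add: mass'[OF elim])
      qed
    qed
    also note G
    finally show ?thesis using False B t nrm_le_iff[OF u, of "B * t"] by simp
  qed
  also have "ennreal (B * t) = ennreal B * ennreal t" using B t by (intro ennreal_mult) auto
  finally show "nrm u \<le> ennreal B * ennreal t" .
qed (rule B)

theorem multiplier_bound:
  assumes g: "integrable mu (ind g)" and m: "\<And>k. k > L \<Longrightarrow> m k = 0" and B: "mbound JJ L m \<le> B" "B > 0"
  shows "nrm (kop (mpoly L m) g) \<le> ennreal B * nrm g"
proof (rule schur_bound[OF g])
  \<comment> \<open>\<open>schur_bound\<close> wants mass exactly \<open>B\<close>; a nonnegative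
    constant kernel fills the gap.\<close>
  define k where "k = dpoly L m + smult (B - mbound JJ L m) (zon lam 0)"
  have kk: "ker k z z' = ker (dpoly L m) z z' + (B - mbound JJ L m)" for z z'
    by (simp add: k_def ker_add ker_smult ker_zon_0)
  show "meas (kop (mpoly L m) g)" by (rule meas_polysE[OF kop_polysE[OF order_refl g]])
  show "B > 0" by fact
  have le: "\<bar>ker (mpoly L m) z z'\<bar> \<le> ker k z z'" if "z \<in> LL a b c" "z' \<in> LL a b c" for z z'
    using ker_mpoly_abs_le[of L m z z', OF m that] B by (simp add: kk)
  show "0 \<le> ker k z z'" if "z \<in> LL a b c" "z' \<in> LL a b c" for z z' using le[OF that] by linarith
  show "(\<integral>z'. ker k z z' \<partial>mu) = B * K0" for z
  proof -
    have "integrable mu (\<lambda>z'. ker (dpoly L m) z z')" using ker_polysE_integrable[OF polysE_const, of "dpoly L m" z 1] by simp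
    then have "(\<integral>z'. ker k z z' \<partial>mu) = (\<integral>z'. ker (dpoly L m) z z' \<partial>mu) + (\<integral>z'. B - mbound JJ L m \<partial>mu)"
      unfolding kk by (rule Bochner_Integration.integral_add) simp
    then show ?thesis by (simp only: ker_dpoly_mass integral_const_mu) (simp add: algebra_simps)
  qed
  fix z :: "'d pt" assume z: "z \<in> LL a b c"
  have I: "integrable mu (\<lambda>z'. ker k z z' * ind g z')" for k by (rule finite_rank_integrable[OF finite_rank_ker[OF order_refl] g])
  have Ia: "integrable mu (\<lambda>z'. ker k z z' * \<bar>ind g z'\<bar>)" for k
    by (rule finite_rank_integrable[OF finite_rank_ker[OF order_refl] integrable_abs[OF g]])
  have "\<bar>\<integral>z'. ker (mpoly L m) z z' * ind g z' \<partial>mu\<bar> \<le> (\<integral>z'. \<bar>ker (mpoly L m) z z' * ind g z'\<bar> \<partial>mu)"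
    by (rule integral_abs_bound)
  also have "\<dots> \<le> (\<integral>z'. ker k z z' * \<bar>ind g z'\<bar> \<partial>mu)"
  proof (rule integral_mono_AE[OF integrable_abs[OF I] Ia])
    show "AE z' in mu. \<bar>ker (mpoly L m) z z' * ind g z'\<bar> \<le> ker k z z' * \<bar>ind g z'\<bar>"
      using AE_mu by eventually_elim (auto simp: abs_mult intro!: mult_right_mono le[OF z])
  qed
  finally show "\<bar>kop (mpoly L m) g z\<bar> \<le> 1 / K0 * (\<integral>z'. ker k z z' * \<bar>ind g z'\<bar> \<partial>mu)"
    using K0_pos by (simp add: kop_def abs_mult divide_right_mono)
qed

end

section \<open>Jackson and Bernstein inequalities\<close>

text \<open>Degrees \<open>0, 1, 2, 4, 8, \<dots>\<close> of the near-best polynomials in the inverse estimate.\<close>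

definition dyad :: "nat \<Rightarrow> nat" where "dyad j = (case j of 0 \<Rightarrow> 0 | Suc i \<Rightarrow> 2 ^ i)"

lemma dyad_0 [simp]: "dyad 0 = 0" and dyad_Suc [simp]: "dyad (Suc i) = 2 ^ i"
  by (simp_all add: dyad_def)

lemma dyad_le: "dyad m \<le> 2 ^ m" by (cases m) auto

text \<open>With h = 2^m / 2 the block has at least h elements k, each with k + 1 >= h and E k >= E
  (2^m). The factor 4^r compares 2 * 2^m with h.\<close>

lemma dyadic_block:
  fixes E :: "nat \<Rightarrow> real"
  assumes anti: "antimono E" and pos: "\<And>k. E k \<ge> 0" and r: "r \<ge> 1"
  shows "(2 * 2 ^ m) ^ r * E (2 ^ m) \<le> 4 ^ r * (\<Sum>k\<in>{dyad m<..2 ^ m}. real (k + 1) ^ (r - 1) * E k)"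
proof -
  let ?h = "2 ^ m / 2 :: real"
  have card: "?h \<le> real (card {dyad m<..2 ^ m})" by (cases m) auto
  have dy: "?h \<le> real (dyad m) + 2" by (cases m) auto
  have "?h ^ r * E (2 ^ m) = ?h * (?h ^ (r - 1) * E (2 ^ m))"
    using r by (cases r) auto
  also have "\<dots> \<le> real (card {dyad m<..2 ^ m}) * (?h ^ (r - 1) * E (2 ^ m))"
    using pos by (intro mult_right_mono card) auto
  also have "\<dots> = (\<Sum>k\<in>{dyad m<..2 ^ m}. ?h ^ (r - 1) * E (2 ^ m))" by simp
  also have "\<dots> \<le> (\<Sum>k\<in>{dyad m<..2 ^ m}. real (k + 1) ^ (r - 1) * E k)"
  proof (rule sum_mono)
    fix k assume k: "k \<in> {dyad m<..2 ^ m}"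
    then have "?h \<le> real (k + 1)" using dy by auto
    moreover have "E (2 ^ m) \<le> E k" using k anti by (auto dest: antimonoD)
    ultimately show "?h ^ (r - 1) * E (2 ^ m) \<le> real (k + 1) ^ (r - 1) * E k"
      using pos by (intro mult_mono power_mono) auto
  qed
  finally have "4 ^ r * (?h ^ r * E (2 ^ m)) \<le> 4 ^ r * (\<Sum>k\<in>{dyad m<..2 ^ m}. real (k + 1) ^ (r - 1) * E k)"
    by (intro mult_left_mono) auto
  moreover have "4 ^ r * (?h ^ r * E (2 ^ m)) = (2 * 2 ^ m) ^ r * E (2 ^ m)"
    by (simp only: mult.assoc[symmetric] power_mult_distrib[symmetric]) simp
  ultimately show ?thesis by simp
qed

lemma dyadic_sum:
  fixes E :: "nat \<Rightarrow> real"
  assumes anti: "antimono E" and pos: "\<And>k. E k \<ge> 0" and r: "r \<ge> 1"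
  shows "(\<Sum>j\<le>m. (2 ^ j) ^ r * E (dyad j)) \<le> 4 ^ r * (\<Sum>k\<le>dyad m. real (k + 1) ^ (r - 1) * E k)"
proof (induction m)
  case 0
  have "1 * E 0 \<le> 4 ^ r * E 0" using pos by (intro mult_right_mono one_le_power) auto
  then show ?case by simp
next
  case (Suc m)
  let ?t = "\<lambda>k. real (k + 1) ^ (r - 1) * E k"
  have "(\<Sum>j\<le>Suc m. (2 ^ j) ^ r * E (dyad j)) \<le> 4 ^ r * sum ?t {..dyad m} + 4 ^ r * sum ?t {dyad m<..2 ^ m}"
    using add_mono[OF Suc.IH dyadic_block[OF anti pos r, of m]] by simp
  also have "\<dots> = 4 ^ r * (sum ?t {..dyad m} + sum ?t {dyad m<..2 ^ m})" by (simp only: distrib_left)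
  also have "sum ?t {..dyad m} + sum ?t {dyad m<..2 ^ m} = sum ?t ({..dyad m} \<union> {dyad m<..2 ^ m})"
    by (rule sum.union_disjoint[symmetric]) auto
  also have "{..dyad m} \<union> {dyad m<..2 ^ m} = {..dyad (Suc m)}" using dyad_le[of m] by auto
  finally show ?case .
qed

lemma ex_dyadic_scale: "n \<ge> 1 \<Longrightarrow> \<exists>m. 2 ^ m \<le> n \<and> n < 2 * 2 ^ m" for n :: nat
proof (induction n rule: nat_induct_at_least)
  case base show ?case by (rule exI[of _ 0]) simp
next
  case (Suc n)
  then obtain m where m: "2 ^ m \<le> n" "n < 2 * 2 ^ m" by blast
  show ?case
  proof (cases "Suc n < 2 * 2 ^ m")
    case True then show ?thesis using m by (intro exI[of _ m]) auto
  next
    case False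
    then have "Suc n = 2 ^ Suc m" using m by simp
    then show ?thesis by (intro exI[of _ "Suc m"]) simp
  qed
qed

lemma eigsq_0 [simp]: "eigsq l 0 = 0" by (simp add: eigsq_def)

context hyperboloid
begin

lemma eigenvalue_eq: "sqrt (real n * (real n + 2 * \<beta> + 2 * \<gamma> + real CARD('d) + 1)) = eigsq lam n"
  unfolding eigsq_def lam_def dimr_def by (simp add: algebra_simps)

lemma frac_op_iff: "frac_op a b c \<beta> \<gamma> r g h \<longleftrightarrow>
    in_Lp a b c \<beta> \<gamma> 2 h \<and> (\<forall>n. prj n h = (\<lambda>z. eigsq lam n ^ r * prj n g z))" for g :: "'d pt \<Rightarrow> real"
  unfolding frac_op_def eigenvalue_eq ..

text \<open>Stone-Weierstrass: even polynomials separate points because t >= 0 on the domain, where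
  t^2 determines t.\<close>

theorem polysE_dense:
  assumes g: "continuous_on (LL a b c) (g :: 'd pt \<Rightarrow> real)" and e: "e > 0"
  shows "\<exists>n. \<exists>P\<in>polysE n. \<forall>z\<in>LL a b c. \<bar>g z - P z\<bar> < e"
proof -
  interpret F: function_ring_on "{P :: 'd pt \<Rightarrow> real. \<exists>n. P \<in> polysE n}" "LL a b c"
  proof
    show "compact (LL a b c :: 'd pt set)" by (rule LL_compact)
    fix f assume "f \<in> {P :: 'd pt \<Rightarrow> real. \<exists>n. P \<in> polysE n}"
    then show "continuous_on (LL a b c) f" using polysE_continuous by blast
  next
    fix f g assume "f \<in> {P :: 'd pt \<Rightarrow> real. \<exists>n. P \<in> polysE n}" "g \<in> {P :: 'd pt \<Rightarrow> real. \<exists>n. P \<in> polysE n}"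
    then obtain n m where "f \<in> polysE n" "g \<in> polysE m" by blast
    then have "f \<in> polysE (n + m)" "g \<in> polysE (n + m)" "(\<lambda>z. f z * g z) \<in> polysE (n + m)"
      by (auto intro: polysE_mono polysE_mult)
    then show "(\<lambda>x. f x + g x) \<in> {P :: 'd pt \<Rightarrow> real. \<exists>n. P \<in> polysE n}" "(\<lambda>x. f x * g x) \<in> {P :: 'd pt \<Rightarrow> real. \<exists>n. P \<in> polysE n}"
      using polysE_add by blast+
  next
    show "(\<lambda>_. s) \<in> {P :: 'd pt \<Rightarrow> real. \<exists>n. P \<in> polysE n}" for s using polysE_const by blast
  next
    fix z w :: "'d pt" assume zw: "z \<in> LL a b c" "w \<in> LL a b c" "z \<noteq> w"
    show "\<exists>f\<in>{P :: 'd pt \<Rightarrow> real. \<exists>n. P \<in> polysE n}. f z \<noteq> f w"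
    proof (cases "fst z = fst w")
      case True
      then have "snd z \<noteq> snd w" using zw(3) by (simp add: prod_eq_iff)
      moreover have "snd z \<ge> 0" "snd w \<ge> 0" using zw(1,2) by (auto simp: LL_def)
      ultimately have "(snd z)\<^sup>2 \<noteq> (snd w)\<^sup>2" by (simp add: power2_eq_iff_nonneg)
      then show ?thesis using polysE_snd2 by (intro bexI[of _ "\<lambda>z. (snd z)\<^sup>2"]) auto
    next
      case False
      then obtain i where "fst z $ i \<noteq> fst w $ i" by (auto simp: vec_eq_iff)
      then show ?thesis using polysE_nth by (intro bexI[of _ "\<lambda>z. fst z $ i"]) auto
    qed
  qed
  show ?thesis using F.Stone_Weierstrass_basic[OF g e] by blast
qed

text \<open>A mean of de la Vallee Poussin type: it keeps polynomials of degree N, is bounded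
  uniformly in N, and its image has degree at most JJ + 1 times as large.\<close>

definition Vop :: "nat \<Rightarrow> ('d pt \<Rightarrow> real) \<Rightarrow> 'd pt \<Rightarrow> real" where
  "Vop N g = kop (mpoly ((JJ + 1) * N) (cutoff JJ N)) g"

lemma Vop_polysE: "integrable mu (ind g) \<Longrightarrow> Vop N g \<in> polysE ((JJ + 1) * N)"
  unfolding Vop_def by (rule kop_polysE[OF mpoly_degree])

lemma prj_polysE_orth: "P \<in> polysE n \<Longrightarrow> n < j \<Longrightarrow> prj j P z = 0"
  by (simp add: proj_eq_kop[OF ind_polysE] kop_zon_polysE_orth)

lemma Vop_reproducing:
  assumes P: "P \<in> polysE n" and N: "n \<le> N"
  shows "Vop N P z = P z"
proof -
  have "Vop N P z = (\<Sum>k\<le>(JJ + 1) * N. cutoff JJ N k * prj k P z)"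
    unfolding Vop_def by (rule kop_mpoly[OF ind_polysE[OF P]])
  also have "\<dots> = (\<Sum>k\<le>(JJ + 1) * N. prj k P z)"
  proof (rule sum.cong[OF refl])
    fix k show "cutoff JJ N k * prj k P z = prj k P z"
      using prj_polysE_orth[OF P, of k z] cutoff_eq_1[of k N JJ] N by (cases "k \<le> N") auto
  qed
  also have "\<dots> = P z" by (rule sum_proj_polysE[OF P]) (use N in simp)
  finally show ?thesis .
qed

text \<open>The operator (-D)^(r/2) on polynomials of degree at most n; it supplies the function h
  required by \<open>frac_op\<close> when g is a polynomial.\<close>

definition fpow :: "nat \<Rightarrow> nat \<Rightarrow> ('d pt \<Rightarrow> real) \<Rightarrow> 'd pt \<Rightarrow> real" where
  "fpow r n P z = (\<Sum>k\<le>n. eigsq lam k ^ r * prj k P z)"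

lemma prj_polysE: "integrable mu (ind g) \<Longrightarrow> prj k g \<in> polysE k"
  unfolding proj_eq_kop by (rule kop_polysE[OF degree_zon_le])

lemma fpow_polysE: "integrable mu (ind P) \<Longrightarrow> fpow r n P \<in> polysE n"
  unfolding fpow_def[abs_def] by (intro polysE_sum polysE_cmult polysE_mono[OF prj_polysE]) auto

lemma fpow_mono:
  assumes "P \<in> polysE k" "k \<le> n"
  shows "fpow r n P = fpow r k P"
proof
  fix z
  show "fpow r n P z = fpow r k P z"
    unfolding fpow_def by (rule sum.mono_neutral_right) (use assms prj_polysE_orth[OF assms(1)] in auto)
qed

lemma fpow_0: "r \<ge> 1 \<Longrightarrow> fpow r 0 P z = 0" by (simp add: fpow_def)

lemma fpow_diff:
  assumes "integrable mu (ind f)" "integrable mu (ind g)"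
  shows "fpow r n (\<lambda>z. f z - g z) z = fpow r n f z - fpow r n g z"
proof -
  have "integrable mu (\<lambda>z. ind f z - ind g z)" using assms by simp
  then have i: "integrable mu (ind (\<lambda>z. f z - g z))" by (simp add: ind_def[abs_def] right_diff_distrib)
  show ?thesis unfolding fpow_def by (simp add: proj_eq_kop[OF i] proj_eq_kop[OF assms(1)] proj_eq_kop[OF assms(2)] kop_diff[OF assms] right_diff_distrib sum_subtractf)
qed

lemma prj_fpow:
  assumes P: "P \<in> polysE n"
  shows "prj j (fpow r n P) z = eigsq lam j ^ r * prj j P z"
proof -
  have iP: "integrable mu (ind P)" by (rule ind_polysE[OF P])
  have iL: "integrable mu (ind (fpow r n P))" by (rule ind_polysE[OF fpow_polysE[OF iP]])
  have "prj j (fpow r n P) z = kop (zon lam j) (\<lambda>z. \<Sum>k\<le>n. eigsq lam k ^ r * prj k P z) z"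
    unfolding proj_eq_kop[OF iL] by (simp add: fpow_def[abs_def])
  also have "\<dots> = (\<Sum>k\<le>n. eigsq lam k ^ r * kop (zon lam j) (prj k P) z)"
    by (rule kop_sum) (auto intro: ind_polysE[OF prj_polysE[OF iP]])
  also have "\<dots> = (\<Sum>k\<le>n. if k = j then eigsq lam j ^ r * prj j P z else 0)"
    unfolding proj_eq_kop[OF iP]
    by (intro sum.cong refl) (use kop_zon_V_orth[OF kop_zon_V[OF iP]] kop_zon_VE[OF kop_zon_V[OF iP]] in auto)
  also have "\<dots> = eigsq lam j ^ r * prj j P z" using prj_polysE_orth[OF P, of j z] by auto
  finally show ?thesis .
qed

end

context hyperboloid_Lp
begin

lemma in_Lp_finite:
  assumes "p \<noteq> \<infinity>" "in_Lp a b c \<beta> \<gamma> (enn2real p) f"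
  shows "meas f" "nrm f < \<infinity>"
  using assms unfolding in_Lp_def meas_def ind_def[abs_def] nrm_def wnorm_def by (auto simp: Let_def)

lemma finite_in_Lp:
  assumes "p \<noteq> \<infinity>" "meas f" "nrm f < \<infinity>"
  shows "in_Lp a b c \<beta> \<gamma> (enn2real p) f"
  using assms unfolding in_Lp_def meas_def ind_def[abs_def] nrm_def wnorm_def
  by (auto simp: Let_def less_top split: if_splits)

lemma nrm_continuous_finite:
  assumes "continuous_on (LL a b c) f"
  shows "nrm f < \<infinity>"
proof -
  obtain B where "\<forall>z\<in>LL a b c. \<bar>f z\<bar> \<le> B" using continuous_on_LL_bound[OF assms] by blast
  then have "nrm f \<le> ennreal (max 1 K0 * (\<bar>B\<bar> + 1))" by (intro nrm_bounded meas_continuous assms) fastforce+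
  then show ?thesis by (simp add: le_less_trans)
qed

end

context hyperboloid
begin

text \<open>\<open>frac_op\<close> places h in the space with exponent 2 whatever p is; the instance
  p = 2 of the norm calculus shows that multipliers may act on it.\<close>

lemma L2_integrable:
  assumes "in_Lp a b c \<beta> \<gamma> 2 (h :: 'd pt \<Rightarrow> real)"
  shows "integrable mu (ind h)"
proof -
  interpret L2: hyperboloid_Lp a b c \<beta> \<gamma> dt 2 by unfold_locales simp
  show ?thesis by (rule L2.nrm_finite_integrable) (use L2.in_Lp_finite[of h] assms in auto)
qed

lemma polysE_L2: "P \<in> polysE n \<Longrightarrow> in_Lp a b c \<beta> \<gamma> 2 P" for P :: "'d pt \<Rightarrow> real"
proof -
  assume P: "P \<in> polysE n"
  interpret L2: hyperboloid_Lp a b c \<beta> \<gamma> dt 2 by unfold_locales simp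
  show ?thesis using L2.finite_in_Lp[OF _ L2.meas_polysE[OF P] L2.nrm_continuous_finite[OF polysE_continuous[OF P]]] by simp
qed

lemma frac_op_fpow: "P \<in> polysE n \<Longrightarrow> frac_op a b c \<beta> \<gamma> r P (fpow r n P)"
  unfolding frac_op_iff using prj_fpow polysE_L2[OF fpow_polysE[OF ind_polysE]] by blast

lemma continuous_integrable: "continuous_on (LL a b c) g \<Longrightarrow> integrable mu (ind g)"
proof -
  assume g: "continuous_on (LL a b c) g"
  interpret L2: hyperboloid_Lp a b c \<beta> \<gamma> dt 2 by unfold_locales simp
  show ?thesis by (rule L2.nrm_finite_integrable[OF L2.meas_continuous[OF g] L2.nrm_continuous_finite[OF g]])
qed

end

context hyperboloid_Lp
begin

lemma meas_kop: "integrable mu (ind g) \<Longrightarrow> meas (kop k g)"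
  by (rule meas_polysE[OF kop_polysE[OF order_refl]])

text \<open>Density of polynomials in the uniform norm, uniform boundedness of \<open>Vop\<close>,
  and exact reproduction of the approximating polynomial for large N.\<close>

lemma Vop_tendsto:
  assumes g: "continuous_on (LL a b c) g" and e: "e > 0"
  shows "\<exists>N0. \<forall>N\<ge>N0. nrm (\<lambda>z. g z - Vop N g z) \<le> ennreal e"
proof -
  obtain C where C: "C > 0" "\<And>N. mbound JJ ((JJ + 1) * N) (cutoff JJ N) \<le> C"
    using cutoff_mbound[of JM] unfolding JJ_def by blast
  define d where "d = e / (1 + C) / max 1 K0"
  have d: "d > 0" using C e by (simp add: d_def)
  obtain n P where P: "P \<in> polysE n" "\<And>z. z \<in> LL a b c \<Longrightarrow> \<bar>g z - P z\<bar> < d"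
    using polysE_dense[OF g d] by blast
  have ig: "integrable mu (ind g)" by (rule continuous_integrable[OF g])
  have iP: "integrable mu (ind P)" by (rule ind_polysE[OF P(1)])
  have c: "continuous_on (LL a b c) (\<lambda>z. g z - P z)" by (intro continuous_on_diff g polysE_continuous[OF P(1)])
  have id: "integrable mu (ind (\<lambda>z. g z - P z))" by (rule continuous_integrable[OF c])
  have "nrm (\<lambda>z. g z - P z) \<le> ennreal (max 1 K0 * d)"
    by (rule nrm_bounded[OF meas_continuous[OF c] d]) (use P(2) in \<open>auto intro: less_imp_le\<close>)
  also have "max 1 K0 * d = e / (1 + C)" by (simp add: d_def)
  finally have gP: "nrm (\<lambda>z. g z - P z) \<le> ennreal (e / (1 + C))" .
  have "nrm (\<lambda>z. g z - Vop N g z) \<le> ennreal e" if N: "n \<le> N" for N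
  proof -
    have "Vop N (\<lambda>z. g z - P z) z = Vop N g z - P z" for z
      using kop_diff[OF ig iP, of "mpoly ((JJ + 1) * N) (cutoff JJ N)" z] Vop_reproducing[OF P(1) N, of z] by (simp add: Vop_def)
    then have "(\<lambda>z. g z - Vop N g z) = (\<lambda>z. (g z - P z) - Vop N (\<lambda>z. g z - P z) z)" by simp
    then have "nrm (\<lambda>z. g z - Vop N g z) \<le> nrm (\<lambda>z. g z - P z) + nrm (Vop N (\<lambda>z. g z - P z))"
      using nrm_diff_le[OF meas_continuous[OF c] meas_kop[OF id]] by (simp only: Vop_def)
    also have "\<dots> \<le> nrm (\<lambda>z. g z - P z) + ennreal C * nrm (\<lambda>z. g z - P z)"
      unfolding Vop_def by (intro add_left_mono multiplier_bound id C cutoff_eq_0)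
    also have "\<dots> \<le> ennreal (e / (1 + C)) + ennreal C * ennreal (e / (1 + C))"
      by (intro add_mono mult_left_mono gP) auto
    also have "\<dots> = ennreal (e / (1 + C) + C * (e / (1 + C)))"
      using ennreal_comb[of 1 C "e / (1 + C)" "e / (1 + C)"] C e by simp
    also have "e / (1 + C) + C * (e / (1 + C)) = (1 + C) * (e / (1 + C))" by (simp only: distrib_right mult_1_left)
    also have "\<dots> = e" using C by simp
    finally show ?thesis .
  qed
  then show ?thesis by blast
qed

text \<open>g - \<open>Vop N g\<close> is the limit of \<open>Vop N' g - Vop N g\<close>. Each of
  these is a multiplier applied to h, with symbol the difference of two cutoffs divided by the r-th
  power of the eigenvalue root, and \<open>jackson_mbound\<close> is uniform in N'.\<close>

theorem jackson:
  assumes r: "r \<ge> 1"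
  shows "\<exists>C>0. \<forall>N g h. continuous_on (LL a b c) g \<longrightarrow> frac_op a b c \<beta> \<gamma> r g h \<longrightarrow>
     nrm (\<lambda>z. g z - Vop N g z) \<le> ennreal (C / real (Suc N) ^ r) * nrm h"
proof -
  define m where "m N N' = (\<lambda>k. (cutoff JJ N' k - cutoff JJ N k) * inverse (eigsq lam k + delta0 k) ^ r)" for N N'
  obtain C where C: "C > 0" "\<And>N N'. N \<le> N' \<Longrightarrow> mbound JJ ((JJ + 1) * N') (m N N') \<le> C / real (Suc N) ^ r"
    using jackson_mbound[OF less_imp_le[OF lam_pos] r, of JM] unfolding JJ_def m_def by blast
  have "nrm (\<lambda>z. g z - Vop N g z) \<le> ennreal (C / real (Suc N) ^ r) * nrm h"
    if g: "continuous_on (LL a b c) g" and h: "frac_op a b c \<beta> \<gamma> r g h" for N g h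
  proof (rule ennreal_le_epsilon)
    fix e :: real assume e: "0 < e"
    obtain N0 where N0: "\<And>N. N \<ge> N0 \<Longrightarrow> nrm (\<lambda>z. g z - Vop N g z) \<le> ennreal e"
      using Vop_tendsto[OF g e] by blast
    define N' where "N' = max N N0"
    have NN: "N \<le> N'" by (simp add: N'_def)
    have ig: "integrable mu (ind g)" by (rule continuous_integrable[OF g])
    have ih: "integrable mu (ind h)" using h L2_integrable unfolding frac_op_iff by blast
    have m0: "m N N' k = 0" if "k > (JJ + 1) * N'" for k
    proof -
      have "(JJ + 1) * N \<le> (JJ + 1) * N'" using NN by (rule mult_le_mono2)
      then show ?thesis using that cutoff_eq_0[of JJ N k] cutoff_eq_0[of JJ N' k] by (simp add: m_def)
    qed
    have d: "Vop N' g z - Vop N g z = kop (mpoly ((JJ + 1) * N') (m N N')) h z" for z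
    proof -
      have "Vop N g z = (\<Sum>k\<le>(JJ + 1) * N. cutoff JJ N k * prj k g z)" unfolding Vop_def by (rule kop_mpoly[OF ig])
      also have "\<dots> = (\<Sum>k\<le>(JJ + 1) * N'. cutoff JJ N k * prj k g z)"
      proof (rule sum.mono_neutral_left)
        show "{..(JJ + 1) * N} \<subseteq> {..(JJ + 1) * N'}" using mult_le_mono2[OF NN] order_trans by blast
      qed (auto simp: cutoff_eq_0 not_le)
      finally have "Vop N' g z - Vop N g z = (\<Sum>k\<le>(JJ + 1) * N'. (cutoff JJ N' k - cutoff JJ N k) * prj k g z)"
        unfolding Vop_def[of N'] kop_mpoly[OF ig] by (simp only: sum_subtractf left_diff_distrib)
      also have "\<dots> = (\<Sum>k\<le>(JJ + 1) * N'. m N N' k * prj k h z)"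
      proof (rule sum.cong[OF refl])
        fix k
        have hk: "prj k h z = eigsq lam k ^ r * prj k g z" using h unfolding frac_op_iff by simp
        show "(cutoff JJ N' k - cutoff JJ N k) * prj k g z = m N N' k * prj k h z"
        proof (cases "k = 0")
          \<comment> \<open>Both cutoffs equal 1 at k = 0, so nothing is ever divided by the
            eigenvalue 0.\<close>
          case True then show ?thesis by (simp add: m_def cutoff_eq_1)
        next
          case False
          then have "eigsq lam k > 0" using eigsq_ge[of lam k] lam_pos by (simp add: less_le_trans[of 0 "real k"])
          then show ?thesis using False unfolding hk m_def by (simp add: delta0_def power_inverse)
        qed
      qed
      also have "\<dots> = kop (mpoly ((JJ + 1) * N') (m N N')) h z" by (rule kop_mpoly[OF ih, symmetric])
      finally show ?thesis .
    qed
    have mg: "meas g" "meas (Vop N' g)" "meas (Vop N g)"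
      using meas_continuous[OF g] meas_kop[OF ig] by (simp_all add: Vop_def)
    have "nrm (\<lambda>z. g z - Vop N g z) \<le> nrm (\<lambda>z. g z - Vop N' g z) + nrm (\<lambda>z. Vop N' g z - Vop N g z)"
      by (rule nrm_diff_triangle[OF mg])
    also have "\<dots> \<le> ennreal e + ennreal (C / real (Suc N) ^ r) * nrm h"
    proof (rule add_mono)
      show "nrm (\<lambda>z. g z - Vop N' g z) \<le> ennreal e" by (rule N0) (simp add: N'_def)
      have "(\<lambda>z. Vop N' g z - Vop N g z) = kop (mpoly ((JJ + 1) * N') (m N N')) h" using d by blast
      then show "nrm (\<lambda>z. Vop N' g z - Vop N g z) \<le> ennreal (C / real (Suc N) ^ r) * nrm h"
        using multiplier_bound[where m = "m N N'" and L = "(JJ + 1) * N'", OF ih m0 C(2)[OF NN]] C(1) by simp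
    qed
    finally show "nrm (\<lambda>z. g z - Vop N g z) \<le> ennreal (C / real (Suc N) ^ r) * nrm h + ennreal e" by (simp add: add.commute)
  qed
  then show ?thesis using C(1) by blast
qed

text \<open>On degree n the cutoff at n is invisible; inserting it turns the powers of the
  eigenvalues into a finitely supported symbol with controlled differences.\<close>

theorem bernstein:
  assumes r: "r \<ge> 1"
  shows "\<exists>C>0. \<forall>n\<ge>1. \<forall>P\<in>polysE n. nrm (fpow r n P) \<le> ennreal (C * real n ^ r) * nrm P"
proof -
  define m where "m n = (\<lambda>k. cutoff JJ n k * eigsq lam k ^ r)" for n
  obtain C where C: "C > 0" "\<And>n. n \<ge> 1 \<Longrightarrow> mbound JJ ((JJ + 1) * n) (m n) \<le> C * real n ^ r"
    using bernstein_mbound[OF less_imp_le[OF lam_pos] r, of JM] unfolding JJ_def m_def by blast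
  have "nrm (fpow r n P) \<le> ennreal (C * real n ^ r) * nrm P" if n: "n \<ge> 1" and P: "P \<in> polysE n" for n P
  proof -
    have iP: "integrable mu (ind P)" by (rule ind_polysE[OF P])
    have "kop (mpoly ((JJ + 1) * n) (m n)) P z = fpow r n P z" for z
    proof -
      have "fpow r n P z = (\<Sum>k\<le>(JJ + 1) * n. eigsq lam k ^ r * prj k P z)"
        using fun_cong[OF fpow_mono[OF P, of "(JJ + 1) * n" r], of z] by (simp add: fpow_def)
      also have "\<dots> = (\<Sum>k\<le>(JJ + 1) * n. m n k * prj k P z)"
      proof (rule sum.cong[OF refl])
        fix k show "eigsq lam k ^ r * prj k P z = m n k * prj k P z"
          using prj_polysE_orth[OF P, of k z] cutoff_eq_1[of k n JJ] by (cases "k \<le> n") (auto simp: m_def)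
      qed
      finally show ?thesis unfolding kop_mpoly[OF iP] by simp
    qed
    then have e: "fpow r n P = kop (mpoly ((JJ + 1) * n) (m n)) P" by (simp add: fun_eq_iff)
    have "C * real n ^ r > 0" using C n by simp
    then show ?thesis unfolding e
      by (intro multiplier_bound iP C(2) n) (simp_all add: m_def cutoff_eq_0)
  qed
  then show ?thesis using C(1) by blast
qed

end

section \<open>Direct and inverse estimates\<close>

lemma inverse_power_le:
  fixes x y z :: real
  assumes "x ^ r \<le> (y * z) ^ r" "x > 0" "z > 0"
  shows "1 / z ^ r \<le> y ^ r * (1 / x) ^ r"
  using assms by (simp add: power_mult_distrib power_one_over divide_simps mult.commute)

context hyperboloid_Lp
begin

abbreviation En' :: "nat \<Rightarrow> ('d pt \<Rightarrow> real) \<Rightarrow> ennreal" where "En' n f \<equiv> En a b c \<beta> \<gamma> p n f"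
abbreviation Kf :: "nat \<Rightarrow> ('d pt \<Rightarrow> real) \<Rightarrow> real \<Rightarrow> ennreal" where "Kf r f \<rho> \<equiv> Kfun a b c \<beta> \<gamma> p r f \<rho>"

lemma En_le: "P \<in> polysE n \<Longrightarrow> En' n f \<le> nrm (\<lambda>z. f z - P z)"
  unfolding En_def nrm_def by (rule INF_lower)

lemma En_le_nrm: "En' n f \<le> nrm f"
  using En_le[OF polysE_const[of 0 n], of f] by simp

lemma En_antimono: "n \<le> m \<Longrightarrow> En' m f \<le> En' n f"
  unfolding En_def by (rule INF_superset_mono) (auto intro: polysE_mono)

lemma En_near_best:
  assumes "En' n f < ennreal t"
  shows "\<exists>P\<in>polysE n. nrm (\<lambda>z. f z - P z) \<le> ennreal t"
  using assms unfolding En_def nrm_def by (force simp: INF_less_iff)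

text \<open>For a competitor g, h of the K-functional, f is approximated by \<open>Vop N g\<close>.
  The triangle inequality and \<open>jackson\<close> then bound the error by the expression defining
  the functional.\<close>

theorem direct_estimate:
  assumes r: "r \<ge> 1"
  shows "\<exists>C>0. \<forall>f n. meas f \<longrightarrow> n \<ge> 1 \<longrightarrow> En' n f \<le> ennreal C * Kf r f (1 / real n)"
proof -
  obtain C where C: "C > 0" "\<And>N g h. continuous_on (LL a b c) g \<Longrightarrow> frac_op a b c \<beta> \<gamma> r g h \<Longrightarrow>
     nrm (\<lambda>z. g z - Vop N g z) \<le> ennreal (C / real (Suc N) ^ r) * nrm h"
    using jackson[OF r] by blast
  define D where "D = max 1 (C * real (JJ + 1) ^ r)"
  have D: "D \<ge> 1" "C * real (JJ + 1) ^ r \<le> D" by (auto simp: D_def)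
  have "En' n f \<le> ennreal D * Kf r f (1 / real n)" if f: "meas f" and n: "n \<ge> 1" for f n
  proof -
    \<comment> \<open>The constant stands on the left so that the estimate can be tested on each
      competitor of the infimum.\<close>
    have "En' n f / ennreal D \<le> Kf r f (1 / real n)"
      unfolding Kfun_def
    proof (rule Inf_greatest, clarify)
      fix g h :: "'d pt \<Rightarrow> real"
      assume g: "g \<in> Cr r (LL a b c)" and h: "frac_op a b c \<beta> \<gamma> r g h"
      have cg: "continuous_on (LL a b c) g" by (rule Cr_imp_continuous_on[OF g])
      have ig: "integrable mu (ind g)" by (rule continuous_integrable[OF cg])
      \<comment> \<open>The largest N for which \<open>Vop N g\<close> has degree at most n; N + 1
        is still at least n / (JJ + 1), whence the factor in \<open>D\<close>.\<close>
      define N where "N = n div (JJ + 1)"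
      have N1: "(JJ + 1) * N \<le> n" unfolding N_def by (rule times_div_less_eq_dividend)
      have N2: "n \<le> (JJ + 1) * Suc N"
        unfolding N_def using dividend_less_times_div[of "JJ + 1" n] by (simp add: algebra_simps)
      have VE: "Vop N g \<in> polysE n" by (rule polysE_mono[OF Vop_polysE[OF ig] N1])
      have n0: "real n > 0" using n by simp
      have "real n \<le> real (JJ + 1) * real (Suc N)" using N2 by (metis of_nat_le_iff of_nat_mult)
      then have "real n ^ r \<le> (real (JJ + 1) * real (Suc N)) ^ r" by (intro power_mono) auto
      then have "1 / real (Suc N) ^ r \<le> real (JJ + 1) ^ r * (1 / real n) ^ r"
        using n0 by (intro inverse_power_le) auto
      then have "C * (1 / real (Suc N) ^ r) \<le> C * (real (JJ + 1) ^ r * (1 / real n) ^ r)"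
        using C(1) by (intro mult_left_mono) auto
      also have "\<dots> \<le> D * (1 / real n) ^ r"
        using D(2) by (simp only: mult.assoc[symmetric]) (intro mult_right_mono, auto)
      finally have cc: "C / real (Suc N) ^ r \<le> D * (1 / real n) ^ r" by simp
      have "En' n f \<le> nrm (\<lambda>z. f z - Vop N g z)" by (rule En_le[OF VE])
      also have "\<dots> \<le> nrm (\<lambda>z. f z - g z) + nrm (\<lambda>z. g z - Vop N g z)"
        by (rule nrm_diff_triangle[OF f meas_continuous[OF cg] meas_polysE[OF VE]])
      also have "\<dots> \<le> ennreal D * nrm (\<lambda>z. f z - g z) + ennreal (D * (1 / real n) ^ r) * nrm h"
      proof (rule add_mono)
        have "ennreal 1 * nrm (\<lambda>z. f z - g z) \<le> ennreal D * nrm (\<lambda>z. f z - g z)"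
          using D(1) by (intro mult_right_mono ennreal_leI) auto
        then show "nrm (\<lambda>z. f z - g z) \<le> ennreal D * nrm (\<lambda>z. f z - g z)" by simp
        have "nrm (\<lambda>z. g z - Vop N g z) \<le> ennreal (C / real (Suc N) ^ r) * nrm h" by (rule C(2)[OF cg h])
        also have "\<dots> \<le> ennreal (D * (1 / real n) ^ r) * nrm h" by (intro mult_right_mono ennreal_leI cc) auto
        finally show "nrm (\<lambda>z. g z - Vop N g z) \<le> ennreal (D * (1 / real n) ^ r) * nrm h" .
      qed
      also have "\<dots> = ennreal D * (nrm (\<lambda>z. f z - g z) + ennreal ((1 / real n) ^ r) * nrm h)"
      proof -
        have "ennreal (D * (1 / real n) ^ r) = ennreal D * ennreal ((1 / real n) ^ r)"
          using D(1) by (intro ennreal_mult) auto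
        then show ?thesis by (simp only: distrib_left mult.assoc)
      qed
      finally have "En' n f / ennreal D \<le> ennreal D * (nrm (\<lambda>z. f z - g z) + ennreal ((1 / real n) ^ r) * nrm h) / ennreal D"
        by (rule divide_right_mono_ennreal)
      also have "\<dots> = nrm (\<lambda>z. f z - g z) + ennreal ((1 / real n) ^ r) * nrm h"
        using D(1) by (subst mult.commute, subst ennreal_mult_divide_eq) (auto simp: ennreal_eq_0_iff)
      finally show "En' n f / ennreal D \<le> wnorm a b c \<beta> \<gamma> p (\<lambda>z. f z - g z) + ennreal ((1 / real n) ^ r) * wnorm a b c \<beta> \<gamma> p h"
        unfolding nrm_def .
    qed
    then have "ennreal D * (En' n f / ennreal D) \<le> ennreal D * Kf r f (1 / real n)" by (rule mult_left_mono) simp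
    moreover have "ennreal D * (En' n f / ennreal D) = En' n f"
      using D(1) by (simp only: ennreal_times_divide) (subst mult.commute, subst ennreal_mult_divide_eq, auto simp: ennreal_eq_0_iff)
    ultimately show ?thesis by simp
  qed
  then show ?thesis using D(1) by (intro exI[of _ D]) auto
qed

text \<open>The competitor is a near-best polynomial of degree 2^m with 2^m <= n < 2^(m+1). Its
  fractional derivative is telescoped over the dyadic degrees, and \<open>dyadic_sum\<close>
  compares the result with the full sum.\<close>

theorem inverse_estimate:
  assumes r: "r \<ge> 1"
  shows "\<exists>C>0. \<forall>f n. meas f \<longrightarrow> nrm f < \<infinity> \<longrightarrow> n \<ge> 1 \<longrightarrow> Kf r f (1 / real n) \<le>
    ennreal (C / real n ^ r) * (\<Sum>k\<le>n. ennreal (real (k + 1) ^ (r - 1)) * En' k f)"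
proof -
  obtain C where C: "C > 0" "\<And>n P. n \<ge> 1 \<Longrightarrow> P \<in> polysE n \<Longrightarrow> nrm (fpow r n P) \<le> ennreal (C * real n ^ r) * nrm P"
    using bernstein[OF r] by blast
  define D where "D = 4 ^ r * (1 + 2 * C)"
  have "Kf r f (1 / real n) \<le> ennreal (D / real n ^ r) * (\<Sum>k\<le>n. ennreal (real (k + 1) ^ (r - 1)) * En' k f)"
    if f: "meas f" and fin: "nrm f < \<infinity>" and n: "n \<ge> 1" for f n
  proof -
    define E where "E k = enn2real (En' k f)" for k
    have Efin: "En' k f < top" for k using En_le_nrm[of k f] fin by (simp add: le_less_trans)
    have En: "En' k f = ennreal (E k)" for k using Efin by (simp add: E_def)
    have E0: "E k \<ge> 0" for k by (simp add: E_def)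
    have anti: "antimono E"
      by (rule antimonoI) (use En_antimono Efin in \<open>auto simp: E_def intro: enn2real_mono\<close>)
    obtain m where m: "2 ^ m \<le> n" "n < 2 * 2 ^ m" using ex_dyadic_scale[OF n] by blast
    define \<Sigma> where "\<Sigma> = (\<Sum>k\<le>n. real (k + 1) ^ (r - 1) * E k)"
    \<comment> \<open>Best approximants are replaced by near-best ones with slack e;
      \<open>A\<close> collects all factors of e, which is sent to 0 at the end with n and m
      fixed.\<close>
    define A where "A = 1 + C * (1 / real n) ^ r * (2 * (\<Sum>j\<le>m. (2 ^ j) ^ r))"
    have A: "A > 0" unfolding A_def using C(1) by (intro add_pos_nonneg mult_nonneg_nonneg sum_nonneg) auto
    have n0: "real n > 0" using n by simp
    have main: "Kf r f (1 / real n) \<le> ennreal (D / real n ^ r * \<Sigma> + A * e)" if e: "e > 0" for e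
    proof -
      have "\<exists>P\<in>polysE (dyad j). nrm (\<lambda>z. f z - P z) \<le> ennreal (E (dyad j) + e)" for j
        by (rule En_near_best) (use e E0 in \<open>simp add: En ennreal_lessI add_nonneg_pos\<close>)
      then obtain P where P: "\<And>j. P j \<in> polysE (dyad j)" "\<And>j. nrm (\<lambda>z. f z - P j z) \<le> ennreal (E (dyad j) + e)"
        by metis
      have mP: "meas (P j)" for j by (rule meas_polysE[OF P(1)])
      have iP: "integrable mu (ind (P j))" for j by (rule ind_polysE[OF P(1)])
      have iL: "meas (fpow r k (P j))" for k j by (rule meas_polysE[OF fpow_polysE[OF iP]])
      \<comment> \<open>The sum starts from a constant polynomial, which the operator annihilates
        since r >= 1. Each step applies \<open>bernstein\<close> in degree 2^i to the difference of
        consecutive approximants, whose norm is at most twice the larger error.\<close>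
      have tel: "nrm (fpow r (dyad i) (P i)) \<le> ennreal (\<Sum>j<i. C * (2 ^ j) ^ r * (2 * (E (dyad j) + e)))" for i
      proof (induction i)
        case 0
        have "fpow r 0 (P 0) = (\<lambda>z. 0)" using fpow_0[OF r] by blast
        then show ?case using nrm_sum_le[of "{}" "\<lambda>_ _. 0"] by simp
      next
        case (Suc i)
        let ?Q = "\<lambda>z. P (Suc i) z - P i z"
        have PE: "P i \<in> polysE (2 ^ i)" by (rule polysE_mono[OF P(1) dyad_le])
        have QE: "?Q \<in> polysE (2 ^ i)" using polysE_diff[OF P(1)[of "Suc i", simplified] PE] .
        have Ed: "E (2 ^ i) \<le> E (dyad i)" using anti dyad_le by (auto dest: antimonoD)
        have "nrm ?Q \<le> nrm (\<lambda>z. P (Suc i) z - f z) + nrm (\<lambda>z. f z - P i z)"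
          by (rule nrm_diff_triangle[OF mP f mP])
        also have "\<dots> \<le> ennreal (E (dyad (Suc i)) + e) + ennreal (E (dyad i) + e)"
          using P(2)[of "Suc i"] P(2)[of i] by (intro add_mono) (simp_all only: nrm_diff_commute[of "P (Suc i)" f])
        also have "\<dots> = ennreal (E (dyad (Suc i)) + e + (E (dyad i) + e))" using E0 e by (intro ennreal_plus[symmetric]) (auto intro: add_nonneg_nonneg)
        also have "\<dots> \<le> ennreal (2 * (E (dyad i) + e))" using Ed by (intro ennreal_leI) simp
        finally have Q: "nrm ?Q \<le> ennreal (2 * (E (dyad i) + e))" .
        have iQ: "meas (fpow r (2 ^ i) ?Q)" by (rule meas_polysE[OF fpow_polysE[OF ind_polysE[OF QE]]])
        have "fpow r (2 ^ i) (P (Suc i)) z = fpow r (2 ^ i) ?Q z + fpow r (dyad i) (P i) z" for z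
          using fpow_diff[OF iP[of "Suc i"] iP[of i], of r "2 ^ i" z] fun_cong[OF fpow_mono[OF P(1)[of i] dyad_le[of i], of r], of z] by simp
        then have "nrm (fpow r (dyad (Suc i)) (P (Suc i))) = nrm (\<lambda>z. fpow r (2 ^ i) ?Q z + fpow r (dyad i) (P i) z)"
          by (intro arg_cong[of _ _ nrm] ext) (simp only: dyad_Suc)
        also have "\<dots> \<le> nrm (fpow r (2 ^ i) ?Q) + nrm (fpow r (dyad i) (P i))" by (rule nrm_triangle[OF iQ iL])
        also have "\<dots> \<le> ennreal (C * real (2 ^ i) ^ r) * ennreal (2 * (E (dyad i) + e)) + ennreal (\<Sum>j<i. C * (2 ^ j) ^ r * (2 * (E (dyad j) + e)))"
        proof (intro add_mono Suc.IH)
          have "nrm (fpow r (2 ^ i) ?Q) \<le> ennreal (C * real (2 ^ i) ^ r) * nrm ?Q" by (rule C(2)[OF _ QE]) simp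
          also have "\<dots> \<le> ennreal (C * real (2 ^ i) ^ r) * ennreal (2 * (E (dyad i) + e))" by (intro mult_left_mono Q) simp
          finally show "nrm (fpow r (2 ^ i) ?Q) \<le> ennreal (C * real (2 ^ i) ^ r) * ennreal (2 * (E (dyad i) + e))" .
        qed
        also have "ennreal (C * real (2 ^ i) ^ r) * ennreal (2 * (E (dyad i) + e)) = ennreal (C * (2 ^ i) ^ r * (2 * (E (dyad i) + e)))"
          using C(1) E0 e by (subst ennreal_mult[symmetric]) (auto intro: add_nonneg_nonneg)
        also have "ennreal (C * (2 ^ i) ^ r * (2 * (E (dyad i) + e))) + ennreal (\<Sum>j<i. C * (2 ^ j) ^ r * (2 * (E (dyad j) + e)))
          = ennreal (C * (2 ^ i) ^ r * (2 * (E (dyad i) + e)) + (\<Sum>j<i. C * (2 ^ j) ^ r * (2 * (E (dyad j) + e))))"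
          using C(1) E0 e by (intro ennreal_plus[symmetric] sum_nonneg mult_nonneg_nonneg) (auto intro: add_nonneg_nonneg)
        finally show ?case by (simp add: add.commute)
      qed
      let ?g = "P (Suc m)" and ?h = "fpow r (2 ^ m) (P (Suc m))"
      have gE: "?g \<in> polysE (2 ^ m)" using P(1)[of "Suc m"] by simp
      define H where "H = (\<Sum>j\<le>m. C * (2 ^ j) ^ r * (2 * (E (dyad j) + e)))"
      have H0: "H \<ge> 0" unfolding H_def using C(1) E0 e by (intro sum_nonneg mult_nonneg_nonneg) (auto intro: add_nonneg_nonneg)
      have h: "nrm ?h \<le> ennreal H" using tel[of "Suc m"] by (simp add: H_def lessThan_Suc_atMost)
      have "Kf r f (1 / real n) \<le> nrm (\<lambda>z. f z - ?g z) + ennreal ((1 / real n) ^ r) * nrm ?h"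
        unfolding Kfun_def nrm_def
      proof (rule Inf_lower, rule CollectI, rule exI[of _ ?g], rule exI[of _ ?h], intro conjI refl)
        show "?g \<in> Cr r (LL a b c)" using gE polys_in_Cr by (auto simp: polysE_iff)
        show "frac_op a b c \<beta> \<gamma> r ?g ?h" by (rule frac_op_fpow[OF gE])
      qed
      also have "\<dots> \<le> ennreal (E (2 ^ m) + e) + ennreal ((1 / real n) ^ r) * ennreal H"
        using P(2)[of "Suc m"] h by (intro add_mono mult_left_mono) auto
      also have "\<dots> = ennreal (E (2 ^ m) + e + (1 / real n) ^ r * H)"
        using E0 e H0 n0 by (subst ennreal_mult[symmetric], simp, simp, subst ennreal_plus[symmetric]) (auto intro: add_nonneg_nonneg)
      also have "\<dots> \<le> ennreal (D / real n ^ r * \<Sigma> + A * e)"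
      proof (rule ennreal_leI)
        have Hs: "H = 2 * C * (\<Sum>j\<le>m. (2 ^ j) ^ r * E (dyad j)) + C * (2 * (\<Sum>j\<le>m. (2 ^ j) ^ r)) * e"
          unfolding H_def by (simp add: sum_distrib_left sum_distrib_right sum.distrib[symmetric] algebra_simps)
        have sub: "(\<Sum>k\<in>K. real (k + 1) ^ (r - 1) * E k) \<le> \<Sigma>" if "K \<subseteq> {..n}" for K
          unfolding \<Sigma>_def using E0 that by (intro sum_mono2) auto
        have "(\<Sum>j\<le>m. (2 ^ j) ^ r * E (dyad j)) \<le> 4 ^ r * (\<Sum>k\<le>dyad m. real (k + 1) ^ (r - 1) * E k)"
          by (rule dyadic_sum[OF anti E0 r])
        also have "\<dots> \<le> 4 ^ r * \<Sigma>" using dyad_le[of m] m(1) by (intro mult_left_mono sub) auto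
        finally have s1: "(\<Sum>j\<le>m. (2 ^ j) ^ r * E (dyad j)) \<le> 4 ^ r * \<Sigma>" .
        \<comment> \<open>The error of the competitor itself: n is below 2 * 2^m, and the last
          dyadic block below n already controls this term.\<close>
        have "real n ^ r * E (2 ^ m) \<le> (2 * 2 ^ m) ^ r * E (2 ^ m)"
        proof (intro mult_right_mono power_mono E0)
          have "real n \<le> real (2 * 2 ^ m)" using m(2) by (simp only: of_nat_le_iff)
          then show "real n \<le> 2 * 2 ^ m" by simp
        qed simp
        also have "\<dots> \<le> 4 ^ r * (\<Sum>k\<in>{dyad m<..2 ^ m}. real (k + 1) ^ (r - 1) * E k)" by (rule dyadic_block[OF anti E0 r])
        also have "\<dots> \<le> 4 ^ r * \<Sigma>" using m(1) by (intro mult_left_mono sub) auto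
        finally have s2: "E (2 ^ m) \<le> (1 / real n) ^ r * (4 ^ r * \<Sigma>)" using n0 by (simp add: power_divide field_simps)
        have "(1 / real n) ^ r * (2 * C * (\<Sum>j\<le>m. (2 ^ j) ^ r * E (dyad j))) \<le> (1 / real n) ^ r * (2 * C * (4 ^ r * \<Sigma>))"
          using C(1) by (intro mult_left_mono s1) auto
        with s2 have "E (2 ^ m) + (1 / real n) ^ r * (2 * C * (\<Sum>j\<le>m. (2 ^ j) ^ r * E (dyad j)))
          \<le> (1 / real n) ^ r * (4 ^ r * \<Sigma>) + (1 / real n) ^ r * (2 * C * (4 ^ r * \<Sigma>))" by (rule add_mono)
        also have "\<dots> = D / real n ^ r * \<Sigma>" unfolding D_def by (simp add: power_divide algebra_simps add_divide_distrib)
        finally have "E (2 ^ m) + (1 / real n) ^ r * (2 * C * (\<Sum>j\<le>m. (2 ^ j) ^ r * E (dyad j))) \<le> D / real n ^ r * \<Sigma>" .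
        moreover have "u + e + R * (X + C * (2 * S) * e) \<le> v + (1 + C * R * (2 * S)) * e" if "u + R * X \<le> v" for u v R X S :: real
          using that by (simp add: algebra_simps)
        ultimately show "E (2 ^ m) + e + (1 / real n) ^ r * H \<le> D / real n ^ r * \<Sigma> + A * e"
          unfolding Hs A_def by blast
      qed
      finally show ?thesis .
    qed
    have D0: "D > 0" using C(1) by (simp add: D_def add_pos_nonneg)
    have S0: "\<Sigma> \<ge> 0" unfolding \<Sigma>_def using E0 by (intro sum_nonneg) auto
    have "Kf r f (1 / real n) \<le> ennreal (D / real n ^ r * \<Sigma>)"
    proof (rule ennreal_le_epsilon)
      fix e :: real assume e: "0 < e"
      have "Kf r f (1 / real n) \<le> ennreal (D / real n ^ r * \<Sigma> + A * (e / A))" using e A by (intro main) simp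
      also have "\<dots> = ennreal (D / real n ^ r * \<Sigma>) + ennreal e"
        using e A D0 S0 n0 by (simp add: ennreal_plus)
      finally show "Kf r f (1 / real n) \<le> ennreal (D / real n ^ r * \<Sigma>) + ennreal e" .
    qed
    also have "\<dots> = ennreal (D / real n ^ r) * ennreal \<Sigma>" using D0 S0 n0 by (intro ennreal_mult) auto
    also have "ennreal \<Sigma> = (\<Sum>k\<le>n. ennreal (real (k + 1) ^ (r - 1)) * En' k f)"
      unfolding \<Sigma>_def En using E0 by (subst sum_ennreal[symmetric]) (auto simp: ennreal_mult)
    finally show ?thesis .
  qed
  moreover have "D > 0" using C(1) by (simp add: D_def add_pos_nonneg)
  ultimately show ?thesis by blast
qed

end

theorem theorem4p9:
  fixes a b c \<beta> \<gamma> :: real and r :: nat and p :: ennreal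
  assumes "0 \<le> a" and "a < b" and "0 \<le> c" and "0 \<le> \<beta>" and "\<gamma> > -1"
    and "r \<ge> 1" and "1 \<le> p"
  shows "\<exists>C>0. \<forall>f :: ('d::finite) pt \<Rightarrow> real.
     ((p \<noteq> \<infinity> \<longrightarrow> in_Lp a b c \<beta> \<gamma> (enn2real p) f) \<and> (p = \<infinity> \<longrightarrow> continuous_on (LL a b c) f)) \<longrightarrow>
     (\<forall>n::nat. n \<ge> 1 \<longrightarrow>
        En a b c \<beta> \<gamma> p n f \<le> ennreal C * Kfun a b c \<beta> \<gamma> p r f (1 / real n) \<and>
        Kfun a b c \<beta> \<gamma> p r f (1 / real n) \<le>
          ennreal (C / real n ^ r) * (\<Sum>k\<le>n. ennreal (real (k + 1) ^ (r - 1)) * En a b c \<beta> \<gamma> p k f))"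
proof -
  interpret hyperboloid_Lp a b c \<beta> \<gamma> "TYPE('d)" p
    by unfold_locales (use assms in auto)
  obtain C where C: "C > 0" "\<And>f n. meas f \<Longrightarrow> n \<ge> 1 \<Longrightarrow> En' n f \<le> ennreal C * Kf r f (1 / real n)"
    using direct_estimate[OF assms(6)] by blast
  obtain C' where C': "C' > 0" "\<And>f n. meas f \<Longrightarrow> nrm f < \<infinity> \<Longrightarrow> n \<ge> 1 \<Longrightarrow> Kf r f (1 / real n) \<le>
    ennreal (C' / real n ^ r) * (\<Sum>k\<le>n. ennreal (real (k + 1) ^ (r - 1)) * En' k f)"
    using inverse_estimate[OF assms(6)] by blast
  show ?thesis
  proof (intro exI[of _ "max C C'"] conjI allI impI)
    show "max C C' > 0" using C(1) by simp
    fix f :: "'d pt \<Rightarrow> real" and n :: nat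
    assume f: "(p \<noteq> \<infinity> \<longrightarrow> in_Lp a b c \<beta> \<gamma> (enn2real p) f) \<and> (p = \<infinity> \<longrightarrow> continuous_on (LL a b c) f)" and n: "1 \<le> n"
    have mf: "meas f" "nrm f < \<infinity>"
      using f in_Lp_finite[of f] meas_continuous[of f] nrm_continuous_finite[of f] by (cases "p = \<infinity>"; blast)+
    have "En' n f \<le> ennreal C * Kf r f (1 / real n)" by (rule C(2)[OF mf(1) n])
    also have "\<dots> \<le> ennreal (max C C') * Kf r f (1 / real n)" by (intro mult_right_mono ennreal_leI) auto
    finally show "En' n f \<le> ennreal (max C C') * Kf r f (1 / real n)" .
    have "Kf r f (1 / real n) \<le> ennreal (C' / real n ^ r) * (\<Sum>k\<le>n. ennreal (real (k + 1) ^ (r - 1)) * En' k f)"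
      by (rule C'(2)[OF mf n])
    also have "\<dots> \<le> ennreal (max C C' / real n ^ r) * (\<Sum>k\<le>n. ennreal (real (k + 1) ^ (r - 1)) * En' k f)"
      by (intro mult_right_mono ennreal_leI divide_right_mono) auto
    finally show "Kf r f (1 / real n) \<le> ennreal (max C C' / real n ^ r) * (\<Sum>k\<le>n. ennreal (real (k + 1) ^ (r - 1)) * En' k f)" .
  qed
qed

end
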